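(* Let $r>1$ and let $\mathcal A^*$ be an $(r-1)$-connected Poincaré DGCA of degree $n$ of Hodge type over $\mathbb F$, with $n\le 5r-3$. The Hochschild cohomology class $[\mu_3]$ of the ternary operation $\mu_3$ on $H^*(\mathcal A^* )$ (defined in the context from a choice of adapted harmonic subspace and associated Hodge type decomposition) is independent of the choice of adapted harmonic subspace and of associated Hodge type decomposition, and so it defines a distinguished element $[\mu_3^{\mathcal A^*}]\in\mathsf{Hoch}^2(H^*(\mathcal A^* ),H^*(\mathcal A^* ))$ depending only on the Poincaré DGCA $\mathcal A^*$. Moreover, the class $[\mu_3^{\mathcal A^*}]$ is the only obstruction to the formality of $\mathcal A^*$; that is, $\mathcal A^*$ is formal if and only if $[\mu_3^{\mathcal A^*}]=0$.
   Context: $\mathbb F$ is a fixed field of characteristic $0$. A DGCA is a (unital) differential graded commutative algebra over $\mathbb F$ with differential $d$ of degree $+1$; $\mathcal A^*_d=\ker d$. Two DGCAs are equivalent if they are connected by a zig-zag of DGCA quasi-isomorphisms; a DGCA is formal if it is equivalent to its cohomology algebra with zero differential. A DGCA is connected if $H^0\cong\mathbb F$, and $s$-connected if moreover $H^k=0$ for $1\le k\le s$. A Poincaré algebra of degree $n$ is a finite dimensional graded commutative algebra $H^*=\bigoplus_{k=0}^nH^k$ with a linear functional $\int\in(H^n)^\vee$ such that the pairing $\langle\alpha^k,\beta^l\rangle=\int\alpha^k\beta^l$ if $k+l=n$, and $0$ otherwise, is non-degenerate. A Poincaré DGCA of degree $n$ is a DGCA $\mathcal A^*=\bigoplus_{k=0}^n\mathcal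 A^k$ whose cohomology ring is a Poincaré algebra of degree $n$; it carries the induced pairing $\langle\alpha^k,\beta^l\rangle=\int[\alpha^k\beta^l]$ if $k+l=n$, and $0$ otherwise. A harmonic subspace is a graded subspace $\mathcal H^*\subseteq\mathcal A^*_d$ complementary to $d\mathcal A^{*-1}$ in $\mathcal A^*_d$. A Hodge type decomposition is a direct sum decomposition $\mathcal A^*=d\mathcal A^{*-1}\oplus\mathcal H^*\oplus\mathcal B^*$ with $\mathcal H^*$ a harmonic subspace and $\langle\mathcal H^*\oplus\mathcal B^*,\mathcal B^*\rangle=0$; $\mathcal A^*$ is of Hodge type if such a decomposition exists. Given one, $d:\mathcal B^*\to d\mathcal A^*$ is bijective; $d^-:\mathcal A^*\to\mathcal A^{*-1}$ is its inverse on $d\mathcal A^*$, extended by $0$ on $\mathcal H^*\oplus\mathcal B^*$, and $\pi_{\mathcal H^*}$ is the projection of $\mathcal A^*$ onto $\mathcal H^*$. Let $H^*=H^*(\mathcal A^* )$ and $H^*_+=\bigoplus_{k\ge1}H^k$. A generating subspace is a graded subspace $H^*_{gen}\subseteq H^*_+$ with $H^*_+=H^*_{gen}\oplus(H^*_+\cdot H^*_+)$. A partial splitting map is a linear degree-preserving map $\imath_0:H^*_{gen}\to\mathcal A^*_d$ with $[\imath_0(x)]=x$; it extends to an algebra morphism $\imath_0:S^*(H^*_{gen})\to\mathcal A^*_d$ from the graded symmetric algebra. A harmonic subspace $\mathcal H^*$ is adapted if, for some $H^*_{gen}$ and $\imath_0$, $\mathcal H^*=\imath(H^* )$ for a linear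 section $\imath:H^*\to\mathcal A^*_d$ of the projection $\mathcal A^*_d\to H^*$ with $\imath|_{H^*_{gen}}=\imath_0$ and $\imath(H^* )\subseteq\imath_0(S^*(H^*_{gen}))$. For a Hodge type decomposition with adapted harmonic subspace $\mathcal H^*=\imath(H^* )$, set $m_3(\alpha,\beta,\gamma)=\pi_{\mathcal H^*}\big(d^-(\alpha\beta)\gamma-(-1)^{\deg\alpha}\alpha\, d^-(\beta\gamma)\big)$ for $\alpha,\beta,\gamma\in\mathcal H^*$, and $\mu_3([\alpha],[\beta],[\gamma])=[m_3(\imath[\alpha],\imath[\beta],\imath[\gamma])]$, a degree $-1$ trilinear map on $H^*$. When $n\le5r-3$ it is a Hochschild cocycle. $\mathsf{Hoch}^{p,q}(H^*,H^* )$ is Hochschild cohomology represented by $p$-linear maps $(H^* )^{\otimes p}\to H^*$ of degree $q$; it is contained in $\mathsf{Hoch}^{p+q}(H^*,H^* )$. With $m$ the product of $H^*$ and Koszul signs, a trilinear $f$ of degree $-1$ is a cocycle iff $m(f\otimes \mathrm{id})+m(\mathrm{id}\otimes f)-f(m\otimes\mathrm{id}\otimes\mathrm{id})+f(\mathrm{id}\otimes m\otimes\mathrm{id})-f(\mathrm{id}\otimes\mathrm{id}\otimes m)=0$, and coboundaries are the maps $d_{\mathsf{Hoch}}\phi=m(\phi\otimes\mathrm{id})-m(\mathrm{id}\otimes\phi)-\phi(m\otimes\mathrm{id})+\phi(\mathrm{id}\otimes m)$ with $\phi$ bilinear of degree $-1$.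
   Formalization: The signs of the last two terms of the Hochschild coboundary are reversed, to m(φ⊗id) − m(id⊗φ) + φ(m⊗id) − φ(id⊗m); with the signs as printed, coboundaries are in general not cocycles (e.g. on H*(S²×S³)), so the cohomology group would be undefined. *)

theory Defs
  imports "HOL-Algebra.QuotRing" "HOL-Algebra.Ideal_Product" "HOL-Algebra.Module"
begin

section \<open>Graded algebras and DGCAs\<close>

text \<open>
  Algebras are graded by the natural numbers. An object carries a product, a scalar
  multiplication, its homogeneous pieces and a differential; a graded algebra without
  differential is an object whose differential is not looked at, or is zero.
\<close>

record ('k, 'a) dga = "('k, 'a) module" +
  piece :: "nat \<Rightarrow> 'a set"
  diff :: "'a \<Rightarrow> 'a"

definition char_zero :: "('k, 'm) ring_scheme \<Rightarrow> bool" where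
  "char_zero K \<longleftrightarrow> (\<forall>m::nat. 0 < m \<longrightarrow> [m] \<cdot>\<^bsub>K\<^esub> \<one>\<^bsub>K\<^esub> \<noteq> \<zero>\<^bsub>K\<^esub>)"

text \<open>\<open>ksign A k x\<close> is the element $(-1)^k x$.\<close>

definition ksign :: "('a, 'm) ring_scheme \<Rightarrow> nat \<Rightarrow> 'a \<Rightarrow> 'a" where
  "ksign A k x = (if even k then x else \<ominus>\<^bsub>A\<^esub> x)"

definition is_decomposition :: "('k, 'a, 'm) dga_scheme \<Rightarrow> 'a \<Rightarrow> (nat \<Rightarrow> 'a) \<Rightarrow> bool" where
  "is_decomposition A x c \<longleftrightarrow>
     (\<forall>k. c k \<in> piece A k) \<and> finite {k. c k \<noteq> \<zero>\<^bsub>A\<^esub>} \<and>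
     x = (\<Oplus>\<^bsub>A\<^esub>k\<in>{k. c k \<noteq> \<zero>\<^bsub>A\<^esub>}. c k)"

definition component :: "('k, 'a, 'm) dga_scheme \<Rightarrow> nat \<Rightarrow> 'a \<Rightarrow> 'a" where
  "component A k x = (THE c. is_decomposition A x c) k"

text \<open>
  The linear extension of $x \mapsto (-1)^{\deg x} x$. It is the Koszul sign that arises
  whenever an operation of odd degree is moved past $x$.
\<close>

definition parity :: "('k, 'a, 'm) dga_scheme \<Rightarrow> 'a \<Rightarrow> 'a" where
  "parity A x = (\<Oplus>\<^bsub>A\<^esub>k\<in>{k. component A k x \<noteq> \<zero>\<^bsub>A\<^esub>}. ksign A k (component A k x))"

locale graded_comm_algebra = K: field K + A: ring A + module K A
  for K :: "('k, 'l) ring_scheme" and A :: "('k, 'a, 'm) dga_scheme" +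
  assumes smult_mult_left: "\<lbrakk>a \<in> carrier K; x \<in> carrier A; y \<in> carrier A\<rbrakk>
      \<Longrightarrow> (a \<odot>\<^bsub>A\<^esub> x) \<otimes>\<^bsub>A\<^esub> y = a \<odot>\<^bsub>A\<^esub> (x \<otimes>\<^bsub>A\<^esub> y)"
    and smult_mult_right: "\<lbrakk>a \<in> carrier K; x \<in> carrier A; y \<in> carrier A\<rbrakk>
      \<Longrightarrow> x \<otimes>\<^bsub>A\<^esub> (a \<odot>\<^bsub>A\<^esub> y) = a \<odot>\<^bsub>A\<^esub> (x \<otimes>\<^bsub>A\<^esub> y)"
    and piece_submodule: "submodule (piece A k) K A"
    and unique_decomposition: "x \<in> carrier A \<Longrightarrow> \<exists>!c. is_decomposition A x c"
    and one_piece: "\<one>\<^bsub>A\<^esub> \<in> piece A 0"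
    and mult_piece: "\<lbrakk>x \<in> piece A i; y \<in> piece A j\<rbrakk> \<Longrightarrow> x \<otimes>\<^bsub>A\<^esub> y \<in> piece A (i + j)"
    and graded_comm: "\<lbrakk>x \<in> piece A i; y \<in> piece A j\<rbrakk>
      \<Longrightarrow> x \<otimes>\<^bsub>A\<^esub> y = ksign A (i * j) (y \<otimes>\<^bsub>A\<^esub> x)"

locale dgca = graded_comm_algebra K A
  for K :: "('k, 'l) ring_scheme" and A :: "('k, 'a, 'm) dga_scheme" +
  assumes diff_add: "\<lbrakk>x \<in> carrier A; y \<in> carrier A\<rbrakk>
      \<Longrightarrow> diff A (x \<oplus>\<^bsub>A\<^esub> y) = diff A x \<oplus>\<^bsub>A\<^esub> diff A y"
    and diff_smult: "\<lbrakk>a \<in> carrier K; x \<in> carrier A\<rbrakk>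
      \<Longrightarrow> diff A (a \<odot>\<^bsub>A\<^esub> x) = a \<odot>\<^bsub>A\<^esub> diff A x"
    and diff_piece: "x \<in> piece A k \<Longrightarrow> diff A x \<in> piece A (Suc k)"
    and diff_diff: "x \<in> carrier A \<Longrightarrow> diff A (diff A x) = \<zero>\<^bsub>A\<^esub>"
    and leibniz: "\<lbrakk>x \<in> piece A k; y \<in> carrier A\<rbrakk>
      \<Longrightarrow> diff A (x \<otimes>\<^bsub>A\<^esub> y) = (diff A x \<otimes>\<^bsub>A\<^esub> y) \<oplus>\<^bsub>A\<^esub> ksign A k (x \<otimes>\<^bsub>A\<^esub> diff A y)"

definition graded_subspace ::
    "('k, 'l) ring_scheme \<Rightarrow> ('k, 'a, 'm) dga_scheme \<Rightarrow> 'a set \<Rightarrow> bool" where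
  "graded_subspace K A S \<longleftrightarrow>
     submodule S K A \<and> (\<forall>x\<in>S. \<forall>k. component A k x \<in> S)"

definition direct_sum :: "('a, 'm) ring_scheme \<Rightarrow> 'a set \<Rightarrow> 'a set \<Rightarrow> 'a set \<Rightarrow> bool" where
  "direct_sum A U V W \<longleftrightarrow> U = V <+>\<^bsub>A\<^esub> W \<and> V \<inter> W = {\<zero>\<^bsub>A\<^esub>}"

definition linear_on ::
    "('k, 'l) ring_scheme \<Rightarrow> ('k, 'a, 'm) module_scheme \<Rightarrow> 'a set \<Rightarrow>
     ('k, 'b, 'n) module_scheme \<Rightarrow> ('a \<Rightarrow> 'b) \<Rightarrow> bool" where
  "linear_on K V S W f \<longleftrightarrow>
     f \<in> S \<rightarrow> carrier W \<and>
     (\<forall>x\<in>S. \<forall>y\<in>S. f (x \<oplus>\<^bsub>V\<^esub> y) = f x \<oplus>\<^bsub>W\<^esub> f y) \<and>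
     (\<forall>a\<in>carrier K. \<forall>x\<in>S. f (a \<odot>\<^bsub>V\<^esub> x) = a \<odot>\<^bsub>W\<^esub> f x)"

definition algebra_hom ::
    "('k, 'l) ring_scheme \<Rightarrow> ('k, 'a, 'm) module_scheme \<Rightarrow>
     ('k, 'b, 'n) module_scheme \<Rightarrow> ('a \<Rightarrow> 'b) set" where
  "algebra_hom K A B =
     {f \<in> ring_hom A B. \<forall>a\<in>carrier K. \<forall>x\<in>carrier A. f (a \<odot>\<^bsub>A\<^esub> x) = a \<odot>\<^bsub>B\<^esub> f x}"

definition quotient_algebra ::
    "('k, 'a, 'm) module_scheme \<Rightarrow> 'a set \<Rightarrow> ('k, 'a set) module" where
  "quotient_algebra A J =
     \<lparr>carrier = carrier (A Quot J), monoid.mult = monoid.mult (A Quot J), monoid.one = monoid.one (A Quot J),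
      ring.zero = ring.zero (A Quot J), ring.add = ring.add (A Quot J),
      smult = (\<lambda>a U. (\<Union>x\<in>U. J +>\<^bsub>A\<^esub> (a \<odot>\<^bsub>A\<^esub> x)))\<rparr>"


section \<open>Cohomology, quasi-isomorphisms and formality\<close>

definition cocycles :: "('k, 'a, 'm) dga_scheme \<Rightarrow> 'a set" where
  "cocycles A = {x \<in> carrier A. diff A x = \<zero>\<^bsub>A\<^esub>}"

definition boundaries :: "('k, 'a, 'm) dga_scheme \<Rightarrow> 'a set" where
  "boundaries A = diff A ` carrier A"

definition cls :: "('k, 'a, 'm) dga_scheme \<Rightarrow> 'a \<Rightarrow> 'a set" where
  "cls A x = boundaries A +>\<^bsub>A\<^esub> x"

definition cohomology :: "('k, 'a, 'm) dga_scheme \<Rightarrow> ('k, 'a set) dga" where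
  "cohomology A =
    (let Q = quotient_algebra (A\<lparr>carrier := cocycles A\<rparr>) (boundaries A)
     in \<lparr>carrier = carrier Q, monoid.mult = monoid.mult Q, monoid.one = monoid.one Q,
         ring.zero = ring.zero Q, ring.add = ring.add Q, smult = smult Q,
         piece = (\<lambda>k. cls A ` (cocycles A \<inter> piece A k)),
         diff = (\<lambda>_. ring.zero Q)\<rparr>)"

definition cohomology_map ::
    "('k, 'a, 'm) dga_scheme \<Rightarrow> ('k, 'b, 'n) dga_scheme \<Rightarrow> ('a \<Rightarrow> 'b) \<Rightarrow> 'a set \<Rightarrow> 'b set" where
  "cohomology_map A B f U = (\<Union>x\<in>U. cls B (f x))"

definition dgca_hom ::
    "('k, 'l) ring_scheme \<Rightarrow> ('k, 'a, 'm) dga_scheme \<Rightarrow>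
     ('k, 'b, 'n) dga_scheme \<Rightarrow> ('a \<Rightarrow> 'b) set" where
  "dgca_hom K A B =
     {f \<in> algebra_hom K A B.
        (\<forall>k. f ` piece A k \<subseteq> piece B k) \<and> (\<forall>x\<in>carrier A. f (diff A x) = diff B (f x))}"

definition quasi_iso ::
    "('k, 'l) ring_scheme \<Rightarrow> ('k, 'a, 'm) dga_scheme \<Rightarrow>
     ('k, 'b, 'n) dga_scheme \<Rightarrow> ('a \<Rightarrow> 'b) \<Rightarrow> bool" where
  "quasi_iso K A B f \<longleftrightarrow>
     dgca K A \<and> dgca K B \<and> f \<in> dgca_hom K A B \<and>
     bij_betw (cohomology_map A B f) (carrier (cohomology A)) (carrier (cohomology B))"

definition qi_step ::
    "('k, 'l) ring_scheme \<Rightarrow> ('k, 'a, 'm) dga_scheme \<Rightarrow> ('k, 'b, 'n) dga_scheme \<Rightarrow> bool" where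
  "qi_step K A B \<longleftrightarrow> (\<exists>f. quasi_iso K A B f) \<or> (\<exists>g. quasi_iso K B A g)"

text \<open>
  A zig-zag of quasi-isomorphisms. HOL cannot quantify over types inside a formula, so the
  intermediate algebras live on one type \<open>'u\<close>, passed as an argument.
\<close>

definition dgca_equivalent ::
    "'u itself \<Rightarrow> ('k, 'l) ring_scheme \<Rightarrow> ('k, 'a, 'm) dga_scheme \<Rightarrow>
     ('k, 'b, 'n) dga_scheme \<Rightarrow> bool" where
  "dgca_equivalent u K A B \<longleftrightarrow>
     (\<exists>(C :: ('k, 'u) dga) D. qi_step K A C \<and> (qi_step K)\<^sup>*\<^sup>* C D \<and> qi_step K D B)"

text \<open>
  The type of the intermediate algebras contains a copy of the type of \<open>A\<close>, is infinite, is
  large enough for free constructions over the ground field, and contains a copy of the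
  parameter \<open>'u\<close>. Since \<open>'u\<close> is arbitrary, any zig-zag whatsoever is captured for a suitable
  choice of \<open>'u\<close>; a theorem in which \<open>'u\<close> is a free type variable speaks about all of them.
\<close>

definition formal ::
    "'u itself \<Rightarrow> ('k, 'l) ring_scheme \<Rightarrow> ('k, 'a, 'm) dga_scheme \<Rightarrow> bool" where
  "formal u K A \<longleftrightarrow> dgca_equivalent TYPE(('k + 'a + 'u) list) K A (cohomology A)"

text \<open>The isomorphism $H^0 \cong F$ is one of algebras over the ground field.\<close>

definition highly_connected ::
    "('k, 'l) ring_scheme \<Rightarrow> ('k, 'a, 'm) dga_scheme \<Rightarrow> nat \<Rightarrow> bool" where
  "highly_connected K A s \<longleftrightarrow>
     (let H = cohomology A in
       (\<exists>f \<in> ring_iso K (H\<lparr>carrier := piece H 0\<rparr>).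
           \<forall>a\<in>carrier K. \<forall>b\<in>carrier K. f (a \<otimes>\<^bsub>K\<^esub> b) = a \<odot>\<^bsub>H\<^esub> f b) \<and>
       (\<forall>k. 1 \<le> k \<and> k \<le> s \<longrightarrow> piece H k = {\<zero>\<^bsub>H\<^esub>}))"


section \<open>Poincare algebras and Hodge type decompositions\<close>

definition finite_dimensional ::
    "('k, 'l) ring_scheme \<Rightarrow> ('k, 'a, 'm) module_scheme \<Rightarrow> bool" where
  "finite_dimensional K V \<longleftrightarrow>
     (\<exists>S. finite S \<and> S \<subseteq> carrier V \<and>
       (\<forall>x\<in>carrier V. \<exists>c \<in> S \<rightarrow> carrier K. x = (\<Oplus>\<^bsub>V\<^esub>s\<in>S. c s \<odot>\<^bsub>V\<^esub> s)))"

text \<open>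
  The bilinear extension of the pairing of homogeneous elements that is
  $\int \alpha^k \beta^l$ for $k + l = n$ and $0$ otherwise.
\<close>

definition pairing ::
    "('k, 'l) ring_scheme \<Rightarrow> ('k, 'a, 'm) dga_scheme \<Rightarrow> nat \<Rightarrow> ('a \<Rightarrow> 'k) \<Rightarrow> 'a \<Rightarrow> 'a \<Rightarrow> 'k" where
  "pairing K A n I x y = (\<Oplus>\<^bsub>K\<^esub>k\<in>{..n}. I (component A k x \<otimes>\<^bsub>A\<^esub> component A (n - k) y))"

definition poincare_algebra ::
    "('k, 'l) ring_scheme \<Rightarrow> ('k, 'a, 'm) dga_scheme \<Rightarrow> nat \<Rightarrow> ('a \<Rightarrow> 'k) \<Rightarrow> bool" where
  "poincare_algebra K H n I \<longleftrightarrow>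
     graded_comm_algebra K H \<and> finite_dimensional K H \<and>
     (\<forall>k>n. piece H k = {\<zero>\<^bsub>H\<^esub>}) \<and>
     I \<in> piece H n \<rightarrow> carrier K \<and>
     (\<forall>x\<in>piece H n. \<forall>y\<in>piece H n. I (x \<oplus>\<^bsub>H\<^esub> y) = I x \<oplus>\<^bsub>K\<^esub> I y) \<and>
     (\<forall>a\<in>carrier K. \<forall>x\<in>piece H n. I (a \<odot>\<^bsub>H\<^esub> x) = a \<otimes>\<^bsub>K\<^esub> I x) \<and>
     (\<forall>x\<in>carrier H. (\<forall>y\<in>carrier H. pairing K H n I x y = \<zero>\<^bsub>K\<^esub>) \<longrightarrow> x = \<zero>\<^bsub>H\<^esub>) \<and>
     (\<forall>y\<in>carrier H. (\<forall>x\<in>carrier H. pairing K H n I x y = \<zero>\<^bsub>K\<^esub>) \<longrightarrow> y = \<zero>\<^bsub>H\<^esub>)"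

definition poincare_dgca ::
    "('k, 'l) ring_scheme \<Rightarrow> ('k, 'a, 'm) dga_scheme \<Rightarrow> nat \<Rightarrow> ('a set \<Rightarrow> 'k) \<Rightarrow> bool" where
  "poincare_dgca K A n I \<longleftrightarrow>
     dgca K A \<and> (\<forall>k>n. piece A k = {\<zero>\<^bsub>A\<^esub>}) \<and> poincare_algebra K (cohomology A) n I"

text \<open>Elements of degree \<open>n\<close> of a Poincare DGCA are closed, so \<open>I \<circ> cls A\<close> makes sense on them.\<close>

definition induced_pairing ::
    "('k, 'l) ring_scheme \<Rightarrow> ('k, 'a, 'm) dga_scheme \<Rightarrow> nat \<Rightarrow> ('a set \<Rightarrow> 'k) \<Rightarrow> 'a \<Rightarrow> 'a \<Rightarrow> 'k" where
  "induced_pairing K A n I = pairing K A n (I \<circ> cls A)"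

definition harmonic_subspace ::
    "('k, 'l) ring_scheme \<Rightarrow> ('k, 'a, 'm) dga_scheme \<Rightarrow> 'a set \<Rightarrow> bool" where
  "harmonic_subspace K A \<H> \<longleftrightarrow>
     graded_subspace K A \<H> \<and> direct_sum A (cocycles A) (boundaries A) \<H>"

definition hodge_parts :: "('k, 'a, 'm) dga_scheme \<Rightarrow> 'a set \<Rightarrow> 'a set \<Rightarrow> 'a \<Rightarrow> 'a \<times> 'a \<times> 'a \<Rightarrow> bool" where
  "hodge_parts A \<H> \<B> x = (\<lambda>(e, h, b).
     e \<in> boundaries A \<and> h \<in> \<H> \<and> b \<in> \<B> \<and> x = e \<oplus>\<^bsub>A\<^esub> h \<oplus>\<^bsub>A\<^esub> b)"

definition hodge_decomposition ::
    "('k, 'l) ring_scheme \<Rightarrow> ('k, 'a, 'm) dga_scheme \<Rightarrow> nat \<Rightarrow> ('a set \<Rightarrow> 'k) \<Rightarrow>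
     'a set \<Rightarrow> 'a set \<Rightarrow> bool" where
  "hodge_decomposition K A n I \<H> \<B> \<longleftrightarrow>
     harmonic_subspace K A \<H> \<and> graded_subspace K A \<B> \<and>
     (\<forall>x\<in>carrier A. \<exists>!p. hodge_parts A \<H> \<B> x p) \<and>
     (\<forall>x \<in> \<H> <+>\<^bsub>A\<^esub> \<B>. \<forall>y\<in>\<B>. induced_pairing K A n I x y = \<zero>\<^bsub>K\<^esub>)"

definition hodge_type ::
    "('k, 'l) ring_scheme \<Rightarrow> ('k, 'a, 'm) dga_scheme \<Rightarrow> nat \<Rightarrow> ('a set \<Rightarrow> 'k) \<Rightarrow> bool" where
  "hodge_type K A n I \<longleftrightarrow> (\<exists>\<H> \<B>. hodge_decomposition K A n I \<H> \<B>)"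

definition exact_part :: "('k, 'a, 'm) dga_scheme \<Rightarrow> 'a set \<Rightarrow> 'a set \<Rightarrow> 'a \<Rightarrow> 'a" where
  "exact_part A \<H> \<B> x = fst (THE p. hodge_parts A \<H> \<B> x p)"

definition harmonic_part :: "('k, 'a, 'm) dga_scheme \<Rightarrow> 'a set \<Rightarrow> 'a set \<Rightarrow> 'a \<Rightarrow> 'a" where
  "harmonic_part A \<H> \<B> x = fst (snd (THE p. hodge_parts A \<H> \<B> x p))"

definition diff_inv :: "('k, 'a, 'm) dga_scheme \<Rightarrow> 'a set \<Rightarrow> 'a set \<Rightarrow> 'a \<Rightarrow> 'a" where
  "diff_inv A \<H> \<B> x = (THE b. b \<in> \<B> \<and> diff A b = exact_part A \<H> \<B> x)"


section \<open>Adapted harmonic subspaces\<close>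

text \<open>Noncommutative polynomials in the elements of \<open>U\<close>: finitely supported functions on words.\<close>

definition free_algebra :: "('k, 'l) ring_scheme \<Rightarrow> 'x set \<Rightarrow> ('k, 'x list \<Rightarrow> 'k) module" where
  "free_algebra K U =
     \<lparr>carrier = {f. (\<forall>w. f w \<in> carrier K) \<and> finite {w. f w \<noteq> \<zero>\<^bsub>K\<^esub>} \<and>
                    (\<forall>w. f w \<noteq> \<zero>\<^bsub>K\<^esub> \<longrightarrow> set w \<subseteq> U)},
      monoid.mult = (\<lambda>f g w. \<Oplus>\<^bsub>K\<^esub>i\<in>{..length w}. f (take i w) \<otimes>\<^bsub>K\<^esub> g (drop i w)),
      monoid.one = (\<lambda>w. if w = [] then \<one>\<^bsub>K\<^esub> else \<zero>\<^bsub>K\<^esub>),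
      ring.zero = (\<lambda>w. \<zero>\<^bsub>K\<^esub>),
      ring.add = (\<lambda>f g w. f w \<oplus>\<^bsub>K\<^esub> g w),
      smult = (\<lambda>a f w. a \<otimes>\<^bsub>K\<^esub> f w)\<rparr>"

definition letter :: "('k, 'l) ring_scheme \<Rightarrow> 'x \<Rightarrow> 'x list \<Rightarrow> 'k" where
  "letter K x = (\<lambda>w. if w = [x] then \<one>\<^bsub>K\<^esub> else \<zero>\<^bsub>K\<^esub>)"

text \<open>
  The graded symmetric algebra of a graded subspace \<open>G\<close> of \<open>H\<close>: generators are the elements of
  \<open>G\<close>; relations are the linear relations of \<open>G\<close> and graded commutativity.
\<close>

definition sym_relations ::
    "('k, 'l) ring_scheme \<Rightarrow> ('k, 'h, 'm) dga_scheme \<Rightarrow> 'h set \<Rightarrow> ('h list \<Rightarrow> 'k) set" where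
  "sym_relations K H G = (let F = free_algebra K G; \<l> = letter K in
     {\<l> (x \<oplus>\<^bsub>H\<^esub> y) \<ominus>\<^bsub>F\<^esub> (\<l> x \<oplus>\<^bsub>F\<^esub> \<l> y) | x y. x \<in> G \<and> y \<in> G} \<union>
     {\<l> (a \<odot>\<^bsub>H\<^esub> x) \<ominus>\<^bsub>F\<^esub> (a \<odot>\<^bsub>F\<^esub> \<l> x) | a x. a \<in> carrier K \<and> x \<in> G} \<union>
     {(\<l> x \<otimes>\<^bsub>F\<^esub> \<l> y) \<ominus>\<^bsub>F\<^esub> ksign F (i * j) (\<l> y \<otimes>\<^bsub>F\<^esub> \<l> x)
        | x y i j. x \<in> G \<inter> piece H i \<and> y \<in> G \<inter> piece H j})"

definition sym_ideal ::
    "('k, 'l) ring_scheme \<Rightarrow> ('k, 'h, 'm) dga_scheme \<Rightarrow> 'h set \<Rightarrow> ('h list \<Rightarrow> 'k) set" where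
  "sym_ideal K H G = Idl\<^bsub>free_algebra K G\<^esub> (sym_relations K H G)"

definition sym_algebra ::
    "('k, 'l) ring_scheme \<Rightarrow> ('k, 'h, 'm) dga_scheme \<Rightarrow> 'h set \<Rightarrow> ('k, ('h list \<Rightarrow> 'k) set) module" where
  "sym_algebra K H G = quotient_algebra (free_algebra K G) (sym_ideal K H G)"

definition sym_incl ::
    "('k, 'l) ring_scheme \<Rightarrow> ('k, 'h, 'm) dga_scheme \<Rightarrow> 'h set \<Rightarrow> 'h \<Rightarrow> ('h list \<Rightarrow> 'k) set" where
  "sym_incl K H G x = sym_ideal K H G +>\<^bsub>free_algebra K G\<^esub> letter K x"

definition positive_part :: "('k, 'h, 'm) dga_scheme \<Rightarrow> 'h set" where
  "positive_part H = {x \<in> carrier H. component H 0 x = \<zero>\<^bsub>H\<^esub>}"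

definition generating_subspace ::
    "('k, 'l) ring_scheme \<Rightarrow> ('k, 'h, 'm) dga_scheme \<Rightarrow> 'h set \<Rightarrow> bool" where
  "generating_subspace K H G \<longleftrightarrow>
     graded_subspace K H G \<and>
     direct_sum H (positive_part H) G (ideal_prod H (positive_part H) (positive_part H))"

definition partial_splitting ::
    "('k, 'l) ring_scheme \<Rightarrow> ('k, 'a, 'm) dga_scheme \<Rightarrow> 'a set set \<Rightarrow> ('a set \<Rightarrow> 'a) \<Rightarrow> bool" where
  "partial_splitting K A G \<iota>\<^sub>0 \<longleftrightarrow>
     linear_on K (cohomology A) G (A\<lparr>carrier := cocycles A\<rparr>) \<iota>\<^sub>0 \<and>
     (\<forall>k. \<forall>x \<in> G \<inter> piece (cohomology A) k. \<iota>\<^sub>0 x \<in> piece A k) \<and>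
     (\<forall>x\<in>G. cls A (\<iota>\<^sub>0 x) = x)"

definition sym_extension ::
    "('k, 'l) ring_scheme \<Rightarrow> ('k, 'a, 'm) dga_scheme \<Rightarrow> 'a set set \<Rightarrow> ('a set \<Rightarrow> 'a) \<Rightarrow>
     (('a set list \<Rightarrow> 'k) set \<Rightarrow> 'a) \<Rightarrow> bool" where
  "sym_extension K A G \<iota>\<^sub>0 \<Phi> \<longleftrightarrow>
     \<Phi> \<in> algebra_hom K (sym_algebra K (cohomology A) G) (A\<lparr>carrier := cocycles A\<rparr>) \<and>
     (\<forall>x\<in>G. \<Phi> (sym_incl K (cohomology A) G x) = \<iota>\<^sub>0 x)"

text \<open>\<open>\<H>\<close> is adapted, as witnessed by the section \<open>\<iota>\<close>, which \<open>\<H>\<close> determines.\<close>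

definition adapted ::
    "('k, 'l) ring_scheme \<Rightarrow> ('k, 'a, 'm) dga_scheme \<Rightarrow> 'a set \<Rightarrow> ('a set \<Rightarrow> 'a) \<Rightarrow> bool" where
  "adapted K A \<H> \<iota> \<longleftrightarrow>
     (let H = cohomology A in
       harmonic_subspace K A \<H> \<and> \<H> = \<iota> ` carrier H \<and>
       linear_on K H (carrier H) (A\<lparr>carrier := cocycles A\<rparr>) \<iota> \<and>
       (\<forall>x\<in>carrier H. cls A (\<iota> x) = x) \<and>
       (\<exists>G \<iota>\<^sub>0 \<Phi>. generating_subspace K H G \<and> partial_splitting K A G \<iota>\<^sub>0 \<and>
          sym_extension K A G \<iota>\<^sub>0 \<Phi> \<and>
          (\<forall>x\<in>G. \<iota> x = \<iota>\<^sub>0 x) \<and> \<iota> ` carrier H \<subseteq> \<Phi> ` carrier (sym_algebra K H G)))"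


section \<open>Hochschild cohomology in bidegree (3, -1)\<close>

definition piece_pred :: "('k, 'h, 'm) dga_scheme \<Rightarrow> nat \<Rightarrow> 'h set" where
  "piece_pred H k = (case k of 0 \<Rightarrow> {\<zero>\<^bsub>H\<^esub>} | Suc j \<Rightarrow> piece H j)"

text \<open>
  Multilinear maps are extensional functions on tuples, so that two cochains are equal iff they
  agree on the carrier.
\<close>

definition cochains2 ::
    "('k, 'l) ring_scheme \<Rightarrow> ('k, 'h, 'm) dga_scheme \<Rightarrow> ('h \<times> 'h \<Rightarrow> 'h) set" where
  "cochains2 K H = {\<phi> \<in> carrier H \<times> carrier H \<rightarrow>\<^sub>E carrier H.
     (\<forall>x\<in>carrier H. linear_on K H (carrier H) H (\<lambda>y. \<phi> (x, y))) \<and>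
     (\<forall>y\<in>carrier H. linear_on K H (carrier H) H (\<lambda>x. \<phi> (x, y))) \<and>
     (\<forall>i j. \<forall>x\<in>piece H i. \<forall>y\<in>piece H j. \<phi> (x, y) \<in> piece_pred H (i + j))}"

definition cochains3 ::
    "('k, 'l) ring_scheme \<Rightarrow> ('k, 'h, 'm) dga_scheme \<Rightarrow> ('h \<times> 'h \<times> 'h \<Rightarrow> 'h) set" where
  "cochains3 K H = {f \<in> carrier H \<times> carrier H \<times> carrier H \<rightarrow>\<^sub>E carrier H.
     (\<forall>y\<in>carrier H. \<forall>z\<in>carrier H. linear_on K H (carrier H) H (\<lambda>x. f (x, y, z))) \<and>
     (\<forall>x\<in>carrier H. \<forall>z\<in>carrier H. linear_on K H (carrier H) H (\<lambda>y. f (x, y, z))) \<and>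
     (\<forall>x\<in>carrier H. \<forall>y\<in>carrier H. linear_on K H (carrier H) H (\<lambda>z. f (x, y, z))) \<and>
     (\<forall>i j k. \<forall>x\<in>piece H i. \<forall>y\<in>piece H j. \<forall>z\<in>piece H k.
        f (x, y, z) \<in> piece_pred H (i + j + k))}"

definition cochain3_group ::
    "('k, 'l) ring_scheme \<Rightarrow> ('k, 'h, 'm) dga_scheme \<Rightarrow> ('h \<times> 'h \<times> 'h \<Rightarrow> 'h) monoid" where
  "cochain3_group K H =
     \<lparr>carrier = cochains3 K H,
      monoid.mult = (\<lambda>f g. \<lambda>t \<in> carrier H \<times> carrier H \<times> carrier H. f t \<oplus>\<^bsub>H\<^esub> g t),
      monoid.one = (\<lambda>t \<in> carrier H \<times> carrier H \<times> carrier H. \<zero>\<^bsub>H\<^esub>)\<rparr>"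

definition hoch_cocycles ::
    "('k, 'l) ring_scheme \<Rightarrow> ('k, 'h, 'm) dga_scheme \<Rightarrow> ('h \<times> 'h \<times> 'h \<Rightarrow> 'h) set" where
  "hoch_cocycles K H = {f \<in> cochains3 K H.
     \<forall>x\<in>carrier H. \<forall>y\<in>carrier H. \<forall>z\<in>carrier H. \<forall>w\<in>carrier H.
       (f (x, y, z) \<otimes>\<^bsub>H\<^esub> w) \<oplus>\<^bsub>H\<^esub> (parity H x \<otimes>\<^bsub>H\<^esub> f (y, z, w)) \<ominus>\<^bsub>H\<^esub> f (x \<otimes>\<^bsub>H\<^esub> y, z, w)
         \<oplus>\<^bsub>H\<^esub> f (x, y \<otimes>\<^bsub>H\<^esub> z, w) \<ominus>\<^bsub>H\<^esub> f (x, y, z \<otimes>\<^bsub>H\<^esub> w) = \<zero>\<^bsub>H\<^esub>}"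

text \<open>
  The signs of the last two terms are the ones for which coboundaries satisfy the cocycle
  condition above. With both of them reversed, the cocycle expression of the result is
  $2(\phi(x, yz)w - \phi(xy, z)w + (-1)^{\deg x} x(\phi(y, zw) - \phi(yz, w)))$,
  which need not vanish.
\<close>

definition d_hoch ::
    "('k, 'h, 'm) dga_scheme \<Rightarrow> ('h \<times> 'h \<Rightarrow> 'h) \<Rightarrow> 'h \<times> 'h \<times> 'h \<Rightarrow> 'h" where
  "d_hoch H \<phi> = (\<lambda>(x, y, z) \<in> carrier H \<times> carrier H \<times> carrier H.
     (\<phi> (x, y) \<otimes>\<^bsub>H\<^esub> z) \<ominus>\<^bsub>H\<^esub> (parity H x \<otimes>\<^bsub>H\<^esub> \<phi> (y, z))
       \<oplus>\<^bsub>H\<^esub> \<phi> (x \<otimes>\<^bsub>H\<^esub> y, z) \<ominus>\<^bsub>H\<^esub> \<phi> (x, y \<otimes>\<^bsub>H\<^esub> z))"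

definition hoch_coboundaries ::
    "('k, 'l) ring_scheme \<Rightarrow> ('k, 'h, 'm) dga_scheme \<Rightarrow> ('h \<times> 'h \<times> 'h \<Rightarrow> 'h) set" where
  "hoch_coboundaries K H = d_hoch H ` cochains2 K H"

text \<open>\<open>Hoch3 K H\<close> is the summand of bidegree $(3,-1)$ of the Hochschild cohomology in degree 2.\<close>

definition Hoch3 ::
    "('k, 'l) ring_scheme \<Rightarrow> ('k, 'h, 'm) dga_scheme \<Rightarrow> ('h \<times> 'h \<times> 'h \<Rightarrow> 'h) set monoid" where
  "Hoch3 K H = (cochain3_group K H)\<lparr>carrier := hoch_cocycles K H\<rparr> Mod hoch_coboundaries K H"

definition hoch_class ::
    "('k, 'l) ring_scheme \<Rightarrow> ('k, 'h, 'm) dga_scheme \<Rightarrow> ('h \<times> 'h \<times> 'h \<Rightarrow> 'h) \<Rightarrow>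
     ('h \<times> 'h \<times> 'h \<Rightarrow> 'h) set" where
  "hoch_class K H f = hoch_coboundaries K H #>\<^bsub>cochain3_group K H\<^esub> f"


section \<open>The ternary operation\<close>

definition m3 :: "('k, 'a, 'm) dga_scheme \<Rightarrow> 'a set \<Rightarrow> 'a set \<Rightarrow> 'a \<Rightarrow> 'a \<Rightarrow> 'a \<Rightarrow> 'a" where
  "m3 A \<H> \<B> \<alpha> \<beta> \<gamma> = harmonic_part A \<H> \<B>
     ((diff_inv A \<H> \<B> (\<alpha> \<otimes>\<^bsub>A\<^esub> \<beta>) \<otimes>\<^bsub>A\<^esub> \<gamma>) \<ominus>\<^bsub>A\<^esub>
      (parity A \<alpha> \<otimes>\<^bsub>A\<^esub> diff_inv A \<H> \<B> (\<beta> \<otimes>\<^bsub>A\<^esub> \<gamma>)))"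

definition mu3 ::
    "('k, 'a, 'm) dga_scheme \<Rightarrow> 'a set \<Rightarrow> ('a set \<Rightarrow> 'a) \<Rightarrow> 'a set \<Rightarrow>
     'a set \<times> 'a set \<times> 'a set \<Rightarrow> 'a set" where
  "mu3 A \<H> \<iota> \<B> =
     (let C = carrier (cohomology A) in
       (\<lambda>(x, y, z) \<in> C \<times> C \<times> C. cls A (m3 A \<H> \<B> (\<iota> x) (\<iota> y) (\<iota> z))))"

text \<open>A choice of an adapted harmonic subspace and an associated Hodge type decomposition.\<close>

definition adapted_hodge ::
    "('k, 'l) ring_scheme \<Rightarrow> ('k, 'a, 'm) dga_scheme \<Rightarrow> nat \<Rightarrow> ('a set \<Rightarrow> 'k) \<Rightarrow>
     'a set \<Rightarrow> ('a set \<Rightarrow> 'a) \<Rightarrow> 'a set \<Rightarrow> bool" where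
  "adapted_hodge K A n I \<H> \<iota> \<B> \<longleftrightarrow> adapted K A \<H> \<iota> \<and> hodge_decomposition K A n I \<H> \<B>"

definition mu3_class ::
    "('k, 'l) ring_scheme \<Rightarrow> ('k, 'a, 'm) dga_scheme \<Rightarrow> nat \<Rightarrow> ('a set \<Rightarrow> 'k) \<Rightarrow>
     ('a set \<times> 'a set \<times> 'a set \<Rightarrow> 'a set) set" where
  "mu3_class K A n I =
     (THE c. \<exists>\<H> \<iota> \<B>. adapted_hodge K A n I \<H> \<iota> \<B> \<and>
               c = hoch_class K (cohomology A) (mu3 A \<H> \<iota> \<B>))"

end

theory Submission
  imports Defs "HOL-Library.Multiset"
begin

text \<open>
  The class of \<open>\<mu>\<^sub>3\<close> is the Massey class of a DGCA: any section \<open>\<iota>\<close> of the cohomology and any homotopy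
  \<open>h\<close> for its multiplicativity give a cocycle, another choice changes it by a coboundary, and
  quasi-isomorphisms preserve the class. Hence it is well defined and vanishes for formal algebras.

  Conversely, a primitive \<open>\<phi>\<close> of \<open>\<mu>\<^sub>3\<close> can be made graded symmetric without component in degree \<open>n\<close>.
  The harmonic projection \<open>f\<close> has a homotopy \<open>f\<^sub>2\<close>, which by $n \le 5r - 3$ and Poincare duality is associative
  up to \<open>\<mu>\<^sub>3\<close>. Correcting it by \<open>\<phi>\<close> makes a cylinder of \<open>f\<close>, on a subalgebra of high degree, into a DGCA
  quasi-isomorphic to both the algebra and its cohomology.

  An adapted harmonic subspace is a complement of the exact elements in the subalgebra generated
  by a partial splitting; a Hodge decomposition can be moved to it, dividing by 2.
\<close>

section \<open>Linear arithmetic in abelian groups\<close>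

text \<open>The usual path object of an A-infinity morphism $f$ multiplies the shifted cohomology by
  $f(q)$ on one side and by a strict value $h$ on the other. This is associative but not graded
  commutative, so it is no DGCA. Here both sides act through the average of $f(q)$ and $h$; the
  Leibniz rule survives since $aa' - bb' = (a-b)(a'+b')/2 + (a+b)(a'-b')/2$. The average is not
  multiplicative, and the degree bounds are chosen so that this does no harm. A product of two
  classes of positive degree has degree at least $2r$, a primitive of it at least $2r-1$. Unwanted
  terms then fall into one of two ranges: degree at least $5r-2$, which exceeds $n$, or degree at
  least $4r-2$ with vanishing integral, where connectedness and Poincare duality leave only $H^n$,
  which the integral detects.\<close>

fun lsum :: "('a, 'm) ring_scheme => 'a list => 'a" where
  "lsum G [] = \<zero>\<^bsub>G\<^esub>"
| "lsum G (x # xs) = x \<oplus>\<^bsub>G\<^esub> lsum G xs"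

text \<open>
  An equation between sums with signs is reduced by the rules \<open>ag\<close> to an equation of
  multisets of atoms; \<open>rep G x ps ns\<close> says that $x = \sum ps - \sum ns$.
\<close>

definition rep :: "('a, 'm) ring_scheme => 'a => 'a list => 'a list => bool" where
  "rep G x ps ns \<longleftrightarrow> (set (ps @ ns) \<subseteq> carrier G \<longrightarrow>
     x \<in> carrier G \<and> x \<oplus>\<^bsub>G\<^esub> lsum G ns = lsum G ps)"

context abelian_group
begin

lemma lsum_closed: "set xs \<subseteq> carrier G ==> lsum G xs \<in> carrier G" by (induct xs) auto

lemma lsum_append:
  "[|set xs \<subseteq> carrier G; set ys \<subseteq> carrier G|] ==> lsum G (xs @ ys) = lsum G xs \<oplus> lsum G ys"
  by (induct xs) (auto simp: lsum_closed a_assoc)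

lemma lsum_mset:
  "[|mset xs = mset ys; set xs \<subseteq> carrier G|] ==> lsum G xs = lsum G ys"
proof (induct xs arbitrary: ys)
  case (Cons x xs)
  then have "x \<in> set ys" by (metis list.set_intros(1) set_mset_mset)
  then obtain us vs where ys: "ys = us @ x # vs" by (meson split_list)
  have xs: "mset xs = mset (us @ vs)" using Cons.prems(1) ys by simp
  have sub: "set (us @ vs) \<subseteq> carrier G"
    using xs Cons.prems(2) by (metis dual_order.trans set_mset_mset set_subset_Cons)
  have x: "x \<in> carrier G" using Cons.prems(2) by simp
  have "lsum G xs = lsum G (us @ vs)" using Cons xs by simp
  then show ?case using sub x by (simp add: ys lsum_append lsum_closed a_lcomm)
qed simp

lemma rep_add:
  assumes "rep G x ps ns" "rep G y ps' ns'" shows "rep G (x \<oplus> y) (ps @ ps') (ns @ ns')"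
proof -
  { assume s: "set ps \<subseteq> carrier G" "set ns \<subseteq> carrier G" "set ps' \<subseteq> carrier G" "set ns' \<subseteq> carrier G"
    then have c: "x \<in> carrier G" "y \<in> carrier G" "lsum G ns \<in> carrier G" "lsum G ns' \<in> carrier G"
      using assms by (auto simp: rep_def lsum_closed)
    then have "x \<oplus> y \<oplus> (lsum G ns \<oplus> lsum G ns') = (x \<oplus> lsum G ns) \<oplus> (y \<oplus> lsum G ns')"
      by (simp add: a_ac)
    then have "x \<oplus> y \<oplus> (lsum G ns \<oplus> lsum G ns') = lsum G ps \<oplus> lsum G ps'"
      using assms s by (simp add: rep_def) }
  with assms show ?thesis by (auto simp: rep_def lsum_append)
qed

lemma rep_neg:
  assumes "rep G x ps ns" shows "rep G (\<ominus> x) ns ps"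
proof -
  { assume s: "set ps \<subseteq> carrier G" "set ns \<subseteq> carrier G"
    then have c: "x \<in> carrier G" "lsum G ns \<in> carrier G"
      using assms by (auto simp: rep_def lsum_closed)
    have "\<ominus> x \<oplus> lsum G ps = \<ominus> x \<oplus> (x \<oplus> lsum G ns)" using assms s by (simp add: rep_def)
    also have "\<dots> = lsum G ns" using c by (simp add: r_neg1)
    finally have "\<ominus> x \<oplus> lsum G ps = lsum G ns" . }
  with assms show ?thesis by (auto simp: rep_def)
qed

lemma rep_minus:
  "[|rep G x ps ns; rep G y ps' ns'|] ==> rep G (x \<ominus> y) (ps @ ns') (ns @ ps')"
  unfolding a_minus_def by (intro rep_add rep_neg)

lemma rep_zero: "rep G \<zero> [] []" by (simp add: rep_def)

lemma rep_atom: "rep G x [x] []" by (simp add: rep_def)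

lemmas rep_intros = rep_add rep_minus rep_neg rep_zero rep_atom

text \<open>Moving the negative atoms across gives \<open>x + ns + ns' = y + ns + ns'\<close>, and
  the common part cancels.\<close>

lemma ag_eqI:
  assumes "rep G x ps ns" "rep G y ps' ns'" "set ps \<union> set ns \<union> set ps' \<union> set ns' \<subseteq> carrier G"
    and "mset (ps @ ns') = mset (ps' @ ns)"
  shows "x = y"
proof -
  have c: "x \<in> carrier G" "y \<in> carrier G" "lsum G ns \<in> carrier G" "lsum G ns' \<in> carrier G"
    using assms by (auto simp: rep_def lsum_closed)
  have e: "x \<oplus> lsum G ns = lsum G ps" "y \<oplus> lsum G ns' = lsum G ps'"
    using assms by (auto simp: rep_def)
  have "(x \<oplus> lsum G ns) \<oplus> lsum G ns' = (y \<oplus> lsum G ns') \<oplus> lsum G ns"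
    using lsum_mset[OF assms(4)] assms(3) e by (simp add: lsum_append)
  then have "x \<oplus> (lsum G ns \<oplus> lsum G ns') = y \<oplus> (lsum G ns \<oplus> lsum G ns')"
    using c by (simp add: a_assoc) (simp add: a_comm)
  then show ?thesis using c by simp
qed

text \<open>\<open>(rule ag)+\<close> turns an equation of group terms into two goals: the atoms lie
  in the carrier, and two multisets of atoms agree. Because the carrier condition is a premise
  inside \<open>rep\<close>, unification can fill in the lists before anything is known about their
  members. \<open>rep_atom\<close> comes last and takes whatever is not a sum, difference, negative
  or zero.\<close>

lemmas ag = ag_eqI rep_intros

lemma diff_zero_eq: "[|x \<in> carrier G; y \<in> carrier G; x \<ominus> y = \<zero>|] ==> x = y"
  by (metis add.inv_closed add.inv_solve_right' l_zero minus_eq zero_closed)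

lemma minus_self [simp]: "x \<in> carrier G ==> x \<ominus> x = \<zero>" by (simp add: minus_eq r_neg)

lemma finsum_superset:
  assumes "finite S" "T \<subseteq> S" "!!k. k \<in> S ==> k \<notin> T ==> c k = \<zero>" "!!k. k \<in> S ==> c k \<in> carrier G"
  shows "finsum G c T = finsum G c S" using assms by (intro add.finprod_mono_neutral_cong_left) auto

end

section \<open>Graded algebras\<close>

locale gca = graded_comm_algebra K A
  for K :: "('k, 'l) ring_scheme" and A :: "('k, 'a, 'm) dga_scheme" (structure)
begin

lemma piece_carrier: "x \<in> piece A k ==> x \<in> carrier A"
  using submoduleE(1)[OF piece_submodule] by blast

lemma piece_add: "[|x \<in> piece A k; y \<in> piece A k|] ==> x \<oplus> y \<in> piece A k"
  using submoduleE(5)[OF piece_submodule] by blast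

lemma piece_neg: "x \<in> piece A k ==> \<ominus> x \<in> piece A k"
  using submoduleE(3)[OF piece_submodule] by blast

lemma piece_minus: "[|x \<in> piece A k; y \<in> piece A k|] ==> x \<ominus> y \<in> piece A k"
  by (simp add: a_minus_def piece_add piece_neg)

lemma piece_smult: "[|a \<in> carrier K; x \<in> piece A k|] ==> a \<odot> x \<in> piece A k"
  using submoduleE(4)[OF piece_submodule] by blast

lemma piece_zero: "\<zero> \<in> piece A k"
  using piece_smult[OF K.zero_closed] submoduleE(1,2)[OF piece_submodule[of k]]
  by (metis ex_in_conv smult_l_null subset_iff)

lemma smult_neg: "[|a \<in> carrier K; x \<in> carrier A|] ==> a \<odot> (\<ominus> x) = \<ominus> (a \<odot> x)"
  by (rule smult_r_minus)

lemma smult_minus: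
  "[|a \<in> carrier K; x \<in> carrier A; y \<in> carrier A|] ==> a \<odot> (x \<ominus> y) = a \<odot> x \<ominus> a \<odot> y"
  by (simp add: a_minus_def smult_r_distr smult_neg)

lemma decomposition_component:
  assumes "x \<in> carrier A" shows "is_decomposition A x (\<lambda>k. component A k x)"
  using theI'[OF unique_decomposition[OF assms]] by (simp add: component_def)

lemma component_unique: "[|x \<in> carrier A; is_decomposition A x c|] ==> component A k x = c k"
  unfolding component_def by (simp add: the1_equality[OF unique_decomposition])

lemma decompositionI:
  assumes "finite S" "!!k. c k \<in> piece A k" "!!k. k \<notin> S ==> c k = \<zero>" "x = (\<Oplus>k\<in>S. c k)"
  shows "is_decomposition A x c"
proof -
  have sub: "{k. c k \<noteq> \<zero>} \<subseteq> S" using assms(3) by blast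
  then have "finite {k. c k \<noteq> \<zero>}" using assms(1) finite_subset by blast
  moreover have "finsum A c {k. c k \<noteq> \<zero>} = finsum A c S"
    using assms(1,2) sub piece_carrier by (intro A.finsum_superset) auto
  ultimately show ?thesis using assms by (simp add: is_decomposition_def)
qed

lemma component_piece: "x \<in> carrier A ==> component A k x \<in> piece A k"
  using decomposition_component by (auto simp: is_decomposition_def)

lemma component_carrier [simp]: "x \<in> carrier A ==> component A k x \<in> carrier A"
  using component_piece piece_carrier by blast

lemma finite_support: "x \<in> carrier A ==> finite {k. component A k x \<noteq> \<zero>}"
  using decomposition_component by (auto simp: is_decomposition_def)

lemma sum_components:
  assumes "x \<in> carrier A" "finite S" "{k. component A k x \<noteq> \<zero>} \<subseteq> S"
  shows "(\<Oplus>k\<in>S. component A k x) = x"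
proof -
  have "x = (\<Oplus>k\<in>{k. component A k x \<noteq> \<zero>}. component A k x)"
    using decomposition_component[OF assms(1)] by (simp add: is_decomposition_def)
  also have "\<dots> = (\<Oplus>k\<in>S. component A k x)" using assms by (intro A.finsum_superset) auto
  finally show ?thesis by simp
qed

lemma component_of_piece:
  assumes "x \<in> piece A j" shows "component A k x = (if k = j then x else \<zero>)"
  using assms piece_zero piece_carrier by (intro component_unique decompositionI[of "{j}"]) auto

lemma component_same [simp]: "x \<in> piece A k ==> component A k x = x"
  by (simp add: component_of_piece)

lemma component_zero [simp]: "component A k \<zero> = \<zero>"
  using component_of_piece[OF piece_zero[of k]] by simp

lemma component_add:
  assumes "x \<in> carrier A" "y \<in> carrier A"
  shows "component A k (x \<oplus> y) = component A k x \<oplus> component A k y"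
proof -
  let ?S = "{k. component A k x \<noteq> \<zero>} \<union> {k. component A k y \<noteq> \<zero>}"
  have fin: "finite ?S" using assms finite_support by simp
  have "x \<oplus> y = (\<Oplus>k\<in>?S. component A k x) \<oplus> (\<Oplus>k\<in>?S. component A k y)"
    using sum_components[OF assms(1) fin] sum_components[OF assms(2) fin] by simp
  also have "\<dots> = (\<Oplus>k\<in>?S. component A k x \<oplus> component A k y)"
    using assms by (intro A.finsum_addf[symmetric]) auto
  finally have "is_decomposition A (x \<oplus> y) (\<lambda>k. component A k x \<oplus> component A k y)"
    using assms fin by (intro decompositionI[of ?S]) (auto intro!: piece_add component_piece)
  then show ?thesis using assms by (simp add: component_unique)
qed

lemma component_smult:
  assumes "a \<in> carrier K" "x \<in> carrier A"
  shows "component A k (a \<odot> x) = a \<odot> component A k x"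
proof -
  let ?S = "{k. component A k x \<noteq> \<zero>}"
  have fin: "finite ?S" using assms finite_support by simp
  have "a \<odot> x = a \<odot> (\<Oplus>k\<in>?S. component A k x)" using sum_components[OF assms(2) fin] by simp
  also have "\<dots> = (\<Oplus>k\<in>?S. a \<odot> component A k x)" using assms fin by (intro finsum_smult_ldistr) auto
  finally have "is_decomposition A (a \<odot> x) (\<lambda>k. a \<odot> component A k x)"
    using assms fin by (intro decompositionI[of ?S]) (auto intro!: piece_smult component_piece)
  then show ?thesis using assms by (simp add: component_unique)
qed

lemma component_neg:
  assumes "x \<in> carrier A" shows "component A k (\<ominus> x) = \<ominus> component A k x"
  using assms component_add[of x "\<ominus> x" k]
  by (metis A.add.inv_closed A.minus_equality A.r_neg A.a_comm component_carrier component_zero)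

lemma component_minus:
  "[|x \<in> carrier A; y \<in> carrier A|] ==> component A k (x \<ominus> y) = component A k x \<ominus> component A k y"
  by (simp add: a_minus_def component_add component_neg)

lemma component_component:
  "x \<in> carrier A ==> component A j (component A k x) = (if j = k then component A k x else \<zero>)"
  by (rule component_of_piece[OF component_piece])

lemma component_eqI:
  assumes "x \<in> carrier A" "y \<in> carrier A" "!!k. component A k x = component A k y"
  shows "x = y" using sum_components[OF assms(1) finite_support[OF assms(1)]]
    sum_components[OF assms(2) finite_support[OF assms(1)]] assms(3) by auto

lemma pieceI: "[|x \<in> carrier A; !!j. j \<noteq> k ==> component A j x = \<zero>|] ==> x \<in> piece A k"
  using component_eqI[of x "component A k x"] component_component[of x] component_piece[of x k]
  by (metis component_carrier)

text \<open>The elements of degree at least \<open>k\<close>. Degree estimates are made with this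
  filtration instead of homogeneous components: indices add under products
  (\<open>filt_mult\<close>), and the differential and the homotopy shift them by one.\<close>

definition filt :: "nat => 'a set" where
  "filt k = {x \<in> carrier A. \<forall>j<k. component A j x = \<zero>}"

lemma filt_carrier: "x \<in> filt k ==> x \<in> carrier A" by (simp add: filt_def)

lemma filt_add: "[|x \<in> filt k; y \<in> filt k|] ==> x \<oplus> y \<in> filt k"
  by (auto simp: filt_def component_add)

lemma filt_smult: "[|a \<in> carrier K; x \<in> filt k|] ==> a \<odot> x \<in> filt k"
  by (auto simp: filt_def component_smult)

lemma filt_neg: "x \<in> filt k ==> \<ominus> x \<in> filt k" by (auto simp: filt_def component_neg)

lemma filt_minus: "[|x \<in> filt k; y \<in> filt k|] ==> x \<ominus> y \<in> filt k"
  by (simp add: a_minus_def filt_add filt_neg)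

lemma filt_zero: "\<zero> \<in> filt k" by (auto simp: filt_def)

lemma filt_mono: "[|x \<in> filt k; j \<le> k|] ==> x \<in> filt j" by (auto simp: filt_def)

lemma filt_piece: "[|x \<in> piece A k; j \<le> k|] ==> x \<in> filt j"
  by (auto simp: filt_def component_of_piece piece_carrier)

lemma filt_0 [simp]: "filt 0 = carrier A" by (auto simp: filt_def)

text \<open>The components of \<open>x\<close> stay in \<open>filt i\<close>, and those of degree
  below \<open>i\<close> are zero. Hence homogeneous elements of degree at least \<open>i\<close>
  suffice, and both summands in the second case may be assumed to lie in
  \<open>filt i\<close>.\<close>

lemma filt_induct [consumes 1, case_names piece add]:
  assumes "x \<in> filt i" "!!k y. i \<le> k ==> y \<in> piece A k ==> Q y"
    "!!y z. y \<in> filt i ==> z \<in> filt i ==> Q y ==> Q z ==> Q (y \<oplus> z)"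
  shows "Q x"
proof -
  have x: "x \<in> carrier A" using assms(1) by (rule filt_carrier)
  have ge: "component A k x \<in> filt i \<and> Q (component A k x)" for k
  proof (cases "i \<le> k")
    case True
    then show ?thesis using component_piece[OF x, of k] assms(2) filt_piece by blast
  next
    case False
    then have "component A k x = \<zero>" using assms(1) by (simp add: filt_def)
    then show ?thesis using assms(2)[OF order_refl piece_zero] filt_zero by simp
  qed
  have "(\<Oplus>k\<in>S. component A k x) \<in> filt i \<and> Q (\<Oplus>k\<in>S. component A k x)" if "finite S" for S using that
  proof (induct S rule: finite_induct)
    case empty
    then show ?case using assms(2)[OF order_refl piece_zero] filt_zero by simp
  next
    case (insert k S)
    then show ?case using ge x by (auto simp: Pi_def intro!: filt_add assms(3))
  qed
  from this[OF finite_support[OF x]] show ?thesis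
    using sum_components[OF x finite_support[OF x] order_refl] by simp
qed

lemma graded_induct [consumes 1, case_names piece add]:
  assumes "x \<in> carrier A" "!!k y. y \<in> piece A k ==> Q y"
    "!!y z. y \<in> carrier A ==> z \<in> carrier A ==> Q y ==> Q z ==> Q (y \<oplus> z)"
  shows "Q x" using filt_induct[of x 0 Q] assms by auto

lemma filt_mult: "[|x \<in> filt i; y \<in> filt j|] ==> x \<otimes> y \<in> filt (i + j)"
proof (induct rule: filt_induct)
  case (piece k x)
  from piece(3) show ?case
  proof (induct rule: filt_induct)
    case (piece l y)
    then show ?case using mult_piece[OF \<open>x \<in> piece A k\<close>] \<open>i \<le> k\<close> by (blast intro: filt_piece add_mono)
  next
    case (add y z)
    then show ?case using piece(2) by (simp add: A.r_distr filt_carrier piece_carrier filt_add)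
  qed
next
  case (add y z)
  then show ?case by (simp add: A.l_distr filt_carrier filt_add)
qed

lemma filt_mult_ge: "[|x \<in> filt i; y \<in> filt j; k \<le> i + j|] ==> x \<otimes> y \<in> filt k"
  using filt_mult filt_mono by blast

lemma ksign_closed [simp]: "x \<in> carrier A ==> ksign A k x \<in> carrier A" by (simp add: ksign_def)

lemma ksign_piece: "x \<in> piece A j ==> ksign A k x \<in> piece A j" by (simp add: ksign_def piece_neg)

lemma ksign_add:
  "[|x \<in> carrier A; y \<in> carrier A|] ==> ksign A k (x \<oplus> y) = ksign A k x \<oplus> ksign A k y"
  by (simp add: ksign_def A.minus_add)

lemma component_parity:
  assumes "x \<in> carrier A"
  shows "component A k (parity A x) = ksign A k (component A k x)" "parity A x \<in> carrier A"
proof -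
  have d: "is_decomposition A (parity A x) (\<lambda>k. ksign A k (component A k x))"
    unfolding parity_def using assms finite_support
    by (intro decompositionI[of "{k. component A k x \<noteq> \<zero>}"])
      (auto simp: ksign_def intro!: piece_neg component_piece)
  show c: "parity A x \<in> carrier A" unfolding parity_def using assms by (intro A.finsum_closed) auto
  show "component A k (parity A x) = ksign A k (component A k x)" by (rule component_unique[OF c d])
qed

lemma parity_closed [simp]: "x \<in> carrier A ==> parity A x \<in> carrier A" by (rule component_parity(2))

lemma parity_homogeneous: "x \<in> piece A k ==> parity A x = ksign A k x"
  by (rule component_eqI) (auto simp: piece_carrier component_parity component_of_piece ksign_def component_neg)

lemma parity_add:
  "[|x \<in> carrier A; y \<in> carrier A|] ==> parity A (x \<oplus> y) = parity A x \<oplus> parity A y"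
  by (rule component_eqI) (auto simp: component_parity component_add ksign_add)

lemma parity_smult:
  "[|a \<in> carrier K; x \<in> carrier A|] ==> parity A (a \<odot> x) = a \<odot> parity A x"
  by (rule component_eqI) (auto simp: component_parity component_smult ksign_def smult_neg)

lemma parity_neg: "x \<in> carrier A ==> parity A (\<ominus> x) = \<ominus> parity A x"
  by (rule component_eqI) (auto simp: component_parity component_neg ksign_def)

lemma parity_minus:
  "[|x \<in> carrier A; y \<in> carrier A|] ==> parity A (x \<ominus> y) = parity A x \<ominus> parity A y"
  by (simp add: a_minus_def parity_add parity_neg)

lemma parity_zero [simp]: "parity A \<zero> = \<zero>"
  using parity_homogeneous[OF piece_zero[of 0]] by (simp add: ksign_def)

lemma parity_one [simp]: "parity A \<one> = \<one>"
  using parity_homogeneous[OF one_piece] by (simp add: ksign_def)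

lemma parity_parity [simp]: "x \<in> carrier A ==> parity A (parity A x) = x"
  by (rule component_eqI) (auto simp: component_parity ksign_def)

lemma parity_piece: "x \<in> piece A k ==> parity A x \<in> piece A k"
  by (simp add: parity_homogeneous ksign_piece)

lemma parity_filt: "x \<in> filt k ==> parity A x \<in> filt k"
  by (auto simp: filt_def component_parity ksign_def)

lemma parity_mult:
  "[|x \<in> carrier A; y \<in> carrier A|] ==> parity A (x \<otimes> y) = parity A x \<otimes> parity A y"
proof (induct rule: graded_induct)
  case (piece k x)
  from piece(2) show ?case
  proof (induct rule: graded_induct)
    case (piece l y)
    then show ?case using \<open>x \<in> piece A k\<close> mult_piece[OF \<open>x \<in> piece A k\<close>, of y l]
      by (auto simp: parity_homogeneous ksign_def piece_carrier A.l_minus A.r_minus)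
  next
    case (add y z)
    then show ?case using piece(1) by (simp add: A.r_distr piece_carrier parity_add)
  qed
next
  case (add y z)
  then show ?case by (simp add: A.l_distr parity_add)
qed

end

section \<open>Differential graded algebras\<close>

locale dg = dgca K A
  for K :: "('k, 'l) ring_scheme" and A :: "('k, 'a, 'm) dga_scheme" (structure)

sublocale dg \<subseteq> gca K A by unfold_locales

context dg
begin

abbreviation d :: "'a => 'a" where "d \<equiv> diff A"

lemma diff_closed [simp]: "x \<in> carrier A ==> d x \<in> carrier A"
proof (induct rule: graded_induct)
  case (piece k y)
  then show ?case using diff_piece piece_carrier by blast
qed (simp add: diff_add)

lemma diff_zero [simp]: "d \<zero> = \<zero>" using diff_smult[OF K.zero_closed A.zero_closed] by simp

lemma diff_neg: "x \<in> carrier A ==> d (\<ominus> x) = \<ominus> d x" using diff_add[of x "\<ominus> x"]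
  by (metis A.add.inv_closed A.minus_equality A.r_neg A.a_comm diff_closed diff_zero)

lemma diff_minus: "[|x \<in> carrier A; y \<in> carrier A|] ==> d (x \<ominus> y) = d x \<ominus> d y"
  by (simp add: a_minus_def diff_add diff_neg)

lemma component_diff_Suc: "x \<in> carrier A ==> component A (Suc k) (d x) = d (component A k x)"
proof (induct rule: graded_induct)
  case (piece l y)
  then show ?case using diff_piece[of y l] by (auto simp: component_of_piece)
qed (simp add: diff_add component_add)

lemma component_diff_0: "x \<in> carrier A ==> component A 0 (d x) = \<zero>"
proof (induct rule: graded_induct)
  case (piece l y)
  then show ?case using diff_piece[of y l] by (auto simp: component_of_piece)
qed (simp add: diff_add component_add)

lemma parity_diff: "x \<in> carrier A ==> parity A (d x) = \<ominus> d (parity A x)"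
proof (induct rule: graded_induct)
  case (piece l y)
  then show ?case using diff_piece[of y l]
    by (auto simp: parity_homogeneous ksign_def piece_carrier diff_neg)
qed (simp add: diff_add parity_add A.minus_add)

lemma diff_parity: "x \<in> carrier A ==> d (parity A x) = \<ominus> parity A (d x)" by (simp add: parity_diff)

text \<open>With \<open>parity\<close> in place of a sign the Leibniz rule holds for inhomogeneous
  elements too. Long identities can then be expanded by rewriting and closed by linear
  arithmetic.\<close>

lemma diff_mult:
  "[|x \<in> carrier A; y \<in> carrier A|] ==> d (x \<otimes> y) = d x \<otimes> y \<oplus> parity A x \<otimes> d y"
proof (induct rule: graded_induct)
  case (piece l x)
  then show ?case by (auto simp: leibniz parity_homogeneous ksign_def piece_carrier A.l_minus)
next
  case (add x z)
  have "d ((x \<oplus> z) \<otimes> y) = (d x \<otimes> y \<oplus> parity A x \<otimes> d y) \<oplus> (d z \<otimes> y \<oplus> parity A z \<otimes> d y)"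
    using add by (simp add: A.l_distr diff_add)
  also have "\<dots> = d (x \<oplus> z) \<otimes> y \<oplus> parity A (x \<oplus> z) \<otimes> d y"
    using add by (simp add: A.l_distr diff_add parity_add) ((rule A.ag)+, simp_all)
  finally show ?case .
qed

lemma diff_one [simp]: "d \<one> = \<zero>"
proof -
  have "d \<one> = d \<one> \<oplus> d \<one>" using diff_mult[of \<one> \<one>] by simp
  then show ?thesis by (metis A.add.r_cancel_one' A.one_closed diff_closed)
qed

lemma filt_diff: "x \<in> filt k ==> d x \<in> filt (Suc k)"
proof -
  assume x: "x \<in> filt k"
  have "component A j (d x) = \<zero>" if "j < Suc k" for j
    using x that by (cases j) (auto simp: filt_def component_diff_0 component_diff_Suc)
  then show ?thesis using x by (simp add: filt_def)
qed

lemma cocycles_iff: "x \<in> cocycles A \<longleftrightarrow> x \<in> carrier A \<and> d x = \<zero>" by (auto simp: cocycles_def)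

lemma cocycles_carrier: "x \<in> cocycles A ==> x \<in> carrier A" by (simp add: cocycles_iff)

lemma boundaries_cocycles: "x \<in> boundaries A ==> x \<in> cocycles A"
  by (auto simp: cocycles_iff boundaries_def diff_diff)

lemma boundaries_carrier: "x \<in> boundaries A ==> x \<in> carrier A" by (auto simp: boundaries_def)

lemma boundaries_diff: "x \<in> carrier A ==> d x \<in> boundaries A" by (auto simp: boundaries_def)

lemma boundaries_submodule: "submodule (boundaries A) K A"
proof (rule submoduleI)
  show "\<zero> \<in> boundaries A" using boundaries_diff[OF A.zero_closed] by simp
  show "!!a. a \<in> boundaries A ==> \<ominus> a \<in> boundaries A"
    by (auto simp: boundaries_def diff_neg[symmetric])
  show "!!a b. a \<in> boundaries A ==> b \<in> boundaries A ==> a \<oplus> b \<in> boundaries A"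
    by (auto simp: boundaries_def diff_add[symmetric])
  show "!!a b. a \<in> carrier K ==> b \<in> boundaries A ==> a \<odot> b \<in> boundaries A"
    by (auto simp: boundaries_def diff_smult[symmetric])
qed (auto simp: boundaries_def)

lemma cocycles_submodule: "submodule (cocycles A) K A"
  by (rule submoduleI) (auto simp: cocycles_iff diff_neg diff_add diff_smult)

lemma cocycles_mult: "[|x \<in> cocycles A; y \<in> cocycles A|] ==> x \<otimes> y \<in> cocycles A"
  by (simp add: cocycles_iff diff_mult)

lemma cocycles_parity: "x \<in> cocycles A ==> parity A x \<in> cocycles A"
  by (simp add: cocycles_iff diff_parity)

lemma cocycles_component: "x \<in> cocycles A ==> component A k x \<in> cocycles A"
  by (auto simp: cocycles_iff component_diff_Suc[symmetric])

lemma boundaries_component: "x \<in> boundaries A ==> component A k x \<in> boundaries A"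
  using boundaries_diff[OF A.zero_closed]
  by (cases k) (auto simp: boundaries_def component_diff_Suc component_diff_0)

lemma boundaries_mult_left: "[|x \<in> boundaries A; y \<in> cocycles A|] ==> x \<otimes> y \<in> boundaries A"
proof -
  assume x: "x \<in> boundaries A" and y: "y \<in> cocycles A"
  then obtain u where "u \<in> carrier A" "x = d u" by (auto simp: boundaries_def)
  then have "x \<otimes> y = d (u \<otimes> y)" using y by (simp add: diff_mult cocycles_iff)
  then show ?thesis using \<open>u \<in> carrier A\<close> y by (simp add: boundaries_diff cocycles_iff)
qed

lemma boundaries_mult_right: "[|x \<in> cocycles A; y \<in> boundaries A|] ==> x \<otimes> y \<in> boundaries A"
proof -
  assume x: "x \<in> cocycles A" and y: "y \<in> boundaries A"
  then obtain u where "u \<in> carrier A" "y = d u" by (auto simp: boundaries_def)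
  then have "x \<otimes> y = d (parity A x \<otimes> u)" using x by (simp add: diff_mult cocycles_iff diff_parity)
  then show ?thesis using \<open>u \<in> carrier A\<close> x by (simp add: boundaries_diff cocycles_iff)
qed

lemma cocycles_graded: "graded_subspace K A (cocycles A)"
  by (simp add: graded_subspace_def cocycles_submodule cocycles_component)

lemma boundaries_graded: "graded_subspace K A (boundaries A)"
  by (simp add: graded_subspace_def boundaries_submodule boundaries_component)

end

section \<open>Graded complements and Hodge splittings\<close>

context gca
begin

lemma mem_set_add: "x \<in> U <+>\<^bsub>A\<^esub> W \<longleftrightarrow> (\<exists>u\<in>U. \<exists>w\<in>W. x = u \<oplus> w)" by (auto simp: set_add_def')

lemma graded_subspaceD:
  assumes "graded_subspace K A S"
  shows "S \<subseteq> carrier A" "\<zero> \<in> S" "!!x y. x \<in> S ==> y \<in> S ==> x \<oplus> y \<in> S"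
    "!!x. x \<in> S ==> \<ominus> x \<in> S" "!!x y. x \<in> S ==> y \<in> S ==> x \<ominus> y \<in> S"
    "!!a x. a \<in> carrier K ==> x \<in> S ==> a \<odot> x \<in> S" "!!k x. x \<in> S ==> component A k x \<in> S"
proof -
  note S = submoduleE[of S]
  have sub: "submodule S K A" using assms by (simp add: graded_subspace_def)
  show c: "S \<subseteq> carrier A" and a: "!!x y. x \<in> S ==> y \<in> S ==> x \<oplus> y \<in> S"
    and n: "!!x. x \<in> S ==> \<ominus> x \<in> S" and m: "!!a x. a \<in> carrier K ==> x \<in> S ==> a \<odot> x \<in> S"
    using S[OF sub] by blast+
  show "!!x y. x \<in> S ==> y \<in> S ==> x \<ominus> y \<in> S" by (simp add: a_minus_def a n)
  show "\<zero> \<in> S" using S(2)[OF sub] m[OF K.zero_closed] c by (metis all_not_in_conv smult_l_null subsetD)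
  show "!!k x. x \<in> S ==> component A k x \<in> S" using assms by (simp add: graded_subspace_def)
qed

lemma graded_subspace_parity:
  assumes "graded_subspace K A S" "x \<in> S" shows "parity A x \<in> S"
proof -
  note S = graded_subspaceD[OF assms(1)]
  have x: "x \<in> carrier A" using S(1) assms(2) by blast
  let ?f = "\<lambda>k. ksign A k (component A k x)"
  have f: "?f k \<in> S" for k using S(4,7) assms(2) by (simp add: ksign_def)
  have "(\<Oplus>k\<in>T. ?f k) \<in> S" if "finite T" for T
    using that by (induct T rule: finite_induct) (use S(1-3) f x in \<open>auto simp: Pi_def\<close>)
  then show ?thesis unfolding parity_def using finite_support[OF x] by blast
qed

lemma graded_subspaceI:
  assumes "S \<subseteq> carrier A" "\<zero> \<in> S" "!!x y. x \<in> S ==> y \<in> S ==> x \<oplus> y \<in> S"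
    "!!a x. a \<in> carrier K ==> x \<in> S ==> a \<odot> x \<in> S" "!!k x. x \<in> S ==> component A k x \<in> S"
  shows "graded_subspace K A S"
proof -
  have "\<ominus> x \<in> S" if "x \<in> S" for x
    using assms(4)[of "\<ominus>\<^bsub>K\<^esub> \<one>\<^bsub>K\<^esub>" x] that assms(1) smult_l_minus[of "\<one>\<^bsub>K\<^esub>" x] by auto
  then have "submodule S K A" using assms by (intro submoduleI) auto
  then show ?thesis using assms(5) by (simp add: graded_subspace_def)
qed

lemma filt_graded: "graded_subspace K A (filt k)" by (rule graded_subspaceI)
    (auto simp: filt_carrier filt_zero filt_add filt_smult, auto simp: filt_def component_component)

lemma carrier_graded: "graded_subspace K A (carrier A)" by (rule graded_subspaceI) auto

lemma zero_graded: "graded_subspace K A {\<zero>}" by (rule graded_subspaceI) auto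

lemma graded_subspace_Int:
  assumes "graded_subspace K A U" "graded_subspace K A W" shows "graded_subspace K A (U \<inter> W)"
  using graded_subspaceD[OF assms(1)] graded_subspaceD[OF assms(2)] by (intro graded_subspaceI) auto

lemma graded_subspace_add:
  assumes "graded_subspace K A U" "graded_subspace K A W" shows "graded_subspace K A (U <+>\<^bsub>A\<^esub> W)"
proof (rule graded_subspaceI)
  note U = graded_subspaceD[OF assms(1)] and W = graded_subspaceD[OF assms(2)]
  show "U <+>\<^bsub>A\<^esub> W \<subseteq> carrier A" using U(1) W(1) by (auto simp: mem_set_add subset_iff)
  show "\<zero> \<in> U <+>\<^bsub>A\<^esub> W" using U(2) W(2) A.l_zero[OF A.zero_closed] unfolding mem_set_add by metis
  show "x \<oplus> y \<in> U <+>\<^bsub>A\<^esub> W" if xy: "x \<in> U <+>\<^bsub>A\<^esub> W" "y \<in> U <+>\<^bsub>A\<^esub> W" for x y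
  proof -
    obtain u w u' w' where e: "u \<in> U" "w \<in> W" "x = u \<oplus> w" "u' \<in> U" "w' \<in> W" "y = u' \<oplus> w'"
      using xy unfolding mem_set_add by blast
    then have "x \<oplus> y = (u \<oplus> u') \<oplus> (w \<oplus> w')" using U(1) W(1) by (auto simp: A.a_ac subset_iff)
    then show ?thesis using e U(3) W(3) unfolding mem_set_add by blast
  qed
  show "a \<odot> x \<in> U <+>\<^bsub>A\<^esub> W" if ax: "a \<in> carrier K" "x \<in> U <+>\<^bsub>A\<^esub> W" for a x
  proof -
    obtain u w where e: "u \<in> U" "w \<in> W" "x = u \<oplus> w" using ax unfolding mem_set_add by blast
    then have "a \<odot> x = a \<odot> u \<oplus> a \<odot> w" using U(1) W(1) ax by (auto simp: smult_r_distr subset_iff)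
    then show ?thesis using e U(6) W(6) ax unfolding mem_set_add by blast
  qed
  show "component A k x \<in> U <+>\<^bsub>A\<^esub> W" if ax: "x \<in> U <+>\<^bsub>A\<^esub> W" for k x
  proof -
    obtain u w where e: "u \<in> U" "w \<in> W" "x = u \<oplus> w" using ax unfolding mem_set_add by blast
    then have "component A k x = component A k u \<oplus> component A k w"
      using U(1) W(1) by (auto simp: component_add subset_iff)
    then show ?thesis using e U(7) W(7) unfolding mem_set_add by blast
  qed
qed

lemma set_add_ge:
  assumes "graded_subspace K A U" "graded_subspace K A W"
  shows "U \<subseteq> U <+>\<^bsub>A\<^esub> W" "W \<subseteq> U <+>\<^bsub>A\<^esub> W"
proof -
  note U = graded_subspaceD(1,2)[OF assms(1)] and W = graded_subspaceD(1,2)[OF assms(2)]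
  show "U \<subseteq> U <+>\<^bsub>A\<^esub> W"
  proof
    fix u assume u: "u \<in> U"
    then have "u = u \<oplus> \<zero>" using U by (simp add: subset_iff)
    then show "u \<in> U <+>\<^bsub>A\<^esub> W" using u W unfolding mem_set_add by blast
  qed
  show "W \<subseteq> U <+>\<^bsub>A\<^esub> W"
  proof
    fix w assume w: "w \<in> W"
    then have "w = \<zero> \<oplus> w" using W by (simp add: subset_iff)
    then show "w \<in> U <+>\<^bsub>A\<^esub> W" using w U unfolding mem_set_add by blast
  qed
qed

lemma line_graded:
  assumes "z \<in> piece A k" shows "graded_subspace K A {a \<odot> z | a. a \<in> carrier K}"
proof (rule graded_subspaceI)
  have z: "z \<in> carrier A" using assms piece_carrier by blast
  show "{a \<odot> z | a. a \<in> carrier K} \<subseteq> carrier A" using z by auto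
  show "\<zero> \<in> {a \<odot> z | a. a \<in> carrier K}" using smult_l_null[OF z] K.zero_closed by force
  show "x \<oplus> y \<in> {a \<odot> z | a. a \<in> carrier K}"
    if "x \<in> {a \<odot> z | a. a \<in> carrier K}" "y \<in> {a \<odot> z | a. a \<in> carrier K}" for x y
    using that smult_l_distr[OF _ _ z, symmetric] by blast
  show "b \<odot> x \<in> {a \<odot> z | a. a \<in> carrier K}"
    if "b \<in> carrier K" "x \<in> {a \<odot> z | a. a \<in> carrier K}" for b x
    using that smult_assoc1[OF _ _ z, symmetric] by blast
  show "component A j x \<in> {a \<odot> z | a. a \<in> carrier K}" if ax: "x \<in> {a \<odot> z | a. a \<in> carrier K}" for j x
  proof -
    obtain a where a: "a \<in> carrier K" "x = a \<odot> z" using ax by blast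
    then have "component A j x = (if j = k then a else \<zero>\<^bsub>K\<^esub>) \<odot> z"
      using z assms by (simp add: component_smult component_of_piece)
    moreover have "(if j = k then a else \<zero>\<^bsub>K\<^esub>) \<in> carrier K" using a by simp
    ultimately show ?thesis by blast
  qed
qed

text \<open>Zorn's lemma yields a maximal graded \<open>W\<close> between \<open>W0\<close> and
  \<open>Z\<close> that meets \<open>U\<close> only in zero. If a homogeneous \<open>z\<close> in
  \<open>Z\<close> were outside \<open>U + W\<close>, the line through \<open>z\<close>, graded
  because \<open>z\<close> is homogeneous, could be added to \<open>W\<close>. The lower bound
  \<open>W0\<close> serves to force given elements into the complement.\<close>

lemma graded_complement:
  assumes Z: "graded_subspace K A Z" and U: "graded_subspace K A U" "U \<subseteq> Z"
    and W0: "graded_subspace K A W0" "W0 \<subseteq> Z" "U \<inter> W0 = {\<zero>}"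
  obtains W where "graded_subspace K A W" "W0 \<subseteq> W" "W \<subseteq> Z" "U \<inter> W = {\<zero>}" "Z = U <+>\<^bsub>A\<^esub> W"
proof -
  let ?F = "{W. graded_subspace K A W \<and> W0 \<subseteq> W \<and> W \<subseteq> Z \<and> U \<inter> W = {\<zero>}}"
  have "\<exists>M\<in>?F. \<forall>X\<in>?F. M \<subseteq> X \<longrightarrow> X = M"
  proof (rule subset_Zorn_nonempty)
    show "?F \<noteq> {}" using W0 by blast
    fix C assume C: "C \<noteq> {}" "subset.chain ?F C"
    then have mem: "!!W. W \<in> C ==> W \<in> ?F" by (auto simp: subset_chain_def)
    then have gr: "!!W. W \<in> C ==> graded_subspace K A W" by blast
    have "graded_subspace K A (\<Union>C)"
    proof (rule graded_subspaceI)
      show "\<Union>C \<subseteq> carrier A" using graded_subspaceD(1)[OF gr] by blast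
      show "\<zero> \<in> \<Union>C" using graded_subspaceD(2)[OF gr] C(1) by blast
      show "x \<oplus> y \<in> \<Union>C" if xy: "x \<in> \<Union>C" "y \<in> \<Union>C" for x y
      proof -
        obtain V W where VW: "V \<in> C" "W \<in> C" "x \<in> V" "y \<in> W" using xy by blast
        then have "V \<subseteq> W \<or> W \<subseteq> V" using C(2) by (auto simp: subset_chain_def)
        then show ?thesis
          using VW graded_subspaceD(3)[OF gr[OF VW(1)], of x y] graded_subspaceD(3)[OF gr[OF VW(2)], of x y]
          by blast
      qed
      show "a \<odot> x \<in> \<Union>C" if "a \<in> carrier K" "x \<in> \<Union>C" for a x
        using that graded_subspaceD(6)[OF gr] by blast
      show "component A k x \<in> \<Union>C" if "x \<in> \<Union>C" for k x using that graded_subspaceD(7)[OF gr] by blast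
    qed
    moreover have "W0 \<subseteq> \<Union>C" "\<Union>C \<subseteq> Z" "U \<inter> \<Union>C = {\<zero>}" using mem C(1) by blast+
    ultimately show "\<Union>C \<in> ?F" by blast
  qed
  then obtain W where WF: "W \<in> ?F" and "\<forall>X\<in>?F. W \<subseteq> X \<longrightarrow> X = W" by (rule bexE)
  then have max: "!!X. X \<in> ?F ==> W \<subseteq> X ==> X = W" by (meson bspec)
  from WF have W: "graded_subspace K A W" "W0 \<subseteq> W" "W \<subseteq> Z" "U \<inter> W = {\<zero>}" by simp_all
  note Wd = graded_subspaceD[OF W(1)] and Ud = graded_subspaceD[OF U(1)]
    and Zd = graded_subspaceD[OF Z] and UWd = graded_subspaceD[OF graded_subspace_add[OF U(1) W(1)]]
  note sub = set_add_ge[OF U(1) W(1)]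
  have hom: "z \<in> U <+>\<^bsub>A\<^esub> W" if z: "z \<in> Z" "z \<in> piece A k" for z k
  proof (rule ccontr)
    assume nz: "z \<notin> U <+>\<^bsub>A\<^esub> W"
    have zc: "z \<in> carrier A" using z Zd(1) by blast
    let ?L = "{a \<odot> z | a. a \<in> carrier K}"
    let ?W' = "W <+>\<^bsub>A\<^esub> ?L"
    note L = line_graded[OF z(2)]
    have g: "graded_subspace K A ?W'" by (rule graded_subspace_add[OF W(1) L])
    note WW = set_add_ge(1)[OF W(1) L]
    have zW: "z \<in> ?W'"
    proof -
      have "z = \<zero> \<oplus> \<one>\<^bsub>K\<^esub> \<odot> z" using zc by simp
      then show ?thesis using Wd(2) K.one_closed unfolding mem_set_add by blast
    qed
    have "x = \<zero>" if x: "x \<in> U" "x \<in> ?W'" for x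
    proof -
      obtain w a where e: "w \<in> W" "a \<in> carrier K" "x = w \<oplus> a \<odot> z"
        using x(2) unfolding mem_set_add by blast
      have c: "w \<in> carrier A" "x \<in> carrier A" using e x Wd(1) Ud(1) by blast+
      show ?thesis
      proof (cases "a = \<zero>\<^bsub>K\<^esub>")
        case True
        then have "x = w" using e c zc by simp
        then show ?thesis using e x W(4) by blast
      next
        case False
        \<comment> \<open>An invertible coefficient would put \<open>z\<close> itself into
          \<open>U + W\<close>.\<close>
        then have u: "a \<in> Units K" using e K.field_Units by blast
        have "a \<odot> z = x \<oplus> \<ominus> w" unfolding e(3) by ((rule A.ag)+, insert c zc e(1,2), simp_all)
        moreover have "x \<oplus> \<ominus> w \<in> U <+>\<^bsub>A\<^esub> W"
          using UWd(3)[of x "\<ominus> w"] sub x(1) Wd(4)[OF e(1)] by blast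
        ultimately have "inv\<^bsub>K\<^esub> a \<odot> (a \<odot> z) \<in> U <+>\<^bsub>A\<^esub> W"
          using UWd(6)[OF K.Units_inv_closed[OF u]] by simp
        then show ?thesis using nz u e zc by (simp add: smult_assoc1[symmetric] K.Units_l_inv)
      qed
    qed
    then have "U \<inter> ?W' = {\<zero>}" using Ud(2) graded_subspaceD(2)[OF g] by blast
    moreover have "?W' \<subseteq> Z" using z W(3) Zd(3,6) by (auto simp: mem_set_add subset_iff)
    ultimately have "?W' \<in> ?F" using g WW W(2) by auto
    then have "?W' = W" using max WW by blast
    then show False using zW nz sub by blast
  qed
  have "Z \<subseteq> U <+>\<^bsub>A\<^esub> W"
  proof
    fix z assume z: "z \<in> Z"
    then have zc: "z \<in> carrier A" using Zd(1) by blast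
    have c: "component A k z \<in> U <+>\<^bsub>A\<^esub> W" for k using hom[OF Zd(7)[OF z] component_piece[OF zc]] .
    have "(\<Oplus>k\<in>T. component A k z) \<in> U <+>\<^bsub>A\<^esub> W" if "finite T" for T
      using that by (induct T rule: finite_induct) (use UWd(2,3) c zc in \<open>auto simp: Pi_def\<close>)
    then show "z \<in> U <+>\<^bsub>A\<^esub> W"
      using sum_components[OF zc finite_support[OF zc] order_refl] finite_support[OF zc] by metis
  qed
  moreover have "U <+>\<^bsub>A\<^esub> W \<subseteq> Z" using U(2) W(3) Zd(3) by (auto simp: mem_set_add subset_iff)
  ultimately show ?thesis using that W by blast
qed

text \<open>The images of the components of \<open>x\<close> form a decomposition of
  \<open>f x\<close>, and decompositions are unique.\<close>

lemma graded_map_component: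
  assumes B: "gca K B" and S: "graded_subspace K A S"
    and f: "f \<in> S \<rightarrow> carrier B" "!!x y. x \<in> S ==> y \<in> S ==> f (x \<oplus> y) = f x \<oplus>\<^bsub>B\<^esub> f y"
      "!!k x. x \<in> S ==> x \<in> piece A k ==> f x \<in> piece B k"
    and x: "x \<in> S"
  shows "f (component A k x) = component B k (f x)"
proof -
  interpret B: gca K B by (rule B)
  note Sd = graded_subspaceD[OF S]
  have f0: "f \<zero> = \<zero>\<^bsub>B\<^esub>"
  proof -
    have "f \<zero> = f \<zero> \<oplus>\<^bsub>B\<^esub> f \<zero>" using f(2)[OF Sd(2) Sd(2)] by simp
    moreover have "f \<zero> \<in> carrier B" using f(1) Sd(2) by blast
    ultimately show ?thesis using B.A.add.r_cancel_one' by blast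
  qed
  have xc: "x \<in> carrier A" using x Sd(1) by blast
  let ?T = "{k. component A k x \<noteq> \<zero>}"
  have sum: "(\<Oplus>k\<in>T. component A k x) \<in> S \<and>
    f (\<Oplus>k\<in>T. component A k x) = (\<Oplus>\<^bsub>B\<^esub>k\<in>T. f (component A k x))" if "finite T" for T using that
  proof (induct T rule: finite_induct)
    case (insert k T)
    have "(\<Oplus>k\<in>insert k T. component A k x) = component A k x \<oplus> (\<Oplus>k\<in>T. component A k x)"
      using insert(1,2) xc by (simp add: Pi_def)
    moreover have "(\<Oplus>\<^bsub>B\<^esub>k\<in>insert k T. f (component A k x))
        = f (component A k x) \<oplus>\<^bsub>B\<^esub> (\<Oplus>\<^bsub>B\<^esub>k\<in>T. f (component A k x))"
      using insert(1,2) f(1) Sd(7)[OF x] by (simp add: Pi_def)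
    ultimately show ?case using insert(3) f(2) Sd(3) Sd(7)[OF x] by simp
  qed (use f0 Sd(2) in simp)
  have "f x = (\<Oplus>\<^bsub>B\<^esub>k\<in>?T. f (component A k x))"
    using sum[OF finite_support[OF xc]] sum_components[OF xc finite_support[OF xc] order_refl] by simp
  then have "is_decomposition B (f x) (\<lambda>k. f (component A k x))"
    using f(3)[OF Sd(7)[OF x] component_piece[OF xc]] f0 finite_support[OF xc]
    by (intro B.decompositionI[of ?T]) auto
  then show ?thesis using B.component_unique f(1) x by (metis PiE)
qed

end

lemma (in dg) boundariesE:
  assumes "x \<in> boundaries A" obtains u where "u \<in> carrier A" "x = d u"
  using assms unfolding boundaries_def by blast

text \<open>A Hodge type decomposition without the orthogonality condition. One exists in every DGCA
  (\<open>splitting_exists\<close>), so Massey cochains can be formed at every stage of a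
  zig-zag.\<close>

locale splitting = dg K A
  for K :: "('k, 'l) ring_scheme" and A :: "('k, 'a, 'm) dga_scheme" (structure) +
  fixes Hs Bs :: "'a set"
  assumes harmonic: "harmonic_subspace K A Hs"
    and B_graded: "graded_subspace K A Bs"
    and unique_parts: "x \<in> carrier A ==> \<exists>!p. hodge_parts A Hs Bs x p"
begin

definition pE where "pE x = exact_part A Hs Bs x"
definition pH where "pH x = harmonic_part A Hs Bs x"
definition pB where "pB x = snd (snd (THE p. hodge_parts A Hs Bs x p))"
text \<open>The operator $d^-$. By \<open>diff_s\<close> and \<open>s_diff\<close> it is a
  contracting homotopy: $ds + sd$ is the identity minus the harmonic projection
  \<open>pH\<close>.\<close>

definition s where "s x = diff_inv A Hs Bs x"

lemma H_graded: "graded_subspace K A Hs" using harmonic by (simp add: harmonic_subspace_def)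

lemmas Hs = graded_subspaceD[OF H_graded]
lemmas Bs = graded_subspaceD[OF B_graded]
lemmas Es = graded_subspaceD[OF boundaries_graded]

lemma Hs_carrier [simp]: "x \<in> Hs ==> x \<in> carrier A" using Hs(1) by blast
lemma Bs_carrier [simp]: "x \<in> Bs ==> x \<in> carrier A" using Bs(1) by blast
lemma Es_carrier [simp]: "x \<in> boundaries A ==> x \<in> carrier A" using Es(1) by blast

lemma cocycles_split: "x \<in> cocycles A \<longleftrightarrow> (\<exists>e\<in>boundaries A. \<exists>h\<in>Hs. x = e \<oplus> h)"
  using harmonic by (simp add: harmonic_subspace_def direct_sum_def mem_set_add)

lemma Hs_cocycles: "x \<in> Hs ==> x \<in> cocycles A"
  using cocycles_split Es(2) Hs_carrier by (metis A.l_zero)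

lemma diff_Hs [simp]: "x \<in> Hs ==> d x = \<zero>" using Hs_cocycles cocycles_iff by blast

lemma diff_Es [simp]: "x \<in> boundaries A ==> d x = \<zero>" using boundaries_cocycles cocycles_iff by blast

lemma parts:
  assumes "x \<in> carrier A"
  shows "pE x \<in> boundaries A" "pH x \<in> Hs" "pB x \<in> Bs" "x = pE x \<oplus> pH x \<oplus> pB x"
proof -
  obtain e h b where p: "(THE p. hodge_parts A Hs Bs x p) = (e, h, b)" by (metis prod_cases3)
  then have "hodge_parts A Hs Bs x (e, h, b)" using theI'[OF unique_parts[OF assms]] by simp
  moreover have "pE x = e" "pH x = h" "pB x = b"
    by (simp_all add: p pE_def pH_def pB_def exact_part_def harmonic_part_def)
  ultimately show "pE x \<in> boundaries A" "pH x \<in> Hs" "pB x \<in> Bs" "x = pE x \<oplus> pH x \<oplus> pB x"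
    by (simp_all add: hodge_parts_def)
qed

lemma parts_eqI:
  assumes "e \<in> boundaries A" "h \<in> Hs" "b \<in> Bs" "x = e \<oplus> h \<oplus> b"
  shows "pE x = e" "pH x = h" "pB x = b"
proof -
  have "hodge_parts A Hs Bs x (e, h, b)" using assms by (simp add: hodge_parts_def)
  then have "(THE p. hodge_parts A Hs Bs x p) = (e, h, b)"
    using unique_parts[of x] assms by (intro the1_equality) auto
  then show "pE x = e" "pH x = h" "pB x = b"
    by (simp_all add: pE_def pH_def pB_def exact_part_def harmonic_part_def)
qed

lemma parts_closed [simp]:
  "x \<in> carrier A ==> pE x \<in> carrier A" "x \<in> carrier A ==> pH x \<in> carrier A"
  "x \<in> carrier A ==> pB x \<in> carrier A" using parts by auto

lemma parts_Es [simp]: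
  assumes "x \<in> boundaries A" shows "pE x = x" "pH x = \<zero>" "pB x = \<zero>"
  using parts_eqI[OF assms Hs(2) Bs(2), of x] assms by auto

lemma parts_Hs [simp]:
  assumes "x \<in> Hs" shows "pE x = \<zero>" "pH x = x" "pB x = \<zero>"
  using parts_eqI[OF Es(2) assms Bs(2), of x] assms by auto

lemma parts_Bs [simp]:
  assumes "x \<in> Bs" shows "pE x = \<zero>" "pH x = \<zero>" "pB x = x"
  using parts_eqI[OF Es(2) Hs(2) assms, of x] assms by auto

lemma parts_add:
  assumes "x \<in> carrier A" "y \<in> carrier A"
  shows "pE (x \<oplus> y) = pE x \<oplus> pE y" "pH (x \<oplus> y) = pH x \<oplus> pH y" "pB (x \<oplus> y) = pB x \<oplus> pB y"
proof -
  note p = parts[OF assms(1)] parts[OF assms(2)]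
  have "x \<oplus> y = (pE x \<oplus> pH x \<oplus> pB x) \<oplus> (pE y \<oplus> pH y \<oplus> pB y)" using p by simp
  also have "\<dots> = (pE x \<oplus> pE y) \<oplus> (pH x \<oplus> pH y) \<oplus> (pB x \<oplus> pB y)"
    by ((rule A.ag)+, insert assms, simp_all)
  finally have eq: "x \<oplus> y = (pE x \<oplus> pE y) \<oplus> (pH x \<oplus> pH y) \<oplus> (pB x \<oplus> pB y)" .
  show "pE (x \<oplus> y) = pE x \<oplus> pE y" "pH (x \<oplus> y) = pH x \<oplus> pH y" "pB (x \<oplus> y) = pB x \<oplus> pB y"
    by (fact parts_eqI[OF Es(3)[OF p(1,5)] Hs(3)[OF p(2,6)] Bs(3)[OF p(3,7)] eq])+
qed

lemma parts_smult:
  assumes "a \<in> carrier K" "x \<in> carrier A"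
  shows "pE (a \<odot> x) = a \<odot> pE x" "pH (a \<odot> x) = a \<odot> pH x" "pB (a \<odot> x) = a \<odot> pB x"
proof -
  note p = parts[OF assms(2)]
  have "a \<odot> x = a \<odot> (pE x \<oplus> pH x \<oplus> pB x)" using p by simp
  also have "\<dots> = a \<odot> pE x \<oplus> a \<odot> pH x \<oplus> a \<odot> pB x" using assms by (simp add: smult_r_distr)
  finally have eq: "a \<odot> x = a \<odot> pE x \<oplus> a \<odot> pH x \<oplus> a \<odot> pB x" .
  show "pE (a \<odot> x) = a \<odot> pE x" "pH (a \<odot> x) = a \<odot> pH x" "pB (a \<odot> x) = a \<odot> pB x"
    by (fact parts_eqI[OF Es(6)[OF assms(1) p(1)] Hs(6)[OF assms(1) p(2)] Bs(6)[OF assms(1) p(3)] eq])+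
qed

lemma parts_neg:
  assumes "x \<in> carrier A"
  shows "pE (\<ominus> x) = \<ominus> pE x" "pH (\<ominus> x) = \<ominus> pH x" "pB (\<ominus> x) = \<ominus> pB x"
  using parts_smult[of "\<ominus>\<^bsub>K\<^esub> \<one>\<^bsub>K\<^esub>" x] assms smult_l_minus[OF K.one_closed] by auto

lemma parts_minus:
  assumes "x \<in> carrier A" "y \<in> carrier A"
  shows "pE (x \<ominus> y) = pE x \<ominus> pE y" "pH (x \<ominus> y) = pH x \<ominus> pH y" "pB (x \<ominus> y) = pB x \<ominus> pB y"
  using assms by (simp_all add: a_minus_def parts_add parts_neg)

lemma parts_component:
  assumes "x \<in> carrier A"
  shows "pE (component A k x) = component A k (pE x)" "pH (component A k x) = component A k (pH x)"
    "pB (component A k x) = component A k (pB x)"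
proof -
  note p = parts[OF assms]
  have "component A k x = component A k (pE x \<oplus> pH x \<oplus> pB x)" using p by simp
  also have "\<dots> = component A k (pE x) \<oplus> component A k (pH x) \<oplus> component A k (pB x)"
    using assms by (simp add: component_add)
  finally have eq: "component A k x
    = component A k (pE x) \<oplus> component A k (pH x) \<oplus> component A k (pB x)" .
  show "pE (component A k x) = component A k (pE x)"
    "pH (component A k x) = component A k (pH x)" "pB (component A k x) = component A k (pB x)"
    by (fact parts_eqI[OF Es(7)[OF p(1)] Hs(7)[OF p(2)] Bs(7)[OF p(3)] eq])+
qed

lemma parts_parity:
  assumes "x \<in> carrier A"
  shows "pE (parity A x) = parity A (pE x)" "pH (parity A x) = parity A (pH x)"
    "pB (parity A x) = parity A (pB x)" by (rule component_eqI; use assms in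
      \<open>simp add: parts_component[symmetric] component_parity ksign_def parts_neg\<close>)+

lemma parts_piece:
  assumes "x \<in> piece A k" shows "pE x \<in> piece A k" "pH x \<in> piece A k" "pB x \<in> piece A k"
  using parts_component[of x k] assms component_piece[of _ k]
  by (metis component_same parts_closed piece_carrier)+

lemma parts_filt:
  assumes "x \<in> filt k" shows "pE x \<in> filt k" "pH x \<in> filt k" "pB x \<in> filt k"
  using assms parts_component[of x, symmetric] by (auto simp: filt_def Es(2) Hs(2) Bs(2))

lemma pE_diff: "x \<in> carrier A ==> d x = d (pB x)"
proof -
  assume x: "x \<in> carrier A"
  have "d x = d (pE x \<oplus> pH x \<oplus> pB x)" using parts(4)[OF x] by (rule arg_cong)
  also have "\<dots> = d (pB x)" using parts(1-3)[OF x] by (simp add: diff_add)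
  finally show ?thesis .
qed

text \<open>A closed \<open>b\<close> is also a sum of an exact and a harmonic element; uniqueness
  of the parts leaves nothing for \<open>Bs\<close>.\<close>

lemma Bs_cocycle: "[|b \<in> Bs; d b = \<zero>|] ==> b = \<zero>"
proof -
  assume b: "b \<in> Bs" "d b = \<zero>"
  then have "b \<in> cocycles A" by (simp add: cocycles_iff)
  then obtain e h where "e \<in> boundaries A" "h \<in> Hs" "b = e \<oplus> h" using cocycles_split by blast
  then have "pB b = \<zero>" using parts_eqI(3)[of e h \<zero> b] Bs(2) by simp
  then show ?thesis using b by simp
qed

lemma Bs_inj: "[|b \<in> Bs; b' \<in> Bs; d b = d b'|] ==> b = b'"
  using Bs_cocycle[of "b \<ominus> b'"] Bs(5)[of b b'] A.diff_zero_eq[of b b'] by (simp add: diff_minus)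

lemma cocycles_pB: "x \<in> cocycles A ==> pB x = \<zero>"
  using Bs_cocycle[of "pB x"] parts(3)[of x] pE_diff[of x] by (simp add: cocycles_iff)

lemma cocycles_parts: "x \<in> cocycles A ==> x = pE x \<oplus> pH x"
proof -
  assume x: "x \<in> cocycles A"
  then have c: "x \<in> carrier A" by (rule cocycles_carrier)
  have "x = pE x \<oplus> pH x \<oplus> pB x" by (rule parts(4)[OF c])
  also have "\<dots> = pE x \<oplus> pH x" using c by (simp add: cocycles_pB[OF x])
  finally show ?thesis .
qed

lemma s_ex1: "x \<in> carrier A ==> \<exists>!b. b \<in> Bs \<and> d b = pE x"
proof -
  assume x: "x \<in> carrier A"
  obtain u where "u \<in> carrier A" "pE x = d u" using boundariesE[OF parts(1)[OF x]] .
  then have u: "pB u \<in> Bs \<and> d (pB u) = pE x" using pE_diff[of u] parts(3)[of u] by simp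
  show ?thesis
  proof (rule ex1I[of _ "pB u"])
    show "pB u \<in> Bs \<and> d (pB u) = pE x" by (rule u)
    fix b assume b: "b \<in> Bs \<and> d b = pE x"
    show "b = pB u" by (rule Bs_inj[OF conjunct1[OF b] conjunct1[OF u]]) (simp only: b u)
  qed
qed

lemma s_Bs: "x \<in> carrier A ==> s x \<in> Bs"
  and diff_s: "x \<in> carrier A ==> d (s x) = pE x"
  using theI'[OF s_ex1] by (simp_all add: s_def diff_inv_def pE_def)

lemma s_closed [simp]: "x \<in> carrier A ==> s x \<in> carrier A" using s_Bs by simp

lemma s_eqI: "[|x \<in> carrier A; b \<in> Bs; d b = pE x|] ==> s x = b" using s_ex1 s_Bs diff_s by blast

lemma s_add: "[|x \<in> carrier A; y \<in> carrier A|] ==> s (x \<oplus> y) = s x \<oplus> s y"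
  by (rule s_eqI) (auto simp: Bs(3) s_Bs diff_add diff_s parts_add)

lemma s_smult: "[|a \<in> carrier K; x \<in> carrier A|] ==> s (a \<odot> x) = a \<odot> s x"
  by (rule s_eqI) (auto simp: Bs(6) s_Bs diff_smult diff_s parts_smult)

lemma s_neg: "x \<in> carrier A ==> s (\<ominus> x) = \<ominus> s x"
  by (rule s_eqI) (auto simp: Bs(4) s_Bs diff_neg diff_s parts_neg)

lemma s_zero [simp]: "s \<zero> = \<zero>" by (rule s_eqI) (auto simp: Bs(2) Es(2))

lemma s_Hs_zero [simp]: "x \<in> Hs ==> s x = \<zero>" by (rule s_eqI) (auto simp: Bs(2))

lemma s_diff: "x \<in> carrier A ==> s (d x) = pB x"
  using parts[of x] pE_diff[of x] boundaries_diff[of x] by (intro s_eqI) auto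

lemma s_pE: "x \<in> carrier A ==> s (pE x) = s x"
  using parts(1)[of x] by (intro s_eqI) (auto simp: s_Bs diff_s)

lemma component_s: "x \<in> carrier A ==> component A k (s x) = s (component A (Suc k) x)"
  by (rule s_eqI[symmetric])
    (auto simp: Bs(7) s_Bs parts_component diff_s component_diff_Suc[symmetric])

lemma s_piece: "x \<in> piece A (Suc k) ==> s x \<in> piece A k"
  using component_s[of x k] component_piece[of "s x" k] piece_carrier[of x "Suc k"] by simp

text \<open>An exact element has no component in degree 0, since nothing has degree -1.\<close>

lemma s_piece_0: "x \<in> piece A 0 ==> s x = \<zero>"
proof (rule s_eqI)
  assume x: "x \<in> piece A 0"
  show xc: "x \<in> carrier A" using x piece_carrier by blast
  obtain u where "u \<in> carrier A" "pE x = d u" using boundariesE[OF parts(1)[OF xc]] .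
  then show "d \<zero> = pE x" using component_diff_0[of u] parts_piece(1)[OF x] by simp
qed (rule Bs(2))

lemma s_piece_pred: "x \<in> piece A k ==> s x \<in> piece_pred A k"
  using s_piece s_piece_0 by (cases k) (auto simp: piece_pred_def)

lemma s_filt: "x \<in> filt (Suc k) ==> s x \<in> filt k" by (auto simp: filt_def component_s)

lemma parity_s: "x \<in> carrier A ==> parity A (s x) = \<ominus> s (parity A x)"
proof -
  assume x: "x \<in> carrier A"
  have "s (parity A x) = \<ominus> parity A (s x)" using x graded_subspace_parity[OF B_graded s_Bs[OF x]]
    by (intro s_eqI) (auto simp: Bs(4) diff_neg diff_parity diff_s parts_parity)
  then show ?thesis using x by simp
qed

end

text \<open>Two graded complements are chosen: of the boundaries in the cocycles, and of the
  cocycles in the whole algebra.\<close>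

lemma (in dg) splitting_exists: obtains Hs Bs where "splitting K A Hs Bs"
proof -
  have bz: "boundaries A \<subseteq> cocycles A" using boundaries_cocycles by blast
  have zc: "cocycles A \<subseteq> carrier A" using cocycles_carrier by blast
  have b0: "\<zero> \<in> boundaries A" "\<zero> \<in> cocycles A"
    using graded_subspaceD(2) boundaries_graded cocycles_graded by blast+
  have z: "{\<zero>} \<subseteq> cocycles A" "boundaries A \<inter> {\<zero>} = {\<zero>}" using b0 by auto
  have z': "{\<zero>} \<subseteq> carrier A" "cocycles A \<inter> {\<zero>} = {\<zero>}" using b0 by auto
  obtain Hs where H: "graded_subspace K A Hs" "{\<zero>} \<subseteq> Hs" "Hs \<subseteq> cocycles A"
      "boundaries A \<inter> Hs = {\<zero>}" "cocycles A = boundaries A <+>\<^bsub>A\<^esub> Hs"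
    using graded_complement[OF cocycles_graded boundaries_graded bz zero_graded z] .
  obtain Bs where B: "graded_subspace K A Bs" "{\<zero>} \<subseteq> Bs" "Bs \<subseteq> carrier A"
      "cocycles A \<inter> Bs = {\<zero>}" "carrier A = cocycles A <+>\<^bsub>A\<^esub> Bs"
    using graded_complement[OF carrier_graded cocycles_graded zc zero_graded z'] .
  note Hd = graded_subspaceD[OF H(1)] and Bd = graded_subspaceD[OF B(1)]
    and Ed = graded_subspaceD[OF boundaries_graded] and Zd = graded_subspaceD[OF cocycles_graded]
  have "\<exists>!p. hodge_parts A Hs Bs x p" if x: "x \<in> carrier A" for x
  proof -
    obtain z b where zb: "z \<in> cocycles A" "b \<in> Bs" "x = z \<oplus> b" using x B(5) mem_set_add by blast
    then obtain e h where eh: "e \<in> boundaries A" "h \<in> Hs" "z = e \<oplus> h" using H(5) mem_set_add by blast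
    have "hodge_parts A Hs Bs x (e, h, b)" using zb eh by (simp add: hodge_parts_def)
    moreover have "p = (e, h, b)" if p: "hodge_parts A Hs Bs x p" for p
    proof -
      obtain e' h' b' where p': "p = (e', h', b')" by (cases p) auto
      then have q: "e' \<in> boundaries A" "h' \<in> Hs" "b' \<in> Bs" "x = e' \<oplus> h' \<oplus> b'"
        using p by (simp_all add: hodge_parts_def)
      have c: "e \<in> carrier A" "h \<in> carrier A" "b \<in> carrier A" "e' \<in> carrier A" "h' \<in> carrier A"
        "b' \<in> carrier A" using zb eh q Hd(1) Bd(1) Ed(1) by blast+
      have eq: "e \<oplus> h \<oplus> b = e' \<oplus> h' \<oplus> b'" using q zb eh by simp
      have "b' \<ominus> b = (e \<oplus> h \<oplus> b) \<ominus> (e' \<oplus> h') \<ominus> b" unfolding eq by ((rule A.ag)+, insert c, simp_all)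
      also have "\<dots> = (e \<oplus> h) \<ominus> (e' \<oplus> h')" by ((rule A.ag)+, insert c, simp_all)
      finally have "b' \<ominus> b \<in> cocycles A" using Zd(3,5) bz H(3) q eh by (simp add: subset_iff)
      then have "b' \<ominus> b = \<zero>" using B(4) Bd(5)[OF q(3) zb(2)] by blast
      then have bb: "b' = b" using c A.diff_zero_eq by blast
      then have eq2: "e \<oplus> h = e' \<oplus> h'" using eq c by simp
      have "h' \<ominus> h = (e \<oplus> h) \<ominus> e' \<ominus> h" unfolding eq2 by ((rule A.ag)+, insert c, simp_all)
      also have "\<dots> = e \<ominus> e'" by ((rule A.ag)+, insert c, simp_all)
      finally have "h' \<ominus> h \<in> boundaries A" using Ed(5) q eh by simp
      then have "h' \<ominus> h = \<zero>" using H(4) Hd(5)[OF q(2) eh(2)] by blast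
      then have hh: "h' = h" using c A.diff_zero_eq by blast
      then show ?thesis using bb eq2 c p' by simp
    qed
    ultimately show ?thesis by blast
  qed
  moreover have "harmonic_subspace K A Hs"
    using H by (simp add: harmonic_subspace_def direct_sum_def)
  ultimately have "splitting K A Hs Bs"
    using B(1) dg_axioms by (simp add: splitting_def splitting_axioms_def)
  then show ?thesis using that by blast
qed

section \<open>The Massey cocycle of a differential graded algebra\<close>

context ring
begin

lemma minus_l_distr:
  "[|x \<in> carrier R; y \<in> carrier R; z \<in> carrier R|] ==> (x \<ominus> y) \<otimes> z = x \<otimes> z \<ominus> y \<otimes> z"
  by (simp add: a_minus_def l_distr l_minus)

lemma minus_r_distr:
  "[|x \<in> carrier R; y \<in> carrier R; z \<in> carrier R|] ==> z \<otimes> (x \<ominus> y) = z \<otimes> x \<ominus> z \<otimes> y"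
  by (simp add: a_minus_def r_distr r_minus)

lemmas ring_expand = l_distr r_distr minus_l_distr minus_r_distr l_minus r_minus m_assoc

end

context gca
begin

lemma piece_pred_carrier: "x \<in> piece_pred A k ==> x \<in> carrier A"
  by (cases k) (auto simp: piece_pred_def intro: piece_carrier)

lemma piece_pred_zero: "\<zero> \<in> piece_pred A k" by (cases k) (auto simp: piece_pred_def piece_zero)

lemma piece_pred_add: "[|x \<in> piece_pred A k; y \<in> piece_pred A k|] ==> x \<oplus> y \<in> piece_pred A k"
  by (cases k) (auto simp: piece_pred_def piece_add)

lemma piece_pred_minus: "[|x \<in> piece_pred A k; y \<in> piece_pred A k|] ==> x \<ominus> y \<in> piece_pred A k"
  by (cases k) (auto simp: piece_pred_def piece_minus)

lemma piece_pred_smult: "[|a \<in> carrier K; x \<in> piece_pred A k|] ==> a \<odot> x \<in> piece_pred A k"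
  by (cases k) (auto simp: piece_pred_def piece_smult)

lemma piece_pred_mult_right:
  "[|x \<in> piece_pred A k; y \<in> piece A j; m = k + j|] ==> x \<otimes> y \<in> piece_pred A m"
  using piece_carrier[of y j] piece_pred_zero by (cases k) (auto simp: piece_pred_def mult_piece)

lemma piece_pred_mult_left:
  "[|y \<in> piece A j; x \<in> piece_pred A k; m = j + k|] ==> y \<otimes> x \<in> piece_pred A m"
  using piece_carrier[of y j] piece_pred_zero mult_piece[of y j x "k - 1"]
  by (cases k) (auto simp: piece_pred_def)

lemma ksign_ksign [simp]: "x \<in> carrier A ==> ksign A i (ksign A j x) = ksign A (i + j) x"
  by (auto simp: ksign_def)

lemma ksign_mult_left: "[|x \<in> carrier A; y \<in> carrier A|] ==> ksign A i x \<otimes> y = ksign A i (x \<otimes> y)"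
  by (simp add: ksign_def A.l_minus)

lemma ksign_mult_right: "[|x \<in> carrier A; y \<in> carrier A|] ==> x \<otimes> ksign A i y = ksign A i (x \<otimes> y)"
  by (simp add: ksign_def A.r_minus)

lemma ksign_neg: "x \<in> carrier A ==> ksign A i (\<ominus> x) = \<ominus> ksign A i x" by (simp add: ksign_def)

lemma ksign_minus: "[|x \<in> carrier A; y \<in> carrier A|] ==> ksign A i (x \<ominus> y) = ksign A i x \<ominus> ksign A i y"
  by (simp add: a_minus_def ksign_add ksign_neg)

lemma ksign_cong: "even i = even j ==> ksign A i x = ksign A j x" by (simp add: ksign_def)

lemma ksign_inj: "[|x \<in> carrier A; y \<in> carrier A; ksign A i x = ksign A i y|] ==> x = y"
  by (metis A.minus_minus ksign_def)

lemma ksign_smult: "[|a \<in> carrier K; x \<in> carrier A|] ==> ksign A i (a \<odot> x) = a \<odot> ksign A i x"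
  by (simp add: ksign_def smult_neg)

text \<open>Here \<open>z\<close> has degree \<open>i - 1\<close>, so the commutation sign has
  exponent $(i-1)j$. Writing the factor $(-1)^j$ as \<open>parity A u\<close> leaves an exponent
  without subtraction, and the formula covers \<open>i = 0\<close> as well.\<close>

lemma piece_pred_comm:
  assumes z: "z \<in> piece_pred A i" and u: "u \<in> piece A j"
  shows "z \<otimes> u = ksign A (i * j) (parity A u \<otimes> z)"
proof -
  have uc: "u \<in> carrier A" by (rule piece_carrier[OF u])
  show ?thesis
  proof (cases i)
    case 0
    then show ?thesis using z uc by (simp add: piece_pred_def ksign_def)
  next
    case (Suc i')
    then have z': "z \<in> piece A i'" using z by (simp add: piece_pred_def)
    then show ?thesis using graded_comm[OF z' u] Suc uc piece_carrier[OF z']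
      by (auto simp: parity_homogeneous[OF u] ksign_def A.l_minus)
  qed
qed

lemma graded_map_parity:
  assumes B: "gca K B" and S: "graded_subspace K A S"
    and f: "f \<in> S \<rightarrow> carrier B" "!!x y. x \<in> S ==> y \<in> S ==> f (x \<oplus> y) = f x \<oplus>\<^bsub>B\<^esub> f y"
      "!!k x. x \<in> S ==> x \<in> piece A k ==> f x \<in> piece B k"
    and x: "x \<in> S"
  shows "f (parity A x) = parity B (f x)"
proof -
  interpret B: gca K B by (rule B)
  note Sd = graded_subspaceD[OF S]
  have fc: "f (component A k u) = component B k (f u)" if "u \<in> S" for u k
    by (rule graded_map_component[OF B S]) (use f that in auto)
  have Px: "parity A x \<in> S" by (rule graded_subspace_parity[OF S x])
  have f0: "f \<zero> = \<zero>\<^bsub>B\<^esub>"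
    using f(2)[OF Sd(2) Sd(2)] f(1) Sd(2) B.A.add.r_cancel_one'[of "f \<zero>" "f \<zero>"] by auto
  have neg: "f (\<ominus> u) = \<ominus>\<^bsub>B\<^esub> f u" if u: "u \<in> S" for u
  proof -
    have uc: "u \<in> carrier A" using u Sd(1) by blast
    have fu: "f u \<in> carrier B" "f (\<ominus> u) \<in> carrier B" using f(1) u Sd(4)[OF u] by blast+
    have "f (\<ominus> u) \<oplus>\<^bsub>B\<^esub> f u = \<zero>\<^bsub>B\<^esub>" using f(2)[OF Sd(4)[OF u] u] uc by (simp add: A.l_neg f0)
    then show ?thesis using fu by (simp add: B.A.minus_equality)
  qed
  have fx: "f x \<in> carrier B" "f (parity A x) \<in> carrier B" using f(1) x Px by blast+
  show ?thesis
  proof (rule B.component_eqI)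
    fix k
    have xc: "x \<in> carrier A" using x Sd(1) by blast
    have "component B k (f (parity A x)) = f (ksign A k (component A k x))"
      using fc[OF Px, of k] xc by (simp add: component_parity)
    also have "\<dots> = ksign B k (component B k (f x))"
      using fc[OF x, of k] neg[OF Sd(7)[OF x]] by (simp add: ksign_def)
    finally show "component B k (f (parity A x)) = component B k (parity B (f x))"
      using fx by (simp add: B.component_parity)
  qed (use fx in simp_all)
qed

end

context dg
begin

lemma cocycles_add: "[|x \<in> cocycles A; y \<in> cocycles A|] ==> x \<oplus> y \<in> cocycles A"
  by (simp add: cocycles_iff diff_add)

lemma cocycles_neg: "x \<in> cocycles A ==> \<ominus> x \<in> cocycles A" by (simp add: cocycles_iff diff_neg)

lemma cocycles_minus: "[|x \<in> cocycles A; y \<in> cocycles A|] ==> x \<ominus> y \<in> cocycles A"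
  by (simp add: cocycles_iff diff_minus)

lemma cocycles_smult: "[|a \<in> carrier K; x \<in> cocycles A|] ==> a \<odot> x \<in> cocycles A"
  by (simp add: cocycles_iff diff_smult)

lemmas cocycles_closed =
  cocycles_add cocycles_neg cocycles_minus cocycles_smult cocycles_mult cocycles_parity

lemmas dg_expand = A.ring_expand diff_add diff_minus diff_neg diff_mult diff_parity
  parity_add parity_minus parity_neg parity_mult

end

text \<open>
  A multiplicative identification \<open>rho\<close> of the cohomology of \<open>A\<close> with a graded algebra \<open>H\<close>,
  given on cocycles.
\<close>

locale ident = dg K A + H: gca K H
  for K :: "('k, 'l) ring_scheme" and A :: "('k, 'a, 'm) dga_scheme" (structure)
    and H :: "('k, 'h, 'n) dga_scheme" +
  fixes rho :: "'a => 'h"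
  assumes rho_closed [simp]: "x \<in> cocycles A ==> rho x \<in> carrier H"
    and rho_add: "[|x \<in> cocycles A; y \<in> cocycles A|] ==> rho (x \<oplus> y) = rho x \<oplus>\<^bsub>H\<^esub> rho y"
    and rho_smult: "[|a \<in> carrier K; x \<in> cocycles A|] ==> rho (a \<odot> x) = a \<odot>\<^bsub>H\<^esub> rho x"
    and rho_mult: "[|x \<in> cocycles A; y \<in> cocycles A|] ==> rho (x \<otimes> y) = rho x \<otimes>\<^bsub>H\<^esub> rho y"
    and rho_piece: "[|x \<in> cocycles A; x \<in> piece A k|] ==> rho x \<in> piece H k"
    and rho_zero_iff: "x \<in> cocycles A ==> rho x = \<zero>\<^bsub>H\<^esub> \<longleftrightarrow> x \<in> boundaries A"
    and rho_surj: "w \<in> carrier H ==> \<exists>u\<in>cocycles A. rho u = w"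
begin

lemma H_gca: "gca K H" ..

lemma rho_boundary [simp]: "x \<in> boundaries A ==> rho x = \<zero>\<^bsub>H\<^esub>"
  using rho_zero_iff boundaries_cocycles by blast

lemma rho_neg: "x \<in> cocycles A ==> rho (\<ominus> x) = \<ominus>\<^bsub>H\<^esub> rho x"
proof -
  assume x: "x \<in> cocycles A"
  have "\<ominus> x \<oplus> x = \<zero>" using x by (simp add: A.l_neg cocycles_carrier)
  then have "rho (\<ominus> x) \<oplus>\<^bsub>H\<^esub> rho x = rho \<zero>" using rho_add[OF cocycles_neg[OF x] x] by simp
  moreover have "rho \<zero> = \<zero>\<^bsub>H\<^esub>" using boundaries_diff[OF A.zero_closed] by simp
  ultimately show ?thesis using x cocycles_neg[OF x] by (simp add: H.A.minus_equality)
qed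

lemma rho_minus: "[|x \<in> cocycles A; y \<in> cocycles A|] ==> rho (x \<ominus> y) = rho x \<ominus>\<^bsub>H\<^esub> rho y"
  by (simp add: a_minus_def rho_add rho_neg cocycles_neg)

lemma rho_component: "x \<in> cocycles A ==> rho (component A k x) = component H k (rho x)"
  by (rule graded_map_component[OF H_gca cocycles_graded]) (auto intro: rho_piece simp: rho_add)

lemma rho_parity: "x \<in> cocycles A ==> rho (parity A x) = parity H (rho x)"
  by (rule graded_map_parity[OF H_gca cocycles_graded]) (auto intro: rho_piece simp: rho_add)

lemma rho_eq_iff:
  assumes "x \<in> cocycles A" "y \<in> cocycles A" shows "rho x = rho y \<longleftrightarrow> x \<ominus> y \<in> boundaries A"
proof -
  have "rho x = rho y \<longleftrightarrow> rho x \<ominus>\<^bsub>H\<^esub> rho y = \<zero>\<^bsub>H\<^esub>"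
    using assms H.A.diff_zero_eq[of "rho x" "rho y"] by auto
  then show ?thesis using assms by (simp add: rho_minus[symmetric] rho_zero_iff cocycles_minus)
qed

lemma rho_piece_pred:
  "[|x \<in> cocycles A; x \<in> piece_pred A k|] ==> rho x \<in> piece_pred H k"
  using boundaries_diff[OF A.zero_closed] by (cases k) (auto simp: piece_pred_def rho_piece)

end

text \<open>In the third relation of an A-infinity morphism from \<open>H\<close> to
  \<open>A\<close>, these are the terms built from the first two components \<open>\<iota>\<close>
  and \<open>h\<close> and the two products. Their class is the value that a ternary operation on
  \<open>H\<close> must have for a third component to exist.\<close>

definition massey_rep ::
    "('k, 'a, 'm) dga_scheme => ('k, 'h, 'n) dga_scheme => ('h => 'a) => ('h => 'h => 'a) =>
     'h => 'h => 'h => 'a" where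
  "massey_rep A H \<iota> h x y z = (h x y \<otimes>\<^bsub>A\<^esub> \<iota> z) \<ominus>\<^bsub>A\<^esub> (parity A (\<iota> x) \<otimes>\<^bsub>A\<^esub> h y z)
     \<oplus>\<^bsub>A\<^esub> h (x \<otimes>\<^bsub>H\<^esub> y) z \<ominus>\<^bsub>A\<^esub> h x (y \<otimes>\<^bsub>H\<^esub> z)"

definition massey ::
    "('k, 'a, 'm) dga_scheme => ('k, 'h, 'n) dga_scheme => ('a => 'h) => ('h => 'a) =>
     ('h => 'h => 'a) => 'h \<times> 'h \<times> 'h => 'h" where
  "massey A H rho \<iota> h = (\<lambda>(x, y, z) \<in> carrier H \<times> carrier H \<times> carrier H.
     rho (massey_rep A H \<iota> h x y z))"

text \<open>
  The first two components of an $A_\infty$ quasi-isomorphism from \<open>H\<close> to \<open>A\<close>: a section \<open>\<iota>\<close> and a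
  homotopy \<open>h\<close> for its multiplicativity.
\<close>

locale realization = ident K A H rho
  for K :: "('k, 'l) ring_scheme" and A :: "('k, 'a, 'm) dga_scheme" (structure)
    and H :: "('k, 'h, 'n) dga_scheme" and rho +
  fixes \<iota> :: "'h => 'a" and h :: "'h => 'h => 'a"
  assumes iota_cocycle [simp]: "x \<in> carrier H ==> \<iota> x \<in> cocycles A"
    and iota_add: "[|x \<in> carrier H; y \<in> carrier H|] ==> \<iota> (x \<oplus>\<^bsub>H\<^esub> y) = \<iota> x \<oplus> \<iota> y"
    and iota_smult: "[|a \<in> carrier K; x \<in> carrier H|] ==> \<iota> (a \<odot>\<^bsub>H\<^esub> x) = a \<odot> \<iota> x"
    and iota_piece: "x \<in> piece H k ==> \<iota> x \<in> piece A k"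
    and rho_iota [simp]: "x \<in> carrier H ==> rho (\<iota> x) = x"
    and h_closed [simp]: "[|x \<in> carrier H; y \<in> carrier H|] ==> h x y \<in> carrier A"
    and h_add_left: "[|x \<in> carrier H; x' \<in> carrier H; y \<in> carrier H|]
      ==> h (x \<oplus>\<^bsub>H\<^esub> x') y = h x y \<oplus> h x' y"
    and h_add_right: "[|x \<in> carrier H; y \<in> carrier H; y' \<in> carrier H|]
      ==> h x (y \<oplus>\<^bsub>H\<^esub> y') = h x y \<oplus> h x y'"
    and h_smult_left: "[|a \<in> carrier K; x \<in> carrier H; y \<in> carrier H|]
      ==> h (a \<odot>\<^bsub>H\<^esub> x) y = a \<odot> h x y"
    and h_smult_right: "[|a \<in> carrier K; x \<in> carrier H; y \<in> carrier H|]
      ==> h x (a \<odot>\<^bsub>H\<^esub> y) = a \<odot> h x y"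
    and h_piece: "[|x \<in> piece H i; y \<in> piece H j|] ==> h x y \<in> piece_pred A (i + j)"
    and diff_h: "[|x \<in> carrier H; y \<in> carrier H|] ==> d (h x y) = \<iota> x \<otimes> \<iota> y \<ominus> \<iota> (x \<otimes>\<^bsub>H\<^esub> y)"
begin

lemma iota_closed [simp]: "x \<in> carrier H ==> \<iota> x \<in> carrier A"
  using iota_cocycle cocycles_carrier by blast

lemma diff_iota [simp]: "x \<in> carrier H ==> d (\<iota> x) = \<zero>" using iota_cocycle cocycles_iff by blast

text \<open>By \<open>diff_h\<close> the differential consists of values of \<open>\<iota>\<close>
  and their products, which cancel in pairs by associativity in \<open>A\<close> and
  \<open>H\<close>.\<close>

lemma massey_rep_cocycle:
  assumes "x \<in> carrier H" "y \<in> carrier H" "z \<in> carrier H"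
  shows "massey_rep A H \<iota> h x y z \<in> cocycles A"
proof -
  have "d (massey_rep A H \<iota> h x y z) = \<zero>" unfolding massey_rep_def using assms
    by (simp add: dg_expand diff_h H.A.m_assoc) ((rule A.ag)+, simp_all)
  moreover have "massey_rep A H \<iota> h x y z \<in> carrier A" using assms by (simp add: massey_rep_def)
  ultimately show ?thesis by (simp add: cocycles_iff)
qed

lemma massey_apply:
  "[|x \<in> carrier H; y \<in> carrier H; z \<in> carrier H|]
    ==> massey A H rho \<iota> h (x, y, z) = rho (massey_rep A H \<iota> h x y z)" by (simp add: massey_def)

lemma massey_rep_add:
  assumes "x \<in> carrier H" "y \<in> carrier H" "z \<in> carrier H" "u \<in> carrier H"
  shows "massey_rep A H \<iota> h (x \<oplus>\<^bsub>H\<^esub> u) y z = massey_rep A H \<iota> h x y z \<oplus> massey_rep A H \<iota> h u y z"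
    "massey_rep A H \<iota> h x (y \<oplus>\<^bsub>H\<^esub> u) z = massey_rep A H \<iota> h x y z \<oplus> massey_rep A H \<iota> h x u z"
    "massey_rep A H \<iota> h x y (z \<oplus>\<^bsub>H\<^esub> u) = massey_rep A H \<iota> h x y z \<oplus> massey_rep A H \<iota> h x y u"
  unfolding massey_rep_def
  by (insert assms, simp add: dg_expand iota_add h_add_left h_add_right H.A.ring_expand,
      (rule A.ag)+, simp_all)+

lemma massey_rep_smult:
  assumes "x \<in> carrier H" "y \<in> carrier H" "z \<in> carrier H" "a \<in> carrier K"
  shows "massey_rep A H \<iota> h (a \<odot>\<^bsub>H\<^esub> x) y z = a \<odot> massey_rep A H \<iota> h x y z"
    "massey_rep A H \<iota> h x (a \<odot>\<^bsub>H\<^esub> y) z = a \<odot> massey_rep A H \<iota> h x y z"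
    "massey_rep A H \<iota> h x y (a \<odot>\<^bsub>H\<^esub> z) = a \<odot> massey_rep A H \<iota> h x y z"
  using assms unfolding massey_rep_def
  by (simp_all add: iota_smult h_smult_left h_smult_right smult_mult_left smult_mult_right
      H.smult_mult_left H.smult_mult_right parity_smult smult_minus smult_r_distr)

lemma massey_cochain: "massey A H rho \<iota> h \<in> cochains3 K H"
proof -
  have "massey A H rho \<iota> h (x, y, z) \<in> piece_pred H (i + j + k)"
    if p: "x \<in> piece H i" "y \<in> piece H j" "z \<in> piece H k" for i j k x y z
  proof -
    have c: "x \<in> carrier H" "y \<in> carrier H" "z \<in> carrier H" using p H.piece_carrier by blast+
    have "h x y \<otimes> \<iota> z \<in> piece_pred A (i + j + k)"
      by (rule piece_pred_mult_right[OF h_piece[OF p(1,2)] iota_piece[OF p(3)]]) simp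
    moreover have "parity A (\<iota> x) \<otimes> h y z \<in> piece_pred A (i + j + k)"
      by (rule piece_pred_mult_left[OF parity_piece[OF iota_piece[OF p(1)]] h_piece[OF p(2,3)]]) simp
    moreover have "h (x \<otimes>\<^bsub>H\<^esub> y) z \<in> piece_pred A (i + j + k)"
      by (rule h_piece[OF H.mult_piece[OF p(1,2)] p(3)])
    moreover have "h x (y \<otimes>\<^bsub>H\<^esub> z) \<in> piece_pred A (i + j + k)"
      using h_piece[OF p(1) H.mult_piece[OF p(2,3)]] by (simp add: add.assoc)
    ultimately have "massey_rep A H \<iota> h x y z \<in> piece_pred A (i + j + k)"
      unfolding massey_rep_def by (intro piece_pred_add piece_pred_minus)
    then show ?thesis using rho_piece_pred[OF massey_rep_cocycle[OF c]] c by (simp add: massey_apply)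
  qed
  moreover have "massey A H rho \<iota> h \<in> carrier H \<times> carrier H \<times> carrier H \<rightarrow>\<^sub>E carrier H"
    using massey_rep_cocycle by (auto simp: massey_def)
  ultimately show ?thesis
    by (simp add: cochains3_def linear_on_def Pi_def massey_apply massey_rep_add massey_rep_smult
        massey_rep_cocycle rho_add rho_smult)
qed

theorem massey_hoch_cocycle: "massey A H rho \<iota> h \<in> hoch_cocycles K H"
proof -
  let ?m = "massey_rep A H \<iota> h" and ?f = "massey A H rho \<iota> h"
  have "(?f (x, y, z) \<otimes>\<^bsub>H\<^esub> w) \<oplus>\<^bsub>H\<^esub> (parity H x \<otimes>\<^bsub>H\<^esub> ?f (y, z, w)) \<ominus>\<^bsub>H\<^esub> ?f (x \<otimes>\<^bsub>H\<^esub> y, z, w)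
         \<oplus>\<^bsub>H\<^esub> ?f (x, y \<otimes>\<^bsub>H\<^esub> z, w) \<ominus>\<^bsub>H\<^esub> ?f (x, y, z \<otimes>\<^bsub>H\<^esub> w) = \<zero>\<^bsub>H\<^esub>"
    if c: "x \<in> carrier H" "y \<in> carrier H" "z \<in> carrier H" "w \<in> carrier H" for x y z w
  proof -
    let ?T = "?m x y z \<otimes> \<iota> w \<oplus> parity A (\<iota> x) \<otimes> ?m y z w \<ominus> ?m (x \<otimes>\<^bsub>H\<^esub> y) z w
      \<oplus> ?m x (y \<otimes>\<^bsub>H\<^esub> z) w \<ominus> ?m x y (z \<otimes>\<^bsub>H\<^esub> w)"
    \<comment> \<open>The cocycle identity fails for the representatives but holds up to an exact
      term: what survives are the products of one of the homotopies \<open>h x y\<close>,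
      \<open>h z w\<close> with the differential of the other, and these form the differential of
      their signed product.\<close>
    have "?T = d (parity A (h x y) \<otimes> h z w)" unfolding massey_rep_def using c
      by (simp add: dg_expand diff_h H.A.m_assoc) ((rule A.ag)+, simp_all)
    then have "?T \<in> boundaries A" using c by (simp add: boundaries_diff)
    then have "rho ?T = \<zero>\<^bsub>H\<^esub>" by simp
    then show ?thesis
      using c by (simp add: massey_apply massey_rep_cocycle rho_add rho_minus rho_mult rho_parity
          cocycles_closed)
  qed
  then show ?thesis using massey_cochain by (simp add: hoch_cocycles_def)
qed

end

context ident
begin

text \<open>Two sections differ by \<open>d (s x)\<close>. Adding \<open>\<sigma>\<close>, which is
  built from \<open>s\<close>, turns \<open>h\<close> into a homotopy for \<open>\<iota>'\<close>.
  The remaining difference \<open>k\<close> from \<open>h'\<close> is closed, so its class is a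
  bilinear map \<open>\<phi>\<close> of degree -1, and the two Massey cochains differ by the
  Hochschild coboundary of \<open>\<phi>\<close>.\<close>

theorem massey_unique:
  assumes R: "realization K A H rho \<iota> h" and R': "realization K A H rho \<iota>' h'"
  obtains \<phi> where "\<phi> \<in> cochains2 K H"
    "!!x y z. [|x \<in> carrier H; y \<in> carrier H; z \<in> carrier H|] ==>
      massey A H rho \<iota>' h' (x, y, z) = massey A H rho \<iota> h (x, y, z) \<oplus>\<^bsub>H\<^esub> d_hoch H \<phi> (x, y, z)"
proof -
  interpret R: realization K A H rho \<iota> h by (rule R)
  interpret R': realization K A H rho \<iota>' h' by (rule R')
  obtain Hs Bs where "splitting K A Hs Bs" by (rule splitting_exists)
  then interpret S: splitting K A Hs Bs .
  define s where "s x = S.s (\<iota>' x \<ominus> \<iota> x)" for x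
  have s_closed [simp]: "s x \<in> carrier A" if "x \<in> carrier H" for x using that by (simp add: s_def)
  have s_add: "s (x \<oplus>\<^bsub>H\<^esub> y) = s x \<oplus> s y" if "x \<in> carrier H" "y \<in> carrier H" for x y
  proof -
    have "\<iota>' (x \<oplus>\<^bsub>H\<^esub> y) \<ominus> \<iota> (x \<oplus>\<^bsub>H\<^esub> y) = (\<iota>' x \<ominus> \<iota> x) \<oplus> (\<iota>' y \<ominus> \<iota> y)"
      unfolding R.iota_add[OF that] R'.iota_add[OF that] by ((rule A.ag)+, insert that, simp_all)
    then show ?thesis using that by (simp add: s_def S.s_add)
  qed
  have s_smult: "s (a \<odot>\<^bsub>H\<^esub> x) = a \<odot> s x" if "a \<in> carrier K" "x \<in> carrier H" for a x using that
    by (simp add: s_def R.iota_smult R'.iota_smult S.s_smult[symmetric] smult_minus)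
  have s_piece: "s x \<in> piece_pred A k" if "x \<in> piece H k" for x k
    using that unfolding s_def by (intro S.s_piece_pred piece_minus R.iota_piece R'.iota_piece)
  have diff_s: "d (s x) = \<iota>' x \<ominus> \<iota> x" if "x \<in> carrier H" for x
  proof -
    have "\<iota>' x \<ominus> \<iota> x \<in> boundaries A" using that rho_eq_iff[of "\<iota>' x" "\<iota> x"] by simp
    then show ?thesis using that by (simp add: s_def S.diff_s)
  qed
  define \<sigma> where "\<sigma> x y = s x \<otimes> \<iota>' y \<oplus> parity A (\<iota> x) \<otimes> s y \<ominus> s (x \<otimes>\<^bsub>H\<^esub> y)" for x y
  define k where "k x y = h' x y \<ominus> h x y \<ominus> \<sigma> x y" for x y
  have kc [simp]: "k x y \<in> cocycles A" if "x \<in> carrier H" "y \<in> carrier H" for x y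
  proof -
    have "d (k x y) = \<zero>" unfolding k_def \<sigma>_def using that
      by (simp add: dg_expand R.diff_h R'.diff_h diff_s) ((rule A.ag)+, simp_all)
    moreover have "k x y \<in> carrier A" using that by (simp add: k_def \<sigma>_def)
    ultimately show ?thesis by (simp add: cocycles_iff)
  qed
  define \<phi> where "\<phi> = (\<lambda>(x, y) \<in> carrier H \<times> carrier H. rho (k x y))"
  have k_add: "k (x \<oplus>\<^bsub>H\<^esub> u) y = k x y \<oplus> k u y" "k x (y \<oplus>\<^bsub>H\<^esub> u) = k x y \<oplus> k x u"
    if "x \<in> carrier H" "y \<in> carrier H" "u \<in> carrier H" for x y u unfolding k_def \<sigma>_def
    subgoal
      by (insert that, simp add: dg_expand R.iota_add R'.iota_add s_add R.h_add_left R'.h_add_left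
        H.A.ring_expand, (rule A.ag)+, simp_all)
    subgoal
      by (insert that, simp add: dg_expand R.iota_add R'.iota_add s_add R.h_add_right R'.h_add_right
        H.A.ring_expand, (rule A.ag)+, simp_all)
    done
  have k_smult: "k (a \<odot>\<^bsub>H\<^esub> x) y = a \<odot> k x y" "k x (a \<odot>\<^bsub>H\<^esub> y) = a \<odot> k x y"
    if "x \<in> carrier H" "y \<in> carrier H" "a \<in> carrier K" for x y a using that unfolding k_def \<sigma>_def
    by (simp_all add: R.iota_smult R'.iota_smult s_smult R.h_smult_left R'.h_smult_left
        R.h_smult_right R'.h_smult_right smult_mult_left smult_mult_right H.smult_mult_left
        H.smult_mult_right parity_smult smult_minus smult_r_distr)
  have k_piece: "k x y \<in> piece_pred A (i + j)" if p: "x \<in> piece H i" "y \<in> piece H j" for x y i j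
    unfolding k_def \<sigma>_def using R.h_piece[OF p] R'.h_piece[OF p] s_piece[OF H.mult_piece[OF p]]
      piece_pred_mult_right[OF s_piece[OF p(1)] R'.iota_piece[OF p(2)] refl]
      piece_pred_mult_left[OF parity_piece[OF R.iota_piece[OF p(1)]] s_piece[OF p(2)] refl]
    by (intro piece_pred_minus piece_pred_add)
  have \<phi>_apply: "\<phi> (x, y) = rho (k x y)" if "x \<in> carrier H" "y \<in> carrier H" for x y
    using that by (simp add: \<phi>_def)
  have \<phi>: "\<phi> \<in> cochains2 K H"
  proof -
    have "\<phi> \<in> carrier H \<times> carrier H \<rightarrow>\<^sub>E carrier H" by (auto simp: \<phi>_def)
    moreover have "\<phi> (x, y) \<in> piece_pred H (i + j)" if "x \<in> piece H i" "y \<in> piece H j" for x y i j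
      using that k_piece[OF that] by (simp add: \<phi>_apply H.piece_carrier rho_piece_pred)
    ultimately show ?thesis
      by (simp add: cochains2_def linear_on_def Pi_def \<phi>_apply k_add k_smult rho_add rho_smult)
  qed
  have "massey A H rho \<iota>' h' (x, y, z) = massey A H rho \<iota> h (x, y, z) \<oplus>\<^bsub>H\<^esub> d_hoch H \<phi> (x, y, z)"
    if c: "x \<in> carrier H" "y \<in> carrier H" "z \<in> carrier H" for x y z
  proof -
    let ?m = "massey_rep A H \<iota> h x y z" and ?m' = "massey_rep A H \<iota>' h' x y z"
    let ?D = "k x y \<otimes> \<iota>' z \<ominus> parity A (\<iota>' x) \<otimes> k y z \<oplus> k (x \<otimes>\<^bsub>H\<^esub> y) z \<ominus> k x (y \<otimes>\<^bsub>H\<^esub> z)"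
    \<comment> \<open>Products of two maps of degree -1: \<open>h\<close> with \<open>s\<close>,
      \<open>s\<close> with \<open>h\<close>, and \<open>s\<close> with the change
      \<open>\<sigma>\<close> of \<open>h\<close>.\<close>
    let ?W = "parity A (h x y) \<otimes> s z \<oplus> parity A (s x) \<otimes> h y z \<oplus> parity A (s x) \<otimes> \<sigma> y z"
    have "?m' \<ominus> (?m \<oplus> ?D) = d ?W" unfolding massey_rep_def k_def \<sigma>_def using c
      by (simp add: dg_expand R.diff_h R'.diff_h diff_s H.A.m_assoc) ((rule A.ag)+, simp_all)
    moreover have "?W \<in> carrier A" using c by (simp add: \<sigma>_def)
    ultimately have "?m' \<ominus> (?m \<oplus> ?D) \<in> boundaries A" using boundaries_diff by simp
    then have "rho ?m' = rho (?m \<oplus> ?D)"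
      using c by (simp add: rho_eq_iff R.massey_rep_cocycle R'.massey_rep_cocycle cocycles_closed)
    also have "\<dots> = rho ?m \<oplus>\<^bsub>H\<^esub> d_hoch H \<phi> (x, y, z)"
      using c by (simp add: d_hoch_def \<phi>_apply rho_add rho_minus rho_mult rho_parity
          R.massey_rep_cocycle cocycles_closed)
    finally show ?thesis using c by (simp add: R.massey_apply R'.massey_apply)
  qed
  then show ?thesis using that \<phi> by blast
qed

end

locale split_ident = ident K A H rho + splitting K A Hs Bs
  for K :: "('k, 'l) ring_scheme" and A :: "('k, 'a, 'm) dga_scheme" (structure)
    and H :: "('k, 'h, 'n) dga_scheme" and rho Hs Bs
begin

lemma rho_inj_Hs: "[|x \<in> Hs; y \<in> Hs; rho x = rho y|] ==> x = y"
proof -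
  assume x: "x \<in> Hs" "y \<in> Hs" "rho x = rho y"
  then have "x \<ominus> y \<in> boundaries A" using rho_eq_iff Hs_cocycles by simp
  then have "pH (x \<ominus> y) = \<zero>" by simp
  then have "x \<ominus> y = \<zero>" using Hs(5)[OF x(1,2)] by simp
  then show "x = y" using x A.diff_zero_eq by simp
qed

lemma rho_pH: "x \<in> cocycles A ==> rho (pH x) = rho x"
proof -
  assume x: "x \<in> cocycles A"
  have c: "x \<in> carrier A" by (rule cocycles_carrier[OF x])
  have e: "pE x \<in> boundaries A" and hh: "pH x \<in> cocycles A" using parts[OF c] Hs_cocycles by blast+
  have "rho x = rho (pE x \<oplus> pH x)" using cocycles_parts[OF x] by (rule arg_cong)
  also have "\<dots> = rho (pH x)" using e hh by (simp add: rho_add boundaries_cocycles)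
  finally show ?thesis by simp
qed

lemma section_exists: "\<exists>\<iota>. \<forall>x\<in>carrier H. \<iota> x \<in> Hs \<and> rho (\<iota> x) = x"
proof (rule bchoice, rule ballI)
  fix x assume x: "x \<in> carrier H"
  obtain z where z: "z \<in> cocycles A" "rho z = x" using rho_surj[OF x] by blast
  then have "pH z \<in> Hs \<and> rho (pH z) = x"
    using rho_pH[OF z(1)] parts(2)[OF cocycles_carrier[OF z(1)]] by simp
  then show "\<exists>u. u \<in> Hs \<and> rho u = x" by blast
qed

text \<open>For harmonic representatives \<open>s\<close> gives a primitive of the exact part of
  \<open>\<iota> x \<otimes> \<iota> y\<close>. The harmonic part is the chosen representative of
  the product class, because a harmonic element is determined by its class. The same injectivity
  makes \<open>\<iota>\<close> linear and degree preserving.\<close>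

lemma section_realization:
  assumes i: "!!x. x \<in> carrier H ==> \<iota> x \<in> Hs" "!!x. x \<in> carrier H ==> rho (\<iota> x) = x"
  shows "realization K A H rho \<iota> (\<lambda>x y. s (\<iota> x \<otimes> \<iota> y))"
proof -
  have z [simp]: "\<iota> x \<in> cocycles A" "\<iota> x \<in> carrier A" if "x \<in> carrier H" for x
    using i(1)[OF that] Hs_cocycles by simp_all
  have eq: "\<iota> x = u" if "x \<in> carrier H" "u \<in> Hs" "rho u = x" for x u
    by (rule rho_inj_Hs) (use that i in simp_all)
  have add: "\<iota> (x \<oplus>\<^bsub>H\<^esub> y) = \<iota> x \<oplus> \<iota> y" if "x \<in> carrier H" "y \<in> carrier H" for x y
    using that by (intro eq) (auto simp: i rho_add intro: Hs(3))
  have smult: "\<iota> (a \<odot>\<^bsub>H\<^esub> x) = a \<odot> \<iota> x" if "a \<in> carrier K" "x \<in> carrier H" for a x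
    using that by (intro eq) (auto simp: i rho_smult intro: Hs(6))
  have comp: "\<iota> x \<in> piece A k" if "x \<in> piece H k" for x k
  proof -
    have x: "x \<in> carrier H" using that H.piece_carrier by blast
    have "\<iota> x = component A k (\<iota> x)"
      using x that i[OF x] by (intro eq) (auto simp: rho_component intro: Hs(7))
    then show ?thesis using component_piece[of "\<iota> x" k] x by simp
  qed
  have mult: "d (s (\<iota> x \<otimes> \<iota> y)) = \<iota> x \<otimes> \<iota> y \<ominus> \<iota> (x \<otimes>\<^bsub>H\<^esub> y)"
    if xy: "x \<in> carrier H" "y \<in> carrier H" for x y
  proof -
    let ?u = "\<iota> x \<otimes> \<iota> y"
    have u: "?u \<in> cocycles A" "?u \<in> carrier A" using xy cocycles_mult by simp_all
    have "\<iota> (x \<otimes>\<^bsub>H\<^esub> y) = pH ?u"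
      using xy u parts(2)[OF u(2)] by (intro eq) (simp_all add: rho_pH rho_mult i)
    moreover have "pE ?u = (pE ?u \<oplus> pH ?u) \<ominus> pH ?u" by ((rule A.ag)+, insert u, simp_all)
    ultimately show ?thesis using diff_s[OF u(2)] cocycles_parts[OF u(1)] by simp
  qed
  have piece: "s (\<iota> x \<otimes> \<iota> y) \<in> piece_pred A (i + j)" if "x \<in> piece H i" "y \<in> piece H j" for x y i j
    by (rule s_piece_pred[OF mult_piece[OF comp[OF that(1)] comp[OF that(2)]]])
  show ?thesis by unfold_locales
      (auto simp: add smult comp i piece mult A.l_distr A.r_distr s_add smult_mult_left
        smult_mult_right s_smult)
qed

end

context ident
begin

lemma realization_exists: obtains \<iota> h where "realization K A H rho \<iota> h"
proof -
  obtain Hs Bs where "splitting K A Hs Bs" by (rule splitting_exists)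
  then interpret S: splitting K A Hs Bs .
  interpret S: split_ident K A H rho Hs Bs ..
  obtain \<iota> where "\<forall>x\<in>carrier H. \<iota> x \<in> Hs \<and> rho (\<iota> x) = x" using S.section_exists by blast
  then have "realization K A H rho \<iota> (\<lambda>x y. S.s (\<iota> x \<otimes> \<iota> y))" by (intro S.section_realization) auto
  then show ?thesis by (rule that)
qed

text \<open>With zero differential \<open>diff_h\<close> forces the section to be multiplicative, so
  the homotopy can be replaced by zero.\<close>

lemma realization_zero_diff:
  assumes "!!x. x \<in> carrier A ==> d x = \<zero>"
  obtains \<iota> where "realization K A H rho \<iota> (\<lambda>x y. \<zero>)"
    "!!x y z. [|x \<in> carrier H; y \<in> carrier H; z \<in> carrier H|]
      ==> massey A H rho \<iota> (\<lambda>x y. \<zero>) (x, y, z) = \<zero>\<^bsub>H\<^esub>"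
proof -
  obtain \<iota> h where "realization K A H rho \<iota> h" by (rule realization_exists)
  then interpret R: realization K A H rho \<iota> h .
  have e: "\<iota> x \<otimes> \<iota> y \<ominus> \<iota> (x \<otimes>\<^bsub>H\<^esub> y) = \<zero>" if "x \<in> carrier H" "y \<in> carrier H" for x y
    using R.diff_h[OF that, symmetric] assms that by simp
  have R0: "realization K A H rho \<iota> (\<lambda>x y. \<zero>)" by unfold_locales
      (auto simp: R.iota_add R.iota_smult R.iota_piece piece_pred_zero e)
  interpret R0: realization K A H rho \<iota> "\<lambda>x y. \<zero>" by (rule R0)
  have "rho \<zero> = \<zero>\<^bsub>H\<^esub>" using boundaries_diff[OF A.zero_closed] by simp
  then have "massey A H rho \<iota> (\<lambda>x y. \<zero>) (x, y, z) = \<zero>\<^bsub>H\<^esub>"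
    if "x \<in> carrier H" "y \<in> carrier H" "z \<in> carrier H" for x y z
    using that by (simp add: R0.massey_apply massey_rep_def)
  then show ?thesis by (rule that[OF R0])
qed

end

text \<open>A morphism carries the section, the homotopy and every term of the Massey representative
  along. Since it respects the identifications with \<open>H\<close>, the cochain on
  \<open>H\<close> stays the same.\<close>

lemma realization_push:
  assumes R: "realization K A H rho \<iota> h" and B: "ident K B H rho'" and f: "f \<in> dgca_hom K A B"
    and rho: "!!x. x \<in> cocycles A ==> rho' (f x) = rho x"
  shows "realization K B H rho' (\<lambda>x. f (\<iota> x)) (\<lambda>x y. f (h x y))"
    "[|x \<in> carrier H; y \<in> carrier H; z \<in> carrier H|] ==>
      massey B H rho' (\<lambda>x. f (\<iota> x)) (\<lambda>x y. f (h x y)) (x, y, z) = massey A H rho \<iota> h (x, y, z)"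
proof -
  interpret R: realization K A H rho \<iota> h by (rule R)
  interpret B: ident K B H rho' by (rule B)
  have f_closed [simp]: "f u \<in> carrier B" if "u \<in> carrier A" for u
    using f that by (auto simp: dgca_hom_def algebra_hom_def ring_hom_def)
  have f_add: "f (u \<oplus>\<^bsub>A\<^esub> v) = f u \<oplus>\<^bsub>B\<^esub> f v" if "u \<in> carrier A" "v \<in> carrier A" for u v
    using f that by (auto simp: dgca_hom_def algebra_hom_def ring_hom_def)
  have f_mult: "f (u \<otimes>\<^bsub>A\<^esub> v) = f u \<otimes>\<^bsub>B\<^esub> f v" if "u \<in> carrier A" "v \<in> carrier A" for u v
    using f that by (auto simp: dgca_hom_def algebra_hom_def ring_hom_def)
  have f_smult: "f (a \<odot>\<^bsub>A\<^esub> u) = a \<odot>\<^bsub>B\<^esub> f u" if "a \<in> carrier K" "u \<in> carrier A" for a u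
    using f that by (auto simp: dgca_hom_def algebra_hom_def)
  have f_piece: "f u \<in> piece B k" if "u \<in> piece A k" for u k
    using f that by (auto simp: dgca_hom_def)
  have f_diff: "f (diff A u) = diff B (f u)" if "u \<in> carrier A" for u
    using f that by (auto simp: dgca_hom_def)
  have f_parity: "f (parity A u) = parity B (f u)" if "u \<in> carrier A" for u
    by (rule R.graded_map_parity[OF _ R.carrier_graded])
      (auto simp: f_add f_piece that B.gca_axioms)
  have f0: "f \<zero>\<^bsub>A\<^esub> = \<zero>\<^bsub>B\<^esub>"
    using f_add[of "\<zero>\<^bsub>A\<^esub>" "\<zero>\<^bsub>A\<^esub>"] B.A.add.r_cancel_one'[of "f \<zero>\<^bsub>A\<^esub>" "f \<zero>\<^bsub>A\<^esub>"] by simp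
  have f_neg: "f (\<ominus>\<^bsub>A\<^esub> u) = \<ominus>\<^bsub>B\<^esub> f u" if "u \<in> carrier A" for u
    using f_add[of "\<ominus>\<^bsub>A\<^esub> u" u] that by (simp add: R.A.l_neg f0 B.A.minus_equality)
  have f_minus: "f (u \<ominus>\<^bsub>A\<^esub> v) = f u \<ominus>\<^bsub>B\<^esub> f v" if "u \<in> carrier A" "v \<in> carrier A" for u v
    using that by (simp add: a_minus_def f_add f_neg)
  have f_cocycle: "f u \<in> cocycles B" if "u \<in> cocycles A" for u
    using that f_diff[of u] by (simp add: R.cocycles_iff B.cocycles_iff f0)
  have f_pred: "f u \<in> piece_pred B k" if "u \<in> piece_pred A k" for u k
    using that f_piece by (cases k) (auto simp: piece_pred_def f0)
  show RB: "realization K B H rho' (\<lambda>x. f (\<iota> x)) (\<lambda>x y. f (h x y))" by unfold_locales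
      (auto simp: f_cocycle R.iota_add f_add R.iota_smult f_smult f_piece R.iota_piece rho
        R.h_add_left R.h_add_right R.h_smult_left R.h_smult_right f_pred R.h_piece
        f_diff[symmetric] R.diff_h f_minus f_mult)
  interpret RB: realization K B H rho' "\<lambda>x. f (\<iota> x)" "\<lambda>x y. f (h x y)" by (rule RB)
  assume c: "x \<in> carrier H" "y \<in> carrier H" "z \<in> carrier H"
  then have "massey_rep B H (\<lambda>x. f (\<iota> x)) (\<lambda>x y. f (h x y)) x y z = f (massey_rep A H \<iota> h x y z)"
    by (simp add: massey_rep_def f_minus f_add f_mult f_parity)
  then show "massey B H rho' (\<lambda>x. f (\<iota> x)) (\<lambda>x y. f (h x y)) (x, y, z) = massey A H rho \<iota> h (x, y, z)"
    using c by (simp add: RB.massey_apply R.massey_apply rho R.massey_rep_cocycle)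
qed

section \<open>Cohomology and quasi-isomorphisms\<close>

context dg
begin

lemma mem_cls: "u \<in> cls A x \<longleftrightarrow> (\<exists>b\<in>boundaries A. u = b \<oplus> x)" by (auto simp: cls_def a_r_coset_def')

lemma boundaries_zero: "\<zero> \<in> boundaries A" using boundaries_diff[OF A.zero_closed] by simp

lemmas boundaries_ops = graded_subspaceD(3-6)[OF boundaries_graded]

lemma cls_self: "x \<in> carrier A ==> x \<in> cls A x"
  using boundaries_zero by (auto simp: mem_cls intro!: bexI[of _ \<zero>])

lemma cls_eq_iff:
  assumes "x \<in> carrier A" "y \<in> carrier A"
  shows "cls A x = cls A y \<longleftrightarrow> x \<ominus> y \<in> boundaries A"
proof
  assume "cls A x = cls A y"
  then have "x \<in> cls A y" using cls_self[OF assms(1)] by simp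
  then obtain b where b: "b \<in> boundaries A" "x = b \<oplus> y" by (auto simp: mem_cls)
  have "x \<ominus> y = b"
    unfolding b(2) by ((rule A.ag)+, insert assms b(1), simp_all add: boundaries_carrier)
  then show "x \<ominus> y \<in> boundaries A" using b by simp
next
  assume xy: "x \<ominus> y \<in> boundaries A"
  have 1: "cls A u \<subseteq> cls A v" if uv: "u \<in> carrier A" "v \<in> carrier A" "u \<ominus> v \<in> boundaries A" for u v
  proof
    fix w assume "w \<in> cls A u"
    then obtain b where b: "b \<in> boundaries A" "w = b \<oplus> u" by (auto simp: mem_cls)
    have "w = (b \<oplus> (u \<ominus> v)) \<oplus> v"
      unfolding b(2) by ((rule A.ag)+, insert uv(1,2) b(1), simp_all add: boundaries_carrier)
    then show "w \<in> cls A v" using boundaries_ops(1)[OF b(1) uv(3)] by (auto simp: mem_cls)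
  qed
  have "y \<ominus> x = \<ominus> (x \<ominus> y)" by ((rule A.ag)+, insert assms, simp_all)
  then show "cls A x = cls A y"
    using 1[OF assms xy] 1[OF assms(2,1)] boundaries_ops(2)[OF xy] by auto
qed

lemma cls_eqI: "[|x \<in> carrier A; y \<in> carrier A; u \<in> cls A x; u \<in> cls A y|] ==> cls A x = cls A y"
proof -
  assume c: "x \<in> carrier A" "y \<in> carrier A" and "u \<in> cls A x" "u \<in> cls A y"
  then obtain a b where ab: "a \<in> boundaries A" "u = a \<oplus> x" "b \<in> boundaries A" "u = b \<oplus> y"
    by (auto simp: mem_cls)
  have cc: "a \<in> carrier A" "b \<in> carrier A" using ab boundaries_carrier by blast+
  have eq: "a \<oplus> x = b \<oplus> y" using ab by simp
  have "x \<ominus> y = (a \<oplus> x) \<ominus> y \<ominus> a" by ((rule A.ag)+, insert c cc, simp_all)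
  also have "\<dots> = b \<ominus> a" unfolding eq by ((rule A.ag)+, insert c cc, simp_all)
  finally show ?thesis using boundaries_ops(3)[OF ab(3,1)] cls_eq_iff[OF c] by simp
qed

lemma cls_carrier: "[|x \<in> carrier A; u \<in> cls A x|] ==> u \<in> carrier A"
  by (auto simp: mem_cls boundaries_carrier)

lemma cls_cls: "[|x \<in> carrier A; u \<in> cls A x|] ==> cls A u = cls A x"
  by (rule cls_eqI[OF cls_carrier _ cls_self[OF cls_carrier]])

lemma cls_cocycle: "[|x \<in> cocycles A; u \<in> cls A x|] ==> u \<in> cocycles A"
  by (auto simp: mem_cls cocycles_add boundaries_cocycles)

text \<open>Operations on the quotient are unions over representatives. They are evaluated by
  showing that all representatives give the same value.\<close>

lemma UN_cls: "[|x \<in> carrier A; !!u. u \<in> cls A x ==> F u = c|] ==> (\<Union>u\<in>cls A x. F u) = c"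
  using cls_self[of x] by blast

lemma cohomology_carrier: "carrier (cohomology A) = cls A ` cocycles A"
  by (auto simp: cohomology_def quotient_algebra_def Let_def FactRing_def A_RCOSETS_def'
      a_r_coset_def' cls_def)

lemma cohomology_piece: "piece (cohomology A) k = cls A ` (cocycles A \<inter> piece A k)"
  by (simp add: cohomology_def Let_def)

lemma cohomology_diff: "diff (cohomology A) x = \<zero>\<^bsub>cohomology A\<^esub>"
  by (simp add: cohomology_def Let_def)

lemma cohomology_zero: "\<zero>\<^bsub>cohomology A\<^esub> = cls A \<zero>"
proof -
  have "cls A \<zero> = boundaries A" using boundaries_carrier by (auto simp: mem_cls)
  then show ?thesis by (simp add: cohomology_def Let_def quotient_algebra_def FactRing_def)
qed

lemma cohomology_one: "\<one>\<^bsub>cohomology A\<^esub> = cls A \<one>"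
  by (simp add: cohomology_def Let_def quotient_algebra_def FactRing_def a_r_coset_def' cls_def)

lemma cohomology_add:
  assumes x: "x \<in> cocycles A" and y: "y \<in> cocycles A"
  shows "cls A x \<oplus>\<^bsub>cohomology A\<^esub> cls A y = cls A (x \<oplus> y)"
proof -
  have c: "x \<in> carrier A" "y \<in> carrier A" using x y cocycles_carrier by blast+
  have "cls A x \<oplus>\<^bsub>cohomology A\<^esub> cls A y = cls A x <+>\<^bsub>A\<^esub> cls A y"
    by (simp add: cohomology_def Let_def quotient_algebra_def FactRing_def set_add_def')
  also have "\<dots> = cls A (x \<oplus> y)"
  proof (intro subset_antisym subsetI)
    fix u assume "u \<in> cls A x <+>\<^bsub>A\<^esub> cls A y"
    then obtain a b where ab: "a \<in> boundaries A" "b \<in> boundaries A" "u = (a \<oplus> x) \<oplus> (b \<oplus> y)"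
      by (auto simp: mem_set_add mem_cls)
    have "u = (a \<oplus> b) \<oplus> (x \<oplus> y)"
      unfolding ab(3) by ((rule A.ag)+, insert ab(1,2) c, simp_all add: boundaries_carrier)
    then show "u \<in> cls A (x \<oplus> y)" using boundaries_ops(1)[OF ab(1,2)] by (auto simp: mem_cls)
  next
    fix u assume "u \<in> cls A (x \<oplus> y)"
    then obtain b where b: "b \<in> boundaries A" "u = b \<oplus> (x \<oplus> y)" by (auto simp: mem_cls)
    then have "u = (b \<oplus> x) \<oplus> y" using c by (simp add: A.a_assoc boundaries_carrier)
    moreover have "b \<oplus> x \<in> cls A x" using b by (auto simp: mem_cls)
    ultimately show "u \<in> cls A x <+>\<^bsub>A\<^esub> cls A y" using cls_self[OF c(2)] by (auto simp: mem_set_add)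
  qed
  finally show ?thesis .
qed

lemma cohomology_mult:
  assumes x: "x \<in> cocycles A" and y: "y \<in> cocycles A"
  shows "cls A x \<otimes>\<^bsub>cohomology A\<^esub> cls A y = cls A (x \<otimes> y)"
proof -
  have c: "x \<in> carrier A" "y \<in> carrier A" using x y cocycles_carrier by blast+
  have eq: "cls A (u \<otimes> v) = cls A (x \<otimes> y)" if u: "u \<in> cls A x" and v: "v \<in> cls A y" for u v
  proof -
    obtain a b where ab: "a \<in> boundaries A" "u = a \<oplus> x" "b \<in> boundaries A" "v = b \<oplus> y"
      using u v by (auto simp: mem_cls)
    have abc: "a \<in> carrier A" "b \<in> carrier A" using ab boundaries_carrier by blast+
    have vz: "v \<in> cocycles A" using cls_cocycle[OF y v] .
    have "u \<otimes> v \<ominus> x \<otimes> y = a \<otimes> v \<oplus> x \<otimes> b"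
      unfolding ab(2,4) by (insert c abc, simp add: A.ring_expand, (rule A.ag)+, simp_all)
    then have "u \<otimes> v \<ominus> x \<otimes> y \<in> boundaries A"
      using boundaries_ops(1)[OF boundaries_mult_left[OF ab(1) vz] boundaries_mult_right[OF x ab(3)]]
      by simp
    then show ?thesis using cls_eq_iff c cls_carrier[OF c(1) u] cls_carrier[OF c(2) v] by simp
  qed
  have "cls A x \<otimes>\<^bsub>cohomology A\<^esub> cls A y = (\<Union>u\<in>cls A x. \<Union>v\<in>cls A y. cls A (u \<otimes> v))"
    by (simp add: cohomology_def Let_def quotient_algebra_def FactRing_def rcoset_mult_def
        a_r_coset_def' cls_def)
  also have "\<dots> = cls A (x \<otimes> y)" by (intro UN_cls[OF c(1)] UN_cls[OF c(2)] eq)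
  finally show ?thesis .
qed

lemma cohomology_smult:
  assumes a: "a \<in> carrier K" and x: "x \<in> cocycles A"
  shows "a \<odot>\<^bsub>cohomology A\<^esub> cls A x = cls A (a \<odot> x)"
proof -
  have c: "x \<in> carrier A" using x cocycles_carrier by blast
  have eq: "cls A (a \<odot> u) = cls A (a \<odot> x)" if u: "u \<in> cls A x" for u
  proof -
    obtain b where b: "b \<in> boundaries A" "u = b \<oplus> x" using u by (auto simp: mem_cls)
    then have "a \<odot> u = a \<odot> b \<oplus> a \<odot> x" using a c by (simp add: smult_r_distr boundaries_carrier)
    then have "a \<odot> u \<in> cls A (a \<odot> x)" using boundaries_ops(4)[OF a b(1)] by (auto simp: mem_cls)
    then show ?thesis using a c by (intro cls_cls) auto
  qed
  have "a \<odot>\<^bsub>cohomology A\<^esub> cls A x = (\<Union>u\<in>cls A x. cls A (a \<odot> u))"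
    by (simp add: cohomology_def Let_def quotient_algebra_def a_r_coset_def' cls_def)
  also have "\<dots> = cls A (a \<odot> x)" by (intro UN_cls[OF c] eq)
  finally show ?thesis .
qed

lemma ident_cls:
  assumes "gca K (cohomology A)" shows "ident K A (cohomology A) (cls A)"
proof -
  interpret H: gca K "cohomology A" by (rule assms)
  show ?thesis by unfold_locales
      (auto simp: cohomology_carrier cohomology_piece cohomology_add cohomology_mult
        cohomology_smult cohomology_zero cls_eq_iff cocycles_carrier A.minus_eq)
qed

end

section \<open>Morphisms and quasi-isomorphisms of DGCAs\<close>

lemma dgca_homD:
  assumes "f \<in> dgca_hom K A B"
  shows "!!u. u \<in> carrier A ==> f u \<in> carrier B"
    "!!u v. [|u \<in> carrier A; v \<in> carrier A|] ==> f (u \<oplus>\<^bsub>A\<^esub> v) = f u \<oplus>\<^bsub>B\<^esub> f v"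
    "!!u v. [|u \<in> carrier A; v \<in> carrier A|] ==> f (u \<otimes>\<^bsub>A\<^esub> v) = f u \<otimes>\<^bsub>B\<^esub> f v"
    "!!a u. [|a \<in> carrier K; u \<in> carrier A|] ==> f (a \<odot>\<^bsub>A\<^esub> u) = a \<odot>\<^bsub>B\<^esub> f u"
    "!!u k. u \<in> piece A k ==> f u \<in> piece B k"
    "!!u. u \<in> carrier A ==> f (diff A u) = diff B (f u)"
  using assms by (auto simp: dgca_hom_def algebra_hom_def ring_hom_def image_subset_iff)

locale dg_hom = A: dg K A + B: dg K B
  for K :: "('k, 'l) ring_scheme" and A :: "('k, 'a, 'm) dga_scheme"
    and B :: "('k, 'b, 'n) dga_scheme" +
  fixes f :: "'a => 'b"
  assumes hom: "f \<in> dgca_hom K A B"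
begin

lemmas f_closed [simp] = dgca_homD(1)[OF hom]
lemmas f_add = dgca_homD(2)[OF hom]
lemmas f_mult = dgca_homD(3)[OF hom]
lemmas f_smult = dgca_homD(4)[OF hom]
lemmas f_piece = dgca_homD(5)[OF hom]
lemmas f_diff = dgca_homD(6)[OF hom]

lemma f_zero [simp]: "f \<zero>\<^bsub>A\<^esub> = \<zero>\<^bsub>B\<^esub>"
  using f_add[of "\<zero>\<^bsub>A\<^esub>" "\<zero>\<^bsub>A\<^esub>"] B.A.add.r_cancel_one'[of "f \<zero>\<^bsub>A\<^esub>" "f \<zero>\<^bsub>A\<^esub>"] by simp

lemma f_neg: "u \<in> carrier A ==> f (\<ominus>\<^bsub>A\<^esub> u) = \<ominus>\<^bsub>B\<^esub> f u"
  using f_add[of "\<ominus>\<^bsub>A\<^esub> u" u] by (simp add: A.A.l_neg B.A.minus_equality)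

lemma f_minus: "[|u \<in> carrier A; v \<in> carrier A|] ==> f (u \<ominus>\<^bsub>A\<^esub> v) = f u \<ominus>\<^bsub>B\<^esub> f v"
  by (simp add: a_minus_def f_add f_neg)

lemma f_cocycle: "u \<in> cocycles A ==> f u \<in> cocycles B"
  using f_diff[of u] by (simp add: A.cocycles_iff B.cocycles_iff)

lemma f_boundary: "u \<in> boundaries A ==> f u \<in> boundaries B" by (auto simp: boundaries_def f_diff)

lemma f_cls: "u \<in> cocycles A ==> cohomology_map A B f (cls A u) = cls B (f u)"
  unfolding cohomology_map_def
proof (rule A.UN_cls)
  fix v assume u: "u \<in> cocycles A" and v: "v \<in> cls A u"
  then obtain b where b: "b \<in> boundaries A" "v = b \<oplus>\<^bsub>A\<^esub> u" by (auto simp: A.mem_cls)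
  then have "f v = f b \<oplus>\<^bsub>B\<^esub> f u" using u by (simp add: f_add A.boundaries_carrier A.cocycles_carrier)
  then have "f v \<in> cls B (f u)" using f_boundary[OF b(1)] by (auto simp: B.mem_cls)
  then show "cls B (f v) = cls B (f u)" using u by (intro B.cls_cls) (auto simp: A.cocycles_carrier)
qed (rule A.cocycles_carrier)

lemma quasi_iso_iff:
  "quasi_iso K A B f \<longleftrightarrow> (\<forall>u\<in>cocycles A. f u \<in> boundaries B \<longrightarrow> u \<in> boundaries A) \<and>
    (\<forall>v\<in>cocycles B. \<exists>u\<in>cocycles A. f u \<ominus>\<^bsub>B\<^esub> v \<in> boundaries B)"
proof -
  have c: "f u \<in> carrier B" if "u \<in> cocycles A" for u using that A.cocycles_carrier by simp
  have "quasi_iso K A B f \<longleftrightarrow>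
      bij_betw (cohomology_map A B f) (cls A ` cocycles A) (cls B ` cocycles B)"
    using A.dgca_axioms B.dgca_axioms hom
    by (simp add: quasi_iso_def A.cohomology_carrier B.cohomology_carrier)
  also have "\<dots> \<longleftrightarrow> (\<forall>u\<in>cocycles A. \<forall>v\<in>cocycles A. cls B (f u) = cls B (f v) \<longrightarrow> cls A u = cls A v)
      \<and> cls B ` f ` cocycles A = cls B ` cocycles B"
    by (auto simp: bij_betw_def inj_on_def f_cls image_image)
  also have "cls B ` f ` cocycles A = cls B ` cocycles B \<longleftrightarrow>
      (\<forall>v\<in>cocycles B. \<exists>u\<in>cocycles A. f u \<ominus>\<^bsub>B\<^esub> v \<in> boundaries B)" (is "?L \<longleftrightarrow> ?R")
  proof
    assume L: ?L
    show ?R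
    proof
      fix v assume v: "v \<in> cocycles B"
      then have "cls B v \<in> cls B ` f ` cocycles A" using L by blast
      then obtain u where u: "u \<in> cocycles A" "cls B (f u) = cls B v" by (metis imageE)
      then show "\<exists>u\<in>cocycles A. f u \<ominus>\<^bsub>B\<^esub> v \<in> boundaries B"
        using B.cls_eq_iff[OF c[OF u(1)] B.cocycles_carrier[OF v]] by blast
    qed
  next
    assume R: ?R
    show ?L
    proof (intro subset_antisym subsetI)
      fix U assume "U \<in> cls B ` f ` cocycles A" then show "U \<in> cls B ` cocycles B" using f_cocycle by blast
    next
      fix U assume "U \<in> cls B ` cocycles B"
      then obtain v where v: "v \<in> cocycles B" "U = cls B v" by blast
      then obtain u where u: "u \<in> cocycles A" "f u \<ominus>\<^bsub>B\<^esub> v \<in> boundaries B" using R by blast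
      then have "cls B (f u) = U"
        using B.cls_eq_iff[OF c[OF u(1)] B.cocycles_carrier[OF v(1)]] v by simp
      then show "U \<in> cls B ` f ` cocycles A" using u by blast
    qed
  qed
  also have "(\<forall>u\<in>cocycles A. \<forall>v\<in>cocycles A. cls B (f u) = cls B (f v) \<longrightarrow> cls A u = cls A v) \<longleftrightarrow>
      (\<forall>u\<in>cocycles A. f u \<in> boundaries B \<longrightarrow> u \<in> boundaries A)" (is "?L \<longleftrightarrow> ?R")
  proof
    assume L: ?L
    show ?R
    proof (intro ballI impI)
      fix u assume u: "u \<in> cocycles A" "f u \<in> boundaries B"
      have z: "\<zero>\<^bsub>A\<^esub> \<in> cocycles A" using A.boundaries_zero A.boundaries_cocycles by blast
      have "cls B (f u) = cls B (f \<zero>\<^bsub>A\<^esub>)"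
        using u c[OF u(1)] by (simp add: B.cls_eq_iff B.A.minus_eq)
      then have "cls A u = cls A \<zero>\<^bsub>A\<^esub>" using L u(1) z by blast
      then show "u \<in> boundaries A"
        using A.cocycles_carrier[OF u(1)] by (simp add: A.cls_eq_iff A.A.minus_eq)
    qed
  next
    assume R: ?R
    show ?L
    proof (intro ballI impI)
      fix u v assume uv: "u \<in> cocycles A" "v \<in> cocycles A" "cls B (f u) = cls B (f v)"
      then have "f (u \<ominus>\<^bsub>A\<^esub> v) \<in> boundaries B"
        by (simp add: B.cls_eq_iff c f_minus A.cocycles_carrier)
      then have "u \<ominus>\<^bsub>A\<^esub> v \<in> boundaries A" using R uv A.cocycles_minus by blast
      then show "cls A u = cls A v" using uv by (simp add: A.cls_eq_iff A.cocycles_carrier)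
    qed
  qed
  finally show ?thesis by blast
qed

end

locale quasi = dg_hom +
  assumes quasi: "quasi_iso K A B f"
begin

lemma f_boundary_iff: "u \<in> cocycles A ==> f u \<in> boundaries B \<longleftrightarrow> u \<in> boundaries A"
  using quasi quasi_iso_iff f_boundary by blast

lemma f_surj: "v \<in> cocycles B ==> \<exists>u\<in>cocycles A. f u \<ominus>\<^bsub>B\<^esub> v \<in> boundaries B"
  using quasi quasi_iso_iff by blast

lemma ident_pullback:
  assumes "ident K B H rho" shows "ident K A H (\<lambda>u. rho (f u))"
proof -
  interpret R: ident K B H rho by (rule assms)
  have surj: "\<exists>u\<in>cocycles A. rho (f u) = w" if w: "w \<in> carrier H" for w
  proof -
    obtain v where v: "v \<in> cocycles B" "rho v = w" using R.rho_surj[OF w] by blast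
    obtain u where u: "u \<in> cocycles A" "f u \<ominus>\<^bsub>B\<^esub> v \<in> boundaries B" using f_surj[OF v(1)] by blast
    then have "rho (f u) = rho v" using R.rho_eq_iff[OF f_cocycle[OF u(1)] v(1)] by blast
    then show ?thesis using u v by blast
  qed
  show ?thesis by unfold_locales
      (auto simp: f_cocycle f_add f_mult f_smult A.cocycles_carrier R.rho_add R.rho_mult
        R.rho_smult R.rho_piece f_piece R.rho_zero_iff f_boundary_iff surj)
qed

text \<open>As \<open>f\<close> is surjective on classes, a cocycle \<open>v\<close> of
  \<open>B\<close> receives the value of \<open>rho\<close> at some cocycle \<open>g v\<close> of
  \<open>A\<close> lying over the class of \<open>v\<close>. Injectivity on classes makes the value
  independent of that choice (\<open>eq\<close>), so each law of \<open>ident\<close> is proved by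
  exhibiting one suitable preimage.\<close>

lemma ident_pushforward:
  assumes "ident K A H rho"
  obtains rho' where "ident K B H rho'" "!!u. u \<in> cocycles A ==> rho' (f u) = rho u"
proof -
  interpret R: ident K A H rho by (rule assms)
  define g where "g v = (SOME u. u \<in> cocycles A \<and> f u \<ominus>\<^bsub>B\<^esub> v \<in> boundaries B)" for v
  have g: "g v \<in> cocycles A" "f (g v) \<ominus>\<^bsub>B\<^esub> v \<in> boundaries B" if v: "v \<in> cocycles B" for v
    using someI_ex[of "\<lambda>u. u \<in> cocycles A \<and> f u \<ominus>\<^bsub>B\<^esub> v \<in> boundaries B"] f_surj[OF v]
    unfolding g_def by blast+
  have eq: "rho (g v) = rho u" if u: "u \<in> cocycles A" and v: "v \<in> cocycles B"
      and uv: "f u \<ominus>\<^bsub>B\<^esub> v \<in> boundaries B" for u v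
  proof -
    have c: "v \<in> carrier B" "u \<in> carrier A" "g v \<in> carrier A"
      using v u g[OF v] A.cocycles_carrier B.cocycles_carrier by blast+
    have "f (g v \<ominus>\<^bsub>A\<^esub> u) = (f (g v) \<ominus>\<^bsub>B\<^esub> v) \<ominus>\<^bsub>B\<^esub> (f u \<ominus>\<^bsub>B\<^esub> v)"
      unfolding f_minus[OF c(3,2)] by ((rule B.A.ag)+, insert c, simp_all)
    then have "f (g v \<ominus>\<^bsub>A\<^esub> u) \<in> boundaries B" using B.boundaries_ops(3)[OF g(2)[OF v] uv] by simp
    then have "g v \<ominus>\<^bsub>A\<^esub> u \<in> boundaries A"
      using f_boundary_iff[OF A.cocycles_minus[OF g(1)[OF v] u]] by blast
    then show ?thesis using R.rho_eq_iff[OF g(1)[OF v] u] by blast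
  qed
  have eq_hom: "rho (g (f u)) = rho u" if u: "u \<in> cocycles A" for u
    using eq[OF u f_cocycle[OF u]] u B.boundaries_zero by (simp add: A.cocycles_carrier)
  have add: "rho (g (v \<oplus>\<^bsub>B\<^esub> w)) = rho (g v) \<oplus>\<^bsub>H\<^esub> rho (g w)"
    if v: "v \<in> cocycles B" and w: "w \<in> cocycles B" for v w
  proof -
    have c: "v \<in> carrier B" "w \<in> carrier B" "g v \<in> carrier A" "g w \<in> carrier A"
      using v w g[OF v] g[OF w] A.cocycles_carrier B.cocycles_carrier by blast+
    have "f (g v \<oplus>\<^bsub>A\<^esub> g w) \<ominus>\<^bsub>B\<^esub> (v \<oplus>\<^bsub>B\<^esub> w) = (f (g v) \<ominus>\<^bsub>B\<^esub> v) \<oplus>\<^bsub>B\<^esub> (f (g w) \<ominus>\<^bsub>B\<^esub> w)"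
      unfolding f_add[OF c(3,4)] by ((rule B.A.ag)+, insert c, simp_all)
    then have "f (g v \<oplus>\<^bsub>A\<^esub> g w) \<ominus>\<^bsub>B\<^esub> (v \<oplus>\<^bsub>B\<^esub> w) \<in> boundaries B"
      using B.boundaries_ops(1)[OF g(2)[OF v] g(2)[OF w]] by simp
    then show ?thesis using eq[OF A.cocycles_add[OF g(1)[OF v] g(1)[OF w]] B.cocycles_add[OF v w]]
        R.rho_add[OF g(1)[OF v] g(1)[OF w]] by simp
  qed
  have mult: "rho (g (v \<otimes>\<^bsub>B\<^esub> w)) = rho (g v) \<otimes>\<^bsub>H\<^esub> rho (g w)"
    if v: "v \<in> cocycles B" and w: "w \<in> cocycles B" for v w
  proof -
    have c: "v \<in> carrier B" "w \<in> carrier B" "g v \<in> carrier A" "g w \<in> carrier A"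
      using v w g[OF v] g[OF w] A.cocycles_carrier B.cocycles_carrier by blast+
    have "f (g v \<otimes>\<^bsub>A\<^esub> g w) \<ominus>\<^bsub>B\<^esub> (v \<otimes>\<^bsub>B\<^esub> w)
        = (f (g v) \<ominus>\<^bsub>B\<^esub> v) \<otimes>\<^bsub>B\<^esub> f (g w) \<oplus>\<^bsub>B\<^esub> v \<otimes>\<^bsub>B\<^esub> (f (g w) \<ominus>\<^bsub>B\<^esub> w)" unfolding f_mult[OF c(3,4)]
      by (insert c, simp add: B.A.ring_expand, (rule B.A.ag)+, simp_all)
    then have "f (g v \<otimes>\<^bsub>A\<^esub> g w) \<ominus>\<^bsub>B\<^esub> (v \<otimes>\<^bsub>B\<^esub> w) \<in> boundaries B"
      using B.boundaries_ops(1)[OF B.boundaries_mult_left[OF g(2)[OF v] f_cocycle[OF g(1)[OF w]]]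
          B.boundaries_mult_right[OF v g(2)[OF w]]] by simp
    then show ?thesis using eq[OF A.cocycles_mult[OF g(1)[OF v] g(1)[OF w]] B.cocycles_mult[OF v w]]
        R.rho_mult[OF g(1)[OF v] g(1)[OF w]] by simp
  qed
  have smult: "rho (g (a \<odot>\<^bsub>B\<^esub> v)) = a \<odot>\<^bsub>H\<^esub> rho (g v)"
    if v: "v \<in> cocycles B" and a: "a \<in> carrier K" for a v
  proof -
    have c: "v \<in> carrier B" "g v \<in> carrier A"
      using v g[OF v] A.cocycles_carrier B.cocycles_carrier by blast+
    have "f (a \<odot>\<^bsub>A\<^esub> g v) \<ominus>\<^bsub>B\<^esub> (a \<odot>\<^bsub>B\<^esub> v) = a \<odot>\<^bsub>B\<^esub> (f (g v) \<ominus>\<^bsub>B\<^esub> v)"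
      using a c by (simp add: f_smult B.smult_minus)
    then have "f (a \<odot>\<^bsub>A\<^esub> g v) \<ominus>\<^bsub>B\<^esub> (a \<odot>\<^bsub>B\<^esub> v) \<in> boundaries B"
      using B.boundaries_ops(4)[OF a g(2)[OF v]] by simp
    then show ?thesis using eq[OF A.cocycles_smult[OF a g(1)[OF v]] B.cocycles_smult[OF a v]]
        R.rho_smult[OF a g(1)[OF v]] by simp
  qed
  have piece: "rho (g v) \<in> piece H k" if v: "v \<in> cocycles B" and vk: "v \<in> piece B k" for v k
  proof -
    have c: "v \<in> carrier B" "g v \<in> carrier A"
      using v g[OF v] A.cocycles_carrier B.cocycles_carrier by blast+
    have fc: "f (component A k (g v)) = component B k (f (g v))"
      by (rule A.graded_map_component[OF _ A.carrier_graded])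
        (auto simp: f_add f_piece c B.gca_axioms)
    have "f (component A k (g v)) \<ominus>\<^bsub>B\<^esub> v = component B k (f (g v) \<ominus>\<^bsub>B\<^esub> v)"
      using c vk by (simp add: fc B.component_minus)
    then have "f (component A k (g v)) \<ominus>\<^bsub>B\<^esub> v \<in> boundaries B"
      using B.boundaries_component[OF g(2)[OF v]] by simp
    then have "rho (g v) = rho (component A k (g v))"
      using eq[OF A.cocycles_component[OF g(1)[OF v]] v] by simp
    then show ?thesis
      using R.rho_piece[OF A.cocycles_component[OF g(1)[OF v]] A.component_piece[OF c(2)]] by simp
  qed
  have zero: "rho (g v) = \<zero>\<^bsub>H\<^esub> \<longleftrightarrow> v \<in> boundaries B" if v: "v \<in> cocycles B" for v
  proof -
    have c: "v \<in> carrier B" "f (g v) \<in> carrier B"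
      using v g[OF v] A.cocycles_carrier B.cocycles_carrier by auto
    have "rho (g v) = \<zero>\<^bsub>H\<^esub> \<longleftrightarrow> f (g v) \<in> boundaries B"
      using R.rho_zero_iff g[OF v] f_boundary_iff by blast
    moreover have "v = f (g v) \<ominus>\<^bsub>B\<^esub> (f (g v) \<ominus>\<^bsub>B\<^esub> v)" "f (g v) = (f (g v) \<ominus>\<^bsub>B\<^esub> v) \<oplus>\<^bsub>B\<^esub> v"
      by ((rule B.A.ag)+, insert c, simp_all)+
    ultimately show ?thesis using B.boundaries_ops(1,3) g(2)[OF v] by metis
  qed
  have surj: "\<exists>v\<in>cocycles B. rho (g v) = w" if w: "w \<in> carrier H" for w
    using R.rho_surj[OF w] eq_hom f_cocycle by metis
  have "ident K B H (\<lambda>v. rho (g v))" by unfold_locales (auto simp: g add mult smult piece zero surj)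
  then show ?thesis using eq_hom by (rule that)
qed

end

lemma quasiI: "quasi_iso K A B f ==> quasi K A B f"
  by (simp add: quasi_def quasi_axioms_def dg_hom_def dg_hom_axioms_def dg_def quasi_iso_def)

section \<open>Hochschild classes\<close>

lemma cochains2D:
  assumes "\<phi> \<in> cochains2 K H"
  shows "\<phi> \<in> carrier H \<times> carrier H \<rightarrow>\<^sub>E carrier H"
    "!!x y. [|x \<in> carrier H; y \<in> carrier H|] ==> \<phi> (x, y) \<in> carrier H"
    "!!x u y. [|x \<in> carrier H; u \<in> carrier H; y \<in> carrier H|]
      ==> \<phi> (x \<oplus>\<^bsub>H\<^esub> u, y) = \<phi> (x, y) \<oplus>\<^bsub>H\<^esub> \<phi> (u, y)"
    "!!x y u. [|x \<in> carrier H; y \<in> carrier H; u \<in> carrier H|]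
      ==> \<phi> (x, y \<oplus>\<^bsub>H\<^esub> u) = \<phi> (x, y) \<oplus>\<^bsub>H\<^esub> \<phi> (x, u)"
    "!!a x y. [|a \<in> carrier K; x \<in> carrier H; y \<in> carrier H|] ==> \<phi> (a \<odot>\<^bsub>H\<^esub> x, y) = a \<odot>\<^bsub>H\<^esub> \<phi> (x, y)"
    "!!a x y. [|a \<in> carrier K; x \<in> carrier H; y \<in> carrier H|] ==> \<phi> (x, a \<odot>\<^bsub>H\<^esub> y) = a \<odot>\<^bsub>H\<^esub> \<phi> (x, y)"
    "!!i j x y. [|x \<in> piece H i; y \<in> piece H j|] ==> \<phi> (x, y) \<in> piece_pred H (i + j)"
  using assms by (auto simp: cochains2_def linear_on_def)

context gca
begin

lemma d_hoch_apply:
  "[|x \<in> carrier A; y \<in> carrier A; z \<in> carrier A|] ==> d_hoch A \<phi> (x, y, z) =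
    (\<phi> (x, y) \<otimes> z) \<ominus> (parity A x \<otimes> \<phi> (y, z)) \<oplus> \<phi> (x \<otimes> y, z) \<ominus> \<phi> (x, y \<otimes> z)"
  by (simp add: d_hoch_def)

lemma d_hoch_closed:
  "[|\<phi> \<in> cochains2 K A; x \<in> carrier A; y \<in> carrier A; z \<in> carrier A|]
    ==> d_hoch A \<phi> (x, y, z) \<in> carrier A" by (simp add: d_hoch_apply cochains2D(2))

definition cochain2_add where
  "cochain2_add \<phi> \<psi> = (\<lambda>(x, y) \<in> carrier A \<times> carrier A. \<phi> (x, y) \<oplus> \<psi> (x, y))"

definition cochain2_neg where
  "cochain2_neg \<phi> = (\<lambda>(x, y) \<in> carrier A \<times> carrier A. \<ominus> \<phi> (x, y))"

lemma cochain2_add: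
  assumes "\<phi> \<in> cochains2 K A" "\<psi> \<in> cochains2 K A"
  shows "cochain2_add \<phi> \<psi> \<in> cochains2 K A"
    "[|x \<in> carrier A; y \<in> carrier A; z \<in> carrier A|]
      ==> d_hoch A (cochain2_add \<phi> \<psi>) (x, y, z) = d_hoch A \<phi> (x, y, z) \<oplus> d_hoch A \<psi> (x, y, z)"
proof -
  note P = cochains2D(2-7)[OF assms(1)] and S = cochains2D(2-7)[OF assms(2)]
  have ap: "cochain2_add \<phi> \<psi> (x, y) = \<phi> (x, y) \<oplus> \<psi> (x, y)" if "x \<in> carrier A" "y \<in> carrier A" for x y
    using that by (simp add: cochain2_add_def)
  have "cochain2_add \<phi> \<psi> \<in> carrier A \<times> carrier A \<rightarrow>\<^sub>E carrier A"
    using P(1) S(1) by (auto simp: cochain2_add_def)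
  moreover have "cochain2_add \<phi> \<psi> (x, y) \<in> piece_pred A (i + j)"
    if "x \<in> piece A i" "y \<in> piece A j" for x y i j
    using that P(6) S(6) by (simp add: ap piece_carrier piece_pred_add)
  moreover have "cochain2_add \<phi> \<psi> (x \<oplus> u, y) = cochain2_add \<phi> \<psi> (x, y) \<oplus> cochain2_add \<phi> \<psi> (u, y)"
    "cochain2_add \<phi> \<psi> (y, x \<oplus> u) = cochain2_add \<phi> \<psi> (y, x) \<oplus> cochain2_add \<phi> \<psi> (y, u)"
    if "x \<in> carrier A" "y \<in> carrier A" "u \<in> carrier A" for x y u
    using that by (simp_all add: ap P S A.a_ac)
  ultimately show "cochain2_add \<phi> \<psi> \<in> cochains2 K A"
    by (simp add: cochains2_def linear_on_def Pi_def ap P S smult_r_distr)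
  show "d_hoch A (cochain2_add \<phi> \<psi>) (x, y, z) = d_hoch A \<phi> (x, y, z) \<oplus> d_hoch A \<psi> (x, y, z)"
    if "x \<in> carrier A" "y \<in> carrier A" "z \<in> carrier A"
    by (insert that, simp add: d_hoch_apply ap P S A.ring_expand, (rule A.ag)+, simp_all add: P S)
qed

lemma cochain2_neg:
  assumes "\<phi> \<in> cochains2 K A"
  shows "cochain2_neg \<phi> \<in> cochains2 K A"
    "[|x \<in> carrier A; y \<in> carrier A; z \<in> carrier A|]
      ==> d_hoch A (cochain2_neg \<phi>) (x, y, z) = \<ominus> d_hoch A \<phi> (x, y, z)"
proof -
  note P = cochains2D(2-7)[OF assms(1)]
  have ap: "cochain2_neg \<phi> (x, y) = \<ominus> \<phi> (x, y)" if "x \<in> carrier A" "y \<in> carrier A" for x y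
    using that by (simp add: cochain2_neg_def)
  have "cochain2_neg \<phi> \<in> carrier A \<times> carrier A \<rightarrow>\<^sub>E carrier A"
    using P(1) by (auto simp: cochain2_neg_def)
  moreover have "cochain2_neg \<phi> (x, y) \<in> piece_pred A (i + j)"
    if "x \<in> piece A i" "y \<in> piece A j" for x y i j
    using that P(6)[OF that] piece_pred_minus[OF piece_pred_zero P(6)[OF that]] P(1)
    by (simp add: ap piece_carrier a_minus_def)
  ultimately show "cochain2_neg \<phi> \<in> cochains2 K A"
    by (simp add: cochains2_def linear_on_def Pi_def ap P smult_neg A.minus_add)
  show "d_hoch A (cochain2_neg \<phi>) (x, y, z) = \<ominus> d_hoch A \<phi> (x, y, z)"
    if "x \<in> carrier A" "y \<in> carrier A" "z \<in> carrier A"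
    by (insert that, simp add: d_hoch_apply ap P A.ring_expand, (rule A.ag)+, simp_all add: P)
qed

lemma cochain2_zero:
  "(\<lambda>(x, y) \<in> carrier A \<times> carrier A. \<zero>) \<in> cochains2 K A"
  "d_hoch A (\<lambda>(x, y) \<in> carrier A \<times> carrier A. \<zero>) = (\<lambda>(x, y, z) \<in> carrier A \<times> carrier A \<times> carrier A. \<zero>)"
proof -
  let ?z = "\<lambda>(x, y) \<in> carrier A \<times> carrier A. \<zero>"
  have "?z \<in> carrier A \<times> carrier A \<rightarrow>\<^sub>E carrier A" by auto
  then show "?z \<in> cochains2 K A"
    by (simp add: cochains2_def linear_on_def piece_pred_zero piece_carrier)
  show "d_hoch A ?z = (\<lambda>(x, y, z) \<in> carrier A \<times> carrier A \<times> carrier A. \<zero>)"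
    unfolding d_hoch_def by (intro restrict_ext) (auto simp: A.minus_eq)
qed

lemma triple_eqI:
  assumes "f \<in> cochains3 K A" "g \<in> extensional (carrier A \<times> carrier A \<times> carrier A)"
    "!!x y z. [|x \<in> carrier A; y \<in> carrier A; z \<in> carrier A|] ==> f (x, y, z) = g (x, y, z)"
  shows "f = g"
proof (rule extensionalityI[of f "carrier A \<times> carrier A \<times> carrier A"])
  show "f \<in> extensional (carrier A \<times> carrier A \<times> carrier A)"
    using assms(1) by (auto simp: cochains3_def PiE_def)
qed (use assms in auto)

lemma d_hoch_extensional: "d_hoch A \<phi> \<in> extensional (carrier A \<times> carrier A \<times> carrier A)"
  by (simp add: d_hoch_def)

lemma hoch_class_mem:
  "c \<in> hoch_class K A f \<longleftrightarrow> (\<exists>\<phi>\<in>cochains2 K A.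
     c = (\<lambda>t \<in> carrier A \<times> carrier A \<times> carrier A. d_hoch A \<phi> t \<oplus> f t))"
  by (auto simp: hoch_class_def r_coset_def cochain3_group_def hoch_coboundaries_def)

lemma hoch_class_le:
  assumes "\<phi> \<in> cochains2 K A" "f \<in> cochains3 K A" "g \<in> cochains3 K A"
    "!!x y z. [|x \<in> carrier A; y \<in> carrier A; z \<in> carrier A|]
      ==> f (x, y, z) = g (x, y, z) \<oplus> d_hoch A \<phi> (x, y, z)"
  shows "hoch_class K A f \<subseteq> hoch_class K A g"
proof
  fix c assume "c \<in> hoch_class K A f"
  then obtain \<psi> where \<psi>: "\<psi> \<in> cochains2 K A"
      "c = (\<lambda>t \<in> carrier A \<times> carrier A \<times> carrier A. d_hoch A \<psi> t \<oplus> f t)" by (auto simp: hoch_class_mem)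
  have g: "g (x, y, z) \<in> carrier A" if "x \<in> carrier A" "y \<in> carrier A" "z \<in> carrier A" for x y z
    using assms(3) that by (auto simp: cochains3_def)
  have "d_hoch A \<psi> (x, y, z) \<oplus> f (x, y, z) = d_hoch A (cochain2_add \<psi> \<phi>) (x, y, z) \<oplus> g (x, y, z)"
    if "x \<in> carrier A" "y \<in> carrier A" "z \<in> carrier A" for x y z
    unfolding assms(4)[OF that] cochain2_add(2)[OF \<psi>(1) assms(1) that]
    by ((rule A.ag)+, insert that \<psi> assms(1), simp_all add: d_hoch_closed g)
  then have "c = (\<lambda>t \<in> carrier A \<times> carrier A \<times> carrier A. d_hoch A (cochain2_add \<psi> \<phi>) t \<oplus> g t)"
    unfolding \<psi>(2) by (intro restrict_ext) auto
  then show "c \<in> hoch_class K A g" using cochain2_add(1)[OF \<psi>(1) assms(1)] by (auto simp: hoch_class_mem)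
qed

lemma hoch_class_eqI:
  assumes "\<phi> \<in> cochains2 K A" "f \<in> cochains3 K A" "g \<in> cochains3 K A"
    "!!x y z. [|x \<in> carrier A; y \<in> carrier A; z \<in> carrier A|]
      ==> f (x, y, z) = g (x, y, z) \<oplus> d_hoch A \<phi> (x, y, z)"
  shows "hoch_class K A f = hoch_class K A g"
proof
  show "hoch_class K A f \<subseteq> hoch_class K A g" by (rule hoch_class_le[OF assms])
  show "hoch_class K A g \<subseteq> hoch_class K A f"
  proof (rule hoch_class_le[OF cochain2_neg(1)[OF assms(1)] assms(3,2)])
    fix x y z assume c: "x \<in> carrier A" "y \<in> carrier A" "z \<in> carrier A"
    have g: "g (x, y, z) \<in> carrier A" using assms(3) c by (auto simp: cochains3_def)
    show "g (x, y, z) = f (x, y, z) \<oplus> d_hoch A (cochain2_neg \<phi>) (x, y, z)"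
      unfolding assms(4)[OF c] cochain2_neg(2)[OF assms(1) c]
      by ((rule A.ag)+, insert c g assms(1), simp_all add: d_hoch_closed)
  qed
qed

lemma hoch_class_trivial_iff:
  assumes "f \<in> cochains3 K A"
  shows "hoch_class K A f = \<one>\<^bsub>Hoch3 K A\<^esub> \<longleftrightarrow> (\<exists>\<phi>\<in>cochains2 K A. f = d_hoch A \<phi>)"
proof -
  have one: "\<one>\<^bsub>Hoch3 K A\<^esub> = hoch_coboundaries K A" by (simp add: Hoch3_def FactGroup_def)
  have fc: "f (x, y, z) \<in> carrier A" if "x \<in> carrier A" "y \<in> carrier A" "z \<in> carrier A" for x y z
    using assms that by (auto simp: cochains3_def)
  show ?thesis
  proof
    assume "hoch_class K A f = \<one>\<^bsub>Hoch3 K A\<^esub>"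
    moreover have "f \<in> hoch_class K A f" unfolding hoch_class_mem
    proof (rule bexI[OF _ cochain2_zero(1)], rule triple_eqI[OF assms])
    qed (auto simp: cochain2_zero(2) fc)
    ultimately show "\<exists>\<phi>\<in>cochains2 K A. f = d_hoch A \<phi>" by (auto simp: one hoch_coboundaries_def)
  next
    assume "\<exists>\<phi>\<in>cochains2 K A. f = d_hoch A \<phi>"
    then obtain \<phi> where \<phi>: "\<phi> \<in> cochains2 K A" "f = d_hoch A \<phi>" by blast
    have "c \<in> hoch_class K A f \<longleftrightarrow> c \<in> hoch_coboundaries K A" for c
    proof
      assume "c \<in> hoch_class K A f"
      then obtain \<psi> where \<psi>: "\<psi> \<in> cochains2 K A"
          "c = (\<lambda>t \<in> carrier A \<times> carrier A \<times> carrier A. d_hoch A \<psi> t \<oplus> f t)" by (auto simp: hoch_class_mem)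
      have "c = d_hoch A (cochain2_add \<psi> \<phi>)"
        by (rule extensionalityI[OF _ d_hoch_extensional]) (auto simp: \<psi>(2) \<phi> cochain2_add[OF \<psi>(1) \<phi>(1)])
      then show "c \<in> hoch_coboundaries K A"
        using cochain2_add(1)[OF \<psi>(1) \<phi>(1)] by (simp add: hoch_coboundaries_def)
    next
      assume "c \<in> hoch_coboundaries K A"
      then obtain \<psi> where \<psi>: "\<psi> \<in> cochains2 K A" "c = d_hoch A \<psi>" by (auto simp: hoch_coboundaries_def)
      let ?\<chi> = "cochain2_add \<psi> (cochain2_neg \<phi>)"
      have "d_hoch A \<psi> (x, y, z) = d_hoch A ?\<chi> (x, y, z) \<oplus> f (x, y, z)"
        if "x \<in> carrier A" "y \<in> carrier A" "z \<in> carrier A" for x y z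
        unfolding cochain2_add(2)[OF \<psi>(1) cochain2_neg(1)[OF \<phi>(1)] that] cochain2_neg(2)[OF \<phi>(1) that] \<phi>(2)
        by ((rule A.ag)+, insert that \<psi>(1) \<phi>(1), simp_all add: d_hoch_closed)
      then have "c = (\<lambda>t \<in> carrier A \<times> carrier A \<times> carrier A. d_hoch A ?\<chi> t \<oplus> f t)"
        unfolding \<psi>(2) by (intro extensionalityI[OF d_hoch_extensional]) auto
      then show "c \<in> hoch_class K A f"
        using cochain2_add(1)[OF \<psi>(1) cochain2_neg(1)[OF \<phi>(1)]] by (auto simp: hoch_class_mem)
    qed
    then show "hoch_class K A f = \<one>\<^bsub>Hoch3 K A\<^esub>" by (auto simp: one)
  qed
qed

lemma hoch_class_carrier:
  "f \<in> hoch_cocycles K A ==> hoch_class K A f \<in> carrier (Hoch3 K A)"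
  by (auto simp: Hoch3_def FactGroup_def RCOSETS_def hoch_class_def r_coset_def)

end

section \<open>Formality implies triviality of the Massey class\<close>

text \<open>The class of \<open>\<mu>\<close> is the Massey class of \<open>C\<close> for some identification of its cohomology with \<open>H\<close>.\<close>

definition carries_class ::
    "('k, 'l) ring_scheme => ('k, 'h, 'n) dga_scheme => ('h \<times> 'h \<times> 'h => 'h) =>
     ('k, 'a, 'm) dga_scheme => bool" where
  "carries_class K H \<mu> C \<longleftrightarrow> (\<exists>rho \<iota> h \<phi>. realization K C H rho \<iota> h \<and> \<phi> \<in> cochains2 K H \<and>
     (\<forall>x\<in>carrier H. \<forall>y\<in>carrier H. \<forall>z\<in>carrier H.
        massey C H rho \<iota> h (x, y, z) = \<mu> (x, y, z) \<oplus>\<^bsub>H\<^esub> d_hoch H \<phi> (x, y, z)))"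

lemma carries_class_push:
  assumes "quasi_iso K C D f" "carries_class K H \<mu> C" shows "carries_class K H \<mu> D"
proof -
  interpret f: quasi K C D f by (rule quasiI[OF assms(1)])
  obtain rho \<iota> h \<phi> where R: "realization K C H rho \<iota> h" and p: "\<phi> \<in> cochains2 K H"
      "\<forall>x\<in>carrier H. \<forall>y\<in>carrier H. \<forall>z\<in>carrier H.
        massey C H rho \<iota> h (x, y, z) = \<mu> (x, y, z) \<oplus>\<^bsub>H\<^esub> d_hoch H \<phi> (x, y, z)"
    using assms(2) unfolding carries_class_def by blast
  interpret R: realization K C H rho \<iota> h by (rule R)
  obtain rho' where D: "ident K D H rho'" "!!u. u \<in> cocycles C ==> rho' (f u) = rho u"
    using f.ident_pushforward[OF R.ident_axioms] by blast
  note q = realization_push[OF R D(1) f.hom D(2)]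
  show ?thesis unfolding carries_class_def
    by (intro exI conjI, rule q(1), simp, rule p(1)) (use p(2) q(2) in simp)
qed

text \<open>A quasi-isomorphism cannot carry a section and a homotopy backwards. Instead a fresh
  realization is chosen on \<open>D\<close>, pushed forward to \<open>C\<close>, and compared there
  with the given one by \<open>massey_unique\<close>.\<close>

lemma carries_class_pull:
  assumes "quasi_iso K D C f" "carries_class K H \<mu> C" "\<mu> \<in> cochains3 K H"
  shows "carries_class K H \<mu> D"
proof -
  interpret f: quasi K D C f by (rule quasiI[OF assms(1)])
  obtain rho \<iota> h \<phi> where R: "realization K C H rho \<iota> h" and p: "\<phi> \<in> cochains2 K H"
      "\<forall>x\<in>carrier H. \<forall>y\<in>carrier H. \<forall>z\<in>carrier H.
        massey C H rho \<iota> h (x, y, z) = \<mu> (x, y, z) \<oplus>\<^bsub>H\<^esub> d_hoch H \<phi> (x, y, z)"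
    using assms(2) unfolding carries_class_def by blast
  interpret R: realization K C H rho \<iota> h by (rule R)
  have \<mu>: "\<mu> (x, y, z) \<in> carrier H"
    if "x \<in> carrier H" "y \<in> carrier H" "z \<in> carrier H" for x y z
    using that assms(3) by (auto simp: cochains3_def)
  have D: "ident K D H (\<lambda>u. rho (f u))" by (rule f.ident_pullback[OF R.ident_axioms])
  obtain \<iota>' h' where R': "realization K D H (\<lambda>u. rho (f u)) \<iota>' h'"
    using ident.realization_exists[OF D] by blast
  note q = realization_push[OF R' R.ident_axioms f.hom]
  obtain \<psi> where \<psi>: "\<psi> \<in> cochains2 K H"
    "!!x y z. [|x \<in> carrier H; y \<in> carrier H; z \<in> carrier H|] ==>
      massey C H rho (\<lambda>x. f (\<iota>' x)) (\<lambda>x y. f (h' x y)) (x, y, z)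
        = massey C H rho \<iota> h (x, y, z) \<oplus>\<^bsub>H\<^esub> d_hoch H \<psi> (x, y, z)"
    using R.massey_unique[OF R q(1)] by blast
  have "massey D H (\<lambda>u. rho (f u)) \<iota>' h' (x, y, z)
      = \<mu> (x, y, z) \<oplus>\<^bsub>H\<^esub> d_hoch H (R.H.cochain2_add \<phi> \<psi>) (x, y, z)"
    if c: "x \<in> carrier H" "y \<in> carrier H" "z \<in> carrier H" for x y z using c p \<mu>[OF c] \<psi>(1)
    by (simp add: q(2)[symmetric] \<psi>(2) R.H.cochain2_add(2) R.H.A.a_assoc R.H.d_hoch_closed)
  then show ?thesis unfolding carries_class_def using R' R.H.cochain2_add(1)[OF p(1) \<psi>(1)] by blast
qed

text \<open>The identification with \<open>H\<close> is carried along the zig-zag, so at the far end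
  the cohomology of \<open>H\<close> may be identified with \<open>H\<close> in an unexpected way.
  This is harmless: with zero differential the Massey cochain can be made zero under any
  identification.\<close>

theorem formal_imp_trivial:
  fixes K :: "('k, 'l) ring_scheme" and A :: "('k, 'a, 'm) dga_scheme"
  assumes H: "gca K (cohomology A)" and R: "realization K A (cohomology A) (cls A) \<iota> h"
    and formal: "formal TYPE('u) K A"
  obtains \<phi> where "\<phi> \<in> cochains2 K (cohomology A)"
    "massey A (cohomology A) (cls A) \<iota> h = d_hoch (cohomology A) \<phi>"
proof -
  let ?H = "cohomology A" and ?\<mu> = "massey A (cohomology A) (cls A) \<iota> h"
  interpret H: gca K ?H by (rule H)
  interpret R: realization K A ?H "cls A" \<iota> h by (rule R)
  have \<mu>: "?\<mu> (x, y, z) \<in> carrier ?H"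
    if "x \<in> carrier ?H" "y \<in> carrier ?H" "z \<in> carrier ?H" for x y z
    using that R.massey_cochain by (auto simp: cochains3_def)
  have A: "carries_class K ?H ?\<mu> A" unfolding carries_class_def
    by (intro exI conjI, rule R, rule H.cochain2_zero(1)) (simp add: H.cochain2_zero(2) \<mu>)
  obtain C D :: "('k, ('k + 'a + 'u) list) dga"
    where CD: "qi_step K A C" "(qi_step K)\<^sup>*\<^sup>* C D" "qi_step K D ?H"
    using formal unfolding formal_def dgca_equivalent_def by blast
  have C: "carries_class K ?H ?\<mu> C"
    using CD(1) carries_class_push[OF _ A] carries_class_pull[OF _ A R.massey_cochain] unfolding qi_step_def by blast
  have D: "carries_class K ?H ?\<mu> D" using CD(2) C
  proof (induct rule: rtranclp_induct)
    case (step E F)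
    then have "carries_class K ?H ?\<mu> E" by simp
    then show ?case
      using step(2) carries_class_push carries_class_pull[OF _ _ R.massey_cochain] unfolding qi_step_def by metis
  qed
  have "carries_class K ?H ?\<mu> ?H"
    using CD(3) carries_class_push[OF _ D] carries_class_pull[OF _ D R.massey_cochain] unfolding qi_step_def by blast
  then obtain rho \<iota>' h' \<phi> where R': "realization K ?H ?H rho \<iota>' h'" and p: "\<phi> \<in> cochains2 K ?H"
      "\<forall>x\<in>carrier ?H. \<forall>y\<in>carrier ?H. \<forall>z\<in>carrier ?H.
        massey ?H ?H rho \<iota>' h' (x, y, z) = ?\<mu> (x, y, z) \<oplus>\<^bsub>?H\<^esub> d_hoch ?H \<phi> (x, y, z)"
    unfolding carries_class_def by blast
  interpret R': realization K ?H ?H rho \<iota>' h' by (rule R')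
  obtain \<iota>0 where R0: "realization K ?H ?H rho \<iota>0 (\<lambda>x y. \<zero>\<^bsub>?H\<^esub>)"
    "!!x y z. [|x \<in> carrier ?H; y \<in> carrier ?H; z \<in> carrier ?H|]
      ==> massey ?H ?H rho \<iota>0 (\<lambda>x y. \<zero>\<^bsub>?H\<^esub>) (x, y, z) = \<zero>\<^bsub>?H\<^esub>"
    using R'.realization_zero_diff[OF R.cohomology_diff] by blast
  obtain \<psi> where \<psi>: "\<psi> \<in> cochains2 K ?H"
    "!!x y z. [|x \<in> carrier ?H; y \<in> carrier ?H; z \<in> carrier ?H|] ==>
      massey ?H ?H rho \<iota>' h' (x, y, z)
        = massey ?H ?H rho \<iota>0 (\<lambda>x y. \<zero>\<^bsub>?H\<^esub>) (x, y, z) \<oplus>\<^bsub>?H\<^esub> d_hoch ?H \<psi> (x, y, z)"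
    using R'.massey_unique[OF R0(1) R'] by blast
  let ?\<chi> = "H.cochain2_add \<psi> (H.cochain2_neg \<phi>)"
  have "?\<mu> (x, y, z) = d_hoch ?H ?\<chi> (x, y, z)"
    if c: "x \<in> carrier ?H" "y \<in> carrier ?H" "z \<in> carrier ?H" for x y z
  proof -
    have e: "d_hoch ?H \<psi> (x, y, z) = ?\<mu> (x, y, z) \<oplus>\<^bsub>?H\<^esub> d_hoch ?H \<phi> (x, y, z)"
      using p(2) \<psi> R0(2) c by (simp add: H.d_hoch_closed)
    show ?thesis
      unfolding H.cochain2_add(2)[OF \<psi>(1) H.cochain2_neg(1)[OF p(1)] c] H.cochain2_neg(2)[OF p(1) c] e
      by ((rule H.A.ag)+, insert c p(1), simp_all add: H.d_hoch_closed \<mu>)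
  qed
  then have "?\<mu> = d_hoch ?H ?\<chi>" by (intro H.triple_eqI[OF R.massey_cochain H.d_hoch_extensional])
  then show ?thesis using that H.cochain2_add(1)[OF \<psi>(1) H.cochain2_neg(1)[OF p(1)]] by blast
qed

text \<open>The last two terms of \<open>massey_rep\<close> are values of \<open>diff_inv\<close>,
  hence lie in \<open>Bs\<close>, and the harmonic projection removes them. What is left is
  \<open>m3\<close>.\<close>

lemma mu3_massey:
  assumes S: "split_ident K A (cohomology A) (cls A) Hs Bs"
    and i: "!!x. x \<in> carrier (cohomology A) ==> \<iota> x \<in> Hs"
      "!!x. x \<in> carrier (cohomology A) ==> cls A (\<iota> x) = x"
  shows "realization K A (cohomology A) (cls A) \<iota> (\<lambda>x y. diff_inv A Hs Bs (\<iota> x \<otimes>\<^bsub>A\<^esub> \<iota> y))"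
    "mu3 A Hs \<iota> Bs
      = massey A (cohomology A) (cls A) \<iota> (\<lambda>x y. diff_inv A Hs Bs (\<iota> x \<otimes>\<^bsub>A\<^esub> \<iota> y))"
proof -
  let ?H = "cohomology A"
  interpret S: split_ident K A ?H "cls A" Hs Bs by (rule S)
  note s_def = S.s_def[symmetric]
  show R: "realization K A ?H (cls A) \<iota> (\<lambda>x y. diff_inv A Hs Bs (\<iota> x \<otimes>\<^bsub>A\<^esub> \<iota> y))"
    unfolding s_def by (rule S.section_realization) (use i in auto)
  interpret R: realization K A ?H "cls A" \<iota> "\<lambda>x y. diff_inv A Hs Bs (\<iota> x \<otimes>\<^bsub>A\<^esub> \<iota> y)" by (rule R)
  have "cls A (m3 A Hs Bs (\<iota> x) (\<iota> y) (\<iota> z))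
      = cls A (massey_rep A ?H \<iota> (\<lambda>x y. diff_inv A Hs Bs (\<iota> x \<otimes>\<^bsub>A\<^esub> \<iota> y)) x y z)"
    if c: "x \<in> carrier ?H" "y \<in> carrier ?H" "z \<in> carrier ?H" for x y z
  proof -
    let ?m = "massey_rep A ?H \<iota> (\<lambda>x y. diff_inv A Hs Bs (\<iota> x \<otimes>\<^bsub>A\<^esub> \<iota> y)) x y z"
    have "S.pH ?m = m3 A Hs Bs (\<iota> x) (\<iota> y) (\<iota> z)" using c S.s_Bs
      by (simp add: massey_rep_def m3_def S.parts_add S.parts_minus S.pH_def[symmetric] s_def
          S.parts_neg S.A.minus_eq)
    then show ?thesis using S.rho_pH[OF R.massey_rep_cocycle[OF c]] by simp
  qed
  then show "mu3 A Hs \<iota> Bs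
      = massey A ?H (cls A) \<iota> (\<lambda>x y. diff_inv A Hs Bs (\<iota> x \<otimes>\<^bsub>A\<^esub> \<iota> y))"
    unfolding mu3_def massey_def Let_def by (intro restrict_ext) auto
qed

section \<open>Poincare duality\<close>

context gca
begin

text \<open>For homogeneous arguments at most one summand is nonzero, and it is the value at the
  product. The general case follows by bilinearity, which is why additivity of \<open>L\<close> is
  assumed.\<close>

lemma pairing_eq:
  assumes L: "L \<in> piece A n \<rightarrow> carrier K"
    and add: "!!x y. [|x \<in> piece A n; y \<in> piece A n|] ==> L (x \<oplus> y) = L x \<oplus>\<^bsub>K\<^esub> L y"
    and x: "x \<in> carrier A" and y: "y \<in> carrier A"
  shows "pairing K A n L x y = L (component A n (x \<otimes> y))"
proof -
  have L0: "L \<zero> = \<zero>\<^bsub>K\<^esub>"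
    using add[OF piece_zero piece_zero] L piece_zero[of n] K.add.r_cancel_one'[of "L \<zero>" "L \<zero>"] by auto
  have trm: "component A k u \<otimes> component A (n - k) v \<in> piece A n"
    if "k \<le> n" "u \<in> carrier A" "v \<in> carrier A" for k u v
    using mult_piece[OF component_piece[of u k] component_piece[of v "n - k"]] that by simp
  have Lc: "L u \<in> carrier K" if "u \<in> piece A n" for u using L that by blast
  have add1: "pairing K A n L (u \<oplus> u') v = pairing K A n L u v \<oplus>\<^bsub>K\<^esub> pairing K A n L u' v"
    if "u \<in> carrier A" "u' \<in> carrier A" "v \<in> carrier A" for u u' v
  proof -
    have "pairing K A n L (u \<oplus> u') v = (\<Oplus>\<^bsub>K\<^esub>k\<in>{..n}. L (component A k u \<otimes> component A (n - k) v)
        \<oplus>\<^bsub>K\<^esub> L (component A k u' \<otimes> component A (n - k) v))" unfolding pairing_def using that trm Lc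
      by (intro K.finsum_cong') (auto simp: component_add A.l_distr add)
    then show ?thesis unfolding pairing_def using that trm Lc by (simp add: K.finsum_addf Pi_def)
  qed
  have add2: "pairing K A n L v (u \<oplus> u') = pairing K A n L v u \<oplus>\<^bsub>K\<^esub> pairing K A n L v u'"
    if "u \<in> carrier A" "u' \<in> carrier A" "v \<in> carrier A" for u u' v
  proof -
    have "pairing K A n L v (u \<oplus> u') = (\<Oplus>\<^bsub>K\<^esub>k\<in>{..n}. L (component A k v \<otimes> component A (n - k) u)
        \<oplus>\<^bsub>K\<^esub> L (component A k v \<otimes> component A (n - k) u'))" unfolding pairing_def using that trm Lc
      by (intro K.finsum_cong') (auto simp: component_add A.r_distr add)
    then show ?thesis unfolding pairing_def using that trm Lc by (simp add: K.finsum_addf Pi_def)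
  qed
  have rhs_add: "L (component A n (u \<oplus> u')) = L (component A n u) \<oplus>\<^bsub>K\<^esub> L (component A n u')"
    if "u \<in> carrier A" "u' \<in> carrier A" for u u'
    using that by (simp add: component_add add component_piece)
  have hom: "pairing K A n L u v = L (component A n (u \<otimes> v))"
    if u: "u \<in> piece A i" and v: "v \<in> piece A j" for u v i j
  proof -
    have c: "u \<in> carrier A" "v \<in> carrier A" using u v piece_carrier by blast+
    have t: "L (component A k u \<otimes> component A (n - k) v)
        = (if k = i then L (component A n (u \<otimes> v)) else \<zero>\<^bsub>K\<^esub>)" if k: "k \<le> n" for k
      using k u v c mult_piece[OF u v]
      by (auto simp: component_of_piece[OF u] component_of_piece[OF v]
          component_of_piece[OF mult_piece[OF u v]] L0)
    have "pairing K A n L u v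
        = (\<Oplus>\<^bsub>K\<^esub>k\<in>{..n}. if k = i then L (component A n (u \<otimes> v)) else \<zero>\<^bsub>K\<^esub>)"
      unfolding pairing_def using t Lc[OF component_piece] c by (intro K.finsum_cong') auto
    also have "\<dots> = L (component A n (u \<otimes> v))"
    proof (cases "i \<le> n")
      case True
      then show ?thesis
        using K.finsum_singleton[of i "{..n}" "\<lambda>k. L (component A n (u \<otimes> v))"] Lc[OF component_piece] c
        by (simp add: eq_commute[of i])
    next
      case False
      then have "component A n (u \<otimes> v) = \<zero>"
        using component_of_piece[OF mult_piece[OF u v], of n] by simp
      then have e: "(\<Oplus>\<^bsub>K\<^esub>k\<in>{..n}. if k = i then L (component A n (u \<otimes> v)) else \<zero>\<^bsub>K\<^esub>)
          = (\<Oplus>\<^bsub>K\<^esub>k\<in>{..n}. \<zero>\<^bsub>K\<^esub>)" using L0 by (intro K.finsum_cong') auto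
      show ?thesis unfolding e using \<open>component A n (u \<otimes> v) = \<zero>\<close> L0 by simp
    qed
    finally show ?thesis .
  qed
  from x show ?thesis
  proof (induct rule: graded_induct)
    case (piece i u)
    from y show ?case
    proof (induct rule: graded_induct)
      case (piece j v)
      then show ?case using hom \<open>u \<in> piece A i\<close> by blast
    next
      case (add v v')
      then show ?case using piece by (simp add: add2 rhs_add A.r_distr piece_carrier)
    qed
  next
    case (add u u')
    then show ?case using y by (simp add: add1 rhs_add A.l_distr)
  qed
qed

end

section \<open>Functionals represented by a non-degenerate form\<close>

locale bilinear_form = gca K A
  for K :: "('k, 'l) ring_scheme" and A :: "('k, 'a, 'm) dga_scheme" (structure) +
  fixes \<beta> :: "'a => 'a => 'k"
  assumes \<beta>: "!!v x. [|v \<in> carrier A; x \<in> carrier A|] ==> \<beta> v x \<in> carrier K"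
    "!!v w x. [|v \<in> carrier A; w \<in> carrier A; x \<in> carrier A|] ==> \<beta> (v \<oplus> w) x = \<beta> v x \<oplus>\<^bsub>K\<^esub> \<beta> w x"
    "!!v x y. [|v \<in> carrier A; x \<in> carrier A; y \<in> carrier A|] ==> \<beta> v (x \<oplus> y) = \<beta> v x \<oplus>\<^bsub>K\<^esub> \<beta> v y"
    "!!a v x. [|a \<in> carrier K; v \<in> carrier A; x \<in> carrier A|] ==> \<beta> (a \<odot> v) x = a \<otimes>\<^bsub>K\<^esub> \<beta> v x"
    "!!a v x. [|a \<in> carrier K; v \<in> carrier A; x \<in> carrier A|] ==> \<beta> v (a \<odot> x) = a \<otimes>\<^bsub>K\<^esub> \<beta> v x"
begin

text \<open>
  If finitely many of the functionals \<open>\<beta> w\<close> separate points then every functional is a \<open>\<beta> v\<close>; the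
  induction removes one functional at a time, passing to its kernel.
\<close>

lemma functional_representable_aux:
  assumes T: "finite T" "T \<subseteq> carrier A"
    and U: "U \<subseteq> carrier A" "!!x y. x \<in> U ==> y \<in> U ==> x \<oplus> y \<in> U"
      "!!a x. a \<in> carrier K ==> x \<in> U ==> a \<odot> x \<in> U"
    and l: "!!x. x \<in> carrier A ==> l x \<in> carrier K"
      "!!x y. [|x \<in> carrier A; y \<in> carrier A|] ==> l (x \<oplus> y) = l x \<oplus>\<^bsub>K\<^esub> l y"
      "!!a x. [|a \<in> carrier K; x \<in> carrier A|] ==> l (a \<odot> x) = a \<otimes>\<^bsub>K\<^esub> l x"
    and ker: "!!x. x \<in> U ==> (\<forall>w\<in>T. \<beta> w x = \<zero>\<^bsub>K\<^esub>) ==> l x = \<zero>\<^bsub>K\<^esub>"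
  shows "\<exists>v\<in>carrier A. \<forall>x\<in>U. l x = \<beta> v x" using T U ker
proof (induct T arbitrary: U rule: finite_induct)
  case empty
  have "\<beta> \<zero> x = \<zero>\<^bsub>K\<^esub>" if "x \<in> carrier A" for x using \<beta>(4)[of "\<zero>\<^bsub>K\<^esub>" \<zero> x] \<beta>(1)[of \<zero> x] that by simp
  then have "\<forall>x\<in>U. l x = \<beta> \<zero> x" using empty(2,5) by (simp add: subset_iff)
  then show ?case by blast
next
  case (insert w T)
  let ?U = "{x \<in> U. \<beta> w x = \<zero>\<^bsub>K\<^esub>}"
  have w: "w \<in> carrier A" and Tc: "T \<subseteq> carrier A" using insert(4) by simp_all
  have Uc: "x \<in> carrier A" if "x \<in> U" for x using that insert(5) by blast
  have "\<exists>v\<in>carrier A. \<forall>x\<in>?U. l x = \<beta> v x"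
  proof (rule insert(3)[OF Tc])
    show "?U \<subseteq> carrier A" using insert(5) by blast
    show "!!x y. x \<in> ?U ==> y \<in> ?U ==> x \<oplus> y \<in> ?U" using insert(6) w Uc by (simp add: \<beta>(3))
    show "!!a x. a \<in> carrier K ==> x \<in> ?U ==> a \<odot> x \<in> ?U" using insert(7) w Uc by (simp add: \<beta>(5))
    show "!!x. x \<in> ?U ==> \<forall>w\<in>T. \<beta> w x = \<zero>\<^bsub>K\<^esub> ==> l x = \<zero>\<^bsub>K\<^esub>" using insert(8) by simp
  qed
  then obtain v where v: "v \<in> carrier A" "\<forall>x\<in>?U. l x = \<beta> v x" by blast
  show ?case
  proof (cases "\<forall>x\<in>U. \<beta> w x = \<zero>\<^bsub>K\<^esub>")
    case True
    then show ?thesis using v by blast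
  next
    case False
    then obtain e where e: "e \<in> U" "\<beta> w e \<noteq> \<zero>\<^bsub>K\<^esub>" by blast
    define t where "t = \<beta> w e"
    have ec: "e \<in> carrier A" using e Uc by blast
    have tc: "t \<in> carrier K" using \<beta>(1) w ec by (simp add: t_def)
    then have tu: "t \<in> Units K" using e K.field_Units by (simp add: t_def)
    define i where "i = inv\<^bsub>K\<^esub> t"
    have ic: "i \<in> carrier K" "i \<otimes>\<^bsub>K\<^esub> t = \<one>\<^bsub>K\<^esub>" using tu by (simp_all add: i_def)
    \<comment> \<open>Chosen so that \<open>v \<oplus> c \<odot> w\<close> has the right value at
      \<open>e\<close>, where the functional \<open>\<beta> w\<close> does not vanish.\<close>
    define c where "c = i \<otimes>\<^bsub>K\<^esub> (l e \<ominus>\<^bsub>K\<^esub> \<beta> v e)"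
    have cc: "c \<in> carrier K" using ic ec v by (simp add: c_def l \<beta>)
    have "l x = \<beta> (v \<oplus> c \<odot> w) x" if x: "x \<in> U" for x
    proof -
      have xc: "x \<in> carrier A" using x Uc by blast
      \<comment> \<open>Adding this multiple of \<open>e\<close> moves \<open>x\<close> into the
        kernel of \<open>\<beta> w\<close>, where \<open>v\<close> already represents
        \<open>l\<close>.\<close>
      define a where "a = \<ominus>\<^bsub>K\<^esub> (i \<otimes>\<^bsub>K\<^esub> \<beta> w x)"
      have ac: "a \<in> carrier K" using ic w xc by (simp add: a_def \<beta>)
      let ?x = "x \<oplus> a \<odot> e"
      have bw: "\<beta> w x \<in> carrier K" "\<beta> v x \<in> carrier K" "\<beta> v e \<in> carrier K" "l x \<in> carrier K" "l e \<in> carrier K"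
        using w v xc ec by (simp_all add: \<beta> l)
      have at: "a \<otimes>\<^bsub>K\<^esub> t = \<ominus>\<^bsub>K\<^esub> \<beta> w x"
      proof -
        have "(i \<otimes>\<^bsub>K\<^esub> \<beta> w x) \<otimes>\<^bsub>K\<^esub> t = (i \<otimes>\<^bsub>K\<^esub> t) \<otimes>\<^bsub>K\<^esub> \<beta> w x" using ic(1) tc bw by (simp add: K.m_ac)
        then show ?thesis using ic tc bw by (simp add: a_def K.l_minus)
      qed
      have "\<beta> w ?x = \<zero>\<^bsub>K\<^esub>" using w xc ec ac at bw by (simp add: \<beta>(3,5) t_def[symmetric] K.r_neg)
      then have "l ?x = \<beta> v ?x" using v insert(6)[OF x insert(7)[OF ac e(1)]] by simp
      then have eq: "l x \<oplus>\<^bsub>K\<^esub> a \<otimes>\<^bsub>K\<^esub> l e = \<beta> v x \<oplus>\<^bsub>K\<^esub> a \<otimes>\<^bsub>K\<^esub> \<beta> v e"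
        using xc ec ac v by (simp add: l \<beta>)
      have "l x = (l x \<oplus>\<^bsub>K\<^esub> a \<otimes>\<^bsub>K\<^esub> l e) \<ominus>\<^bsub>K\<^esub> a \<otimes>\<^bsub>K\<^esub> l e" by ((rule K.ag)+, insert ac bw, simp_all)
      also have "\<dots> = \<beta> v x \<ominus>\<^bsub>K\<^esub> a \<otimes>\<^bsub>K\<^esub> (l e \<ominus>\<^bsub>K\<^esub> \<beta> v e)"
        unfolding eq by (insert ac bw, simp add: K.ring_expand, (rule K.ag)+, simp_all)
      also have "\<ominus>\<^bsub>K\<^esub> (a \<otimes>\<^bsub>K\<^esub> (l e \<ominus>\<^bsub>K\<^esub> \<beta> v e)) = c \<otimes>\<^bsub>K\<^esub> \<beta> w x"
        using ic bw by (simp add: a_def c_def K.l_minus K.r_minus K.m_ac)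
      then have "\<beta> v x \<ominus>\<^bsub>K\<^esub> a \<otimes>\<^bsub>K\<^esub> (l e \<ominus>\<^bsub>K\<^esub> \<beta> v e) = \<beta> (v \<oplus> c \<odot> w) x"
        using v w xc cc by (simp add: \<beta> a_minus_def)
      finally show ?thesis .
    qed
    then show ?thesis using v cc w by blast
  qed
qed

text \<open>A finite spanning set supplies the separating functionals: an \<open>x\<close>
  orthogonal to it is orthogonal to everything, hence zero. Uniqueness is non-degeneracy in the
  other argument.\<close>

lemma functional_representable:
  assumes nondeg: "!!x. x \<in> carrier A ==> (\<forall>v\<in>carrier A. \<beta> v x = \<zero>\<^bsub>K\<^esub>) ==> x = \<zero>"
      "!!v. v \<in> carrier A ==> (\<forall>x\<in>carrier A. \<beta> v x = \<zero>\<^bsub>K\<^esub>) ==> v = \<zero>"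
    and fd: "finite_dimensional K A"
    and l: "!!x. x \<in> carrier A ==> l x \<in> carrier K"
      "!!x y. [|x \<in> carrier A; y \<in> carrier A|] ==> l (x \<oplus> y) = l x \<oplus>\<^bsub>K\<^esub> l y"
      "!!a x. [|a \<in> carrier K; x \<in> carrier A|] ==> l (a \<odot> x) = a \<otimes>\<^bsub>K\<^esub> l x"
  shows "\<exists>!v. v \<in> carrier A \<and> (\<forall>x\<in>carrier A. \<beta> v x = l x)"
proof -
  obtain S where S: "finite S" "S \<subseteq> carrier A"
    "\<forall>x\<in>carrier A. \<exists>c\<in>S \<rightarrow> carrier K. x = (\<Oplus>s\<in>S. c s \<odot> s)"
    using fd unfolding finite_dimensional_def by blast
  have l0: "l \<zero> = \<zero>\<^bsub>K\<^esub>" using l(3)[of "\<zero>\<^bsub>K\<^esub>" \<zero>] l(1)[of \<zero>] by simp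
  have b0: "\<beta> \<zero> x = \<zero>\<^bsub>K\<^esub>" if "x \<in> carrier A" for x
    using \<beta>(4)[of "\<zero>\<^bsub>K\<^esub>" \<zero> x] \<beta>(1)[of \<zero> x] that by simp
  have ker: "l x = \<zero>\<^bsub>K\<^esub>" if x: "x \<in> carrier A" and z: "\<forall>w\<in>S. \<beta> w x = \<zero>\<^bsub>K\<^esub>" for x
  proof -
    have "\<beta> v x = \<zero>\<^bsub>K\<^esub>" if v: "v \<in> carrier A" for v
    proof -
      obtain c where c: "c \<in> S \<rightarrow> carrier K" "v = (\<Oplus>s\<in>S. c s \<odot> s)" using S v by blast
      have "T \<subseteq> S ==> \<beta> (\<Oplus>s\<in>T. c s \<odot> s) x = \<zero>\<^bsub>K\<^esub>" if "finite T" for T using that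
      proof (induct T rule: finite_induct)
        case (insert s T)
        have cs: "c s \<in> carrier K" "s \<in> carrier A" using insert c S by auto
        have f: "(\<lambda>s. c s \<odot> s) \<in> T \<rightarrow> carrier A"
          using insert(4) c(1) S(2) by (auto simp: Pi_def subset_iff)
        have "(\<Oplus>s\<in>insert s T. c s \<odot> s) = c s \<odot> s \<oplus> (\<Oplus>s\<in>T. c s \<odot> s)" using insert(1,2) f cs by simp
        then show ?case using insert f cs x z A.finsum_closed[OF f] by (simp add: \<beta>)
      qed (use b0 x in simp)
      then show ?thesis using S(1) c by blast
    qed
    then have "x = \<zero>" using nondeg(1)[OF x] by blast
    then show ?thesis using l0 by simp
  qed
  have "\<exists>v\<in>carrier A. \<forall>x\<in>carrier A. l x = \<beta> v x"
    by (rule functional_representable_aux[of S "carrier A" l]) (use S l ker in auto)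
  then obtain v where v: "v \<in> carrier A" "\<forall>x\<in>carrier A. \<beta> v x = l x" by force
  moreover have "w = v" if w: "w \<in> carrier A" "\<forall>x\<in>carrier A. \<beta> w x = l x" for w
  proof -
    have "\<beta> (w \<ominus> v) x = \<zero>\<^bsub>K\<^esub>" if "x \<in> carrier A" for x
    proof -
      have "\<beta> ((w \<ominus> v) \<oplus> v) x = \<beta> (w \<ominus> v) x \<oplus>\<^bsub>K\<^esub> \<beta> v x" using that v w by (simp add: \<beta>)
      moreover have "(w \<ominus> v) \<oplus> v = w" by ((rule A.ag)+, insert v w, simp_all)
      ultimately have "l x = \<beta> (w \<ominus> v) x \<oplus>\<^bsub>K\<^esub> l x" using v w that by simp
      then show ?thesis
        using K.add.l_cancel_one'[of "l x" "\<beta> (w \<ominus> v) x"] \<beta>(1)[of "w \<ominus> v" x] l(1)[OF that] v w that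
        by simp
    qed
    then have "w \<ominus> v = \<zero>" using nondeg(2)[of "w \<ominus> v"] v w by simp
    then show ?thesis using v w A.diff_zero_eq by blast
  qed
  ultimately show ?thesis by blast
qed

end

section \<open>Integration on a Poincare DGCA\<close>

locale poincare = dg K A
  for K :: "('k, 'l) ring_scheme" and A :: "('k, 'a, 'm) dga_scheme" (structure) +
  fixes n :: nat and I :: "'a set => 'k"
  assumes poincare: "poincare_dgca K A n I"
begin

abbreviation H :: "('k, 'a set) dga" where "H \<equiv> cohomology A"
abbreviation CH where "CH \<equiv> carrier H"

abbreviation H_ops_add (infixl "\<oplus>\<^sub>H" 65) where "X \<oplus>\<^sub>H Y \<equiv> X \<oplus>\<^bsub>H\<^esub> Y"
abbreviation H_ops_diff (infixl "\<ominus>\<^sub>H" 65) where "X \<ominus>\<^sub>H Y \<equiv> X \<ominus>\<^bsub>H\<^esub> Y"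
abbreviation H_ops_mult (infixl "\<otimes>\<^sub>H" 70) where "X \<otimes>\<^sub>H Y \<equiv> X \<otimes>\<^bsub>H\<^esub> Y"
abbreviation H_ops_neg ("\<ominus>\<^sub>H _" [81] 80) where "\<ominus>\<^sub>H X \<equiv> \<ominus>\<^bsub>H\<^esub> X"
abbreviation H_ops_smult (infixl "\<odot>\<^sub>H" 70) where "a \<odot>\<^sub>H X \<equiv> a \<odot>\<^bsub>H\<^esub> X"
abbreviation H_ops_zero ("\<zero>\<^sub>H") where "\<zero>\<^sub>H \<equiv> \<zero>\<^bsub>H\<^esub>"
abbreviation H_ops_one ("\<one>\<^sub>H") where "\<one>\<^sub>H \<equiv> \<one>\<^bsub>H\<^esub>"
abbreviation K_ops_add (infixl "\<oplus>\<^sub>K" 65) where "a \<oplus>\<^sub>K b \<equiv> a \<oplus>\<^bsub>K\<^esub> b"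
abbreviation K_ops_diff (infixl "\<ominus>\<^sub>K" 65) where "a \<ominus>\<^sub>K b \<equiv> a \<ominus>\<^bsub>K\<^esub> b"
abbreviation K_ops_mult (infixl "\<otimes>\<^sub>K" 70) where "a \<otimes>\<^sub>K b \<equiv> a \<otimes>\<^bsub>K\<^esub> b"
abbreviation K_ops_neg ("\<ominus>\<^sub>K _" [81] 80) where "\<ominus>\<^sub>K a \<equiv> \<ominus>\<^bsub>K\<^esub> a"
abbreviation K_ops_zero ("\<zero>\<^sub>K") where "\<zero>\<^sub>K \<equiv> \<zero>\<^bsub>K\<^esub>"
abbreviation K_ops_one ("\<one>\<^sub>K") where "\<one>\<^sub>K \<equiv> \<one>\<^bsub>K\<^esub>"

lemma cohomology_gca: "gca K H"
  using poincare by (simp add: poincare_dgca_def poincare_algebra_def gca_def)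

end

sublocale poincare \<subseteq> ident K A "cohomology A" "cls A" by (rule ident_cls[OF cohomology_gca])

context poincare
begin

lemma piece_above: "k > n ==> piece A k = {\<zero>}" using poincare by (simp add: poincare_dgca_def)

lemma H_piece_above: "k > n ==> piece H k = {\<zero>\<^sub>H}"
  using poincare by (simp add: poincare_dgca_def poincare_algebra_def)

lemma filt_above: "x \<in> filt k ==> k > n ==> x = \<zero>"
proof (rule component_eqI)
  fix j assume x: "x \<in> filt k" and k: "k > n"
  show "component A j x = component A j \<zero>"
  proof (cases "j < k")
    case True then show ?thesis using x by (simp add: filt_def)
  next
    case False
    then show ?thesis using component_piece[OF filt_carrier[OF x], of j] piece_above[of j] k by simp
  qed
qed (auto intro: filt_carrier)

lemma H_filt_above: "x \<in> H.filt k ==> k > n ==> x = \<zero>\<^sub>H"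
proof (rule H.component_eqI)
  fix j assume x: "x \<in> H.filt k" and k: "k > n"
  show "component H j x = component H j \<zero>\<^sub>H"
  proof (cases "j < k")
    case True then show ?thesis using x by (simp add: H.filt_def)
  next
    case False
    then show ?thesis
      using H.component_piece[OF H.filt_carrier[OF x], of j] H_piece_above[of j] k by simp
  qed
qed (auto intro: H.filt_carrier)

lemma I_closed: "x \<in> piece H n ==> I x \<in> carrier K"
  and I_add: "[|x \<in> piece H n; y \<in> piece H n|] ==> I (x \<oplus>\<^sub>H y) = I x \<oplus>\<^sub>K I y"
  and I_smult: "[|a \<in> carrier K; x \<in> piece H n|] ==> I (a \<odot>\<^sub>H x) = a \<otimes>\<^sub>K I x"
  using poincare by (auto simp: poincare_dgca_def poincare_algebra_def)

text \<open>The integral, extended by zero to the other degrees. The pairing then is the integral of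
  the product (\<open>pairing_JH\<close>, \<open>induced_pairing_J\<close>), and sums over degrees
  disappear.\<close>

definition JH :: "'a set => 'k" where "JH x = I (component H n x)"
definition J :: "'a => 'k" where "J x = I (cls A (component A n x))"

lemma JH_closed [simp]: "x \<in> CH ==> JH x \<in> carrier K"
  by (simp add: JH_def I_closed H.component_piece)

lemma JH_add: "[|x \<in> CH; y \<in> CH|] ==> JH (x \<oplus>\<^sub>H y) = JH x \<oplus>\<^sub>K JH y"
  by (simp add: JH_def I_add H.component_piece H.component_add)

lemma JH_smult: "[|a \<in> carrier K; x \<in> CH|] ==> JH (a \<odot>\<^sub>H x) = a \<otimes>\<^sub>K JH x"
  by (simp add: JH_def I_smult H.component_piece H.component_smult)

lemma top_cocycle: "x \<in> piece A n ==> x \<in> cocycles A"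
  using diff_piece[of x n] piece_above[of "Suc n"] by (simp add: cocycles_iff piece_carrier)

lemma J_closed [simp]: "x \<in> carrier A ==> J x \<in> carrier K"
  by (simp add: J_def I_closed rho_piece top_cocycle component_piece)

lemma J_add: "[|x \<in> carrier A; y \<in> carrier A|] ==> J (x \<oplus> y) = J x \<oplus>\<^sub>K J y"
  by (simp add: J_def component_add rho_add top_cocycle component_piece I_add rho_piece)

lemma J_smult: "[|a \<in> carrier K; x \<in> carrier A|] ==> J (a \<odot> x) = a \<otimes>\<^sub>K J x"
  by (simp add: J_def component_smult rho_smult top_cocycle component_piece I_smult rho_piece)

lemma J_zero [simp]: "J \<zero> = \<zero>\<^sub>K" using J_smult[of "\<zero>\<^sub>K" \<zero>] by simp

lemma JH_zero [simp]: "JH \<zero>\<^sub>H = \<zero>\<^sub>K" using JH_smult[of "\<zero>\<^sub>K" "\<zero>\<^sub>H"] by simp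

lemma J_neg: "x \<in> carrier A ==> J (\<ominus> x) = \<ominus>\<^sub>K J x"
  using J_smult[of "\<ominus>\<^sub>K \<one>\<^sub>K" x] smult_l_minus[OF K.one_closed, of x] by (simp add: K.l_minus)

lemma JH_neg: "x \<in> CH ==> JH (\<ominus>\<^sub>H x) = \<ominus>\<^sub>K JH x"
  using JH_smult[of "\<ominus>\<^sub>K \<one>\<^sub>K" x] H.smult_l_minus[OF K.one_closed, of x] by (simp add: K.l_minus)

lemma J_minus: "[|x \<in> carrier A; y \<in> carrier A|] ==> J (x \<ominus> y) = J x \<ominus>\<^sub>K J y"
  by (simp add: a_minus_def J_add J_neg)

lemma J_component: "x \<in> carrier A ==> J (component A n x) = J x"
  by (simp add: J_def component_component)

lemma J_piece: "[|x \<in> piece A k; k \<noteq> n|] ==> J x = \<zero>\<^sub>K"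
  using J_component[of x] component_of_piece[of x k n] by (simp add: piece_carrier)

lemma J_boundary: "x \<in> boundaries A ==> J x = \<zero>\<^sub>K"
proof -
  assume x: "x \<in> boundaries A"
  have "cls A (component A n x) = cls A \<zero>"
    using boundaries_component[OF x, of n] by (simp add: cohomology_zero)
  then show ?thesis using J_zero by (simp add: J_def)
qed

lemma J_cocycle: "x \<in> cocycles A ==> J x = JH (cls A x)" by (simp add: J_def JH_def rho_component)

lemma induced_pairing_J:
  "[|x \<in> carrier A; y \<in> carrier A|] ==> induced_pairing K A n I x y = J (x \<otimes> y)"
  unfolding induced_pairing_def J_def by (subst pairing_eq)
    (auto simp: I_closed rho_piece top_cocycle rho_add I_add)

lemma pairing_JH: "[|x \<in> CH; y \<in> CH|] ==> pairing K H n I x y = JH (x \<otimes>\<^sub>H y)"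
  unfolding JH_def by (rule H.pairing_eq) (auto simp: I_closed I_add)

lemma JH_nondegenerate:
  "x \<in> CH ==> (!!y. y \<in> CH ==> JH (x \<otimes>\<^sub>H y) = \<zero>\<^sub>K) ==> x = \<zero>\<^sub>H"
  "y \<in> CH ==> (!!x. x \<in> CH ==> JH (x \<otimes>\<^sub>H y) = \<zero>\<^sub>K) ==> y = \<zero>\<^sub>H"
  using poincare by (auto simp: poincare_dgca_def poincare_algebra_def pairing_JH)

lemma H_finite_dimensional: "finite_dimensional K H"
  using poincare by (simp add: poincare_dgca_def poincare_algebra_def)

lemma dual_left:
  assumes "!!x. x \<in> CH ==> l x \<in> carrier K"
    "!!x y. [|x \<in> CH; y \<in> CH|] ==> l (x \<oplus>\<^sub>H y) = l x \<oplus>\<^sub>K l y"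
    "!!a x. [|a \<in> carrier K; x \<in> CH|] ==> l (a \<odot>\<^sub>H x) = a \<otimes>\<^sub>K l x"
  shows "\<exists>!v. v \<in> CH \<and> (\<forall>x\<in>carrier H. JH (v \<otimes>\<^sub>H x) = l x)"
proof -
  interpret bilinear_form K H "\<lambda>v x. JH (v \<otimes>\<^sub>H x)"
    by unfold_locales (auto simp: H.A.l_distr H.A.r_distr JH_add H.smult_mult_left H.smult_mult_right JH_smult)
  show ?thesis by (rule functional_representable) (use assms H_finite_dimensional JH_nondegenerate in auto)
qed

lemma dual_right:
  assumes "!!x. x \<in> CH ==> l x \<in> carrier K"
    "!!x y. [|x \<in> CH; y \<in> CH|] ==> l (x \<oplus>\<^sub>H y) = l x \<oplus>\<^sub>K l y"
    "!!a x. [|a \<in> carrier K; x \<in> CH|] ==> l (a \<odot>\<^sub>H x) = a \<otimes>\<^sub>K l x"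
  shows "\<exists>!v. v \<in> CH \<and> (\<forall>x\<in>carrier H. JH (x \<otimes>\<^sub>H v) = l x)"
proof -
  interpret bilinear_form K H "\<lambda>v x. JH (x \<otimes>\<^sub>H v)"
    by unfold_locales (auto simp: H.A.l_distr H.A.r_distr JH_add H.smult_mult_left H.smult_mult_right JH_smult)
  show ?thesis by (rule functional_representable) (use assms H_finite_dimensional JH_nondegenerate in auto)
qed

lemma J_component_right:
  assumes "x \<in> carrier A" "y \<in> carrier A" "k \<le> n"
  shows "J (x \<otimes> component A k y) = J (component A (n - k) x \<otimes> y)" using assms(1)
proof (induct rule: graded_induct)
  case (piece i x)
  note xc = piece_carrier[OF piece]
  from assms(2) show ?case
  proof (induct rule: graded_induct)
    case (piece j y)
    note yc = piece_carrier[OF piece]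
    note cx = component_of_piece[OF \<open>x \<in> piece A i\<close>, of "n - k"] and cy = component_of_piece[OF piece, of k]
    have "J (x \<otimes> y) = \<zero>\<^sub>K" if "i + j \<noteq> n"
      using J_piece[OF mult_piece[OF \<open>x \<in> piece A i\<close> piece] that] .
    then show ?case using cx cy xc yc assms(3) by auto
  next
    case (add y z)
    then show ?case using xc by (simp add: component_add A.r_distr J_add)
  qed
next
  case (add x z)
  then show ?case using assms(2) by (simp add: component_add A.l_distr J_add)
qed

text \<open>For homogeneous \<open>u\<close> graded commutativity expresses
  \<open>J (b \<otimes> u)\<close> through the product of \<open>u\<close> with one component of
  \<open>b\<close>, and \<open>J_component_right\<close> removes the component. The sign depends on
  the degree of \<open>u\<close>, so the argument passes through the components of \<open>x\<close>,
  which lie in \<open>S\<close> because \<open>S\<close> is graded.\<close>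

lemma J_orthogonal_swap:
  assumes S: "graded_subspace K A S" and b: "b \<in> carrier A"
    and z: "!!y. y \<in> S ==> J (y \<otimes> b) = \<zero>\<^sub>K" and x: "x \<in> S"
  shows "J (b \<otimes> x) = \<zero>\<^sub>K"
proof -
  note Sd = graded_subspaceD[OF S]
  have hom: "J (b \<otimes> u) = \<zero>\<^sub>K" if u: "u \<in> S" "u \<in> piece A j" for u j
  proof -
    have uc: "u \<in> carrier A" using u piece_carrier by blast
    have cJ: "J (c \<otimes> u) = (if j \<le> n then J (ksign A ((n - j) * j) (u \<otimes> component A (n - j) c)) else \<zero>\<^sub>K)"
      if "c \<in> carrier A" for c using that
    proof (induct rule: graded_induct)
      case (piece k c)
      note ck = piece_carrier[OF piece] and m = mult_piece[OF piece u(2)]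
      show ?case
      proof (cases "k + j = n")
        case True
        then have "component A (n - j) c = c" using piece by auto
        then show ?thesis using graded_comm[OF piece u(2)] True by auto
      next
        case False
        then have "j \<le> n ==> component A (n - j) c = \<zero>"
          using component_of_piece[OF piece, of "n - j"] by (auto split: if_splits)
        then show ?thesis using J_piece[OF m False] uc by (auto simp: ksign_def)
      qed
    next
      case (add c c')
      then show ?case using uc by (auto simp: A.l_distr J_add component_add A.r_distr ksign_add)
    qed
    have "J (u \<otimes> component A (n - j) b) = \<zero>\<^sub>K" if j: "j \<le> n"
      using J_component_right[OF uc b, of "n - j"] j u(2) z[OF u(1)] by simp
    then show ?thesis using cJ[OF b] uc b by (auto simp: ksign_def J_neg)
  qed
  have xc: "x \<in> carrier A" using x Sd(1) by blast
  have c: "J (b \<otimes> component A k x) = \<zero>\<^sub>K" for k using hom[OF Sd(7)[OF x] component_piece[OF xc]] .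
  have "J (b \<otimes> (\<Oplus>k\<in>T. component A k x)) = \<zero>\<^sub>K" if "finite T" for T
    using that by (induct T rule: finite_induct) (use c xc b in \<open>auto simp: A.r_distr J_add\<close>)
  then show ?thesis
    using sum_components[OF xc finite_support[OF xc] order_refl] finite_support[OF xc] by metis
qed

end

section \<open>Hodge decompositions\<close>

locale hodge = poincare K A n I + splitting K A Hs Bs
  for K :: "('k, 'l) ring_scheme" and A :: "('k, 'a, 'm) dga_scheme" (structure)
    and n I Hs Bs +
  assumes J_Hs_Bs: "[|x \<in> Hs; y \<in> Bs|] ==> J (x \<otimes> y) = \<zero>\<^sub>K"
    and J_Bs_Bs: "[|x \<in> Bs; y \<in> Bs|] ==> J (x \<otimes> y) = \<zero>\<^sub>K"

sublocale hodge \<subseteq> split_ident K A "cohomology A" "cls A" Hs Bs ..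

lemma (in hodge) J_Bs_Hs: "[|x \<in> Bs; y \<in> Hs|] ==> J (x \<otimes> y) = \<zero>\<^sub>K"
  by (rule J_orthogonal_swap[OF H_graded]) (auto simp: J_Hs_Bs)

lemma (in poincare) hodge_decomposition_iff:
  "hodge_decomposition K A n I Hs Bs \<longleftrightarrow> hodge K A n I Hs Bs"
proof
  assume h: "hodge_decomposition K A n I Hs Bs"
  then have S: "splitting K A Hs Bs"
    using dg_axioms by (simp add: hodge_decomposition_def splitting_def splitting_axioms_def)
  interpret S: splitting K A Hs Bs by (rule S)
  have "J (x \<otimes> y) = \<zero>\<^sub>K" if "x \<in> Hs <+>\<^bsub>A\<^esub> Bs" "y \<in> Bs" for x y
  proof -
    have c: "x \<in> carrier A" "y \<in> carrier A" using that by (auto simp: mem_set_add)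
    have "induced_pairing K A n I x y = \<zero>\<^sub>K" using h that unfolding hodge_decomposition_def by blast
    then show ?thesis by (simp only: induced_pairing_J[OF c])
  qed
  then have "hodge_axioms K A n I Hs Bs"
    using set_add_ge[OF S.H_graded S.B_graded] by (auto simp: hodge_axioms_def)
  then show "hodge K A n I Hs Bs" using S poincare_axioms by (simp add: hodge_def)
next
  assume h: "hodge K A n I Hs Bs"
  interpret S: hodge K A n I Hs Bs by (rule h)
  have "induced_pairing K A n I x y = \<zero>\<^sub>K" if x: "x \<in> Hs <+>\<^bsub>A\<^esub> Bs" and y: "y \<in> Bs" for x y
  proof -
    obtain u v where "u \<in> Hs" "v \<in> Bs" "x = u \<oplus> v" using x unfolding mem_set_add by blast
    then show ?thesis using y by (simp add: induced_pairing_J A.l_distr J_add S.J_Hs_Bs S.J_Bs_Bs)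
  qed
  then show "hodge_decomposition K A n I Hs Bs"
    using S.harmonic S.B_graded S.unique_parts by (simp add: hodge_decomposition_def)
qed

section \<open>Constructions of differential graded algebras\<close>

text \<open>Additive projections \<open>pr k\<close> with finite support that separate points yield
  existence and uniqueness of the decomposition at once. The constructions below therefore only have
  to name their projections.\<close>

lemma gcaI:
  fixes K :: "('k, 'l) ring_scheme" and A :: "('k, 'a, 'm) dga_scheme" (structure)
  assumes ax: "field K" "ring A" "module K A"
    "!!a x y. [|a \<in> carrier K; x \<in> carrier A; y \<in> carrier A|] ==> (a \<odot> x) \<otimes> y = a \<odot> (x \<otimes> y)"
    "!!a x y. [|a \<in> carrier K; x \<in> carrier A; y \<in> carrier A|] ==> x \<otimes> (a \<odot> y) = a \<odot> (x \<otimes> y)"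
    "!!k. submodule (piece A k) K A" "\<one> \<in> piece A 0"
    "!!i j x y. [|x \<in> piece A i; y \<in> piece A j|] ==> x \<otimes> y \<in> piece A (i + j)"
    "!!i j x y. [|x \<in> piece A i; y \<in> piece A j|] ==> x \<otimes> y = ksign A (i * j) (y \<otimes> x)"
    and pr: "!!k x. x \<in> carrier A ==> pr k x \<in> piece A k"
    "!!k x y. [|x \<in> carrier A; y \<in> carrier A|] ==> pr k (x \<oplus> y) = pr k x \<oplus> pr k y"
    "!!k j x. x \<in> piece A j ==> pr k x = (if k = j then x else \<zero>)"
    "!!x. x \<in> carrier A ==> finite {k. pr k x \<noteq> \<zero>}"
    "!!x y. [|x \<in> carrier A; y \<in> carrier A; !!k. pr k x = pr k y|] ==> x = y"
  shows "gca K A"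
proof -
  interpret A: ring A by (rule ax(2))
  interpret M: module K A by (rule ax(3))
  have pc: "x \<in> carrier A" if "x \<in> piece A k" for x k
    using M.submoduleE(1)[OF ax(6)[of k]] that by blast
  have z: "\<zero> \<in> piece A k" for k
    using pr(1)[OF A.zero_closed, of k] pr(2)[OF A.zero_closed A.zero_closed, of k]
      pc[of "pr k \<zero>" k] A.add.r_cancel_one'[of "pr k \<zero>" "pr k \<zero>"] by simp
  have pr0: "pr k \<zero> = \<zero>" for k using pr(3)[OF z[of k], of k] by simp
  have prsum: "pr k (\<Oplus>i\<in>T. c i) = (\<Oplus>i\<in>T. pr k (c i))"
    if "finite T" "c \<in> T \<rightarrow> carrier A" for T c k using that
  proof (induct T rule: finite_induct)
    case (insert i T)
    then have f: "c \<in> T \<rightarrow> carrier A" "c i \<in> carrier A" by auto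
    have g: "(\<lambda>i. pr k (c i)) \<in> T \<rightarrow> carrier A" "pr k (c i) \<in> carrier A" using f pc[OF pr(1)] by auto
    show ?case using insert(1-3) f g by (simp add: pr(2))
  qed (simp add: pr0)
  have single: "(\<Oplus>i\<in>T. pr k (c i)) = (if k \<in> T then c k else \<zero>)"
    if T: "finite T" and c: "!!i. c i \<in> piece A i" for T c k
  proof -
    have ck: "c k \<in> carrier A" using pc[OF c] .
    have "(\<Oplus>i\<in>T. pr k (c i)) = (\<Oplus>i\<in>T. if k = i then c i else \<zero>)"
      using pr(3)[OF c] pc[OF c] by (intro A.finsum_cong') auto
    also have "\<dots> = (if k \<in> T then c k else \<zero>)"
    proof (cases "k \<in> T")
      case True
      then show ?thesis using A.finsum_singleton[OF True T, of c] pc[OF c] by simp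
    next
      case False
      have "(\<Oplus>i\<in>T. if k = i then c i else \<zero>) = (\<Oplus>i\<in>T. \<zero>)" using False by (intro A.finsum_cong') auto
      then show ?thesis using False by simp
    qed
    finally show ?thesis .
  qed
  have ud: "\<exists>!c. is_decomposition A x c" if x: "x \<in> carrier A" for x
  proof (rule ex1I[of _ "\<lambda>k. pr k x"])
    let ?S = "{k. pr k x \<noteq> \<zero>}"
    note fin = pr(4)[OF x]
    have f: "(\<lambda>k. pr k x) \<in> ?S \<rightarrow> carrier A" using pc[OF pr(1)[OF x]] by auto
    have "x = (\<Oplus>k\<in>?S. pr k x)"
    proof (rule pr(5)[OF x])
      show "(\<Oplus>k\<in>?S. pr k x) \<in> carrier A" using f by (rule A.finsum_closed)
      show "pr k x = pr k (\<Oplus>k\<in>?S. pr k x)" for k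
        using prsum[OF fin f, of k] single[OF fin pr(1)[OF x], of k] by auto
    qed
    then show "is_decomposition A x (\<lambda>k. pr k x)"
      using pr(1)[OF x] fin by (simp add: is_decomposition_def)
    fix c assume c: "is_decomposition A x c"
    then have c': "!!k. c k \<in> piece A k" "finite {k. c k \<noteq> \<zero>}" "x = (\<Oplus>k\<in>{k. c k \<noteq> \<zero>}. c k)"
      by (auto simp: is_decomposition_def)
    have f': "c \<in> {k. c k \<noteq> \<zero>} \<rightarrow> carrier A" using pc[OF c'(1)] by auto
    show "c = (\<lambda>k. pr k x)"
    proof
      fix k
      have "pr k x = pr k (\<Oplus>k\<in>{k. c k \<noteq> \<zero>}. c k)" using c'(3) by (rule arg_cong)
      also have "\<dots> = c k" using prsum[OF c'(2) f', of k] single[OF c'(2) c'(1), of k] by auto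
      finally show "c k = pr k x" by simp
    qed
  qed
  have "graded_comm_algebra_axioms K A" by (rule graded_comm_algebra_axioms.intro) (fact ax ud)+
  then show ?thesis using ax(1-3) by (intro gca.intro graded_comm_algebra.intro)
qed

lemma dgI:
  fixes K :: "('k, 'l) ring_scheme" and A :: "('k, 'a, 'm) dga_scheme" (structure)
  assumes "gca K A"
    "!!x y. [|x \<in> carrier A; y \<in> carrier A|] ==> diff A (x \<oplus> y) = diff A x \<oplus> diff A y"
    "!!a x. [|a \<in> carrier K; x \<in> carrier A|] ==> diff A (a \<odot> x) = a \<odot> diff A x"
    "!!k x. x \<in> piece A k ==> diff A x \<in> piece A (Suc k)"
    "!!x. x \<in> carrier A ==> diff A (diff A x) = \<zero>"
    "!!k x y. [|x \<in> piece A k; y \<in> carrier A|]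
      ==> diff A (x \<otimes> y) = (diff A x \<otimes> y) \<oplus> ksign A k (x \<otimes> diff A y)"
  shows "dg K A" using assms by (auto simp: dg_def dgca_def dgca_axioms_def gca_def)

lemma (in dg) cohomology_dg: "gca K (cohomology A) ==> dg K (cohomology A)"
proof (rule dgI)
  assume "gca K (cohomology A)"
  then interpret H: gca K "cohomology A" .
  show "!!k x. x \<in> piece (cohomology A) k ==> diff (cohomology A) x \<in> piece (cohomology A) (Suc k)"
    by (simp add: cohomology_diff H.piece_zero)
  show "!!k x y. [|x \<in> piece (cohomology A) k; y \<in> carrier (cohomology A)|]
      ==> diff (cohomology A) (x \<otimes>\<^bsub>cohomology A\<^esub> y) = (diff (cohomology A) x \<otimes>\<^bsub>cohomology A\<^esub> y)
        \<oplus>\<^bsub>cohomology A\<^esub> ksign (cohomology A) k (x \<otimes>\<^bsub>cohomology A\<^esub> diff (cohomology A) y)"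
    by (simp add: cohomology_diff H.piece_carrier ksign_def)
  show "!!a x. [|a \<in> carrier K; x \<in> carrier (cohomology A)|]
      ==> diff (cohomology A) (a \<odot>\<^bsub>cohomology A\<^esub> x) = a \<odot>\<^bsub>cohomology A\<^esub> diff (cohomology A) x"
    by (simp add: cohomology_diff)
  show "!!x y. [|x \<in> carrier (cohomology A); y \<in> carrier (cohomology A)|]
      ==> diff (cohomology A) (x \<oplus>\<^bsub>cohomology A\<^esub> y)
        = diff (cohomology A) x \<oplus>\<^bsub>cohomology A\<^esub> diff (cohomology A) y"
    by (simp add: cohomology_diff)
qed (simp_all add: cohomology_diff)

lemma ringI':
  fixes R :: "('a, 'm) ring_scheme" (structure)
  assumes "!!x y. [|x \<in> carrier R; y \<in> carrier R|] ==> x \<oplus> y \<in> carrier R" "\<zero> \<in> carrier R"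
    "!!x y z. [|x \<in> carrier R; y \<in> carrier R; z \<in> carrier R|] ==> (x \<oplus> y) \<oplus> z = x \<oplus> (y \<oplus> z)"
    "!!x y. [|x \<in> carrier R; y \<in> carrier R|] ==> x \<oplus> y = y \<oplus> x"
    "!!x. x \<in> carrier R ==> \<zero> \<oplus> x = x"
    "!!x. x \<in> carrier R ==> \<exists>y\<in>carrier R. y \<oplus> x = \<zero>"
    "!!x y. [|x \<in> carrier R; y \<in> carrier R|] ==> x \<otimes> y \<in> carrier R" "\<one> \<in> carrier R"
    "!!x y z. [|x \<in> carrier R; y \<in> carrier R; z \<in> carrier R|] ==> (x \<otimes> y) \<otimes> z = x \<otimes> (y \<otimes> z)"
    "!!x. x \<in> carrier R ==> \<one> \<otimes> x = x" "!!x. x \<in> carrier R ==> x \<otimes> \<one> = x"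
    "!!x y z. [|x \<in> carrier R; y \<in> carrier R; z \<in> carrier R|] ==> (x \<oplus> y) \<otimes> z = x \<otimes> z \<oplus> y \<otimes> z"
    "!!x y z. [|x \<in> carrier R; y \<in> carrier R; z \<in> carrier R|] ==> z \<otimes> (x \<oplus> y) = z \<otimes> x \<oplus> z \<otimes> y"
  shows "ring R"
proof (rule ringI)
  show "abelian_group R" by (rule abelian_groupI) (use assms in auto)
  show "monoid R" by (rule monoidI) (use assms in auto)
qed (use assms in auto)

section \<open>Subalgebras of a product\<close>

text \<open>
  Subalgebras of the product of \<open>A\<close> and \<open>H\<close>, where \<open>H\<close> has zero differential.
\<close>

definition pair_dga ::
    "('k, 'a, 'm) dga_scheme => ('k, 'h, 'n) dga_scheme => ('a \<times> 'h) set => ('k, 'a \<times> 'h) dga" where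
  "pair_dga A H S = \<lparr>carrier = S,
     monoid.mult = (\<lambda>(q, h) (q', h'). (q \<otimes>\<^bsub>A\<^esub> q', h \<otimes>\<^bsub>H\<^esub> h')), monoid.one = (\<one>\<^bsub>A\<^esub>, \<one>\<^bsub>H\<^esub>),
     ring.zero = (\<zero>\<^bsub>A\<^esub>, \<zero>\<^bsub>H\<^esub>), ring.add = (\<lambda>(q, h) (q', h'). (q \<oplus>\<^bsub>A\<^esub> q', h \<oplus>\<^bsub>H\<^esub> h')),
     smult = (\<lambda>a (q, h). (a \<odot>\<^bsub>A\<^esub> q, a \<odot>\<^bsub>H\<^esub> h)),
     piece = (\<lambda>k. S \<inter> piece A k \<times> piece H k), diff = (\<lambda>(q, h). (diff A q, \<zero>\<^bsub>H\<^esub>))\<rparr>"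

locale subpair = A: dg K A + H: gca K H
  for K :: "('k, 'l) ring_scheme" and A :: "('k, 'a, 'm) dga_scheme"
    and H :: "('k, 'h, 'n) dga_scheme" +
  fixes S :: "('a \<times> 'h) set"
  assumes S_carrier: "(q, h) \<in> S ==> q \<in> carrier A \<and> h \<in> carrier H"
    and S_one: "(\<one>\<^bsub>A\<^esub>, \<one>\<^bsub>H\<^esub>) \<in> S"
    and S_add: "[|(q, h) \<in> S; (q', h') \<in> S|] ==> (q \<oplus>\<^bsub>A\<^esub> q', h \<oplus>\<^bsub>H\<^esub> h') \<in> S"
    and S_smult: "[|a \<in> carrier K; (q, h) \<in> S|] ==> (a \<odot>\<^bsub>A\<^esub> q, a \<odot>\<^bsub>H\<^esub> h) \<in> S"
    and S_mult: "[|(q, h) \<in> S; (q', h') \<in> S|] ==> (q \<otimes>\<^bsub>A\<^esub> q', h \<otimes>\<^bsub>H\<^esub> h') \<in> S"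
    and S_component: "(q, h) \<in> S ==> (component A k q, component H k h) \<in> S"
    and S_diff: "(q, h) \<in> S ==> (diff A q, \<zero>\<^bsub>H\<^esub>) \<in> S"
begin

abbreviation N where "N \<equiv> pair_dga A H S"

lemma S_closed [simp]: "(q, h) \<in> S ==> q \<in> carrier A" "(q, h) \<in> S ==> h \<in> carrier H"
  using S_carrier by blast+

lemma S_zero: "(\<zero>\<^bsub>A\<^esub>, \<zero>\<^bsub>H\<^esub>) \<in> S" using S_smult[OF A.K.zero_closed S_one] by simp

lemma S_neg: "(q, h) \<in> S ==> (\<ominus>\<^bsub>A\<^esub> q, \<ominus>\<^bsub>H\<^esub> h) \<in> S"
  using S_smult[of "\<ominus>\<^bsub>K\<^esub> \<one>\<^bsub>K\<^esub>" q h] S_carrier[of q h] by (simp add: A.smult_l_minus H.smult_l_minus)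

lemma pair_simps [simp]:
  "carrier N = S" "(q, h) \<otimes>\<^bsub>N\<^esub> (q', h') = (q \<otimes>\<^bsub>A\<^esub> q', h \<otimes>\<^bsub>H\<^esub> h')" "\<one>\<^bsub>N\<^esub> = (\<one>\<^bsub>A\<^esub>, \<one>\<^bsub>H\<^esub>)"
  "\<zero>\<^bsub>N\<^esub> = (\<zero>\<^bsub>A\<^esub>, \<zero>\<^bsub>H\<^esub>)" "(q, h) \<oplus>\<^bsub>N\<^esub> (q', h') = (q \<oplus>\<^bsub>A\<^esub> q', h \<oplus>\<^bsub>H\<^esub> h')"
  "a \<odot>\<^bsub>N\<^esub> (q, h) = (a \<odot>\<^bsub>A\<^esub> q, a \<odot>\<^bsub>H\<^esub> h)"
  "(q, h) \<in> piece N k \<longleftrightarrow> (q, h) \<in> S \<and> q \<in> piece A k \<and> h \<in> piece H k"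
  "diff N (q, h) = (diff A q, \<zero>\<^bsub>H\<^esub>)" by (auto simp: pair_dga_def)

lemma pair_ring: "ring N"
proof (rule ringI')
  show "\<exists>y\<in>carrier N. y \<oplus>\<^bsub>N\<^esub> x = \<zero>\<^bsub>N\<^esub>" if "x \<in> carrier N" for x
  proof (cases x)
    case (Pair q h)
    then have "(q, h) \<in> S" using that by simp
    then show ?thesis using S_neg[of q h] S_carrier[of q h] Pair
      by (intro bexI[of _ "(\<ominus>\<^bsub>A\<^esub> q, \<ominus>\<^bsub>H\<^esub> h)"]) (simp_all add: A.A.l_neg H.A.l_neg)
  qed
qed (auto intro: S_add S_mult S_one S_zero
    simp: A.A.a_ac H.A.a_ac A.A.m_assoc H.A.m_assoc A.A.l_distr A.A.r_distr H.A.l_distr H.A.r_distr)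

lemma pair_module: "module K N"
proof (rule moduleI)
  show "cring K" ..
  show "abelian_group N" using pair_ring by (simp add: ring_def)
qed (auto intro: S_smult simp: A.smult_l_distr H.smult_l_distr A.smult_r_distr
    H.smult_r_distr A.smult_assoc1 H.smult_assoc1)

lemma pair_neg: "(q, h) \<in> S ==> \<ominus>\<^bsub>N\<^esub> (q, h) = (\<ominus>\<^bsub>A\<^esub> q, \<ominus>\<^bsub>H\<^esub> h)"
proof -
  interpret N: ring N by (rule pair_ring)
  assume "(q, h) \<in> S"
  then show ?thesis using S_neg[of q h] S_carrier[of q h]
    by (intro N.minus_equality) (simp_all add: A.A.l_neg H.A.l_neg)
qed

lemma pair_ksign: "(q, h) \<in> S ==> ksign N k (q, h) = (ksign A k q, ksign H k h)"
  by (simp add: ksign_def pair_neg)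

lemma pair_gca: "gca K N"
proof -
  interpret M: module K N by (rule pair_module)
  let ?pr = "\<lambda>k (q, h). (component A k q, component H k h)"
  have sub: "submodule (piece N k) K N" for k
  proof (rule M.submoduleI)
    show "!!a. a \<in> piece N k ==> \<ominus>\<^bsub>N\<^esub> a \<in> piece N k"
      by (auto simp: pair_neg S_neg A.piece_neg H.piece_neg)
  qed (auto simp: S_zero A.piece_zero H.piece_zero S_add A.piece_add H.piece_add S_smult
      A.piece_smult H.piece_smult)
  show ?thesis
  proof (rule gcaI[where pr = ?pr])
    show "field K" ..
    show "finite {k. ?pr k x \<noteq> \<zero>\<^bsub>N\<^esub>}" if "x \<in> carrier N" for x
    proof (cases x)
      case (Pair q h)
      then have c: "q \<in> carrier A" "h \<in> carrier H" using that S_carrier by auto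
      have "{k. ?pr k x \<noteq> \<zero>\<^bsub>N\<^esub>} \<subseteq> {k. component A k q \<noteq> \<zero>\<^bsub>A\<^esub>} \<union> {k. component H k h \<noteq> \<zero>\<^bsub>H\<^esub>}"
        using Pair by auto
      then show ?thesis
        using A.finite_support[OF c(1)] H.finite_support[OF c(2)] finite_subset by blast
    qed
    show "x = y" if "x \<in> carrier N" "y \<in> carrier N" and eq: "!!k. ?pr k x = ?pr k y" for x y
    proof -
      obtain q h q' h' where xy: "x = (q, h)" "y = (q', h')" by (metis surj_pair)
      have "component A k q = component A k q'" "component H k h = component H k h'" for k
        using eq[of k] xy by auto
      then show ?thesis
        using A.component_eqI[of q q'] H.component_eqI[of h h'] S_carrier[of q h] S_carrier[of q' h']
          that xy by auto
    qed
    show "x \<otimes>\<^bsub>N\<^esub> y = ksign N (i * j) (y \<otimes>\<^bsub>N\<^esub> x)" if "x \<in> piece N i" "y \<in> piece N j" for x y i j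
    proof -
      obtain q h q' h' where xy: "x = (q, h)" "y = (q', h')" by (metis surj_pair)
      then have m: "(q' \<otimes>\<^bsub>A\<^esub> q, h' \<otimes>\<^bsub>H\<^esub> h) \<in> S" using that S_mult by auto
      show ?thesis using that xy A.graded_comm[of q i q' j] H.graded_comm[of h i h' j]
        by (simp add: pair_ksign[OF m])
    qed
  qed (use pair_ring pair_module sub in \<open>auto simp: S_one A.one_piece H.one_piece
      S_mult A.mult_piece H.mult_piece A.smult_mult_left H.smult_mult_left A.smult_mult_right
      H.smult_mult_right S_component A.component_piece H.component_piece A.component_add
      H.component_add A.component_of_piece H.component_of_piece\<close>)
qed

lemma pair_dg: "dg K N"
proof (rule dgI[OF pair_gca])
  show "diff N (x \<otimes>\<^bsub>N\<^esub> y) = (diff N x \<otimes>\<^bsub>N\<^esub> y) \<oplus>\<^bsub>N\<^esub> ksign N k (x \<otimes>\<^bsub>N\<^esub> diff N y)"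
    if "x \<in> piece N k" "y \<in> carrier N" for k x y
  proof -
    obtain q h q' h' where xy: "x = (q, h)" "y = (q', h')" by (metis surj_pair)
    then have m: "(q \<otimes>\<^bsub>A\<^esub> diff A q', h \<otimes>\<^bsub>H\<^esub> \<zero>\<^bsub>H\<^esub>) \<in> S" using that S_mult S_diff by auto
    show ?thesis using that xy A.leibniz[of q k q'] S_carrier[of q' h'] S_carrier[of q h]
      pair_ksign[OF m, of k] by (simp add: ksign_def split: if_splits)
  qed
qed (auto simp: A.diff_add A.diff_smult A.diff_piece A.diff_diff S_diff H.piece_zero)

end

section \<open>Extension by a shifted ideal\<close>

text \<open>
  The extension of \<open>N\<close> by a shifted copy of an ideal \<open>L\<close> of \<open>H\<close>, twisted by the bilinear map \<open>c\<close>.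
  It is the mapping path object of an $A_\infty$ morphism with linear part \<open>\<delta>\<close>.
\<close>

definition cylinder ::
    "('k, 'a, 'm) dga_scheme => ('k, 'h, 'n) dga_scheme => 'h set => ('a => 'h) => ('a => 'h) =>
     ('a => 'a => 'h) => ('k, 'a \<times> 'h) dga" where
  "cylinder N H L \<kappa> \<delta> c = \<lparr>carrier = carrier N \<times> L,
     monoid.mult = (\<lambda>(m, z) (m', z'). (m \<otimes>\<^bsub>N\<^esub> m',
        z \<otimes>\<^bsub>H\<^esub> \<kappa> m' \<oplus>\<^bsub>H\<^esub> parity H (\<kappa> m) \<otimes>\<^bsub>H\<^esub> z' \<oplus>\<^bsub>H\<^esub> c m m')),
     monoid.one = (\<one>\<^bsub>N\<^esub>, \<zero>\<^bsub>H\<^esub>), ring.zero = (\<zero>\<^bsub>N\<^esub>, \<zero>\<^bsub>H\<^esub>),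
     ring.add = (\<lambda>(m, z) (m', z'). (m \<oplus>\<^bsub>N\<^esub> m', z \<oplus>\<^bsub>H\<^esub> z')),
     smult = (\<lambda>a (m, z). (a \<odot>\<^bsub>N\<^esub> m, a \<odot>\<^bsub>H\<^esub> z)),
     piece = (\<lambda>k. piece N k \<times> (L \<inter> piece_pred H k)), diff = (\<lambda>(m, z). (diff N m, \<delta> m))\<rparr>"

text \<open>\<open>lambda_mult\<close> and \<open>c_assoc\<close> are the A-infinity relations for
  two and three arguments; they become the Leibniz rule and associativity. Multiplicativity of
  \<open>\<kappa>\<close> is asked for only next to a factor in \<open>L\<close>, because in the
  application \<open>\<kappa>\<close> is an average of two maps and no morphism. Graded
  commutativity comes from \<open>c_comm\<close> and from using the same \<open>\<kappa>\<close> on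
  both sides.\<close>

locale cylinder_data = N: dg K N + H: gca K H
  for K :: "('k, 'l) ring_scheme" and N :: "('k, 'a, 'm) dga_scheme"
    and H :: "('k, 'h, 'n) dga_scheme" (structure) +
  fixes L :: "'h set" and \<kappa> \<delta> :: "'a => 'h" and c :: "'a => 'a => 'h"
  assumes L_graded: "graded_subspace K H L"
    and L_mult: "[|z \<in> L; u \<in> carrier H|] ==> z \<otimes> u \<in> L" "[|z \<in> L; u \<in> carrier H|] ==> u \<otimes> z \<in> L"
    and kappa_closed [simp]: "m \<in> carrier N ==> \<kappa> m \<in> carrier H"
    and kappa_add: "[|m \<in> carrier N; m' \<in> carrier N|] ==> \<kappa> (m \<oplus>\<^bsub>N\<^esub> m') = \<kappa> m \<oplus> \<kappa> m'"
    and kappa_smult: "[|a \<in> carrier K; m \<in> carrier N|] ==> \<kappa> (a \<odot>\<^bsub>N\<^esub> m) = a \<odot> \<kappa> m"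
    and kappa_piece: "m \<in> piece N k ==> \<kappa> m \<in> piece H k"
    and kappa_one [simp]: "\<kappa> \<one>\<^bsub>N\<^esub> = \<one>"
    and kappa_diff [simp]: "m \<in> carrier N ==> \<kappa> (diff N m) = \<zero>"
    and kappa_mult_left: "[|m \<in> carrier N; m' \<in> carrier N; z \<in> L|]
      ==> z \<otimes> \<kappa> (m \<otimes>\<^bsub>N\<^esub> m') = z \<otimes> (\<kappa> m \<otimes> \<kappa> m')"
    and kappa_mult_right: "[|m \<in> carrier N; m' \<in> carrier N; z \<in> L|]
      ==> parity H (\<kappa> (m \<otimes>\<^bsub>N\<^esub> m')) \<otimes> z = parity H (\<kappa> m \<otimes> \<kappa> m') \<otimes> z"
    and lambda_L: "m \<in> carrier N ==> \<delta> m \<in> L"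
    and lambda_add: "[|m \<in> carrier N; m' \<in> carrier N|] ==> \<delta> (m \<oplus>\<^bsub>N\<^esub> m') = \<delta> m \<oplus> \<delta> m'"
    and lambda_smult: "[|a \<in> carrier K; m \<in> carrier N|] ==> \<delta> (a \<odot>\<^bsub>N\<^esub> m) = a \<odot> \<delta> m"
    and lambda_piece: "m \<in> piece N k ==> \<delta> m \<in> piece H k"
    and lambda_diff [simp]: "m \<in> carrier N ==> \<delta> (diff N m) = \<zero>"
    and c_L: "[|m \<in> carrier N; m' \<in> carrier N|] ==> c m m' \<in> L"
    and c_add_left: "[|m \<in> carrier N; m' \<in> carrier N; m'' \<in> carrier N|]
      ==> c (m \<oplus>\<^bsub>N\<^esub> m') m'' = c m m'' \<oplus> c m' m''"
    and c_add_right: "[|m \<in> carrier N; m' \<in> carrier N; m'' \<in> carrier N|]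
      ==> c m'' (m \<oplus>\<^bsub>N\<^esub> m') = c m'' m \<oplus> c m'' m'"
    and c_smult: "[|a \<in> carrier K; m \<in> carrier N; m' \<in> carrier N|] ==> c (a \<odot>\<^bsub>N\<^esub> m) m' = a \<odot> c m m'"
      "[|a \<in> carrier K; m \<in> carrier N; m' \<in> carrier N|] ==> c m (a \<odot>\<^bsub>N\<^esub> m') = a \<odot> c m m'"
    and c_piece: "[|m \<in> piece N i; m' \<in> piece N j|] ==> c m m' \<in> piece_pred H (i + j)"
    and c_one [simp]: "m \<in> carrier N ==> c \<one>\<^bsub>N\<^esub> m = \<zero>" "m \<in> carrier N ==> c m \<one>\<^bsub>N\<^esub> = \<zero>"
    and c_comm: "[|m \<in> piece N i; m' \<in> piece N j|] ==> c m m' = ksign H (i * j) (c m' m)"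
    and c_assoc: "[|m \<in> carrier N; m' \<in> carrier N; m'' \<in> carrier N|]
      ==> c m m' \<otimes> \<kappa> m'' \<oplus> c (m \<otimes>\<^bsub>N\<^esub> m') m''
        = parity H (\<kappa> m) \<otimes> c m' m'' \<oplus> c m (m' \<otimes>\<^bsub>N\<^esub> m'')"
    and lambda_mult: "[|m \<in> piece N k; m' \<in> carrier N|]
      ==> \<delta> (m \<otimes>\<^bsub>N\<^esub> m') = \<delta> m \<otimes> \<kappa> m' \<oplus> \<kappa> m \<otimes> \<delta> m' \<oplus> c (diff N m) m'
        \<oplus> ksign H k (c m (diff N m'))"
begin

abbreviation M where "M \<equiv> cylinder N H L \<kappa> \<delta> c"

lemmas Ls = H.graded_subspaceD[OF L_graded]

lemma L_carrier [simp]: "z \<in> L ==> z \<in> carrier H" using Ls(1) by blast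

lemma c_closed [simp]: "[|m \<in> carrier N; m' \<in> carrier N|] ==> c m m' \<in> carrier H" by (simp add: c_L)

lemma lambda_closed [simp]: "m \<in> carrier N ==> \<delta> m \<in> carrier H" by (simp add: lambda_L)

lemma cyl_simps [simp]:
  "carrier M = carrier N \<times> L"
  "(m, z) \<otimes>\<^bsub>M\<^esub> (m', z') = (m \<otimes>\<^bsub>N\<^esub> m', z \<otimes> \<kappa> m' \<oplus> parity H (\<kappa> m) \<otimes> z' \<oplus> c m m')"
  "\<one>\<^bsub>M\<^esub> = (\<one>\<^bsub>N\<^esub>, \<zero>)" "\<zero>\<^bsub>M\<^esub> = (\<zero>\<^bsub>N\<^esub>, \<zero>)"
  "(m, z) \<oplus>\<^bsub>M\<^esub> (m', z') = (m \<oplus>\<^bsub>N\<^esub> m', z \<oplus> z')"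
  "a \<odot>\<^bsub>M\<^esub> (m, z) = (a \<odot>\<^bsub>N\<^esub> m, a \<odot> z)"
  "(m, z) \<in> piece M k \<longleftrightarrow> m \<in> piece N k \<and> z \<in> L \<and> z \<in> piece_pred H k"
  "diff M (m, z) = (diff N m, \<delta> m)" by (auto simp: cylinder_def)

lemma cyl_assoc:
  assumes m: "m \<in> carrier N" "m' \<in> carrier N" "m'' \<in> carrier N" and z: "z \<in> L" "z' \<in> L" "z'' \<in> L"
  shows "((m, z) \<otimes>\<^bsub>M\<^esub> (m', z')) \<otimes>\<^bsub>M\<^esub> (m'', z'') = (m, z) \<otimes>\<^bsub>M\<^esub> ((m', z') \<otimes>\<^bsub>M\<^esub> (m'', z''))"
proof -
  have "(z \<otimes> \<kappa> m' \<oplus> parity H (\<kappa> m) \<otimes> z' \<oplus> c m m') \<otimes> \<kappa> m''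
      \<oplus> parity H (\<kappa> (m \<otimes>\<^bsub>N\<^esub> m')) \<otimes> z'' \<oplus> c (m \<otimes>\<^bsub>N\<^esub> m') m''
    = (z \<otimes> (\<kappa> m' \<otimes> \<kappa> m'') \<oplus> parity H (\<kappa> m) \<otimes> z' \<otimes> \<kappa> m''
      \<oplus> parity H (\<kappa> m) \<otimes> (parity H (\<kappa> m') \<otimes> z''))
      \<oplus> (c m m' \<otimes> \<kappa> m'' \<oplus> c (m \<otimes>\<^bsub>N\<^esub> m') m'')" unfolding kappa_mult_right[OF m(1,2) z(3)]
    by (insert m z, simp add: H.A.ring_expand H.parity_mult, (rule H.A.ag)+, simp_all)
  also have "\<dots> = z \<otimes> \<kappa> (m' \<otimes>\<^bsub>N\<^esub> m'') \<oplus> parity H (\<kappa> m) \<otimes>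
      (z' \<otimes> \<kappa> m'' \<oplus> parity H (\<kappa> m') \<otimes> z'' \<oplus> c m' m'') \<oplus> c m (m' \<otimes>\<^bsub>N\<^esub> m'')"
    unfolding c_assoc[OF m] kappa_mult_left[OF m(2,3) z(1)]
    by (insert m z, simp add: H.A.ring_expand, (rule H.A.ag)+, simp_all)
  finally show ?thesis using m by (simp add: N.A.m_assoc)
qed

lemma cyl_mult_L:
  "[|m \<in> carrier N; m' \<in> carrier N; z \<in> L; z' \<in> L|]
    ==> z \<otimes> \<kappa> m' \<oplus> parity H (\<kappa> m) \<otimes> z' \<oplus> c m m' \<in> L" by (intro Ls(3) L_mult c_L) simp_all

lemma cyl_ring: "ring M"
proof (rule ringI')
  show "\<exists>y\<in>carrier M. y \<oplus>\<^bsub>M\<^esub> x = \<zero>\<^bsub>M\<^esub>" if "x \<in> carrier M" for x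
  proof (cases x)
    case (Pair m z)
    then show ?thesis
      using that Ls(4) by (intro bexI[of _ "(\<ominus>\<^bsub>N\<^esub> m, \<ominus> z)"]) (auto simp: N.A.l_neg H.A.l_neg)
  qed
  show "(x \<otimes>\<^bsub>M\<^esub> y) \<otimes>\<^bsub>M\<^esub> w = x \<otimes>\<^bsub>M\<^esub> (y \<otimes>\<^bsub>M\<^esub> w)"
    if "x \<in> carrier M" "y \<in> carrier M" "w \<in> carrier M" for x y w
    using cyl_assoc that by (cases x, cases y, cases w) (auto simp del: cyl_simps(2))
  show "x \<otimes>\<^bsub>M\<^esub> y \<in> carrier M" if "x \<in> carrier M" "y \<in> carrier M" for x y
    using cyl_mult_L that by (cases x, cases y) auto
  show "(x \<oplus>\<^bsub>M\<^esub> y) \<otimes>\<^bsub>M\<^esub> w = x \<otimes>\<^bsub>M\<^esub> w \<oplus>\<^bsub>M\<^esub> y \<otimes>\<^bsub>M\<^esub> w"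
    if xyw: "x \<in> carrier M" "y \<in> carrier M" "w \<in> carrier M" for x y w
  proof -
    obtain m z m' z' m'' z'' where e: "x = (m, z)" "y = (m', z')" "w = (m'', z'')" by (metis surj_pair)
    have k: "m \<in> carrier N" "m' \<in> carrier N" "m'' \<in> carrier N" "z \<in> L" "z' \<in> L" "z'' \<in> L"
      using xyw e by auto
    have "(z \<oplus> z') \<otimes> \<kappa> m'' \<oplus> parity H (\<kappa> (m \<oplus>\<^bsub>N\<^esub> m')) \<otimes> z'' \<oplus> c (m \<oplus>\<^bsub>N\<^esub> m') m''
      = (z \<otimes> \<kappa> m'' \<oplus> parity H (\<kappa> m) \<otimes> z'' \<oplus> c m m'')
        \<oplus> (z' \<otimes> \<kappa> m'' \<oplus> parity H (\<kappa> m') \<otimes> z'' \<oplus> c m' m'')"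
      by (insert k, simp add: H.A.ring_expand kappa_add c_add_left H.parity_add,
        (rule H.A.ag)+, simp_all)
    then show ?thesis using k by (simp add: e N.A.l_distr)
  qed
  show "w \<otimes>\<^bsub>M\<^esub> (x \<oplus>\<^bsub>M\<^esub> y) = w \<otimes>\<^bsub>M\<^esub> x \<oplus>\<^bsub>M\<^esub> w \<otimes>\<^bsub>M\<^esub> y"
    if xyw: "x \<in> carrier M" "y \<in> carrier M" "w \<in> carrier M" for x y w
  proof -
    obtain m z m' z' m'' z'' where e: "x = (m, z)" "y = (m', z')" "w = (m'', z'')" by (metis surj_pair)
    have k: "m \<in> carrier N" "m' \<in> carrier N" "m'' \<in> carrier N" "z \<in> L" "z' \<in> L" "z'' \<in> L"
      using xyw e by auto
    have "z'' \<otimes> \<kappa> (m \<oplus>\<^bsub>N\<^esub> m') \<oplus> parity H (\<kappa> m'') \<otimes> (z \<oplus> z') \<oplus> c m'' (m \<oplus>\<^bsub>N\<^esub> m')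
      = (z'' \<otimes> \<kappa> m \<oplus> parity H (\<kappa> m'') \<otimes> z \<oplus> c m'' m)
        \<oplus> (z'' \<otimes> \<kappa> m' \<oplus> parity H (\<kappa> m'') \<otimes> z' \<oplus> c m'' m')"
      by (insert k, simp add: H.A.ring_expand kappa_add c_add_right H.parity_add,
        (rule H.A.ag)+, simp_all)
    then show ?thesis using k by (simp add: e N.A.r_distr)
  qed
qed (auto simp: N.A.a_ac H.A.a_ac Ls(2,3))

lemma cyl_module: "module K M"
proof (rule moduleI)
  show "cring K" ..
  show "abelian_group M" using cyl_ring by (simp add: ring_def)
qed (auto simp: Ls(6) N.smult_l_distr H.smult_l_distr N.smult_r_distr H.smult_r_distr
    N.smult_assoc1 H.smult_assoc1)

lemma cyl_neg: "[|m \<in> carrier N; z \<in> L|] ==> \<ominus>\<^bsub>M\<^esub> (m, z) = (\<ominus>\<^bsub>N\<^esub> m, \<ominus> z)"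
proof -
  interpret M: ring M by (rule cyl_ring)
  assume "m \<in> carrier N" "z \<in> L"
  then show ?thesis by (intro M.minus_equality) (simp_all add: N.A.l_neg H.A.l_neg Ls(4))
qed

lemma cyl_ksign: "[|m \<in> carrier N; z \<in> L|] ==> ksign M k (m, z) = (ksign N k m, ksign H k z)"
  by (simp add: ksign_def cyl_neg)

text \<open>In degree \<open>i\<close> of the cylinder the second entry has degree
  \<open>i - 1\<close> in \<open>H\<close>. By \<open>piece_pred_comm\<close> this shift is exactly
  compensated by the \<open>parity\<close> in the product.\<close>

lemma cyl_comm:
  assumes x: "m \<in> piece N i" "z \<in> L" "z \<in> piece_pred H i"
    and y: "m' \<in> piece N j" "z' \<in> L" "z' \<in> piece_pred H j"
  shows "(m, z) \<otimes>\<^bsub>M\<^esub> (m', z') = ksign M (i * j) ((m', z') \<otimes>\<^bsub>M\<^esub> (m, z))"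
proof -
  have k: "m \<in> carrier N" "m' \<in> carrier N" using x y N.piece_carrier by blast+
  have mc: "m' \<otimes>\<^bsub>N\<^esub> m \<in> carrier N" using k by simp
  note e1 = H.piece_pred_comm[OF x(3) kappa_piece[OF y(1)]] and e2 = H.piece_pred_comm[OF y(3) kappa_piece[OF x(1)]]
  have e2': "parity H (\<kappa> m) \<otimes> z' = ksign H (i * j) (z' \<otimes> \<kappa> m)"
    unfolding e2 using k y by (simp add: ksign_def mult.commute)
  have "z \<otimes> \<kappa> m' \<oplus> parity H (\<kappa> m) \<otimes> z' \<oplus> c m m'
      = ksign H (i * j) (z' \<otimes> \<kappa> m \<oplus> parity H (\<kappa> m') \<otimes> z \<oplus> c m' m)"
    unfolding e1 e2' c_comm[OF x(1) y(1)] using k x y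
    by (simp add: H.ksign_add[symmetric] H.A.a_comm)
  then show ?thesis
    using N.graded_comm[OF x(1) y(1)] by (simp add: cyl_ksign[OF mc cyl_mult_L[OF k(2,1) y(2) x(2)]])
qed

lemma cyl_gca: "gca K M"
proof -
  interpret M: module K M by (rule cyl_module)
  \<comment> \<open>A second entry of degree \<open>j\<close> in \<open>H\<close> counts in degree
    \<open>Suc j\<close>, so in degree 0 the second entry is zero.\<close>
  let ?pr = "\<lambda>k (m, z). (component N k m, case k of 0 => \<zero> | Suc j => component H j z)"
  have sub: "submodule (piece M k) K M" for k
  proof (rule M.submoduleI)
    show "piece M k \<subseteq> carrier M" using N.piece_carrier by auto
    show "!!a. a \<in> piece M k ==> \<ominus>\<^bsub>M\<^esub> a \<in> piece M k" using H.piece_pred_minus[OF H.piece_pred_zero]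
      by (auto simp: cyl_neg N.piece_carrier N.piece_neg Ls(4) a_minus_def H.piece_pred_carrier)
  qed (auto simp: N.piece_zero Ls H.piece_pred_zero N.piece_add H.piece_pred_add N.piece_smult
      H.piece_pred_smult)
  show ?thesis
  proof (rule gcaI[where pr = ?pr])
    show "field K" ..
    show "finite {k. ?pr k x \<noteq> \<zero>\<^bsub>M\<^esub>}" if "x \<in> carrier M" for x
    proof (cases x)
      case (Pair m z)
      then have k: "m \<in> carrier N" "z \<in> carrier H" using that by auto
      have "{k. ?pr k x \<noteq> \<zero>\<^bsub>M\<^esub>}
          \<subseteq> {k. component N k m \<noteq> \<zero>\<^bsub>N\<^esub>} \<union> Suc ` {k. component H k z \<noteq> \<zero>}"
      proof
        fix j assume "j \<in> {k. ?pr k x \<noteq> \<zero>\<^bsub>M\<^esub>}"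
        then show "j \<in> {k. component N k m \<noteq> \<zero>\<^bsub>N\<^esub>} \<union> Suc ` {k. component H k z \<noteq> \<zero>}"
          using Pair by (cases j) auto
      qed
      then show ?thesis
        using N.finite_support[OF k(1)] H.finite_support[OF k(2)] finite_subset by blast
    qed
    show "x = y" if "x \<in> carrier M" "y \<in> carrier M" and eq: "!!k. ?pr k x = ?pr k y" for x y
    proof -
      obtain m z m' z' where xy: "x = (m, z)" "y = (m', z')" by (metis surj_pair)
      have "component N k m = component N k m'" for k using eq[of k] xy by auto
      moreover have "component H k z = component H k z'" for k using eq[of "Suc k"] xy by auto
      ultimately show ?thesis
        using N.component_eqI[of m m'] H.component_eqI[of z z'] that xy by auto
    qed
    show "?pr k x \<in> piece M k" if "x \<in> carrier M" for k x
      using that by (cases x, cases k) (auto simp: N.component_piece Ls piece_pred_def H.component_piece)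
    show "?pr k (x \<oplus>\<^bsub>M\<^esub> y) = ?pr k x \<oplus>\<^bsub>M\<^esub> ?pr k y" if "x \<in> carrier M" "y \<in> carrier M" for k x y
      using that by (cases x, cases y, cases k) (auto simp: N.component_add H.component_add)
    show "?pr k x = (if k = j then x else \<zero>\<^bsub>M\<^esub>)" if "x \<in> piece M j" for k j x
      using that by (cases x, cases k, cases j)
        (auto simp: N.component_of_piece H.component_of_piece piece_pred_def split: nat.splits)
    show "x \<otimes>\<^bsub>M\<^esub> y = ksign M (i * j) (y \<otimes>\<^bsub>M\<^esub> x)" if "x \<in> piece M i" "y \<in> piece M j" for x y i j
    proof -
      obtain m z m' z' where xy: "x = (m, z)" "y = (m', z')" by (metis surj_pair)
      show ?thesis unfolding xy by (rule cyl_comm) (use that xy in auto)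
    qed
    show "x \<otimes>\<^bsub>M\<^esub> y \<in> piece M (i + j)" if "x \<in> piece M i" "y \<in> piece M j" for x y i j
    proof -
      obtain m z m' z' where xy: "x = (m, z)" "y = (m', z')" by (metis surj_pair)
      have p: "m \<in> piece N i" "m' \<in> piece N j" "z \<in> L" "z' \<in> L" "z \<in> piece_pred H i" "z' \<in> piece_pred H j"
        using that xy by auto
      have k: "m \<in> carrier N" "m' \<in> carrier N" using p N.piece_carrier by blast+
      have "z \<otimes> \<kappa> m' \<oplus> parity H (\<kappa> m) \<otimes> z' \<oplus> c m m' \<in> piece_pred H (i + j)"
        by (intro H.piece_pred_add c_piece p H.piece_pred_mult_right[OF p(5) kappa_piece[OF p(2)] refl]
            H.piece_pred_mult_left[OF H.parity_piece[OF kappa_piece[OF p(1)]] p(6) refl])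
      then show ?thesis using cyl_mult_L[OF k p(3,4)] N.mult_piece[OF p(1,2)] by (simp add: xy)
    qed
    show "(a \<odot>\<^bsub>M\<^esub> x) \<otimes>\<^bsub>M\<^esub> y = a \<odot>\<^bsub>M\<^esub> (x \<otimes>\<^bsub>M\<^esub> y)" "x \<otimes>\<^bsub>M\<^esub> (a \<odot>\<^bsub>M\<^esub> y) = a \<odot>\<^bsub>M\<^esub> (x \<otimes>\<^bsub>M\<^esub> y)"
      if "a \<in> carrier K" "x \<in> carrier M" "y \<in> carrier M" for a x y
      using that by (cases x, cases y, auto simp: N.smult_mult_left N.smult_mult_right kappa_smult
          H.smult_mult_left H.smult_mult_right c_smult H.smult_r_distr H.parity_smult)+
  qed (use cyl_ring cyl_module sub in \<open>auto simp: N.one_piece Ls H.piece_pred_zero\<close>)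
qed

lemma cyl_dg: "dg K M"
proof (rule dgI[OF cyl_gca])
  show "diff M (x \<otimes>\<^bsub>M\<^esub> y) = (diff M x \<otimes>\<^bsub>M\<^esub> y) \<oplus>\<^bsub>M\<^esub> ksign M k (x \<otimes>\<^bsub>M\<^esub> diff M y)"
    if x: "x \<in> piece M k" and y: "y \<in> carrier M" for k x y
  proof -
    obtain m z m' z' where xy: "x = (m, z)" "y = (m', z')" by (metis surj_pair)
    have p: "m \<in> piece N k" "z \<in> L" "m' \<in> carrier N" "z' \<in> L" using x y xy by auto
    have k: "m \<in> carrier N" using p N.piece_carrier by blast
    have mc: "m \<otimes>\<^bsub>N\<^esub> diff N m' \<in> carrier N" using k p by simp
    note sg = cyl_ksign[OF mc cyl_mult_L[OF k N.diff_closed[OF p(3)] p(2) lambda_L[OF p(3)]], of k]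
    have "ksign H k (parity H (\<kappa> m) \<otimes> \<delta> m') = \<kappa> m \<otimes> \<delta> m'"
      using k p by (simp add: H.parity_homogeneous[OF kappa_piece[OF p(1)]] ksign_def H.A.l_minus)
    then have "ksign H k (z \<otimes> \<kappa> (diff N m') \<oplus> parity H (\<kappa> m) \<otimes> \<delta> m' \<oplus> c m (diff N m'))
        = \<kappa> m \<otimes> \<delta> m' \<oplus> ksign H k (c m (diff N m'))" using k p by (simp add: H.ksign_add)
    moreover have "\<delta> (m \<otimes>\<^bsub>N\<^esub> m') = (\<delta> m \<otimes> \<kappa> m' \<oplus> parity H (\<kappa> (diff N m)) \<otimes> z'
        \<oplus> c (diff N m) m') \<oplus> (\<kappa> m \<otimes> \<delta> m' \<oplus> ksign H k (c m (diff N m')))"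
      unfolding lambda_mult[OF p(1,3)] kappa_diff[OF k] by ((rule H.A.ag)+, insert k p, simp_all)
    ultimately show ?thesis using N.leibniz[OF p(1,3)] by (simp add: xy sg)
  qed
qed (auto simp: N.diff_add N.diff_smult N.diff_piece N.diff_diff N.piece_carrier lambda_add lambda_smult
    lambda_L piece_pred_def lambda_piece Ls)

end

section \<open>Transport of a DGCA along an injection\<close>

definition transport :: "('a => 'b) => ('k, 'a, 'm) dga_scheme => ('k, 'b) dga" where
  "transport g A = (let gi = inv_into (carrier A) g in \<lparr>carrier = g ` carrier A,
     monoid.mult = (\<lambda>x y. g (gi x \<otimes>\<^bsub>A\<^esub> gi y)), monoid.one = g \<one>\<^bsub>A\<^esub>, ring.zero = g \<zero>\<^bsub>A\<^esub>,
     ring.add = (\<lambda>x y. g (gi x \<oplus>\<^bsub>A\<^esub> gi y)), smult = (\<lambda>a x. g (a \<odot>\<^bsub>A\<^esub> gi x)),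
     piece = (\<lambda>k. g ` piece A k), diff = (\<lambda>x. g (diff A (gi x)))\<rparr>)"

locale transported = A: dg K A
  for K :: "('k, 'l) ring_scheme" and A :: "('k, 'a, 'm) dga_scheme" +
  fixes g :: "'a => 'b"
  assumes inj: "inj_on g (carrier A)"
begin

abbreviation T where "T \<equiv> transport g A"
definition gi where "gi = inv_into (carrier A) g"

lemma gi_g [simp]: "x \<in> carrier A ==> gi (g x) = x" using inj by (simp add: gi_def)

lemma tr_simps [simp]:
  "carrier T = g ` carrier A"
  "[|x \<in> carrier A; y \<in> carrier A|] ==> g x \<otimes>\<^bsub>T\<^esub> g y = g (x \<otimes>\<^bsub>A\<^esub> y)"
  "[|x \<in> carrier A; y \<in> carrier A|] ==> g x \<oplus>\<^bsub>T\<^esub> g y = g (x \<oplus>\<^bsub>A\<^esub> y)"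
  "\<one>\<^bsub>T\<^esub> = g \<one>\<^bsub>A\<^esub>" "\<zero>\<^bsub>T\<^esub> = g \<zero>\<^bsub>A\<^esub>" "x \<in> carrier A ==> a \<odot>\<^bsub>T\<^esub> g x = g (a \<odot>\<^bsub>A\<^esub> x)"
  "piece T k = g ` piece A k" "x \<in> carrier A ==> diff T (g x) = g (diff A x)"
  by (simp_all add: transport_def Let_def gi_def[symmetric])

lemma g_eq_iff: "[|x \<in> carrier A; y \<in> carrier A|] ==> g x = g y \<longleftrightarrow> x = y"
  using inj by (auto simp: inj_on_def)

lemma tr_ring: "ring T"
proof (rule ringI')
  show "\<exists>y\<in>carrier T. y \<oplus>\<^bsub>T\<^esub> x = \<zero>\<^bsub>T\<^esub>" if x: "x \<in> carrier T" for x
  proof -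
    obtain u where "u \<in> carrier A" "x = g u" using x by auto
    then show ?thesis by (intro bexI[of _ "g (\<ominus>\<^bsub>A\<^esub> u)"]) (simp_all add: A.A.l_neg)
  qed
qed (auto simp: A.A.a_ac A.A.m_assoc A.A.l_distr A.A.r_distr)

lemma tr_module: "module K T"
proof (rule moduleI)
  show "cring K" ..
  show "abelian_group T" using tr_ring by (simp add: ring_def)
qed (auto simp: A.smult_l_distr A.smult_r_distr A.smult_assoc1)

lemma tr_neg: "x \<in> carrier A ==> \<ominus>\<^bsub>T\<^esub> g x = g (\<ominus>\<^bsub>A\<^esub> x)"
proof -
  interpret T: ring T by (rule tr_ring)
  assume "x \<in> carrier A"
  then show ?thesis by (intro T.minus_equality) (simp_all add: A.A.l_neg)
qed

lemma tr_ksign: "x \<in> carrier A ==> ksign T k (g x) = g (ksign A k x)"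
  by (simp add: ksign_def tr_neg)

lemma tr_dg: "dg K T"
proof -
  interpret M: module K T by (rule tr_module)
  have pc: "x \<in> carrier A" if "x \<in> piece A k" for x k using that by (rule A.piece_carrier)
  have sub: "submodule (piece T k) K T" for k by (rule M.submoduleI)
      (auto simp: pc tr_neg A.piece_neg A.piece_zero A.piece_add A.piece_smult)
  have "gca K T"
  proof (rule gcaI[where pr = "\<lambda>k x. g (component A k (gi x))"])
    show "field K" ..
    show "finite {k. g (component A k (gi x)) \<noteq> \<zero>\<^bsub>T\<^esub>}" if x: "x \<in> carrier T" for x
    proof -
      obtain u where u: "u \<in> carrier A" "x = g u" using x by auto
      then have "{k. g (component A k (gi x)) \<noteq> \<zero>\<^bsub>T\<^esub>} = {k. component A k u \<noteq> \<zero>\<^bsub>A\<^esub>}"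
        by (simp add: g_eq_iff)
      then show ?thesis using A.finite_support u by simp
    qed
    show "x = y" if xy: "x \<in> carrier T" "y \<in> carrier T"
      and eq: "!!k. g (component A k (gi x)) = g (component A k (gi y))" for x y
    proof -
      obtain u v where u: "u \<in> carrier A" "x = g u" "v \<in> carrier A" "y = g v" using xy by auto
      have "component A k u = component A k v" for k using eq[of k] u by (simp add: g_eq_iff)
      then show ?thesis using A.component_eqI[of u v] u by simp
    qed
    show "x \<otimes>\<^bsub>T\<^esub> y = ksign T (i * j) (y \<otimes>\<^bsub>T\<^esub> x)" if xy: "x \<in> piece T i" "y \<in> piece T j" for x y i j
    proof -
      obtain u v where u: "u \<in> piece A i" "x = g u" "v \<in> piece A j" "y = g v" using xy by auto
      then show ?thesis using A.graded_comm[OF u(1,3)] by (simp add: pc tr_ksign)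
    qed
  qed (use tr_ring tr_module sub in \<open>auto simp: pc A.one_piece A.mult_piece A.smult_mult_left
      A.smult_mult_right A.component_piece A.component_add A.component_of_piece\<close>)
  then show ?thesis
  proof (rule dgI)
    show "diff T (x \<otimes>\<^bsub>T\<^esub> y) = (diff T x \<otimes>\<^bsub>T\<^esub> y) \<oplus>\<^bsub>T\<^esub> ksign T k (x \<otimes>\<^bsub>T\<^esub> diff T y)"
      if xy: "x \<in> piece T k" "y \<in> carrier T" for k x y
    proof -
      obtain u v where u: "u \<in> piece A k" "x = g u" "v \<in> carrier A" "y = g v" using xy by auto
      then show ?thesis using A.leibniz[OF u(1,3)] by (simp add: pc tr_ksign)
    qed
  qed (auto simp: pc A.diff_add A.diff_smult A.diff_piece A.diff_diff)
qed

lemma tr_quasi_iso: "quasi_iso K A B f ==> quasi_iso K T B (\<lambda>x. f (gi x))"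
proof -
  assume q: "quasi_iso K A B f"
  interpret q: quasi K A B f by (rule quasiI[OF q])
  have one: "f \<one>\<^bsub>A\<^esub> = \<one>\<^bsub>B\<^esub>" using q.hom by (simp add: dgca_hom_def algebra_hom_def ring_hom_def)
  have h: "(\<lambda>x. f (gi x)) \<in> dgca_hom K T B" unfolding dgca_hom_def algebra_hom_def ring_hom_def
    by (auto simp: q.f_mult q.f_add q.f_smult q.f_piece q.f_diff one A.piece_carrier)
  interpret t: dg_hom K T B "\<lambda>x. f (gi x)"
    using h tr_dg q.B.dg_axioms by (simp add: dg_hom_def dg_hom_axioms_def)
  have z: "cocycles T = g ` cocycles A" by (auto simp: cocycles_def g_eq_iff)
  have b: "boundaries T = g ` boundaries A" by (auto simp: boundaries_def image_image)
  show ?thesis unfolding t.quasi_iso_iff z b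
    using q.f_boundary_iff q.f_surj by (auto simp: A.cocycles_carrier)
qed

end

section \<open>Highly connected Hodge decompositions\<close>

lemma (in field) half_exists:
  assumes "char_zero R" shows "\<exists>t\<in>carrier R. t \<otimes> (\<one> \<oplus> \<one>) = \<one>"
proof -
  have "add_pow R (2::nat) \<one> \<noteq> \<zero>" using assms unfolding char_zero_def by (meson zero_less_numeral)
  then have "\<one> \<oplus> \<one> \<noteq> \<zero>" by (simp add: numeral_2_eq_2)
  then have "\<one> \<oplus> \<one> \<in> Units R" by (simp add: field_Units)
  then show ?thesis using Units_l_inv Units_inv_closed by blast
qed

context poincare
begin

lemma connected_H_piece_0:
  assumes "highly_connected K A k" "X \<in> piece H 0" shows "\<exists>a\<in>carrier K. X = a \<odot>\<^sub>H \<one>\<^sub>H"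
proof -
  obtain g where g: "g \<in> ring_iso K (H\<lparr>carrier := piece H 0\<rparr>)"
    "\<forall>a\<in>carrier K. \<forall>b\<in>carrier K. g (a \<otimes>\<^sub>K b) = a \<odot>\<^sub>H g b"
    using assms(1) by (auto simp: highly_connected_def Let_def)
  have "g ` carrier K = piece H 0" "g \<one>\<^sub>K = \<one>\<^sub>H"
    using g(1) by (auto simp: ring_iso_def bij_betw_def ring_hom_def)
  then obtain a where a: "a \<in> carrier K" "X = g a" using assms(2) by (metis imageE)
  have "g (a \<otimes>\<^sub>K \<one>\<^sub>K) = a \<odot>\<^sub>H g \<one>\<^sub>K" using g(2) a(1) K.one_closed by blast
  then have "X = a \<odot>\<^sub>H \<one>\<^sub>H" using a \<open>g \<one>\<^sub>K = \<one>\<^sub>H\<close> by simp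
  then show ?thesis using a by blast
qed

end

locale conn_hodge = hodge K A n I Hs Bs
  for K :: "('k, 'l) ring_scheme" and A :: "('k, 'a, 'm) dga_scheme" (structure)
    and n I Hs Bs +
  fixes r :: nat and \<iota> :: "'a set => 'a"
  assumes r: "r > 1" and conn: "highly_connected K A (r - 1)" and dim: "n \<le> 5 * r - 3"
    and char: "char_zero K"
    and iota_Hs: "X \<in> carrier (cohomology A) ==> \<iota> X \<in> Hs"
    and cls_iota: "X \<in> carrier (cohomology A) ==> cls A (\<iota> X) = X"

sublocale conn_hodge \<subseteq> realization K A "cohomology A" "cls A" \<iota> "\<lambda>X Y. s (\<iota> X \<otimes> \<iota> Y)"
  by (rule section_realization) (auto simp: iota_Hs cls_iota)

context conn_hodge
begin

lemmas H_piece_0 = connected_H_piece_0[OF conn]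

lemma H_piece_low: "[|1 \<le> k; k < r|] ==> piece H k = {\<zero>\<^sub>H}"
  using conn r by (auto simp: highly_connected_def Let_def)

lemma JH_piece: "[|X \<in> piece H k; k \<noteq> n|] ==> JH X = \<zero>\<^sub>K"
  using H.component_of_piece[of X k n] JH_zero by (simp add: JH_def)

lemma JH_pred: "[|X \<in> piece_pred H k; k \<noteq> Suc n|] ==> JH X = \<zero>\<^sub>K"
  using JH_piece by (cases k) (auto simp: piece_pred_def)

lemma JH_eqI:
  assumes "X \<in> CH" "Y \<in> CH"
    "!!Z. Z \<in> CH ==> JH (X \<otimes>\<^sub>H Z) = JH (Y \<otimes>\<^sub>H Z)"
  shows "X = Y"
proof -
  have "JH ((X \<ominus>\<^sub>H Y) \<otimes>\<^sub>H Z) = \<zero>\<^sub>K" if "Z \<in> CH" for Z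
    using assms that by (simp add: a_minus_def H.A.l_distr H.A.l_minus JH_add JH_neg K.r_neg)
  then have "X \<ominus>\<^sub>H Y = \<zero>\<^sub>H" using JH_nondegenerate(1)[of "X \<ominus>\<^sub>H Y"] assms by simp
  then show ?thesis using H.A.diff_zero_eq assms by blast
qed

lemma JH_zeroI:
  assumes "X \<in> CH" "!!j Y. Y \<in> piece H j ==> JH (X \<otimes>\<^sub>H Y) = \<zero>\<^sub>K"
  shows "X = \<zero>\<^sub>H"
proof (rule JH_nondegenerate(1)[OF assms(1)])
  fix Y assume "Y \<in> CH"
  then show "JH (X \<otimes>\<^sub>H Y) = \<zero>\<^sub>K"
    by (induct rule: H.graded_induct) (use assms in \<open>auto simp: H.A.r_distr JH_add\<close>)
qed

text \<open>By degree, \<open>X\<close> can pair nontrivially only with $H^0$, and connectedness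
  leaves there just the multiples of the unit.\<close>

lemma H_top_inj: "[|X \<in> piece H n; JH X = \<zero>\<^sub>K|] ==> X = \<zero>\<^sub>H"
proof (rule JH_zeroI)
  assume X: "X \<in> piece H n" and z: "JH X = \<zero>\<^sub>K"
  show Xc: "X \<in> CH" by (rule H.piece_carrier[OF X])
  fix j Y assume Y: "Y \<in> piece H j"
  show "JH (X \<otimes>\<^sub>H Y) = \<zero>\<^sub>K"
  proof (cases j)
    case 0
    then obtain a where a: "a \<in> carrier K" "Y = a \<odot>\<^sub>H \<one>\<^sub>H" using H_piece_0 Y by blast
    then show ?thesis using Xc z by (simp add: H.smult_mult_right JH_smult)
  next
    case (Suc i)
    then show ?thesis using JH_piece[OF H.mult_piece[OF X Y]] by simp
  qed
qed

text \<open>Duality pairs degree \<open>k\<close> with degree \<open>n - k\<close>, which lies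
  strictly between 0 and \<open>r\<close>, where the cohomology is zero.\<close>

lemma H_piece_high: "[|k < n; n < k + r|] ==> piece H k = {\<zero>\<^sub>H}"
proof -
  assume k: "k < n" "n < k + r"
  have "X = \<zero>\<^sub>H" if X: "X \<in> piece H k" for X
  proof (rule JH_zeroI[OF H.piece_carrier[OF X]])
    fix j Y assume Y: "Y \<in> piece H j"
    show "JH (X \<otimes>\<^sub>H Y) = \<zero>\<^sub>K"
    proof (cases "k + j = n")
      case True
      then have "Y = \<zero>\<^sub>H" using H_piece_low[of j] k Y by auto
      then show ?thesis using H.piece_carrier[OF X] by simp
    next
      case False
      then show ?thesis using JH_piece[OF H.mult_piece[OF X Y]] by simp
    qed
  qed
  then show ?thesis using H.piece_zero by blast
qed

text \<open>Above degree \<open>n - r\<close> only $H^n$ is left, and on it the integral is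
  injective. Error terms too low to vanish by degree are disposed of by this criterion.\<close>

lemma H_filt_top: "[|X \<in> H.filt m; n < m + r; JH X = \<zero>\<^sub>K|] ==> X = \<zero>\<^sub>H"
proof (rule H.component_eqI)
  assume X: "X \<in> H.filt m" and m: "n < m + r" and z: "JH X = \<zero>\<^sub>K"
  show Xc: "X \<in> CH" by (rule H.filt_carrier[OF X])
  fix j
  note cp = H.component_piece[OF Xc, of j]
  have "component H j X = \<zero>\<^sub>H"
  proof (cases "j < m \<or> j > n")
    case True
    then show ?thesis using X cp H_piece_above by (auto simp: H.filt_def)
  next
    case False
    show ?thesis
    proof (cases "j = n")
      case True
      have "JH (component H n X) = JH X" using Xc by (simp add: JH_def H.component_component)
      then show ?thesis using H_top_inj[of "component H j X"] cp z True by simp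
    next
      case f: False
      then show ?thesis using False H_piece_high[of j] m cp by auto
    qed
  qed
  then show "component H j X = component H j \<zero>\<^sub>H" by simp
qed simp

text \<open>In degree 0 there is no nonzero exact element, so the unit, being closed, equals its
  harmonic part.\<close>

lemma one_Hs: "\<one> \<in> Hs"
proof -
  have z: "\<one> \<in> cocycles A" by (simp add: cocycles_iff)
  obtain u where u: "u \<in> carrier A" "pE \<one> = d u" using boundariesE[OF parts(1)[OF A.one_closed]] .
  have "pE \<one> = component A 0 (pE \<one>)" using parts_piece(1)[OF one_piece] by simp
  also have "\<dots> = \<zero>" unfolding u(2) by (rule component_diff_0[OF u(1)])
  finally have "\<one> = pH \<one>" using cocycles_parts[OF z] parts(2)[OF A.one_closed] by simp
  then show ?thesis using parts(2)[OF A.one_closed] by simp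
qed

lemma iota_one [simp]: "\<iota> \<one>\<^sub>H = \<one>" by (rule rho_inj_Hs[OF iota_Hs[OF H.A.one_closed] one_Hs])
    (rule trans[OF cls_iota[OF H.A.one_closed] cohomology_one])

text \<open>The harmonic projection with values in cohomology. It annihilates boundaries, so it is a
  chain map to the cohomology with zero differential and serves as the linear part of the A-infinity
  map.\<close>

definition f :: "'a => 'a set" where "f q = cls A (pH q)"

lemma f_closed [simp]: "q \<in> carrier A ==> f q \<in> CH" by (simp add: f_def parts Hs_cocycles)

lemma f_add: "[|p \<in> carrier A; q \<in> carrier A|] ==> f (p \<oplus> q) = f p \<oplus>\<^sub>H f q"
  by (simp add: f_def parts_add rho_add parts Hs_cocycles)

lemma f_smult: "[|a \<in> carrier K; q \<in> carrier A|] ==> f (a \<odot> q) = a \<odot>\<^sub>H f q"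
  by (simp add: f_def parts_smult rho_smult parts Hs_cocycles)

lemma f_neg: "q \<in> carrier A ==> f (\<ominus> q) = \<ominus>\<^sub>H f q"
  by (simp add: f_def parts_neg rho_neg parts Hs_cocycles)

lemma f_minus: "[|p \<in> carrier A; q \<in> carrier A|] ==> f (p \<ominus> q) = f p \<ominus>\<^sub>H f q"
  by (simp add: a_minus_def f_add f_neg)

lemma f_piece: "q \<in> piece A k ==> f q \<in> piece H k"
  using parts(2)[of q] by (simp add: f_def rho_piece parts_piece Hs_cocycles piece_carrier)

lemma f_component: "q \<in> carrier A ==> f (component A k q) = component H k (f q)"
  by (simp add: f_def parts_component rho_component parts Hs_cocycles)

lemma f_parity: "q \<in> carrier A ==> f (parity A q) = parity H (f q)"
  by (simp add: f_def parts_parity rho_parity parts Hs_cocycles)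

lemma f_ksign: "q \<in> carrier A ==> f (ksign A k q) = ksign H k (f q)" by (simp add: ksign_def f_neg)

lemma f_cocycle: "q \<in> cocycles A ==> f q = cls A q" by (simp add: f_def rho_pH)

lemma f_Hs: "q \<in> Hs ==> f q = cls A q" by (simp add: f_def)

lemma f_boundary [simp]: "q \<in> boundaries A ==> f q = \<zero>\<^sub>H"
  by (simp add: f_cocycle boundaries_cocycles)

lemma f_Bs [simp]: "q \<in> Bs ==> f q = \<zero>\<^sub>H" by (simp add: f_def cohomology_zero)

lemma f_zero [simp]: "f \<zero> = \<zero>\<^sub>H" by (rule f_boundary) (rule boundaries_zero)

lemma f_one [simp]: "f \<one> = \<one>\<^sub>H" by (simp add: f_Hs one_Hs cohomology_one)

lemma f_iota [simp]: "X \<in> CH ==> f (\<iota> X) = X" by (simp add: f_Hs iota_Hs cls_iota)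

lemma f_pH [simp]: "q \<in> carrier A ==> f (pH q) = f q" by (simp add: f_def parts)

lemma iota_f: "q \<in> carrier A ==> \<iota> (f q) = pH q"
  by (rule rho_inj_Hs) (auto simp: iota_Hs parts cls_iota f_def Hs_cocycles)

lemma f_filt: "q \<in> filt k ==> f q \<in> H.filt k"
  by (auto simp: filt_def H.filt_def f_component[symmetric])

lemma f_pred: "q \<in> piece_pred A k ==> f q \<in> piece_pred H k"
  by (cases k) (auto simp: piece_pred_def f_piece)

lemma f_diff [simp]: "q \<in> carrier A ==> f (d q) = \<zero>\<^sub>H" by (simp add: boundaries_diff)

lemma f_mult_Hs: "[|x \<in> Hs; y \<in> Hs|] ==> f (x \<otimes> y) = f x \<otimes>\<^sub>H f y"
  by (simp add: f_cocycle Hs_cocycles cocycles_mult rho_mult)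

lemma J_Bs: "b \<in> Bs ==> J b = \<zero>\<^sub>K" using J_Hs_Bs[OF one_Hs, of b] by simp

text \<open>Since the unit is harmonic, orthogonality of \<open>Hs\<close> and \<open>Bs\<close>
  makes the integral vanish on \<open>Bs\<close>; it vanishes on boundaries anyway.\<close>

lemma JH_f: "q \<in> carrier A ==> JH (f q) = J q"
proof -
  assume q: "q \<in> carrier A"
  note p = parts(1-3)[OF q]
  have "J q = J (pE q \<oplus> pH q \<oplus> pB q)" using parts(4)[OF q] by (rule arg_cong)
  also have "\<dots> = J (pH q)" using q p by (simp add: J_add J_boundary J_Bs)
  also have "\<dots> = JH (f q)" using p(2) by (simp add: J_cocycle Hs_cocycles f_def)
  finally show ?thesis by simp
qed

lemma f_filt_top: "[|q \<in> filt m; n < m + r; J q = \<zero>\<^sub>K|] ==> f q = \<zero>\<^sub>H"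
  using H_filt_top[OF f_filt] JH_f filt_carrier by simp

definition mu :: "'a set => 'a set => 'a set => 'a set" where
  "mu X Y Z = cls A (massey_rep A H \<iota> (\<lambda>X Y. s (\<iota> X \<otimes> \<iota> Y)) X Y Z)"

lemma mu_f:
  assumes "X \<in> CH" "Y \<in> CH" "Z \<in> CH"
  shows "mu X Y Z = f (s (\<iota> X \<otimes> \<iota> Y) \<otimes> \<iota> Z \<ominus> parity A (\<iota> X) \<otimes> s (\<iota> Y \<otimes> \<iota> Z))"
proof -
  have "mu X Y Z = f (massey_rep A H \<iota> (\<lambda>X Y. s (\<iota> X \<otimes> \<iota> Y)) X Y Z)"
    using massey_rep_cocycle[OF assms] by (simp add: mu_def f_cocycle)
  then show ?thesis using assms s_Bs by (simp add: massey_rep_def f_add f_minus H.A.minus_eq)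
qed

lemma mu_closed [simp]:
  "[|X \<in> CH; Y \<in> CH; Z \<in> CH|] ==> mu X Y Z \<in> CH"
  by (simp add: mu_def massey_rep_cocycle)

lemma mu_add:
  assumes "X \<in> CH" "Y \<in> CH" "Z \<in> CH" "U \<in> CH"
  shows "mu (X \<oplus>\<^sub>H U) Y Z = mu X Y Z \<oplus>\<^sub>H mu U Y Z"
    "mu X (Y \<oplus>\<^sub>H U) Z = mu X Y Z \<oplus>\<^sub>H mu X U Z"
    "mu X Y (Z \<oplus>\<^sub>H U) = mu X Y Z \<oplus>\<^sub>H mu X Y U"
  using assms by (simp_all add: mu_def massey_rep_add massey_rep_cocycle rho_add)

lemma mu_one:
  assumes "Z \<in> CH"
  shows "mu \<one>\<^sub>H \<one>\<^sub>H Z = \<zero>\<^sub>H" "mu Z \<one>\<^sub>H \<one>\<^sub>H = \<zero>\<^sub>H"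
  using assms by (simp_all add: mu_f iota_Hs one_Hs H.A.minus_eq A.minus_eq)

text \<open>By \<open>mu_f\<close> the value comes from products of one harmonic factor and one
  factor in \<open>Bs\<close>, and such factors are orthogonal.\<close>

lemma JH_mu:
  assumes "X \<in> CH" "Y \<in> CH" "Z \<in> CH" shows "JH (mu X Y Z) = \<zero>\<^sub>K"
  using assms graded_subspace_parity[OF H_graded iota_Hs]
  by (simp add: mu_f JH_f J_minus J_Bs_Hs J_Hs_Bs s_Bs iota_Hs K.minus_eq)

lemma iota_filt: "X \<in> H.filt k ==> \<iota> X \<in> filt k"
proof -
  assume X: "X \<in> H.filt k"
  have Xc: "X \<in> CH" by (rule H.filt_carrier[OF X])
  have "component A j (\<iota> X) = \<iota> (component H j X)" for j
    by (rule rho_inj_Hs) (auto simp: Xc iota_Hs Hs(7) rho_component cls_iota)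
  moreover have "\<iota> \<zero>\<^sub>H = \<zero>" by (rule rho_inj_Hs[OF iota_Hs[OF H.A.zero_closed] Hs(2)])
      (rule trans[OF cls_iota[OF H.A.zero_closed] cohomology_zero])
  ultimately show ?thesis using X by (auto simp: filt_def H.filt_def)
qed

text \<open>The value has degree at least \<open>i + j + k - 1\<close> and integral zero, so
  \<open>H_filt_top\<close> applies. \<open>0 < i\<close> and \<open>0 < k\<close> guard the
  truncated subtractions.\<close>

lemma mu_filt_zero:
  assumes X: "X \<in> H.filt i" "Y \<in> H.filt j" "Z \<in> H.filt k" and n: "n < i + j + k - 1 + r"
    and pos: "0 < i" "0 < k"
  shows "mu X Y Z = \<zero>\<^sub>H"
proof -
  have c: "X \<in> CH" "Y \<in> CH" "Z \<in> CH" using X H.filt_carrier by blast+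
  note x = iota_filt[OF X(1)] and y = iota_filt[OF X(2)] and z = iota_filt[OF X(3)]
  have "s (\<iota> X \<otimes> \<iota> Y) \<in> filt (i + j - 1)"
    using s_filt[of "\<iota> X \<otimes> \<iota> Y" "i + j - 1"] filt_mult[OF x y] pos by simp
  then have 1: "s (\<iota> X \<otimes> \<iota> Y) \<otimes> \<iota> Z \<in> filt (i + j + k - 1)"
    using z pos by (intro filt_mult_ge[of _ "i + j - 1" _ k]) auto
  have "s (\<iota> Y \<otimes> \<iota> Z) \<in> filt (j + k - 1)"
    using s_filt[of "\<iota> Y \<otimes> \<iota> Z" "j + k - 1"] filt_mult[OF y z] pos by simp
  then have 2: "parity A (\<iota> X) \<otimes> s (\<iota> Y \<otimes> \<iota> Z) \<in> filt (i + j + k - 1)"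
    using x pos by (intro filt_mult_ge[of _ i _ "j + k - 1"] parity_filt) auto
  have "mu X Y Z \<in> H.filt (i + j + k - 1)"
    unfolding mu_f[OF c] by (rule f_filt[OF filt_minus[OF 1 2]])
  then show ?thesis using H_filt_top n JH_mu[OF c] by blast
qed

definition hf :: 'k where "hf = (SOME t. t \<in> carrier K \<and> t \<otimes>\<^sub>K (\<one>\<^sub>K \<oplus>\<^sub>K \<one>\<^sub>K) = \<one>\<^sub>K)"

lemma hf: "hf \<in> carrier K" "hf \<otimes>\<^sub>K (\<one>\<^sub>K \<oplus>\<^sub>K \<one>\<^sub>K) = \<one>\<^sub>K"
  using someI_ex[OF K.half_exists[OF char, unfolded Bex_def]] by (simp_all add: hf_def)

lemma hf_double [simp]: "X \<in> CH ==> hf \<odot>\<^sub>H (X \<oplus>\<^sub>H X) = X"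
proof -
  assume X: "X \<in> CH"
  have "hf \<odot>\<^sub>H (X \<oplus>\<^sub>H X) = hf \<odot>\<^sub>H ((\<one>\<^sub>K \<oplus>\<^sub>K \<one>\<^sub>K) \<odot>\<^sub>H X)" using X by (simp add: H.smult_l_distr)
  also have "\<dots> = X" using X hf by (simp add: H.smult_assoc1[symmetric])
  finally show ?thesis .
qed

lemma hf_double': "X \<in> CH ==> hf \<odot>\<^sub>H X \<oplus>\<^sub>H hf \<odot>\<^sub>H X = X"
  using hf_double[of X] hf by (simp add: H.smult_r_distr)

lemma hf_double_K: "t \<in> carrier K ==> hf \<otimes>\<^sub>K t \<oplus>\<^sub>K hf \<otimes>\<^sub>K t = t"
proof -
  assume t: "t \<in> carrier K"
  have "hf \<otimes>\<^sub>K t \<oplus>\<^sub>K hf \<otimes>\<^sub>K t = (hf \<otimes>\<^sub>K (\<one>\<^sub>K \<oplus>\<^sub>K \<one>\<^sub>K)) \<otimes>\<^sub>K t"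
    using hf(1) t by (simp add: K.r_distr K.l_distr)
  then show ?thesis using t by (simp only: hf(2)) simp
qed

section \<open>Bilinear maps as primitives of the Massey cocycle\<close>

definition hoch_d :: "('a set => 'a set => 'a set) => 'a set => 'a set => 'a set => 'a set" where
  "hoch_d \<phi> X Y Z = \<phi> X Y \<otimes>\<^sub>H Z \<ominus>\<^sub>H parity H X \<otimes>\<^sub>H \<phi> Y Z
     \<oplus>\<^sub>H \<phi> (X \<otimes>\<^sub>H Y) Z \<ominus>\<^sub>H \<phi> X (Y \<otimes>\<^sub>H Z)"

definition bilin :: "('a set => 'a set => 'a set) => bool" where
  "bilin \<phi> \<longleftrightarrow> (\<forall>X\<in>carrier H. \<forall>Y\<in>carrier H. \<phi> X Y \<in> CH) \<and>
    (\<forall>X\<in>carrier H. \<forall>U\<in>carrier H. \<forall>Y\<in>carrier H. \<phi> (X \<oplus>\<^sub>H U) Y = \<phi> X Y \<oplus>\<^sub>H \<phi> U Y) \<and>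
    (\<forall>X\<in>carrier H. \<forall>Y\<in>carrier H. \<forall>U\<in>carrier H. \<phi> X (Y \<oplus>\<^sub>H U) = \<phi> X Y \<oplus>\<^sub>H \<phi> X U) \<and>
    (\<forall>a\<in>carrier K. \<forall>X\<in>carrier H. \<forall>Y\<in>carrier H. \<phi> (a \<odot>\<^sub>H X) Y = a \<odot>\<^sub>H \<phi> X Y) \<and>
    (\<forall>a\<in>carrier K. \<forall>X\<in>carrier H. \<forall>Y\<in>carrier H. \<phi> X (a \<odot>\<^sub>H Y) = a \<odot>\<^sub>H \<phi> X Y) \<and>
    (\<forall>i j. \<forall>X\<in>piece H i. \<forall>Y\<in>piece H j. \<phi> X Y \<in> piece_pred H (i + j))"

definition symm :: "('a set => 'a set => 'a set) => bool" where
  "symm \<phi> \<longleftrightarrow> (\<forall>i j. \<forall>X\<in>piece H i. \<forall>Y\<in>piece H j. \<phi> Y X = ksign H (i * j) (\<phi> X Y))"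

definition primitive :: "('a set => 'a set => 'a set) => bool" where
  "primitive \<phi> \<longleftrightarrow> bilin \<phi> \<and> (\<forall>X\<in>carrier H. \<forall>Y\<in>carrier H. \<forall>Z\<in>carrier H. mu X Y Z = hoch_d \<phi> X Y Z)"

lemma bilinD:
  assumes "bilin \<phi>"
  shows "[|X \<in> CH; Y \<in> CH|] ==> \<phi> X Y \<in> CH"
    "[|X \<in> CH; U \<in> CH; Y \<in> CH|] ==> \<phi> (X \<oplus>\<^sub>H U) Y = \<phi> X Y \<oplus>\<^sub>H \<phi> U Y"
    "[|X \<in> CH; Y \<in> CH; U \<in> CH|] ==> \<phi> X (Y \<oplus>\<^sub>H U) = \<phi> X Y \<oplus>\<^sub>H \<phi> X U"
    "[|a \<in> carrier K; X \<in> CH; Y \<in> CH|] ==> \<phi> (a \<odot>\<^sub>H X) Y = a \<odot>\<^sub>H \<phi> X Y"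
    "[|a \<in> carrier K; X \<in> CH; Y \<in> CH|] ==> \<phi> X (a \<odot>\<^sub>H Y) = a \<odot>\<^sub>H \<phi> X Y"
    "[|X \<in> piece H i; Y \<in> piece H j|] ==> \<phi> X Y \<in> piece_pred H (i + j)"
  using assms by (simp_all add: bilin_def)

lemma bilin_zero:
  assumes "bilin \<phi>" "X \<in> CH" shows "\<phi> X \<zero>\<^sub>H = \<zero>\<^sub>H" "\<phi> \<zero>\<^sub>H X = \<zero>\<^sub>H"
  using bilinD(4)[OF assms(1) K.zero_closed H.A.zero_closed assms(2)]
    bilinD(5)[OF assms(1) K.zero_closed assms(2) H.A.zero_closed] bilinD(1)[OF assms(1)] assms(2)
  by simp_all

lemma bilin_neg:
  assumes "bilin \<phi>" "X \<in> CH" "Y \<in> CH"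
  shows "\<phi> X (\<ominus>\<^sub>H Y) = \<ominus>\<^sub>H \<phi> X Y" "\<phi> (\<ominus>\<^sub>H X) Y = \<ominus>\<^sub>H \<phi> X Y"
proof -
  note D = bilinD[OF assms(1)]
  have m: "\<ominus>\<^sub>H U = (\<ominus>\<^sub>K \<one>\<^sub>K) \<odot>\<^sub>H U" if "U \<in> CH" for U
    using that H.smult_l_minus[OF K.one_closed that] by simp
  show "\<phi> X (\<ominus>\<^sub>H Y) = \<ominus>\<^sub>H \<phi> X Y" "\<phi> (\<ominus>\<^sub>H X) Y = \<ominus>\<^sub>H \<phi> X Y"
    unfolding m[OF assms(2)] m[OF assms(3)] m[OF D(1)[OF assms(2,3)]] using D(4,5) assms by simp_all
qed

lemma bilin_filt:
  assumes b: "bilin \<phi>" and X: "X \<in> H.filt i" and Y: "Y \<in> H.filt j"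
  shows "\<phi> X Y \<in> H.filt (i + j - 1)" using X
proof (induct rule: H.filt_induct)
  case (piece k X)
  from Y show ?case
  proof (induct rule: H.filt_induct)
    case (piece l Y)
    have "\<phi> X Y \<in> piece_pred H (k + l)" by (rule bilinD(6)[OF b \<open>X \<in> piece H k\<close> piece(2)])
    then show ?case
      using \<open>i \<le> k\<close> piece(1) H.filt_piece[of "\<phi> X Y" "k + l - 1" "i + j - 1"] H.filt_zero
      by (cases "k + l") (auto simp: piece_pred_def)
  next
    case (add Y Z)
    then show ?case using piece(2)
      by (simp add: bilinD(3)[OF b] H.piece_carrier H.filt_carrier H.filt_add)
  qed
next
  case (add X Z)
  then show ?case using Y by (simp add: bilinD(2)[OF b] H.filt_carrier H.filt_add)
qed

text \<open>The coboundary equation is evaluated with two of its arguments equal to the unit: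
  \<open>mu\<close> vanishes there, and \<open>\<phi>\<close> of two units would have degree -1, so
  it is zero. A single term remains.\<close>

lemma primitive_one:
  assumes p: "primitive \<phi>" and Z: "Z \<in> CH"
  shows "\<phi> \<one>\<^sub>H Z = \<zero>\<^sub>H" "\<phi> Z \<one>\<^sub>H = \<zero>\<^sub>H"
proof -
  have b: "bilin \<phi>" and e: "!!X Y Z. [|X \<in> CH; Y \<in> CH; Z \<in> CH|] ==> mu X Y Z = hoch_d \<phi> X Y Z"
    using p by (simp_all add: primitive_def)
  note D = bilinD[OF b]
  have z: "\<phi> \<one>\<^sub>H \<one>\<^sub>H = \<zero>\<^sub>H" using D(6)[OF H.one_piece H.one_piece] by (simp add: piece_pred_def)
  have "\<ominus>\<^sub>H \<phi> \<one>\<^sub>H Z = hoch_d \<phi> \<one>\<^sub>H \<one>\<^sub>H Z"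
    unfolding hoch_d_def by (insert Z D(1)[OF H.A.one_closed Z], simp add: z,
      (rule H.A.ag)+, simp_all)
  then have "\<ominus>\<^sub>H \<phi> \<one>\<^sub>H Z = \<zero>\<^sub>H" using e[of "\<one>\<^sub>H" "\<one>\<^sub>H" Z] Z mu_one(1)[OF Z] by simp
  then show "\<phi> \<one>\<^sub>H Z = \<zero>\<^sub>H" using H.A.minus_minus[OF D(1)[OF H.A.one_closed Z]] by simp
  have "\<phi> Z \<one>\<^sub>H = hoch_d \<phi> Z \<one>\<^sub>H \<one>\<^sub>H"
    unfolding hoch_d_def by (insert Z D(1)[OF Z H.A.one_closed], simp add: z,
      (rule H.A.ag)+, simp_all)
  then show "\<phi> Z \<one>\<^sub>H = \<zero>\<^sub>H" using e[of Z "\<one>\<^sub>H" "\<one>\<^sub>H"] Z mu_one(2)[OF Z] by simp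
qed

lemma hoch_d_add:
  assumes "bilin \<phi>" "X \<in> CH" "Y \<in> CH" "Z \<in> CH" "U \<in> CH"
  shows "hoch_d \<phi> (X \<oplus>\<^sub>H U) Y Z = hoch_d \<phi> X Y Z \<oplus>\<^sub>H hoch_d \<phi> U Y Z"
    "hoch_d \<phi> X (Y \<oplus>\<^sub>H U) Z = hoch_d \<phi> X Y Z \<oplus>\<^sub>H hoch_d \<phi> X U Z"
    "hoch_d \<phi> X Y (Z \<oplus>\<^sub>H U) = hoch_d \<phi> X Y Z \<oplus>\<^sub>H hoch_d \<phi> X Y U" unfolding hoch_d_def
  by (insert assms(2-), simp add: bilinD(1-3)[OF assms(1)] H.A.ring_expand H.parity_add,
      (rule H.A.ag)+, simp_all add: bilinD(1)[OF assms(1)])+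

lemma hoch_d_closed:
  "[|bilin \<phi>; X \<in> CH; Y \<in> CH; Z \<in> CH|] ==> hoch_d \<phi> X Y Z \<in> CH"
  by (simp add: hoch_d_def bilinD(1))

lemma primitiveI:
  assumes b: "bilin \<phi>"
    and hom: "!!i j k X Y Z. [|X \<in> piece H i; Y \<in> piece H j; Z \<in> piece H k|]
      ==> mu X Y Z = hoch_d \<phi> X Y Z"
  shows "primitive \<phi>"
proof -
  have 1: "mu X Y Z = hoch_d \<phi> X Y Z" if "X \<in> piece H i" "Y \<in> piece H j" "Z \<in> CH" for X Y Z i j
    using that(3) by (induct rule: H.graded_induct)
      (use that hom in \<open>auto simp: mu_add hoch_d_add[OF b] H.piece_carrier\<close>)
  have 2: "mu X Y Z = hoch_d \<phi> X Y Z" if "X \<in> piece H i" "Y \<in> CH" "Z \<in> CH" for X Y Z i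
    using that(2) by (induct rule: H.graded_induct)
      (use that 1 in \<open>auto simp: mu_add hoch_d_add[OF b] H.piece_carrier\<close>)
  have "mu X Y Z = hoch_d \<phi> X Y Z" if "X \<in> CH" "Y \<in> CH" "Z \<in> CH" for X Y Z
    using that(1) by (induct rule: H.graded_induct)
      (use that 2 in \<open>auto simp: mu_add hoch_d_add[OF b] H.piece_carrier\<close>)
  then show ?thesis using b by (simp add: primitive_def)
qed

section \<open>Normalising a primitive of the Massey cocycle\<close>

text \<open>The graded transpose $\pm\phi(Y, X)$, written without reference to degrees.\<close>

definition transp :: "('a set => 'a set => 'a set) => 'a set => 'a set => 'a set" where
  "transp \<phi> X Y = hf \<odot>\<^sub>H (\<phi> Y (X \<oplus>\<^sub>H parity H X) \<oplus>\<^sub>H \<phi> (parity H Y) (X \<ominus>\<^sub>H parity H X))"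

lemma transp_homogeneous:
  assumes b: "bilin \<phi>" and X: "X \<in> piece H i" and Y: "Y \<in> piece H j"
  shows "transp \<phi> X Y = ksign H (i * j) (\<phi> Y X)"
proof -
  note D = bilinD[OF b]
  have c: "X \<in> CH" "Y \<in> CH" using X Y H.piece_carrier by blast+
  show ?thesis
  proof (cases "even i")
    case True
    then have "parity H X = X" by (simp add: H.parity_homogeneous[OF X] ksign_def)
    then show ?thesis using True c by (simp add: transp_def D bilin_zero[OF b] ksign_def)
  next
    case False
    then have P: "parity H X = \<ominus>\<^sub>H X" by (simp add: H.parity_homogeneous[OF X] ksign_def)
    have "transp \<phi> X Y = hf \<odot>\<^sub>H (\<phi> (parity H Y) X \<oplus>\<^sub>H \<phi> (parity H Y) X)"
      using c by (simp add: transp_def P H.A.r_neg a_minus_def D bilin_zero[OF b])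
    also have "\<dots> = \<phi> (parity H Y) X" using c by (simp add: D)
    also have "\<dots> = ksign H (i * j) (\<phi> Y X)"
      using False c by (simp add: H.parity_homogeneous[OF Y] ksign_def bilin_neg[OF b])
    finally show ?thesis .
  qed
qed

lemma transp_bilin:
  assumes b: "bilin \<phi>" shows "bilin (transp \<phi>)"
proof -
  note D = bilinD[OF b]
  have 1: "transp \<phi> (X \<oplus>\<^sub>H U) Y = transp \<phi> X Y \<oplus>\<^sub>H transp \<phi> U Y"
    if c: "X \<in> CH" "U \<in> CH" "Y \<in> CH" for X U Y
  proof -
    have "X \<oplus>\<^sub>H U \<oplus>\<^sub>H parity H (X \<oplus>\<^sub>H U) = (X \<oplus>\<^sub>H parity H X) \<oplus>\<^sub>H (U \<oplus>\<^sub>H parity H U)"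
      "X \<oplus>\<^sub>H U \<ominus>\<^sub>H parity H (X \<oplus>\<^sub>H U) = (X \<ominus>\<^sub>H parity H X) \<oplus>\<^sub>H (U \<ominus>\<^sub>H parity H U)"
      unfolding H.parity_add[OF c(1,2)] by ((rule H.A.ag)+, insert c, simp_all)+
    then show ?thesis unfolding transp_def using c hf(1)
      by (simp add: D H.smult_r_distr[symmetric] H.A.a_ac)
  qed
  have 2: "transp \<phi> Y (X \<oplus>\<^sub>H U) = transp \<phi> Y X \<oplus>\<^sub>H transp \<phi> Y U"
    if c: "X \<in> CH" "U \<in> CH" "Y \<in> CH" for X U Y
    unfolding transp_def using c hf(1)
    by (simp add: D H.parity_add H.smult_r_distr[symmetric] H.A.a_ac)
  have 3: "transp \<phi> (a \<odot>\<^sub>H X) Y = a \<odot>\<^sub>H transp \<phi> X Y"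
    if c: "X \<in> CH" "a \<in> carrier K" "Y \<in> CH" for X a Y
  proof -
    have "a \<odot>\<^sub>H X \<oplus>\<^sub>H parity H (a \<odot>\<^sub>H X) = a \<odot>\<^sub>H (X \<oplus>\<^sub>H parity H X)"
      "a \<odot>\<^sub>H X \<ominus>\<^sub>H parity H (a \<odot>\<^sub>H X) = a \<odot>\<^sub>H (X \<ominus>\<^sub>H parity H X)"
      using c by (simp_all add: H.parity_smult H.smult_r_distr H.smult_minus)
    then show ?thesis unfolding transp_def using c hf(1)
      by (simp add: D H.smult_r_distr[symmetric] H.smult_assoc1[symmetric] K.m_comm)
  qed
  have 4: "transp \<phi> X (a \<odot>\<^sub>H Y) = a \<odot>\<^sub>H transp \<phi> X Y"
    if c: "X \<in> CH" "a \<in> carrier K" "Y \<in> CH" for X a Y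
    unfolding transp_def using c hf(1)
    by (simp add: D H.parity_smult H.smult_r_distr[symmetric] H.smult_assoc1[symmetric] K.m_comm)
  have 5: "transp \<phi> X Y \<in> piece_pred H (i + j)" if "X \<in> piece H i" "Y \<in> piece H j" for X Y i j
    unfolding transp_homogeneous[OF b that] using D(6)[OF that(2,1)]
      H.piece_pred_minus[OF H.piece_pred_zero D(6)[OF that(2,1)]] D(1)[of Y X] that
    by (auto simp: ksign_def add.commute a_minus_def H.piece_carrier)
  have 6: "transp \<phi> X Y \<in> CH" if "X \<in> CH" "Y \<in> CH" for X Y
    using that hf(1) by (simp add: transp_def D)
  show ?thesis by (simp add: bilin_def 1 2 3 4 5 6)
qed

text \<open>Graded commutativity of \<open>A\<close> makes
  \<open>s (\<iota> X \<otimes> \<iota> Y)\<close> graded symmetric. Reversing the arguments then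
  exchanges the two terms of \<open>mu_f\<close>, which have opposite signs.\<close>

lemma mu_reverse:
  assumes X: "X \<in> piece H i" and Y: "Y \<in> piece H j" and Z: "Z \<in> piece H k"
  shows "mu Z Y X = \<ominus>\<^sub>H ksign H (i * j + j * k + i * k) (mu X Y Z)"
proof -
  have c: "X \<in> CH" "Y \<in> CH" "Z \<in> CH" using X Y Z H.piece_carrier by blast+
  let ?e = "i * j + j * k + i * k"
  define a where "a = \<iota> X" define b where "b = \<iota> Y" define c' where "c' = \<iota> Z"
  have p: "a \<in> piece A i" "b \<in> piece A j" "c' \<in> piece A k"
    using X Y Z iota_piece by (simp_all add: a_def b_def c'_def)
  have pc: "a \<in> carrier A" "b \<in> carrier A" "c' \<in> carrier A" using p piece_carrier by blast+
  define u where "u = s (b \<otimes> c')" define v where "v = s (a \<otimes> b)"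
  have u: "u \<in> piece_pred A (j + k)" "v \<in> piece_pred A (i + j)"
    unfolding u_def v_def by (rule s_piece_pred[OF mult_piece]; rule p)+
  have uc: "u \<in> carrier A" "v \<in> carrier A" using pc by (simp_all add: u_def v_def)
  have sk: "s (ksign A m q) = ksign A m (s q)" if "q \<in> carrier A" for m q
    using that by (simp add: ksign_def s_neg)
  have s1: "s (c' \<otimes> b) = ksign A (k * j) u" "s (b \<otimes> a) = ksign A (j * i) v"
    using graded_comm[OF p(3,2)] graded_comm[OF p(2,1)] pc by (simp_all add: u_def v_def sk)
  have 1: "s (c' \<otimes> b) \<otimes> a = ksign A ?e (parity A a \<otimes> u)" using piece_pred_comm[OF u(1) p(1)] pc uc
    by (simp add: s1 ksign_mult_left) (intro ksign_cong, auto)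
  have "v \<otimes> c' = ksign A ((i + j) * k) (parity A c' \<otimes> v)" by (rule piece_pred_comm[OF u(2) p(3)])
  then have e: "parity A c' \<otimes> v = ksign A ((i + j) * k) (v \<otimes> c')"
    using pc uc by (simp add: ksign_def)
  have 2: "parity A c' \<otimes> s (b \<otimes> a) = ksign A ?e (v \<otimes> c')"
    unfolding s1 ksign_mult_right[OF parity_closed[OF pc(3)] uc(2)] e
      ksign_ksign[OF A.m_closed[OF uc(2) pc(3)]] by (rule ksign_cong) (simp add: algebra_simps)
  have "mu Z Y X = f (ksign A ?e (parity A a \<otimes> u) \<ominus> ksign A ?e (v \<otimes> c'))"
    using mu_f[OF c(3,2,1)] by (simp add: a_def[symmetric] b_def[symmetric] c'_def[symmetric] 1 2)
  also have "\<dots> = f (\<ominus> ksign A ?e (v \<otimes> c' \<ominus> parity A a \<otimes> u))"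
  proof (rule arg_cong[of _ _ f])
    show "ksign A ?e (parity A a \<otimes> u) \<ominus> ksign A ?e (v \<otimes> c')
        = \<ominus> ksign A ?e (v \<otimes> c' \<ominus> parity A a \<otimes> u)"
      unfolding ksign_minus[OF A.m_closed[OF uc(2) pc(3)] A.m_closed[OF parity_closed[OF pc(1)] uc(1)]]
      by ((rule A.ag)+, insert uc pc, simp_all)
  qed
  also have "\<dots> = \<ominus>\<^sub>H ksign H ?e (mu X Y Z)"
    using pc uc mu_f[OF c] by (simp add: f_neg f_ksign a_def b_def c'_def u_def v_def)
  finally show ?thesis .
qed

text \<open>Coboundaries have the same reversal symmetry as \<open>mu\<close>, except that
  \<open>\<phi>\<close> is replaced by its graded transpose. Consequently the transpose of a
  primitive is again a primitive.\<close>

lemma hoch_d_reverse: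
  assumes b: "bilin \<phi>" and X: "X \<in> piece H i" and Y: "Y \<in> piece H j" and Z: "Z \<in> piece H k"
  shows "hoch_d \<phi> Z Y X = \<ominus>\<^sub>H ksign H (i * j + j * k + i * k) (hoch_d (transp \<phi>) X Y Z)"
proof -
  have c: "X \<in> CH" "Y \<in> CH" "Z \<in> CH" using X Y Z H.piece_carrier by blast+
  let ?e = "i * j + j * k + i * k" and ?t = "transp \<phi>"
  note D = bilinD[OF b] and T = bilinD[OF transp_bilin[OF b]]
  have t: "\<phi> V U = ksign H (m * l) (?t U V)" if "U \<in> piece H m" "V \<in> piece H l" for U V m l
    using transp_homogeneous[OF b that] D(1)[of V U] that by (auto simp: ksign_def H.piece_carrier)
  have 1: "\<phi> Z Y \<otimes>\<^sub>H X = ksign H ?e (parity H X \<otimes>\<^sub>H ?t Y Z)"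
    using H.piece_pred_comm[OF T(6)[OF Y Z] X] c T(1)[OF c(2,3)]
    by (simp add: t[OF Y Z] H.ksign_mult_left) (intro H.ksign_cong, auto)
  have "?t X Y \<otimes>\<^sub>H Z = ksign H ((i + j) * k) (parity H Z \<otimes>\<^sub>H ?t X Y)"
    by (rule H.piece_pred_comm[OF T(6)[OF X Y] Z])
  then have e: "parity H Z \<otimes>\<^sub>H ?t X Y = ksign H ((i + j) * k) (?t X Y \<otimes>\<^sub>H Z)"
    using c T(1)[OF c(1,2)] by (simp add: ksign_def)
  have 2: "parity H Z \<otimes>\<^sub>H \<phi> Y X = ksign H ?e (?t X Y \<otimes>\<^sub>H Z)"
    unfolding t[OF X Y] H.ksign_mult_right[OF H.parity_closed[OF c(3)] T(1)[OF c(1,2)]] e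
      H.ksign_ksign[OF H.A.m_closed[OF T(1)[OF c(1,2)] c(3)]]
    by (rule H.ksign_cong) (simp add: algebra_simps)
  have zy: "Z \<otimes>\<^sub>H Y = ksign H (k * j) (Y \<otimes>\<^sub>H Z)" "Y \<otimes>\<^sub>H X = ksign H (j * i) (X \<otimes>\<^sub>H Y)"
    by (rule H.graded_comm[OF Z Y], rule H.graded_comm[OF Y X])
  have tk: "?t U (ksign H m V) = ksign H m (?t U V)" "?t (ksign H m V) U = ksign H m (?t V U)"
    if "U \<in> CH" "V \<in> CH" for U V m
    using that bilin_neg[OF transp_bilin[OF b]] by (simp_all add: ksign_def)
  have 3: "\<phi> (Z \<otimes>\<^sub>H Y) X = ksign H ?e (?t X (Y \<otimes>\<^sub>H Z))"
    unfolding t[OF X H.mult_piece[OF Z Y]] unfolding zy(1) using c T(1)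
    by (simp add: tk) (intro H.ksign_cong, auto)
  have 4: "\<phi> Z (Y \<otimes>\<^sub>H X) = ksign H ?e (?t (X \<otimes>\<^sub>H Y) Z)"
    unfolding t[OF H.mult_piece[OF Y X] Z] unfolding zy(2) using c T(1)
    by (simp add: tk) (intro H.ksign_cong, auto)
  have cl: "parity H X \<otimes>\<^sub>H ?t Y Z \<in> CH" "?t X Y \<otimes>\<^sub>H Z \<in> CH"
    "?t X (Y \<otimes>\<^sub>H Z) \<in> CH" "?t (X \<otimes>\<^sub>H Y) Z \<in> CH" using c T(1) by simp_all
  show ?thesis unfolding hoch_d_def 1 2 3 4 by (insert cl, simp add: H.ksign_add H.ksign_minus,
        (rule H.A.ag)+, simp_all)
qed

lemma transp_primitive:
  assumes p: "primitive \<phi>" shows "primitive (transp \<phi>)"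
proof (rule primitiveI)
  have b: "bilin \<phi>" and e: "!!X Y Z. [|X \<in> CH; Y \<in> CH; Z \<in> CH|] ==> mu X Y Z = hoch_d \<phi> X Y Z"
    using p by (simp_all add: primitive_def)
  show t: "bilin (transp \<phi>)" by (rule transp_bilin[OF b])
  fix i j k X Y Z assume h: "X \<in> piece H i" "Y \<in> piece H j" "Z \<in> piece H k"
  have c: "X \<in> CH" "Y \<in> CH" "Z \<in> CH" using h H.piece_carrier by blast+
  have m: "mu X Y Z \<in> CH" "hoch_d (transp \<phi>) X Y Z \<in> CH"
    using c hoch_d_closed[OF t] by simp_all
  let ?e = "i * j + j * k + i * k"
  have "\<ominus>\<^sub>H ksign H ?e (mu X Y Z) = \<ominus>\<^sub>H ksign H ?e (hoch_d (transp \<phi>) X Y Z)"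
    using e[OF c(3,2,1)] mu_reverse[OF h] hoch_d_reverse[OF b h] by simp
  from arg_cong[OF this, of "a_inv H"]
  have "ksign H ?e (mu X Y Z) = ksign H ?e (hoch_d (transp \<phi>) X Y Z)"
    by (simp add: H.A.minus_minus[OF H.ksign_closed[OF m(1)]] H.A.minus_minus[OF H.ksign_closed[OF m(2)]])
  then show "mu X Y Z = hoch_d (transp \<phi>) X Y Z" using H.ksign_inj[OF m] by blast
qed

text \<open>The average of \<open>\<phi>\<close> and its transpose. It is again a primitive because
  the coboundary is linear in \<open>\<phi>\<close>.\<close>

lemma symmetric_primitive:
  assumes p: "primitive \<phi>" obtains \<phi>' where "primitive \<phi>'" "symm \<phi>'"
proof -
  note q = transp_primitive[OF p]
  let ?t = "transp \<phi>"
  have b: "bilin \<phi>" "bilin ?t" using p q by (simp_all add: primitive_def)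
  have e: "mu X Y Z = hoch_d \<phi> X Y Z" "mu X Y Z = hoch_d ?t X Y Z"
    if "X \<in> CH" "Y \<in> CH" "Z \<in> CH" for X Y Z
    using p q that by (simp_all add: primitive_def)
  note D = bilinD[OF b(1)] and T = bilinD[OF b(2)]
  define \<phi>' where "\<phi>' X Y = hf \<odot>\<^sub>H (\<phi> X Y \<oplus>\<^sub>H ?t X Y)" for X Y
  have b': "bilin \<phi>'" unfolding bilin_def \<phi>'_def using hf(1)
    by (auto simp: D T H.smult_r_distr[symmetric] H.A.a_ac H.smult_assoc1[symmetric] K.m_comm
        intro!: H.piece_pred_smult H.piece_pred_add)
  have "mu X Y Z = hoch_d \<phi>' X Y Z" if c: "X \<in> CH" "Y \<in> CH" "Z \<in> CH" for X Y Z
  proof -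
    have "hf \<odot>\<^sub>H (hoch_d \<phi> X Y Z \<oplus>\<^sub>H hoch_d ?t X Y Z) = hoch_d \<phi>' X Y Z" unfolding hoch_d_def \<phi>'_def
      by (insert c hf(1), simp add: D(1) T(1) H.smult_r_distr H.smult_minus H.A.ring_expand
          H.smult_mult_left H.smult_mult_right, (rule H.A.ag)+,
          simp_all add: D(1) T(1))
    then show ?thesis using e[OF c, symmetric] c by simp
  qed
  then have 1: "primitive \<phi>'" using b' by (simp add: primitive_def)
  have "symm \<phi>'" unfolding symm_def
  proof (intro allI ballI)
    fix i j X Y assume h: "X \<in> piece H i" "Y \<in> piece H j"
    have c: "X \<in> CH" "Y \<in> CH" using h H.piece_carrier by blast+
    show "\<phi>' Y X = ksign H (i * j) (\<phi>' X Y)"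
      unfolding \<phi>'_def transp_homogeneous[OF b(1) h] transp_homogeneous[OF b(1) h(2,1)]
      using c hf(1) D(1)[OF c] D(1)[OF c(2,1)]
      by (simp add: H.ksign_smult H.ksign_add mult.commute) (simp add: ksign_def H.A.a_comm)
  qed
  then show ?thesis using that 1 by blast
qed

text \<open>
  The degree \<open>n\<close> component of a symmetric primitive is removed by adding the coboundary of the map
  \<open>\<psi>\<close> with $\int \psi(X) Y = -\frac{1}{2} \int \phi(X, Y)$.
\<close>

lemma normalised_primitive:
  assumes p: "primitive \<phi>" and sy: "symm \<phi>"
  obtains \<phi>' where "primitive \<phi>'" "symm \<phi>'"
    "!!X Y. [|X \<in> CH; Y \<in> CH|] ==> JH (\<phi>' X Y) = \<zero>\<^sub>K"
proof -
  have b: "bilin \<phi>" and e: "!!X Y Z. [|X \<in> CH; Y \<in> CH; Z \<in> CH|] ==> mu X Y Z = hoch_d \<phi> X Y Z"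
    using p by (simp_all add: primitive_def)
  note D = bilinD[OF b]
  \<comment> \<open>One half, because both \<open>\<psi> X \<otimes> Y\<close> and
    \<open>parity H X \<otimes> \<psi> Y\<close> will contribute this amount to the integral of the
    coboundary.\<close>
  define l where "l X Y = \<ominus>\<^sub>K (hf \<otimes>\<^sub>K JH (\<phi> X Y))" for X Y
  have lc [simp]: "l X Y \<in> carrier K" if "X \<in> CH" "Y \<in> CH" for X Y
    using that hf(1) D(1) by (simp add: l_def)
  have l_add: "l X (Y \<oplus>\<^sub>H Z) = l X Y \<oplus>\<^sub>K l X Z" "l (Y \<oplus>\<^sub>H Z) X = l Y X \<oplus>\<^sub>K l Z X"
    if "X \<in> CH" "Y \<in> CH" "Z \<in> CH" for X Y Z
    using that hf(1) by (simp_all add: l_def D JH_add K.r_distr K.minus_add)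
  have l_smult: "l X (a \<odot>\<^sub>H Y) = a \<otimes>\<^sub>K l X Y" "l (a \<odot>\<^sub>H Y) X = a \<otimes>\<^sub>K l Y X"
    if "X \<in> CH" "Y \<in> CH" "a \<in> carrier K" for X Y a
    using that hf(1) by (simp_all add: l_def D JH_smult K.m_lcomm K.r_minus)
  define \<psi> where "\<psi> X = (THE v. v \<in> CH \<and> (\<forall>Y\<in>carrier H. JH (v \<otimes>\<^sub>H Y) = l X Y))" for X
  have psi: "\<psi> X \<in> CH" "!!Y. Y \<in> CH ==> JH (\<psi> X \<otimes>\<^sub>H Y) = l X Y"
    if X: "X \<in> CH" for X
  proof -
    have "\<exists>!v. v \<in> CH \<and> (\<forall>Y\<in>carrier H. JH (v \<otimes>\<^sub>H Y) = l X Y)"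
      by (rule dual_left) (use X l_add l_smult in auto)
    from theI'[OF this] show "\<psi> X \<in> CH" "!!Y. Y \<in> CH ==> JH (\<psi> X \<otimes>\<^sub>H Y) = l X Y"
      by (auto simp: \<psi>_def)
  qed
  have psi_add: "\<psi> (X \<oplus>\<^sub>H Y) = \<psi> X \<oplus>\<^sub>H \<psi> Y" if "X \<in> CH" "Y \<in> CH" for X Y
    by (rule JH_eqI) (use that psi l_add in \<open>auto simp: H.A.l_distr JH_add\<close>)
  have psi_smult: "\<psi> (a \<odot>\<^sub>H X) = a \<odot>\<^sub>H \<psi> X" if "X \<in> CH" "a \<in> carrier K" for X a
    by (rule JH_eqI) (use that psi l_smult in \<open>auto simp: H.smult_mult_left JH_smult\<close>)
  have psi_neg: "\<psi> (\<ominus>\<^sub>H X) = \<ominus>\<^sub>H \<psi> X" if "X \<in> CH" for X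
    using psi_smult[OF that, of "\<ominus>\<^sub>K \<one>\<^sub>K"] that psi(1)[OF that]
      H.smult_l_minus[OF K.one_closed that] H.smult_l_minus[OF K.one_closed psi(1)[OF that]] by simp
  have comp_J: "JH (component H k u \<otimes>\<^sub>H Y) = JH (u \<otimes>\<^sub>H Y)"
    if "u \<in> CH" "Y \<in> piece H j" "k + j = n" for u Y j k using that(1)
  proof (induct rule: H.graded_induct)
    case (piece m u)
    have Yc: "Y \<in> CH" using that H.piece_carrier by blast
    show ?case
    proof (cases "k = m")
      case False
      then show ?thesis
        using JH_piece[OF H.mult_piece[OF piece that(2)]] that(3) Yc H.component_of_piece[OF piece, of k]
        by simp
    qed (use piece in simp)
  next
    case (add u v)
    then show ?case using H.piece_carrier[OF that(2)] by (simp add: H.component_add H.A.l_distr JH_add)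
  qed
  \<comment> \<open>The component of degree \<open>k\<close> is tested against degree
    \<open>n - k\<close>. There \<open>\<phi> X Y\<close> has degree \<open>i + (n - k) - 1\<close>,
    which differs from \<open>n\<close> unless \<open>Suc k = i\<close>.\<close>
  have psi_comp: "component H k (\<psi> X) = \<zero>\<^sub>H" if X: "X \<in> piece H i" and k: "Suc k \<noteq> i" for X i k
  proof (rule JH_zeroI)
    have Xc: "X \<in> CH" by (rule H.piece_carrier[OF X])
    show cc: "component H k (\<psi> X) \<in> CH" using psi(1)[OF Xc] by simp
    fix j Y assume Y: "Y \<in> piece H j"
    have Yc: "Y \<in> CH" by (rule H.piece_carrier[OF Y])
    show "JH (component H k (\<psi> X) \<otimes>\<^sub>H Y) = \<zero>\<^sub>K"
    proof (cases "k + j = n")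
      case True
      have "JH (\<phi> X Y) = \<zero>\<^sub>K" using JH_pred[OF D(6)[OF X Y]] True k by simp
      then have "l X Y = \<zero>\<^sub>K" using hf(1) by (simp add: l_def)
      then show ?thesis using comp_J[OF psi(1)[OF Xc] Y True] psi(2)[OF Xc Yc] by simp
    next
      case False
      then show ?thesis
        using JH_piece[OF H.mult_piece[OF H.component_piece[OF psi(1)[OF Xc]] Y]] by simp
    qed
  qed
  have psi_piece: "\<psi> X \<in> piece_pred H i" if X: "X \<in> piece H i" for X i
  proof -
    have Xc: "X \<in> CH" by (rule H.piece_carrier[OF X])
    show ?thesis
    proof (cases i)
      case 0
      then have "\<psi> X = \<zero>\<^sub>H"
        by (intro H.component_eqI[OF psi(1)[OF Xc] H.A.zero_closed]) (simp add: psi_comp[OF X])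
      then show ?thesis by (simp add: H.piece_pred_zero)
    next
      case (Suc k)
      then have "\<psi> X \<in> piece H k" by (intro H.pieceI[OF psi(1)[OF Xc]]) (simp add: psi_comp[OF X])
      then show ?thesis using Suc by (simp add: piece_pred_def)
    qed
  qed
  \<comment> \<open>The Hochschild coboundary of the linear map \<open>\<psi>\<close> of degree -1.
    \<open>Delta_d\<close> below is the vanishing of the squared Hochschild differential.\<close>
  define \<Delta> where "\<Delta> X Y = \<psi> X \<otimes>\<^sub>H Y \<oplus>\<^sub>H parity H X \<otimes>\<^sub>H \<psi> Y \<ominus>\<^sub>H \<psi> (X \<otimes>\<^sub>H Y)" for X Y
  have Delta_closed [simp]: "\<Delta> X Y \<in> CH" if "X \<in> CH" "Y \<in> CH" for X Y
    using that psi(1) by (simp add: \<Delta>_def)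
  have Delta_add: "\<Delta> (X \<oplus>\<^sub>H U) Y = \<Delta> X Y \<oplus>\<^sub>H \<Delta> U Y" "\<Delta> Y (X \<oplus>\<^sub>H U) = \<Delta> Y X \<oplus>\<^sub>H \<Delta> Y U"
    if "X \<in> CH" "U \<in> CH" "Y \<in> CH" for X U Y unfolding \<Delta>_def
    by (insert that, simp add: psi_add H.parity_add H.A.ring_expand psi(1),
        (rule H.A.ag)+, simp_all add: psi(1))+
  have Delta_smult: "\<Delta> (a \<odot>\<^sub>H X) Y = a \<odot>\<^sub>H \<Delta> X Y" "\<Delta> X (a \<odot>\<^sub>H Y) = a \<odot>\<^sub>H \<Delta> X Y"
    if "X \<in> CH" "Y \<in> CH" "a \<in> carrier K" for X Y a
    using that by (simp_all add: \<Delta>_def psi_smult H.parity_smult H.smult_mult_left H.smult_mult_right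
        H.smult_r_distr H.smult_minus psi(1))
  have Delta_piece: "\<Delta> X Y \<in> piece_pred H (i + j)" if h: "X \<in> piece H i" "Y \<in> piece H j" for X Y i j
    unfolding \<Delta>_def by (intro H.piece_pred_minus H.piece_pred_add psi_piece H.mult_piece h
        H.piece_pred_mult_right[OF psi_piece[OF h(1)] h(2) refl]
        H.piece_pred_mult_left[OF H.parity_piece[OF h(1)] psi_piece[OF h(2)] refl])
  have Delta_d: "hoch_d \<Delta> X Y Z = \<zero>\<^sub>H" if "X \<in> CH" "Y \<in> CH" "Z \<in> CH" for X Y Z
    unfolding hoch_d_def \<Delta>_def by (insert that, simp add: H.A.ring_expand H.parity_mult psi(1),
        (rule H.A.ag)+, simp_all add: psi(1))
  have Delta_swap: "parity H X \<otimes>\<^sub>H \<psi> Y = ksign H (i * j) (\<psi> Y \<otimes>\<^sub>H X)"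
    if h: "X \<in> piece H i" "Y \<in> piece H j" for X Y i j
    using H.piece_pred_comm[OF psi_piece[OF h(2)] h(1)] H.piece_carrier[OF h(1)]
      psi(1)[OF H.piece_carrier[OF h(2)]] by (auto simp: ksign_def)
  have Delta_sym: "\<Delta> Y X = ksign H (i * j) (\<Delta> X Y)" if h: "X \<in> piece H i" "Y \<in> piece H j" for X Y i j
  proof -
    have c: "X \<in> CH" "Y \<in> CH" using h H.piece_carrier by blast+
    have 1: "\<psi> (Y \<otimes>\<^sub>H X) = ksign H (i * j) (\<psi> (X \<otimes>\<^sub>H Y))"
      using H.graded_comm[OF h(2,1)] c by (simp add: ksign_def psi_neg)
    show ?thesis
    proof (cases "even (i * j)")
      case True
      then have 2: "ksign H (i * j) u = u" "ksign H (j * i) u = u" for u by (auto simp: ksign_def)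
      show ?thesis unfolding \<Delta>_def Delta_swap[OF h] Delta_swap[OF h(2,1)] 1 2
        by ((rule H.A.ag)+, insert c psi(1), simp_all)
    next
      case False
      then have 2: "ksign H (i * j) u = \<ominus>\<^sub>H u" "ksign H (j * i) u = \<ominus>\<^sub>H u" for u
        by (simp_all add: ksign_def)
      show ?thesis unfolding \<Delta>_def Delta_swap[OF h] Delta_swap[OF h(2,1)] 1 2
        by ((rule H.A.ag)+, insert c psi(1), simp_all)
    qed
  qed
  \<comment> \<open>Swapping the two factors costs the same sign as swapping the arguments of the
    symmetric \<open>\<phi>\<close>, so the second product integrates to the same value as the
    first.\<close>
  have J1: "JH (parity H X \<otimes>\<^sub>H \<psi> Y) = l X Y" if "X \<in> CH" "Y \<in> CH" for X Y
  proof -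
    have hom: "JH (parity H X \<otimes>\<^sub>H \<psi> Y) = l X Y" if h: "X \<in> piece H i" "Y \<in> piece H j" for X Y i j
    proof -
      have c: "X \<in> CH" "Y \<in> CH" using h H.piece_carrier by blast+
      have sw: "\<phi> Y X = ksign H (i * j) (\<phi> X Y)" using sy h unfolding symm_def by blast
      show ?thesis unfolding Delta_swap[OF h]
        using psi(2)[OF c(2,1)] c hf(1) psi(1)[OF c(2)] D(1)[OF c]
        by (auto simp: l_def sw ksign_def JH_neg K.r_minus)
    qed
    have 1: "JH (parity H X \<otimes>\<^sub>H \<psi> Y) = l X Y" if h: "X \<in> piece H i" "Y \<in> CH" for X Y i
      using h(2) by (induct rule: H.graded_induct)
        (use h hom in \<open>auto simp: psi_add psi(1) H.A.r_distr JH_add l_add H.piece_carrier\<close>)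
    show ?thesis using that(1) by (induct rule: H.graded_induct)
        (use that 1 in \<open>auto simp: H.parity_add psi(1) H.A.l_distr JH_add l_add\<close>)
  qed
  \<comment> \<open>This integral is \<open>l\<close> at \<open>X\<close> and the unit, and a
    primitive vanishes on the unit. Hence the third term of \<open>\<Delta>\<close> contributes
    nothing.\<close>
  have J2: "JH (\<psi> X) = \<zero>\<^sub>K" if "X \<in> CH" for X
    using psi(2)[OF that H.A.one_closed] psi(1)[OF that] primitive_one(2)[OF p that] hf(1)
    by (simp add: l_def)
  have J_Delta: "JH (\<Delta> X Y) = \<ominus>\<^sub>K JH (\<phi> X Y)" if c: "X \<in> CH" "Y \<in> CH" for X Y
  proof -
    have "JH (\<Delta> X Y) = l X Y \<oplus>\<^sub>K l X Y" using c psi(1) psi(2)[OF c] J1[OF c] J2[of "X \<otimes>\<^sub>H Y"]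
      by (simp add: \<Delta>_def a_minus_def JH_add JH_neg)
    also have "\<dots> = \<ominus>\<^sub>K JH (\<phi> X Y)"
      using hf_double_K[of "JH (\<phi> X Y)"] D(1)[OF c] hf(1) by (simp add: l_def K.minus_add[symmetric])
    finally show ?thesis .
  qed
  define \<phi>' where "\<phi>' X Y = \<phi> X Y \<oplus>\<^sub>H \<Delta> X Y" for X Y
  have "bilin \<phi>'" unfolding bilin_def \<phi>'_def
    by (auto simp: D Delta_add Delta_smult H.smult_r_distr H.A.a_ac Delta_piece
        intro!: H.piece_pred_add)
  moreover have "mu X Y Z = hoch_d \<phi>' X Y Z" if c: "X \<in> CH" "Y \<in> CH" "Z \<in> CH" for X Y Z
  proof -
    have "hoch_d \<phi>' X Y Z = hoch_d \<phi> X Y Z \<oplus>\<^sub>H hoch_d \<Delta> X Y Z" unfolding hoch_d_def \<phi>'_def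
      by (insert c, simp add: D(1) H.A.ring_expand, (rule H.A.ag)+, simp_all add: D(1))
    then show ?thesis using e[OF c] Delta_d[OF c] hoch_d_closed[OF b c] by simp
  qed
  ultimately have 1: "primitive \<phi>'" by (simp add: primitive_def)
  have 2: "symm \<phi>'" unfolding symm_def
  proof (intro allI ballI)
    fix i j X Y assume h: "X \<in> piece H i" "Y \<in> piece H j"
    have c: "X \<in> CH" "Y \<in> CH" using h H.piece_carrier by blast+
    have "\<phi> Y X = ksign H (i * j) (\<phi> X Y)" using sy h unfolding symm_def by blast
    then show "\<phi>' Y X = ksign H (i * j) (\<phi>' X Y)"
      using Delta_sym[OF h] D(1)[OF c] c by (simp add: \<phi>'_def H.ksign_add)
  qed
  have 3: "JH (\<phi>' X Y) = \<zero>\<^sub>K" if "X \<in> CH" "Y \<in> CH" for X Y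
    using that D(1)[OF that] by (simp add: \<phi>'_def JH_add J_Delta K.r_neg)
  show ?thesis by (rule that[OF 1 2 3])
qed

end

section \<open>An A-infinity map from the algebra to its cohomology\<close>

context conn_hodge
begin

lemma n_lt: "n < 5 * r - 2" using dim r by simp

lemma f_filt_high: "[|q \<in> filt m; 5 * r - 2 \<le> m|] ==> f q = \<zero>\<^sub>H"
  using filt_above[of q m] n_lt by simp

text \<open>The bound on \<open>n\<close> puts \<open>4 * r - 2\<close> above \<open>n - r\<close>,
  so the integral alone decides.\<close>

lemma f_filt_J: "[|q \<in> filt m; 4 * r - 2 \<le> m; J q = \<zero>\<^sub>K|] ==> f q = \<zero>\<^sub>H"
  by (rule f_filt_top) (use n_lt in auto)

lemma f_Bs_Bs:
  "[|b \<in> Bs; b' \<in> Bs; b \<in> filt (2 * r - 1); b' \<in> filt (2 * r - 1)|] ==> f (b \<otimes> b') = \<zero>\<^sub>H"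
  by (rule f_filt_J[OF filt_mult]) (use J_Bs_Bs r in auto)

lemma f_Bs_Hs:
  "[|b \<in> Bs; y \<in> Hs; b \<in> filt m; y \<in> filt k; 4 * r - 2 \<le> m + k|] ==> f (b \<otimes> y) = \<zero>\<^sub>H"
  by (rule f_filt_J[OF filt_mult]) (use J_Bs_Hs in auto)

lemma f_Hs_Bs:
  "[|b \<in> Bs; y \<in> Hs; b \<in> filt m; y \<in> filt k; 4 * r - 2 \<le> m + k|] ==> f (y \<otimes> b) = \<zero>\<^sub>H"
  by (rule f_filt_J[OF filt_mult[of _ k _ m]]) (use J_Hs_Bs in auto)

text \<open>Integration by parts: \<open>f\<close> annihilates
  \<open>d (u \<otimes> v)\<close>.\<close>

lemma f_diff_mult:
  assumes "u \<in> carrier A" "v \<in> carrier A"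
  shows "f (d u \<otimes> v) = \<ominus>\<^sub>H f (parity A u \<otimes> d v)"
proof -
  have "f (d u \<otimes> v) \<oplus>\<^sub>H f (parity A u \<otimes> d v) = \<zero>\<^sub>H"
    using f_diff[of "u \<otimes> v"] assms by (simp add: diff_mult f_add)
  then show ?thesis using assms by (intro H.A.minus_equality[symmetric]) auto
qed

lemma f_mult_diff:
  assumes "u \<in> carrier A" "v \<in> carrier A"
  shows "f (u \<otimes> d v) = f (parity A (d u) \<otimes> v)"
  using f_diff_mult[of "parity A u" v] assms by (simp add: parity_diff A.l_minus f_neg)

lemma f_exact_Hs:
  assumes "e \<in> boundaries A" "y \<in> Hs" shows "f (e \<otimes> y) = \<zero>\<^sub>H" "f (y \<otimes> e) = \<zero>\<^sub>H"
proof -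
  obtain u where u: "u \<in> carrier A" "e = d u" using boundariesE[OF assms(1)] .
  show "f (e \<otimes> y) = \<zero>\<^sub>H" using u assms(2) by (simp add: f_diff_mult)
  show "f (y \<otimes> e) = \<zero>\<^sub>H" using u assms(2) by (simp add: f_mult_diff)
qed

lemma f_exact_exact:
  assumes "e \<in> boundaries A" "e' \<in> boundaries A" shows "f (e \<otimes> e') = \<zero>\<^sub>H"
proof -
  obtain u where u: "u \<in> carrier A" "e = d u" using boundariesE[OF assms(1)] .
  then show ?thesis using assms(2) boundaries_cocycles[of e'] by (simp add: f_diff_mult cocycles_iff)
qed

text \<open>In high total degree \<open>f\<close> is linear over harmonic elements: the exact part
  of \<open>u\<close> gives an exact product, and the part in \<open>Bs\<close> gives a product
  whose integral is zero.\<close>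

lemma f_mult_right:
  assumes u: "u \<in> filt m" and y: "y \<in> Hs" "y \<in> filt k" and mk: "4 * r - 2 \<le> m + k"
  shows "f (u \<otimes> y) = f u \<otimes>\<^sub>H f y"
proof -
  have uc: "u \<in> carrier A" by (rule filt_carrier[OF u])
  note p = parts[OF uc] and pf = parts_filt[OF u]
  have "f (u \<otimes> y) = f ((pE u \<oplus> pH u \<oplus> pB u) \<otimes> y)" by (subst p(4)) (rule refl)
  also have "\<dots> = f (pH u \<otimes> y)"
    using p(1-3) y uc f_exact_Hs(1)[OF p(1) y(1)] f_Bs_Hs[OF p(3) y(1) pf(3) y(2) mk]
    by (simp add: A.l_distr f_add)
  also have "\<dots> = f u \<otimes>\<^sub>H f y" using f_mult_Hs[OF p(2) y(1)] uc by simp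
  finally show ?thesis .
qed

lemma f_mult_left:
  assumes u: "u \<in> filt m" and y: "y \<in> Hs" "y \<in> filt k" and mk: "4 * r - 2 \<le> m + k"
  shows "f (y \<otimes> u) = f y \<otimes>\<^sub>H f u"
proof -
  have uc: "u \<in> carrier A" by (rule filt_carrier[OF u])
  note p = parts[OF uc] and pf = parts_filt[OF u]
  have "f (y \<otimes> u) = f (y \<otimes> (pE u \<oplus> pH u \<oplus> pB u))" by (subst p(4)) (rule refl)
  also have "\<dots> = f (y \<otimes> pH u)"
    using p(1-3) y uc f_exact_Hs(2)[OF p(1) y(1)] f_Hs_Bs[OF p(3) y(1) pf(3) y(2) mk]
    by (simp add: A.r_distr f_add)
  also have "\<dots> = f y \<otimes>\<^sub>H f u" using f_mult_Hs[OF y(1) p(2)] uc by simp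
  finally show ?thesis .
qed

definition f2 :: "'a => 'a => 'a set" where
  "f2 q q' = f (s q \<otimes> q') \<oplus>\<^sub>H f (parity A (pH q) \<otimes> s q')"

lemma f2_closed [simp]: "[|q \<in> carrier A; q' \<in> carrier A|] ==> f2 q q' \<in> CH"
  by (simp add: f2_def)

lemma f2_add:
  assumes "q \<in> carrier A" "q' \<in> carrier A" "p \<in> carrier A"
  shows "f2 (q \<oplus> p) q' = f2 q q' \<oplus>\<^sub>H f2 p q'" "f2 q' (q \<oplus> p) = f2 q' q \<oplus>\<^sub>H f2 q' p"
  using assms by (simp_all add: f2_def s_add parts_add parity_add f_add A.l_distr A.r_distr H.A.a_ac)

lemma f2_smult:
  assumes "q \<in> carrier A" "q' \<in> carrier A" "a \<in> carrier K"
  shows "f2 (a \<odot> q) q' = a \<odot>\<^sub>H f2 q q'" "f2 q' (a \<odot> q) = a \<odot>\<^sub>H f2 q' q"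
  using assms by (simp_all add: f2_def s_smult parts_smult parity_smult smult_mult_left
      smult_mult_right f_smult H.smult_r_distr)

lemma f2_neg: "[|q \<in> carrier A; q' \<in> carrier A|] ==> f2 (\<ominus> q) q' = \<ominus>\<^sub>H f2 q q'"
  by (simp add: f2_def s_neg parts_neg parity_neg A.l_minus f_neg H.A.minus_add)

lemma f2_one [simp]:
  assumes "q \<in> carrier A" shows "f2 \<one> q = \<zero>\<^sub>H" "f2 q \<one> = \<zero>\<^sub>H"
  using assms one_Hs by (simp_all add: f2_def s_Bs)

lemma f2_piece:
  assumes q: "q \<in> piece A i" "q' \<in> piece A j" shows "f2 q q' \<in> piece_pred H (i + j)"
  unfolding f2_def
  by (intro H.piece_pred_add f_pred piece_pred_mult_right[OF s_piece_pred[OF q(1)] q(2) refl]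
      piece_pred_mult_left[OF parity_piece[OF parts_piece(2)[OF q(1)]] s_piece_pred[OF q(2)] refl])

text \<open>The second relation of an A-infinity morphism. Decompose both factors: the product of
  the harmonic parts gives the first term, and \<open>f\<close> annihilates exact times closed
  elements. \<open>f2 (d q) q'\<close> collects what involves \<open>pB q\<close>, and the last term
  what involves \<open>pB q'\<close> and the closed parts of \<open>q\<close>.\<close>

lemma f_mult:
  assumes q: "q \<in> carrier A" "q' \<in> carrier A"
  shows "f (q \<otimes> q') = f q \<otimes>\<^sub>H f q' \<oplus>\<^sub>H f2 (d q) q' \<oplus>\<^sub>H f2 (parity A q) (d q')"
proof -
  note p = parts[OF q(1)] and p' = parts[OF q(2)]
  have 1: "f2 (d q) q' = f (pB q \<otimes> q')" using q boundaries_diff[of q] by (simp add: f2_def s_diff)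
  have sv: "s (parity A q) = \<ominus> parity A (s q)" using parity_s[OF q(1)] q by simp
  have "f (s (parity A q) \<otimes> d q') = \<ominus>\<^sub>H f (parity A (s q) \<otimes> d (pB q'))"
    using q pE_diff[OF q(2)] by (simp add: sv A.l_minus f_neg)
  also have "\<dots> = f (pE q \<otimes> pB q')" using f_diff_mult[of "s q" "pB q'"] q by (simp add: diff_s)
  finally have 2: "f2 (parity A q) (d q') = f (pE q \<otimes> pB q') \<oplus>\<^sub>H f (pH q \<otimes> pB q')"
    using q by (simp add: f2_def s_diff parts_parity)
  have "f (q \<otimes> q') = f ((pE q \<oplus> pH q \<oplus> pB q) \<otimes> q')" by (subst p(4)) (rule refl)
  also have "\<dots> = f (pE q \<otimes> q') \<oplus>\<^sub>H f (pH q \<otimes> q') \<oplus>\<^sub>H f (pB q \<otimes> q')"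
    using q by (simp add: A.l_distr f_add)
  also have "f (pE q \<otimes> q') = f (pE q \<otimes> (pE q' \<oplus> pH q' \<oplus> pB q'))" by (subst p'(4)) (rule refl)
  also have "\<dots> = f (pE q \<otimes> pB q')"
    using q f_exact_exact[OF p(1) p'(1)] f_exact_Hs(1)[OF p(1) p'(2)] by (simp add: A.r_distr f_add)
  also have "f (pH q \<otimes> q') = f (pH q \<otimes> (pE q' \<oplus> pH q' \<oplus> pB q'))" by (subst p'(4)) (rule refl)
  also have "\<dots> = f q \<otimes>\<^sub>H f q' \<oplus>\<^sub>H f (pH q \<otimes> pB q')"
    using q f_exact_Hs(2)[OF p'(1) p(2)] f_mult_Hs[OF p(2) p'(2)] by (simp add: A.r_distr f_add)
  finally show ?thesis unfolding 1 2 by (simp only:) ((rule H.A.ag)+, insert q, simp_all)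
qed

text \<open>Harmonic parts are unrestricted, so all classes are still represented, and exact
  elements of \<open>A2\<close> keep their primitives \<open>s q\<close> inside. The cut-offs are
  the degrees of a product of two classes of degree at least \<open>r\<close> and of its primitive;
  they make \<open>A2\<close> closed under products.\<close>

definition A2 :: "'a set" where
  "A2 = {q \<in> carrier A. pE q \<in> filt (2 * r) \<and> pB q \<in> filt (2 * r - 1)}"

definition Ap :: "'a set" where "Ap = A2 \<inter> filt r"

lemma A2D:
  assumes "q \<in> A2" shows "q \<in> carrier A" "pE q \<in> filt (2 * r)" "pB q \<in> filt (2 * r - 1)"
  using assms by (simp_all add: A2_def)

lemma A2I: "[|q \<in> carrier A; pE q \<in> filt (2 * r); pB q \<in> filt (2 * r - 1)|] ==> q \<in> A2"
  by (simp add: A2_def)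

lemma A2_carrier [simp]: "q \<in> A2 ==> q \<in> carrier A" by (rule A2D(1))
lemma Ap_carrier [simp]: "q \<in> Ap ==> q \<in> carrier A" by (simp add: Ap_def)
lemma Ap_A2: "q \<in> Ap ==> q \<in> A2" by (simp add: Ap_def)
lemma Ap_filt: "q \<in> Ap ==> q \<in> filt r" by (simp add: Ap_def)

lemma A2_s: "q \<in> A2 ==> s q \<in> filt (2 * r - 1)"
  using s_filt[of "pE q" "2 * r - 1"] A2D(2)[of q] r by (simp add: s_pE)

lemma A2_rest:
  assumes "q \<in> A2" shows "q \<ominus> pH q \<in> filt (2 * r - 1)"
proof -
  have q: "q \<in> carrier A" "pE q \<in> filt (2 * r)" "pB q \<in> filt (2 * r - 1)" using assms by (rule A2D)+
  have "q \<ominus> pH q = (pE q \<oplus> pH q \<oplus> pB q) \<ominus> pH q" by (subst (1) parts(4)[OF q(1)]) (rule refl)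
  also have "\<dots> = pE q \<oplus> pB q" by ((rule A.ag)+, insert q(1), simp_all)
  finally show ?thesis using q(2,3) filt_mono[of "pE q" "2 * r" "2 * r - 1"] by (simp add: filt_add)
qed

lemma A2_split: "q \<in> A2 ==> q = pH q \<oplus> (q \<ominus> pH q)" by ((rule A.ag)+, simp_all)

lemma A2_add: "[|p \<in> A2; q \<in> A2|] ==> p \<oplus> q \<in> A2"
  by (rule A2I) (simp_all del: One_nat_def add: parts_add filt_add A2D)

lemma A2_smult: "[|a \<in> carrier K; q \<in> A2|] ==> a \<odot> q \<in> A2"
  by (rule A2I) (simp_all del: One_nat_def add: parts_smult filt_smult A2D)

lemma A2_component: "q \<in> A2 ==> component A k q \<in> A2"
  using A2D(2,3)[of q] by (intro A2I) (auto simp: parts_component filt_def component_component)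

lemma A2_one: "\<one> \<in> A2" using one_Hs by (intro A2I) (simp_all add: filt_zero)

lemma A2_filt: "q \<in> filt (2 * r) ==> q \<in> A2"
  using parts_filt[of q "2 * r"] filt_carrier[of q] filt_mono[of "pB q" "2 * r" "2 * r - 1"]
  by (intro A2I) simp_all

lemma A2_diff: "q \<in> A2 ==> d q \<in> Ap"
proof -
  assume q: "q \<in> A2"
  have "d q \<in> filt (2 * r)" using filt_diff[of "pB q" "2 * r - 1"] pE_diff[of q] A2D[OF q] r by simp
  then show ?thesis using A2_filt filt_mono[of "d q" "2 * r" r] by (simp add: Ap_def)
qed

lemma Ap_mult: "[|p \<in> Ap; q \<in> Ap|] ==> p \<otimes> q \<in> Ap"
proof -
  assume h: "p \<in> Ap" "q \<in> Ap"
  have "p \<otimes> q \<in> filt (2 * r)" by (rule filt_mult_ge[OF Ap_filt[OF h(1)] Ap_filt[OF h(2)]]) simp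
  then show ?thesis using A2_filt filt_mono[of "p \<otimes> q" "2 * r" r] by (simp add: Ap_def)
qed

text \<open>Subtracting a multiple of the unit kills the class in degree 0. As \<open>H\<close>
  vanishes in degrees 1 to \<open>r - 1\<close>, the harmonic part then begins in degree
  \<open>r\<close>; the other parts begin in degree \<open>2 * r - 1\<close> by definition of
  \<open>A2\<close>.\<close>

lemma A2_cases:
  assumes "q \<in> A2" obtains a p where "a \<in> carrier K" "p \<in> Ap" "q = a \<odot> \<one> \<oplus> p"
proof -
  have q: "q \<in> carrier A" using assms by simp
  obtain a where a: "a \<in> carrier K" "component H 0 (f q) = a \<odot>\<^sub>H \<one>\<^sub>H"
    using H_piece_0[OF H.component_piece[OF f_closed[OF q], of 0]] by blast
  define p where "p = q \<ominus> a \<odot> \<one>"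
  have pc: "p \<in> carrier A" using q a by (simp add: p_def)
  have ph: "pE p = pE q" "pB p = pB q"
    unfolding p_def parts_minus[OF q smult_closed[OF a(1) A.one_closed]]
    using q a one_Hs by (simp_all add: parts_smult A.minus_eq)
  have "f p = f q \<ominus>\<^sub>H a \<odot>\<^sub>H \<one>\<^sub>H" using q a by (simp add: p_def f_minus f_smult)
  then have comp: "component H k (f p) = component H k (f q) \<ominus>\<^sub>H component H k (a \<odot>\<^sub>H \<one>\<^sub>H)" for k
    using q a by (simp add: H.component_minus)
  have "component H k (f p) = \<zero>\<^sub>H" if k: "k < r" for k
  proof (cases "k = 0")
    case True
    then show ?thesis using a H.component_of_piece[OF H.piece_smult[OF a(1) H.one_piece], of 0]
      by (simp add: comp)
  next
    case False
    then show ?thesis using H_piece_low[of k] k H.component_piece[OF f_closed[OF pc], of k] by simp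
  qed
  then have "f p \<in> H.filt r" using pc by (simp add: H.filt_def)
  from iota_filt[OF this] have "pH p \<in> filt r" by (simp add: iota_f pc)
  moreover have A2: "p \<in> A2" using A2D(2,3)[OF assms] pc by (intro A2I) (simp_all add: ph)
  moreover have "p \<ominus> pH p \<in> filt r" by (rule filt_mono[OF A2_rest[OF A2]]) (use r in simp)
  ultimately have "p \<in> Ap"
    using filt_add[of "pH p" r "p \<ominus> pH p"] A2_split[OF A2] by (simp add: Ap_def)
  moreover have "q = a \<odot> \<one> \<oplus> p" unfolding p_def by ((rule A.ag)+, insert q a, simp_all)
  ultimately show ?thesis using that a(1) by blast
qed

text \<open>Once the unit parts are split off, the remaining product has degree at least
  \<open>2 * r\<close>, and \<open>A2\<close> contains every element of such degree.\<close>

lemma A2_mult: "[|p \<in> A2; q \<in> A2|] ==> p \<otimes> q \<in> A2"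
proof -
  assume h: "p \<in> A2" "q \<in> A2"
  obtain a p' where p: "a \<in> carrier K" "p' \<in> Ap" "p = a \<odot> \<one> \<oplus> p'" using A2_cases[OF h(1)] .
  obtain b q' where q: "b \<in> carrier K" "q' \<in> Ap" "q = b \<odot> \<one> \<oplus> q'" using A2_cases[OF h(2)] .
  have "p \<otimes> q = a \<odot> q \<oplus> (b \<odot> p' \<oplus> p' \<otimes> q')" unfolding p(3) q(3)
    by (insert p q, simp add: A.l_distr A.r_distr smult_mult_left smult_mult_right smult_r_distr
        smult_assoc1[symmetric] K.m_comm[of b a], (rule A.ag)+, simp_all)
  then show ?thesis using h p q Ap_mult[OF p(2) q(2)] by (simp add: A2_add A2_smult Ap_A2)
qed

lemma f2_filt_pos: "[|q \<in> Ap; q' \<in> Ap|] ==> f2 q q' \<in> H.filt (3 * r - 1)" unfolding f2_def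
  by (intro H.filt_add f_filt filt_mult_ge[of _ "2 * r - 1" _ r] filt_mult_ge[of _ r _ "2 * r - 1"] A2_s
      Ap_A2 Ap_filt parity_filt parts_filt(2)) (use r in simp_all)

text \<open>Expand the factor not hit by \<open>s\<close>. Its part in \<open>Bs\<close> drops out
  by orthogonality and degree. The term with its exact part is symmetric after integration by parts,
  and the two terms with harmonic parts are exchanged.\<close>

lemma f2_comm:
  assumes q: "q \<in> A2" "q' \<in> A2" "q \<in> piece A i" "q' \<in> piece A j"
  shows "f2 q q' = ksign H (i * j) (f2 q' q)"
proof -
  have 1: "f2 q q' = f (s q \<otimes> pE q') \<oplus>\<^sub>H f (s q \<otimes> pH q') \<oplus>\<^sub>H f (parity A (pH q) \<otimes> s q')"
    if q: "q \<in> A2" "q' \<in> A2" for q q'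
  proof -
    have c: "q \<in> carrier A" "q' \<in> carrier A" using q by simp_all
    have "f (s q \<otimes> q') = f (s q \<otimes> (pE q' \<oplus> pH q' \<oplus> pB q'))"
      by (subst (1) parts(4)[OF c(2)]) (rule refl)
    also have "\<dots> = f (s q \<otimes> pE q') \<oplus>\<^sub>H f (s q \<otimes> pH q')"
      using c f_Bs_Bs[of "s q" "pB q'"] A2D(3)[OF q(2)] A2_s[OF q(1)] s_Bs parts(3)
      by (simp add: A.r_distr f_add)
    finally show ?thesis by (simp add: f2_def)
  qed
  have c: "q \<in> carrier A" "q' \<in> carrier A" using q by simp_all
  note p = parts_piece[OF q(3)] and p' = parts_piece[OF q(4)]
    and sp = s_piece_pred[OF q(3)] and sp' = s_piece_pred[OF q(4)]
  have a: "f (s q \<otimes> pE q') = ksign H (i * j) (f (s q' \<otimes> pE q))"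
  proof -
    have "s q \<otimes> pE q' = ksign A (i * j) (parity A (pE q') \<otimes> s q)" by (rule piece_pred_comm[OF sp p'(1)])
    moreover have "f (parity A (pE q') \<otimes> s q) = f (s q' \<otimes> pE q)"
      using f_mult_diff[of "s q'" "s q"] c by (simp add: diff_s)
    ultimately show ?thesis using c by (simp add: f_ksign)
  qed
  have b: "f (s q \<otimes> pH q') = ksign H (i * j) (f (parity A (pH q') \<otimes> s q))"
    using piece_pred_comm[OF sp p'(2)] c by (simp add: f_ksign)
  have "s q' \<otimes> pH q = ksign A (j * i) (parity A (pH q) \<otimes> s q')" by (rule piece_pred_comm[OF sp' p(2)])
  then have "ksign A (i * j) (s q' \<otimes> pH q) = parity A (pH q) \<otimes> s q'"
    using c by (simp add: mult.commute)  (simp add: ksign_def)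
  then have e: "f (parity A (pH q) \<otimes> s q') = ksign H (i * j) (f (s q' \<otimes> pH q))"
    using c by (simp add: f_ksign[symmetric])
  show ?thesis unfolding 1[OF q(1,2)] 1[OF q(2,1)] a b e using c by (simp add: H.ksign_add H.A.a_ac)
qed

text \<open>In either order one of the two summands of \<open>f2\<close> has degree at least
  \<open>5 * r - 2\<close>, and the other has degree at least \<open>4 * r - 2\<close> and integral
  zero.\<close>

lemma f2_high:
  assumes v: "v \<in> filt (3 * r - 1)" and q: "q \<in> Ap"
  shows "f2 v q = \<zero>\<^sub>H" "f2 q v = \<zero>\<^sub>H"
proof -
  have c: "q \<in> carrier A" "v \<in> carrier A" using q filt_carrier[OF v] by simp_all
  have sv: "s v \<in> filt (3 * r - 2)" using s_filt[of v "3 * r - 2"] v r by (simp add: Suc_diff_Suc numeral_2_eq_2)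
  have pq: "pE q \<in> filt (2 * r)" "pH q \<in> filt r" using A2D(2)[OF Ap_A2[OF q]] parts_filt(2)[OF Ap_filt[OF q]] by simp_all
  \<comment> \<open>The exact part of \<open>q\<close> need not be orthogonal to \<open>s v\<close>,
    but the product with it already lies above degree \<open>n\<close>.\<close>
  have "s v \<otimes> pE q \<in> filt (5 * r - 2)" using r by (intro filt_mult_ge[OF sv pq(1)]) simp
  then have e: "s v \<otimes> pE q = \<zero>" using filt_above n_lt by blast
  have "s v \<otimes> q = s v \<otimes> (pE q \<oplus> pH q \<oplus> pB q)" by (subst (1) parts(4)[OF c(1)]) (rule refl)
  then have "J (s v \<otimes> q) = \<zero>\<^sub>K"
    using c e J_Bs_Hs[OF s_Bs[OF c(2)] parts(2)[OF c(1)]] J_Bs_Bs[OF s_Bs[OF c(2)] parts(3)[OF c(1)]]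
    by (simp add: A.r_distr J_add)
  then have 1: "f (s v \<otimes> q) = \<zero>\<^sub>H"
    using r by (intro f_filt_J[of _ "4 * r - 2"] filt_mult_ge[OF sv Ap_filt[OF q]]) auto
  have 2: "f (parity A (pH v) \<otimes> s q) = \<zero>\<^sub>H"
    by (rule f_filt_high[OF filt_mult[OF parity_filt[OF parts_filt(2)[OF v]] A2_s[OF Ap_A2[OF q]]]])
      (use r in simp)
  show "f2 v q = \<zero>\<^sub>H" by (simp add: f2_def 1 2)
  have 3: "f (s q \<otimes> v) = \<zero>\<^sub>H"
    by (rule f_filt_high[OF filt_mult[OF A2_s[OF Ap_A2[OF q]] v]]) (use r in simp)
  have 4: "f (parity A (pH q) \<otimes> s v) = \<zero>\<^sub>H"
    by (rule f_Hs_Bs[OF s_Bs[OF c(2)] graded_subspace_parity[OF H_graded parts(2)[OF c(1)]] sv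
          parity_filt[OF pq(2)]]) (use r in simp)
  show "f2 q v = \<zero>\<^sub>H" by (simp add: f2_def 3 4)
qed

lemma Ap_mult_harmonic:
  assumes "q \<in> Ap" "q' \<in> Ap" shows "q \<otimes> q' \<ominus> pH q \<otimes> pH q' \<in> filt (3 * r - 1)"
proof -
  have u: "q \<ominus> pH q \<in> filt (2 * r - 1)" "q' \<ominus> pH q' \<in> filt (2 * r - 1)"
    by (intro A2_rest Ap_A2 assms)+
  have c: "q \<in> carrier A" "q' \<in> carrier A" using assms by simp_all
  have "q \<otimes> q' \<ominus> pH q \<otimes> pH q' = (q \<ominus> pH q) \<otimes> q' \<oplus> pH q \<otimes> (q' \<ominus> pH q')"
    by (insert c, simp add: A.ring_expand, (rule A.ag)+, simp_all)
  moreover have "(q \<ominus> pH q) \<otimes> q' \<in> filt (3 * r - 1)"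
    by (rule filt_mult_ge[OF u(1) Ap_filt[OF assms(2)]]) (use r in simp)
  moreover have "pH q \<otimes> (q' \<ominus> pH q') \<in> filt (3 * r - 1)"
    by (rule filt_mult_ge[OF parts_filt(2)[OF Ap_filt[OF assms(1)]] u(2)]) (use r in simp)
  ultimately show ?thesis by (simp add: filt_add)
qed

text \<open>Replacing both factors by their harmonic parts changes the product in degrees from
  \<open>3 * r - 1\<close> on only, where \<open>f2_high\<close> applies.\<close>

lemma f2_mult_harmonic:
  assumes "q \<in> Ap" "q' \<in> Ap" "q'' \<in> Ap"
  shows "f2 (q \<otimes> q') q'' = f2 (pH q \<otimes> pH q') q''" "f2 q'' (q \<otimes> q') = f2 q'' (pH q \<otimes> pH q')"
proof -
  have c: "q \<in> carrier A" "q' \<in> carrier A" "q'' \<in> carrier A" using assms by simp_all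
  have e: "q \<otimes> q' = pH q \<otimes> pH q' \<oplus> (q \<otimes> q' \<ominus> pH q \<otimes> pH q')" by ((rule A.ag)+, insert c, simp_all)
  note z = f2_high[OF Ap_mult_harmonic[OF assms(1,2)] assms(3)]
  show "f2 (q \<otimes> q') q'' = f2 (pH q \<otimes> pH q') q''" using c z by (subst e) (simp add: f2_add)
  show "f2 q'' (q \<otimes> q') = f2 q'' (pH q \<otimes> pH q')" using c z by (subst e) (simp add: f2_add)
qed

text \<open>The third A-infinity relation, with \<open>mu\<close> as its defect. Up to terms of
  degree above \<open>n\<close> or of integral zero, the arguments not under \<open>s\<close> may be
  replaced by their harmonic parts. This makes all five terms explicit (\<open>t1\<close> to
  \<open>t5\<close>), and they cancel.\<close>

lemma f2_assoc:
  assumes q: "q \<in> Ap" "q' \<in> Ap" "q'' \<in> Ap"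
  shows "f2 q q' \<otimes>\<^sub>H f q'' \<oplus>\<^sub>H f2 (q \<otimes> q') q''
    = parity H (f q) \<otimes>\<^sub>H f2 q' q'' \<oplus>\<^sub>H f2 q (q' \<otimes> q'') \<oplus>\<^sub>H mu (f q) (f q') (f q'')"
proof -
  have c: "q \<in> carrier A" "q' \<in> carrier A" "q'' \<in> carrier A" using q by simp_all
  define x x' x'' where "x = pH q" and "x' = pH q'" and "x'' = pH q''"
  note defs = x_def[symmetric] x'_def[symmetric] x''_def[symmetric]
  have xH: "x \<in> Hs" "x' \<in> Hs" "x'' \<in> Hs" using c by (simp_all add: x_def x'_def x''_def parts)
  have xc: "x \<in> carrier A" "x' \<in> carrier A" "x'' \<in> carrier A" using xH by simp_all
  have xf: "x \<in> filt r" "x' \<in> filt r" "x'' \<in> filt r"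
    using q by (simp_all add: x_def x'_def x''_def parts_filt Ap_filt)
  have PxH: "parity A x \<in> Hs" using graded_subspace_parity[OF H_graded xH(1)] .
  have v: "s q \<in> filt (2 * r - 1)" "s q' \<in> filt (2 * r - 1)" "s q'' \<in> filt (2 * r - 1)"
    by (intro A2_s Ap_A2 q)+
  have u: "q' \<ominus> x' \<in> filt (2 * r - 1)" "q'' \<ominus> x'' \<in> filt (2 * r - 1)"
    unfolding x'_def x''_def by (intro A2_rest Ap_A2 q)+
  have sp: "q' = x' \<oplus> (q' \<ominus> x')" "q'' = x'' \<oplus> (q'' \<ominus> x'')"
    unfolding x'_def x''_def using q by (auto intro: A2_split Ap_A2)
  have U: "s q \<otimes> q' \<oplus> parity A x \<otimes> s q' \<in> filt (3 * r - 1)"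
    "s q' \<otimes> q'' \<oplus> parity A x' \<otimes> s q'' \<in> filt (3 * r - 1)"
    using r by (auto intro!: filt_add filt_mult_ge[OF v(1) Ap_filt[OF q(2)]] filt_mult_ge[OF v(2) Ap_filt[OF q(3)]]
        filt_mult_ge[OF parity_filt[OF xf(1)] v(2)] filt_mult_ge[OF parity_filt[OF xf(2)] v(3)])
  have F: "f2 q q' = f (s q \<otimes> q' \<oplus> parity A x \<otimes> s q')" "f2 q' q'' = f (s q' \<otimes> q'' \<oplus> parity A x' \<otimes> s q'')"
    using c xc by (simp_all add: f2_def defs f_add)
  have t1: "f2 q q' \<otimes>\<^sub>H f q'' = f (s q \<otimes> (x' \<otimes> x'')) \<oplus>\<^sub>H f (parity A x \<otimes> (s q' \<otimes> x''))"
  proof -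
    have "f2 q q' \<otimes>\<^sub>H f q'' = f2 q q' \<otimes>\<^sub>H f x''" using c by (simp add: x''_def)
    also have "\<dots> = f ((s q \<otimes> q' \<oplus> parity A x \<otimes> s q') \<otimes> x'')"
      unfolding F by (rule f_mult_right[OF U(1) xH(3) xf(3), symmetric]) (use r in simp)
    also have "\<dots> = f (s q \<otimes> (q' \<otimes> x'')) \<oplus>\<^sub>H f (parity A x \<otimes> (s q' \<otimes> x''))"
      using c xc by (simp add: A.l_distr f_add A.m_assoc)
    also have "f (s q \<otimes> (q' \<otimes> x'')) = f (s q \<otimes> (x' \<otimes> x'')) \<oplus>\<^sub>H f (s q \<otimes> ((q' \<ominus> x') \<otimes> x''))"
      by (subst (1) sp(1)) (use c xc in \<open>simp add: A.l_distr A.r_distr f_add\<close>)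
    also have "f (s q \<otimes> ((q' \<ominus> x') \<otimes> x'')) = \<zero>\<^sub>H"
      by (rule f_filt_high[OF filt_mult[OF v(1) filt_mult[OF u(1) xf(3)]]]) (use r in simp)
    finally show ?thesis using c xc by simp
  qed
  have xx: "x \<otimes> x' \<in> cocycles A" "x' \<otimes> x'' \<in> cocycles A"
    using xH by (auto intro: cocycles_mult Hs_cocycles)
  have xxf: "x \<otimes> x' \<in> filt (2 * r)" using filt_mult_ge[OF xf(1,2)] by simp
  have sx: "s (x \<otimes> x') \<in> filt (2 * r - 1)" using s_filt[of "x \<otimes> x'" "2 * r - 1"] xxf r by simp
  \<comment> \<open>Since \<open>pE q''\<close> is \<open>d (s q'')\<close>, integration by parts
    moves \<open>d\<close> onto \<open>s (x \<otimes> x')\<close> and produces the exact part of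
    \<open>x \<otimes> x'\<close>. It completes the harmonic part in the other summand to the whole
    product.\<close>
  have t2: "f2 (q \<otimes> q') q'' = f (s (x \<otimes> x') \<otimes> x'') \<oplus>\<^sub>H f (parity A x \<otimes> (parity A x' \<otimes> s q''))"
  proof -
    have pb: "pB q'' \<in> Bs" "pB q'' \<in> filt (2 * r - 1)"
      using A2D(3)[OF Ap_A2[OF q(3)]] parts(3)[OF c(3)] by simp_all
    have "f (s (x \<otimes> x') \<otimes> q'') = f (s (x \<otimes> x') \<otimes> (pE q'' \<oplus> pH q'' \<oplus> pB q''))"
      by (subst (1) parts(4)[OF c(3)]) (rule refl)
    also have "\<dots> = f (s (x \<otimes> x') \<otimes> pE q'') \<oplus>\<^sub>H f (s (x \<otimes> x') \<otimes> x'')"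
      using c xc f_Bs_Bs[OF s_Bs pb(1) sx pb(2)] by (simp add: A.r_distr f_add x''_def)
    also have "f (s (x \<otimes> x') \<otimes> pE q'') = f (parity A (pE (x \<otimes> x')) \<otimes> s q'')"
      using f_mult_diff[of "s (x \<otimes> x')" "s q''"] c xc by (simp add: diff_s)
    finally have 1: "f (s (x \<otimes> x') \<otimes> q'')
        = f (parity A (pE (x \<otimes> x')) \<otimes> s q'') \<oplus>\<^sub>H f (s (x \<otimes> x') \<otimes> x'')" .
    have "f (parity A (x \<otimes> x') \<otimes> s q'') = f (parity A (pE (x \<otimes> x') \<oplus> pH (x \<otimes> x')) \<otimes> s q'')"
      by (subst (1) cocycles_parts[OF xx(1)]) (rule refl)
    also have "\<dots> = f (parity A (pE (x \<otimes> x')) \<otimes> s q'') \<oplus>\<^sub>H f (parity A (pH (x \<otimes> x')) \<otimes> s q'')"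
      using c xc by (simp add: parity_add A.l_distr f_add)
    finally have 2: "f (parity A x \<otimes> (parity A x' \<otimes> s q''))
        = f (parity A (pE (x \<otimes> x')) \<otimes> s q'') \<oplus>\<^sub>H f (parity A (pH (x \<otimes> x')) \<otimes> s q'')"
      using c xc by (simp add: parity_mult A.m_assoc)
    show ?thesis unfolding f2_mult_harmonic(1)[OF q] defs unfolding f2_def 1 2
      by ((rule H.A.ag)+, insert c xc, simp_all)
  qed
  have t3: "parity H (f q) \<otimes>\<^sub>H f2 q' q''
      = f (parity A x \<otimes> (s q' \<otimes> x'')) \<oplus>\<^sub>H f (parity A x \<otimes> (parity A x' \<otimes> s q''))"
  proof -
    have "parity H (f q) = f (parity A x)" using c xc by (simp add: x_def f_parity)
    then have "parity H (f q) \<otimes>\<^sub>H f2 q' q'' = f (parity A x \<otimes> (s q' \<otimes> q'' \<oplus> parity A x' \<otimes> s q''))"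
      unfolding F using f_mult_left[OF U(2) PxH parity_filt[OF xf(1)]] r by simp
    also have "\<dots> = f (parity A x \<otimes> (s q' \<otimes> q'')) \<oplus>\<^sub>H f (parity A x \<otimes> (parity A x' \<otimes> s q''))"
      using c xc by (simp add: A.r_distr f_add)
    also have "f (parity A x \<otimes> (s q' \<otimes> q''))
        = f (parity A x \<otimes> (s q' \<otimes> x'')) \<oplus>\<^sub>H f (parity A x \<otimes> (s q' \<otimes> (q'' \<ominus> x'')))"
      by (subst (1) sp(2)) (use c xc in \<open>simp add: A.r_distr f_add\<close>)
    also have "f (parity A x \<otimes> (s q' \<otimes> (q'' \<ominus> x''))) = \<zero>\<^sub>H"
      by (rule f_filt_high[OF filt_mult[OF parity_filt[OF xf(1)] filt_mult[OF v(2) u(2)]]]) (use r in simp)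
    finally show ?thesis using c xc by simp
  qed
  have t4: "f2 q (q' \<otimes> q'') = f (s q \<otimes> (x' \<otimes> x'')) \<oplus>\<^sub>H f (parity A x \<otimes> s (x' \<otimes> x''))"
    unfolding f2_mult_harmonic(2)[OF q(2,3,1)] by (simp add: f2_def defs)
  have t5: "mu (f q) (f q') (f q'') = f (s (x \<otimes> x') \<otimes> x'') \<ominus>\<^sub>H f (parity A x \<otimes> s (x' \<otimes> x''))"
    using c xc by (simp add: mu_f iota_f defs f_minus)
  show ?thesis unfolding t1 t2 t3 t4 t5 by ((rule H.A.ag)+, insert c xc, simp_all)
qed

end

section \<open>The cylinder of a Hodge decomposition with trivial Massey class\<close>

locale prim_hodge = conn_hodge K A n I Hs Bs r \<iota>
  for K :: "('k, 'l) ring_scheme" and A :: "('k, 'a, 'm) dga_scheme" (structure)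
    and n I Hs Bs r \<iota> +
  fixes \<phi> :: "'a set => 'a set => 'a set"
  assumes prim: "primitive \<phi>" and sym: "symm \<phi>"
    and JH_phi: "[|X \<in> carrier (cohomology A); Y \<in> carrier (cohomology A)|] ==> JH (\<phi> X Y) = \<zero>\<^bsub>K\<^esub>"
begin

lemma phi_bilin: "bilin \<phi>" and mu_phi:
  "[|X \<in> CH; Y \<in> CH; Z \<in> CH|] ==> mu X Y Z = hoch_d \<phi> X Y Z"
  using prim by (simp_all add: primitive_def)

lemmas phi = bilinD[OF phi_bilin]
lemmas phi_one = primitive_one[OF prim]

lemma phi_closed [simp]: "[|X \<in> CH; Y \<in> CH|] ==> \<phi> X Y \<in> CH" by (rule phi(1))

abbreviation L where "L \<equiv> H.filt (2 * r - 1)"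

lemmas L_graded = H.filt_graded[of "2 * r - 1"]

lemma L_mult: "[|z \<in> L; u \<in> CH|] ==> z \<otimes>\<^sub>H u \<in> L" "[|z \<in> L; u \<in> CH|] ==> u \<otimes>\<^sub>H z \<in> L"
  by (rule H.filt_mult_ge[of _ "2 * r - 1" _ 0], simp_all) (rule H.filt_mult_ge[of _ 0 _ "2 * r - 1"], simp_all)

lemma H_filt_mult_zero:
  assumes "x \<in> H.filt i" "y \<in> H.filt j" "5 * r - 2 \<le> i + j" shows "x \<otimes>\<^sub>H y = \<zero>\<^sub>H"
  using H_filt_above[OF H.filt_mult[OF assms(1,2)]] assms(3) n_lt by simp

lemma f2_filt_mixed:
  assumes "q \<in> A2" "p \<in> Ap"
  shows "f2 q p \<in> H.filt (3 * r - 1)" "f2 p q \<in> H.filt (3 * r - 1)"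
proof -
  obtain a p' where q: "a \<in> carrier K" "p' \<in> Ap" "q = a \<odot> \<one> \<oplus> p'" using A2_cases[OF assms(1)] .
  have "f2 q p = f2 p' p" "f2 p q = f2 p p'" using q assms(2) by (simp_all add: f2_add f2_smult)
  then show "f2 q p \<in> H.filt (3 * r - 1)" "f2 p q \<in> H.filt (3 * r - 1)"
    using f2_filt_pos assms(2) q(2) by (simp_all del: One_nat_def)
qed

lemma A2_parity: "q \<in> A2 ==> parity A q \<in> A2"
  using A2D(2,3)[of q] by (intro A2I) (simp_all del: One_nat_def add: parts_parity parity_filt)

text \<open>By \<open>f_mult\<close> the defect consists of values of \<open>f2\<close> with a
  boundary as one argument. Boundaries from \<open>A2\<close> lie in \<open>Ap\<close>, and this
  suffices for the degree bound even if the other argument has a unit part.\<close>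

lemma f_mult_defect:
  assumes "q \<in> A2" "q' \<in> A2" shows "f (q \<otimes> q') \<ominus>\<^sub>H f q \<otimes>\<^sub>H f q' \<in> H.filt (3 * r - 1)"
proof -
  have "f (q \<otimes> q') \<ominus>\<^sub>H f q \<otimes>\<^sub>H f q' = f2 (d q) q' \<oplus>\<^sub>H f2 (parity A q) (d q')"
    unfolding f_mult[OF A2_carrier A2_carrier, OF assms] by ((rule H.A.ag)+, insert assms, simp_all)
  then show ?thesis using f2_filt_mixed(2)[OF assms(2) A2_diff[OF assms(1)]]
      f2_filt_mixed(1)[OF A2_parity[OF assms(1)] A2_diff[OF assms(2)]] by (simp add: H.filt_add)
qed

text \<open>Pairs of an element and an approximation of its image under \<open>f\<close>.\<close>

definition SS :: "('a \<times> 'a set) set" where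
  "SS = {(q, h). q \<in> A2 \<and> h \<in> CH \<and> f q \<ominus>\<^sub>H h \<in> L}"

lemma SS_iff: "(q, h) \<in> SS \<longleftrightarrow> q \<in> A2 \<and> h \<in> CH \<and> f q \<ominus>\<^sub>H h \<in> L" by (simp add: SS_def)

lemma SSD: assumes "m \<in> SS" shows "fst m \<in> A2" "snd m \<in> CH" "f (fst m) \<ominus>\<^sub>H snd m \<in> L"
  "fst m \<in> carrier A" using assms by (auto simp: SS_def)

text \<open>The average of the two values attached to a pair. With \<open>yy\<close> as half their
  difference, \<open>f (fst m)\<close> is \<open>kap m\<close> plus \<open>yy m\<close>, and
  \<open>snd m\<close> is \<open>kap m\<close> minus \<open>yy m\<close>.\<close>

definition kap :: "'a \<times> 'a set => 'a set" where
  "kap m = hf \<odot>\<^sub>H (f (fst m) \<oplus>\<^sub>H snd m)"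

definition lam :: "'a \<times> 'a set => 'a set" where
  "lam m = f (fst m) \<ominus>\<^sub>H snd m"

definition yy :: "'a \<times> 'a set => 'a set" where
  "yy m = hf \<odot>\<^sub>H lam m"

text \<open>\<open>f2\<close> corrected by the primitive: the coboundary of \<open>\<phi>\<close>
  cancels the defect \<open>mu\<close> in \<open>f2_assoc\<close>.\<close>

definition cc :: "'a \<times> 'a set => 'a \<times> 'a set => 'a set" where
  "cc m m' = f2 (fst m) (fst m') \<ominus>\<^sub>H \<phi> (kap m) (kap m')"

lemma kap_closed [simp]: "m \<in> SS ==> kap m \<in> CH" using SSD[of m] hf(1) by (simp add: kap_def)

lemma yy_L: "m \<in> SS ==> yy m \<in> L" using SSD[of m] hf(1) H.filt_smult by (simp add: yy_def lam_def)

lemma yy_closed [simp]: "m \<in> SS ==> yy m \<in> CH" using yy_L H.filt_carrier by blast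

lemma kap_yy:
  assumes "m \<in> SS"
  shows "f (fst m) = kap m \<oplus>\<^sub>H yy m" "snd m = kap m \<ominus>\<^sub>H yy m" "lam m = yy m \<oplus>\<^sub>H yy m"
proof -
  note c = SSD(2,4)[OF assms] hf(1)
  have "kap m \<oplus>\<^sub>H yy m = hf \<odot>\<^sub>H f (fst m) \<oplus>\<^sub>H hf \<odot>\<^sub>H f (fst m)" unfolding kap_def yy_def lam_def
    by (insert c, simp add: H.smult_r_distr H.smult_minus, (rule H.A.ag)+, simp_all)
  then show "f (fst m) = kap m \<oplus>\<^sub>H yy m" using c by (simp add: hf_double')
  have "kap m \<ominus>\<^sub>H yy m = hf \<odot>\<^sub>H snd m \<oplus>\<^sub>H hf \<odot>\<^sub>H snd m" unfolding kap_def yy_def lam_def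
    by (insert c, simp add: H.smult_r_distr H.smult_minus, (rule H.A.ag)+, simp_all)
  then show "snd m = kap m \<ominus>\<^sub>H yy m" using c by (simp add: hf_double')
  show "lam m = yy m \<oplus>\<^sub>H yy m" using c by (simp add: yy_def hf_double' lam_def)
qed

lemma SS_mult:
  assumes "(q, h) \<in> SS" "(q', h') \<in> SS" shows "(q \<otimes> q', h \<otimes>\<^sub>H h') \<in> SS"
proof -
  have m: "q \<in> A2" "h \<in> CH" "f q \<ominus>\<^sub>H h \<in> L" "q' \<in> A2" "h' \<in> CH" "f q' \<ominus>\<^sub>H h' \<in> L"
    using assms by (simp_all add: SS_iff)
  have c: "q \<in> carrier A" "q' \<in> carrier A" using m by simp_all
  have "f (q \<otimes> q') \<ominus>\<^sub>H h \<otimes>\<^sub>H h' = (f (q \<otimes> q') \<ominus>\<^sub>H f q \<otimes>\<^sub>H f q')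
      \<oplus>\<^sub>H ((f q \<ominus>\<^sub>H h) \<otimes>\<^sub>H f q' \<oplus>\<^sub>H h \<otimes>\<^sub>H (f q' \<ominus>\<^sub>H h'))"
    by (insert c m(2,5), simp add: H.A.ring_expand, (rule H.A.ag)+, simp_all)
  moreover have "f (q \<otimes> q') \<ominus>\<^sub>H f q \<otimes>\<^sub>H f q' \<in> L"
    by (rule H.filt_mono[OF f_mult_defect[OF m(1,4)]]) simp
  moreover have "(f q \<ominus>\<^sub>H h) \<otimes>\<^sub>H f q' \<in> L" "h \<otimes>\<^sub>H (f q' \<ominus>\<^sub>H h') \<in> L"
    using L_mult(1)[OF m(3) f_closed[OF c(2)]] L_mult(2)[OF m(6,2)] .
  ultimately show ?thesis using m by (simp del: One_nat_def add: SS_iff A2_mult H.filt_add)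
qed

end

sublocale prim_hodge \<subseteq> sp: subpair K A "cohomology A" SS
proof
  fix q h q' h' a k
  assume m: "(q, h) \<in> SS"
  have m': "q \<in> A2" "h \<in> carrier H" "f q \<ominus>\<^sub>H h \<in> L" "q \<in> carrier A" using m by (simp_all add: SS_iff)
  show "q \<in> carrier A \<and> h \<in> carrier H" using m' by simp
  show "(component A k q, component H k h) \<in> SS"
    using m' H.graded_subspaceD(7)[OF L_graded m'(3), of k]
    by (simp del: One_nat_def add: SS_iff A2_component H.component_minus f_component)
  show "(d q, \<zero>\<^sub>H) \<in> SS"
    using m' A2_diff[OF m'(1)] by (simp del: One_nat_def add: SS_iff Ap_A2 H.filt_zero H.A.minus_eq)
  show "a \<in> carrier K ==> (a \<odot> q, a \<odot>\<^sub>H h) \<in> SS" using m' H.filt_smult[OF _ m'(3), of a]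
    by (simp del: One_nat_def add: SS_iff A2_smult f_smult H.smult_minus)
  assume "(q', h') \<in> SS"
  then have n': "q' \<in> A2" "h' \<in> carrier H" "f q' \<ominus>\<^sub>H h' \<in> L" "q' \<in> carrier A" by (simp_all add: SS_iff)
  show "(q \<otimes> q', h \<otimes>\<^sub>H h') \<in> SS" by (rule SS_mult) fact+
  have "f (q \<oplus> q') \<ominus>\<^sub>H (h \<oplus>\<^sub>H h') = (f q \<ominus>\<^sub>H h) \<oplus>\<^sub>H (f q' \<ominus>\<^sub>H h')"
    by (insert m' n', simp add: f_add, (rule H.A.ag)+, simp_all)
  then show "(q \<oplus> q', h \<oplus>\<^sub>H h') \<in> SS"
    using m' n' H.filt_add[OF m'(3) n'(3)] by (simp del: One_nat_def add: SS_iff A2_add)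
next
  show "(\<one>, \<one>\<^sub>H) \<in> SS" by (simp del: One_nat_def add: SS_iff A2_one H.filt_zero)
qed

context prim_hodge
begin

declare One_nat_def [simp del]

abbreviation N where "N \<equiv> sp.N"

lemma pair_fst_snd [simp]:
  "fst (m \<otimes>\<^bsub>N\<^esub> m') = fst m \<otimes> fst m'" "snd (m \<otimes>\<^bsub>N\<^esub> m') = snd m \<otimes>\<^sub>H snd m'"
  "fst (m \<oplus>\<^bsub>N\<^esub> m') = fst m \<oplus> fst m'" "snd (m \<oplus>\<^bsub>N\<^esub> m') = snd m \<oplus>\<^sub>H snd m'"
  "fst (a \<odot>\<^bsub>N\<^esub> m) = a \<odot> fst m" "snd (a \<odot>\<^bsub>N\<^esub> m) = a \<odot>\<^sub>H snd m"
  "fst (diff N m) = d (fst m)" "snd (diff N m) = \<zero>\<^sub>H" by (cases m; cases m'; simp)+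

lemma SS_closed:
  "[|m \<in> SS; m' \<in> SS|] ==> m \<otimes>\<^bsub>N\<^esub> m' \<in> SS" "[|m \<in> SS; m' \<in> SS|] ==> m \<oplus>\<^bsub>N\<^esub> m' \<in> SS"
  "[|a \<in> carrier K; m \<in> SS|] ==> a \<odot>\<^bsub>N\<^esub> m \<in> SS" "m \<in> SS ==> diff N m \<in> SS"
  "\<one>\<^bsub>N\<^esub> \<in> SS" using sp.S_mult sp.S_add sp.S_smult sp.S_diff sp.S_one by (cases m; cases m'; simp)+

lemma kap_add: "[|m \<in> SS; m' \<in> SS|] ==> kap (m \<oplus>\<^bsub>N\<^esub> m') = kap m \<oplus>\<^sub>H kap m'"
  using SSD[of m] SSD[of m'] hf(1) by (simp add: kap_def f_add H.smult_r_distr H.A.a_ac)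

lemma lam_add: "[|m \<in> SS; m' \<in> SS|] ==> lam (m \<oplus>\<^bsub>N\<^esub> m') = lam m \<oplus>\<^sub>H lam m'" unfolding lam_def
  by (insert SSD[of m] SSD[of m'], simp add: f_add, (rule H.A.ag)+, simp_all)

lemma kap_smult: "[|a \<in> carrier K; m \<in> SS|] ==> kap (a \<odot>\<^bsub>N\<^esub> m) = a \<odot>\<^sub>H kap m"
  using SSD[of m] hf(1) H.smult_assoc1[symmetric]
  by (simp add: kap_def f_smult H.smult_r_distr[symmetric] K.m_comm[of hf a])

lemma lam_smult: "[|a \<in> carrier K; m \<in> SS|] ==> lam (a \<odot>\<^bsub>N\<^esub> m) = a \<odot>\<^sub>H lam m"
  using SSD[of m] by (simp add: lam_def f_smult H.smult_minus)

lemma kap_diff: "m \<in> SS ==> kap (diff N m) = \<zero>\<^sub>H" using SSD[of m] hf(1) by (simp add: kap_def)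

lemma kap_one: "kap \<one>\<^bsub>N\<^esub> = \<one>\<^sub>H" by (simp add: kap_def)

text \<open>For $a = k + y$ and $b = k - y$ one has $aa' + bb' = 2(kk' + yy')$. The error thus
  consists of $yy'$, of degree at least \<open>4 * r - 2\<close>, and half the multiplicativity
  defect of \<open>f\<close>.\<close>

lemma kap_mult:
  assumes "m \<in> SS" "m' \<in> SS"
  obtains \<rho> where "kap (m \<otimes>\<^bsub>N\<^esub> m') = kap m \<otimes>\<^sub>H kap m' \<oplus>\<^sub>H \<rho>" "\<rho> \<in> H.filt (3 * r - 1)"
proof -
  note D = SSD[OF assms(1)] SSD[OF assms(2)]
  note y = kap_yy[OF assms(1)] kap_yy[OF assms(2)]
  have c: "kap m \<in> CH" "kap m' \<in> CH" "yy m \<in> CH" "yy m' \<in> CH"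
    using assms by simp_all
  define e where "e = f (fst m \<otimes> fst m') \<ominus>\<^sub>H f (fst m) \<otimes>\<^sub>H f (fst m')"
  have e: "e \<in> H.filt (3 * r - 1)" unfolding e_def by (rule f_mult_defect[OF D(1,5)])
  have ec: "e \<in> CH" by (rule H.filt_carrier[OF e])
  let ?k = "kap m \<otimes>\<^sub>H kap m' \<oplus>\<^sub>H yy m \<otimes>\<^sub>H yy m'"
  have "f (fst m \<otimes> fst m') \<oplus>\<^sub>H snd m \<otimes>\<^sub>H snd m'
      = e \<oplus>\<^sub>H (f (fst m) \<otimes>\<^sub>H f (fst m') \<oplus>\<^sub>H snd m \<otimes>\<^sub>H snd m')"
    unfolding e_def by ((rule H.A.ag)+, insert D, simp_all)
  also have "f (fst m) \<otimes>\<^sub>H f (fst m') \<oplus>\<^sub>H snd m \<otimes>\<^sub>H snd m' = ?k \<oplus>\<^sub>H ?k" unfolding y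
    by (insert c, simp add: H.A.ring_expand, (rule H.A.ag)+, simp_all)
  finally have "kap (m \<otimes>\<^bsub>N\<^esub> m') = hf \<odot>\<^sub>H (e \<oplus>\<^sub>H (?k \<oplus>\<^sub>H ?k))" by (simp add: kap_def)
  also have "\<dots> = hf \<odot>\<^sub>H e \<oplus>\<^sub>H ?k" using ec c hf(1) hf_double[of ?k]
    by (simp only: H.smult_r_distr H.A.add.m_closed H.A.m_closed)
  finally have 1: "kap (m \<otimes>\<^bsub>N\<^esub> m')
      = kap m \<otimes>\<^sub>H kap m' \<oplus>\<^sub>H (yy m \<otimes>\<^sub>H yy m' \<oplus>\<^sub>H hf \<odot>\<^sub>H e)" using ec c hf(1) by (simp add: H.A.a_ac)
  have "yy m \<otimes>\<^sub>H yy m' \<in> H.filt (3 * r - 1)"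
    by (rule H.filt_mult_ge[OF yy_L[OF assms(1)] yy_L[OF assms(2)]]) (use r in simp)
  then have "yy m \<otimes>\<^sub>H yy m' \<oplus>\<^sub>H hf \<odot>\<^sub>H e \<in> H.filt (3 * r - 1)"
    using H.filt_add H.filt_smult[OF hf(1) e] by blast
  then show ?thesis using that 1 by blast
qed

text \<open>The error has degree at least \<open>3 * r - 1\<close>. Next to a factor in
  \<open>L\<close> the total is at least \<open>5 * r - 2\<close>, which exceeds
  \<open>n\<close>.\<close>

lemma kap_mult_L:
  assumes m: "m \<in> SS" "m' \<in> SS" and z: "z \<in> L"
  shows "z \<otimes>\<^sub>H kap (m \<otimes>\<^bsub>N\<^esub> m') = z \<otimes>\<^sub>H (kap m \<otimes>\<^sub>H kap m')"
    "parity H (kap (m \<otimes>\<^bsub>N\<^esub> m')) \<otimes>\<^sub>H z = parity H (kap m \<otimes>\<^sub>H kap m') \<otimes>\<^sub>H z"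
proof -
  obtain \<rho> where r': "kap (m \<otimes>\<^bsub>N\<^esub> m') = kap m \<otimes>\<^sub>H kap m' \<oplus>\<^sub>H \<rho>" "\<rho> \<in> H.filt (3 * r - 1)"
    using kap_mult[OF m] .
  have c: "z \<in> CH" "\<rho> \<in> CH" "kap m \<in> CH" "kap m' \<in> CH"
    using z r'(2) H.filt_carrier m by auto
  have "z \<otimes>\<^sub>H \<rho> = \<zero>\<^sub>H" by (rule H_filt_mult_zero[OF z r'(2)]) (use r in simp)
  then show "z \<otimes>\<^sub>H kap (m \<otimes>\<^bsub>N\<^esub> m') = z \<otimes>\<^sub>H (kap m \<otimes>\<^sub>H kap m')"
    using c by (simp add: r'(1) H.A.r_distr)
  have "parity H \<rho> \<otimes>\<^sub>H z = \<zero>\<^sub>H"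
    by (rule H_filt_mult_zero[OF H.parity_filt[OF r'(2)] z]) (use r in simp)
  then show "parity H (kap (m \<otimes>\<^bsub>N\<^esub> m')) \<otimes>\<^sub>H z = parity H (kap m \<otimes>\<^sub>H kap m') \<otimes>\<^sub>H z"
    using c by (simp add: r'(1) H.parity_add H.A.l_distr)
qed

lemma cc_closed [simp]: "[|m \<in> SS; m' \<in> SS|] ==> cc m m' \<in> CH"
  using SSD[of m] SSD[of m'] by (simp add: cc_def)

lemma cc_add:
  assumes "m \<in> SS" "m' \<in> SS" "m'' \<in> SS"
  shows "cc (m \<oplus>\<^bsub>N\<^esub> m') m'' = cc m m'' \<oplus>\<^sub>H cc m' m''" "cc m'' (m \<oplus>\<^bsub>N\<^esub> m') = cc m'' m \<oplus>\<^sub>H cc m'' m'"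
  unfolding cc_def by (insert SSD[OF assms(1)] SSD[OF assms(2)] SSD[OF assms(3)] assms,
    simp add: f2_add kap_add phi(2,3), (rule H.A.ag)+, simp_all)+

lemma cc_smult:
  assumes "a \<in> carrier K" "m \<in> SS" "m' \<in> SS"
  shows "cc (a \<odot>\<^bsub>N\<^esub> m) m' = a \<odot>\<^sub>H cc m m'" "cc m (a \<odot>\<^bsub>N\<^esub> m') = a \<odot>\<^sub>H cc m m'"
  using SSD[OF assms(2)] SSD[OF assms(3)] assms
  by (simp_all add: cc_def f2_smult kap_smult phi(4,5) H.smult_minus)

lemma cc_one: "m \<in> SS ==> cc \<one>\<^bsub>N\<^esub> m = \<zero>\<^sub>H" "m \<in> SS ==> cc m \<one>\<^bsub>N\<^esub> = \<zero>\<^sub>H"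
  unfolding cc_def kap_one using SSD[of m] by (simp_all add: phi_one)

definition SP :: "('a \<times> 'a set) set" where "SP = SS \<inter> (Ap \<times> H.filt r)"

lemma SP: assumes "m \<in> SP" shows "m \<in> SS" "fst m \<in> Ap" "snd m \<in> H.filt r" "kap m \<in> H.filt r"
proof -
  show m: "m \<in> SS" "fst m \<in> Ap" "snd m \<in> H.filt r" using assms by (auto simp: SP_def)
  show "kap m \<in> H.filt r"
    unfolding kap_def by (rule H.filt_smult[OF hf(1) H.filt_add[OF f_filt[OF Ap_filt[OF m(2)]] m(3)]])
qed

lemma SS_cases:
  assumes "m \<in> SS"
  obtains a p where "a \<in> carrier K" "p \<in> SP" "m = a \<odot>\<^bsub>N\<^esub> \<one>\<^bsub>N\<^esub> \<oplus>\<^bsub>N\<^esub> p"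
proof -
  obtain a p where q: "a \<in> carrier K" "p \<in> Ap" "fst m = a \<odot> \<one> \<oplus> p" using A2_cases[OF SSD(1)[OF assms]] .
  define h where "h = snd m \<ominus>\<^sub>H a \<odot>\<^sub>H \<one>\<^sub>H"
  note D = SSD[OF assms]
  have hc: "h \<in> CH" using D q by (simp add: h_def)
  have "f (fst m) \<ominus>\<^sub>H snd m = f p \<ominus>\<^sub>H h" unfolding q(3) h_def
    by (insert q D(2), simp add: f_add f_smult, (rule H.A.ag)+, simp_all)
  then have L: "f p \<ominus>\<^sub>H h \<in> L" using D(3) by simp
  \<comment> \<open>\<open>h\<close> inherits its lowest degree from \<open>f p\<close>: the two
    differ by an element of \<open>L\<close>, and \<open>2 * r - 1\<close> is at least
    \<open>r\<close>.\<close>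
  have "h = f p \<ominus>\<^sub>H (f p \<ominus>\<^sub>H h)" by ((rule H.A.ag)+, insert q hc, simp_all)
  also have "\<dots> \<in> H.filt r"
    by (rule H.filt_minus[OF f_filt[OF Ap_filt[OF q(2)]] H.filt_mono[OF L]]) (use r in simp)
  finally have "(p, h) \<in> SP" using q L hc by (simp add: SP_def SS_iff Ap_A2)
  moreover have "m = a \<odot>\<^bsub>N\<^esub> \<one>\<^bsub>N\<^esub> \<oplus>\<^bsub>N\<^esub> (p, h)"
  proof (rule prod_eqI)
    show "snd m = snd (a \<odot>\<^bsub>N\<^esub> \<one>\<^bsub>N\<^esub> \<oplus>\<^bsub>N\<^esub> (p, h))"
      by (insert D q, simp add: h_def, (rule H.A.ag)+, simp_all)
  qed (simp add: q)
  ultimately show ?thesis using that q(1) by blast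
qed

definition cassoc :: "'a \<times> 'a set => 'a \<times> 'a set => 'a \<times> 'a set => bool" where
  "cassoc m m' m'' \<longleftrightarrow> cc m m' \<otimes>\<^sub>H kap m'' \<oplus>\<^sub>H cc (m \<otimes>\<^bsub>N\<^esub> m') m''
     = parity H (kap m) \<otimes>\<^sub>H cc m' m'' \<oplus>\<^sub>H cc m (m' \<otimes>\<^bsub>N\<^esub> m'')"

text \<open>The error of \<open>kap\<close> enters \<open>\<phi>\<close> in total degree at least
  \<open>4 * r - 2\<close>, where only the integral could be nonzero. The normalisation
  \<open>JH_phi\<close> of the primitive makes it vanish.\<close>

lemma phi_kap_mult:
  assumes m: "m \<in> SP" "m' \<in> SP" "m'' \<in> SP"
  shows "\<phi> (kap (m \<otimes>\<^bsub>N\<^esub> m')) (kap m'') = \<phi> (kap m \<otimes>\<^sub>H kap m') (kap m'')"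
    "\<phi> (kap m'') (kap (m \<otimes>\<^bsub>N\<^esub> m')) = \<phi> (kap m'') (kap m \<otimes>\<^sub>H kap m')"
proof -
  obtain \<rho> where r': "kap (m \<otimes>\<^bsub>N\<^esub> m') = kap m \<otimes>\<^sub>H kap m' \<oplus>\<^sub>H \<rho>" "\<rho> \<in> H.filt (3 * r - 1)"
    using kap_mult[OF SP(1)[OF m(1)] SP(1)[OF m(2)]] .
  have c: "\<rho> \<in> CH" "kap m \<in> CH" "kap m' \<in> CH" "kap m'' \<in> CH"
    using r'(2) H.filt_carrier SP(1) m by auto
  have "\<phi> \<rho> (kap m'') = \<zero>\<^sub>H" by (rule H_filt_top[OF bilin_filt[OF phi_bilin r'(2) SP(4)[OF m(3)]]])
      (use r n_lt JH_phi c in auto)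
  moreover have "\<phi> (kap m'') \<rho> = \<zero>\<^sub>H"
    by (rule H_filt_top[OF bilin_filt[OF phi_bilin SP(4)[OF m(3)] r'(2)]])
      (use r n_lt JH_phi c in auto)
  ultimately show "\<phi> (kap (m \<otimes>\<^bsub>N\<^esub> m')) (kap m'') = \<phi> (kap m \<otimes>\<^sub>H kap m') (kap m'')"
    "\<phi> (kap m'') (kap (m \<otimes>\<^bsub>N\<^esub> m')) = \<phi> (kap m'') (kap m \<otimes>\<^sub>H kap m')"
    using c by (simp_all add: r'(1) phi(2,3))
qed

text \<open>The arguments are exchanged one at a time. Each exchange costs a value of
  \<open>mu\<close> with one argument in \<open>L\<close> and two of degree at least
  \<open>r\<close>, which \<open>mu_filt_zero\<close> kills.\<close>

lemma mu_f_kap: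
  assumes m: "m \<in> SP" "m' \<in> SP" "m'' \<in> SP"
  shows "mu (f (fst m)) (f (fst m')) (f (fst m'')) = mu (kap m) (kap m') (kap m'')"
proof -
  have c: "kap m \<in> CH" "kap m' \<in> CH" "kap m'' \<in> CH"
    "yy m \<in> CH" "yy m' \<in> CH" "yy m'' \<in> CH" using SP(1) m by simp_all
  note k = SP(4)[OF m(1)] SP(4)[OF m(2)] SP(4)[OF m(3)]
  note y = yy_L[OF SP(1)[OF m(1)]] yy_L[OF SP(1)[OF m(2)]] yy_L[OF SP(1)[OF m(3)]]
  have g: "f (fst m'') \<in> H.filt r" "f (fst m') \<in> H.filt r"
    using SP(2) m by (simp_all add: f_filt Ap_filt)
  note e = kap_yy(1)[OF SP(1)[OF m(1)]] kap_yy(1)[OF SP(1)[OF m(2)]] kap_yy(1)[OF SP(1)[OF m(3)]]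
  have z: "mu (yy m) (f (fst m')) (f (fst m'')) = \<zero>\<^sub>H" "mu (kap m) (yy m') (f (fst m'')) = \<zero>\<^sub>H"
    "mu (kap m) (kap m') (yy m'') = \<zero>\<^sub>H"
    subgoal by (rule mu_filt_zero[OF y(1) g(2,1)]) (use r n_lt in simp_all)
    subgoal by (rule mu_filt_zero[OF k(1) y(2) g(1)]) (use r n_lt in simp_all)
    subgoal by (rule mu_filt_zero[OF k(1,2) y(3)]) (use r n_lt in simp_all)
    done
  have "mu (f (fst m)) (f (fst m')) (f (fst m'')) = mu (kap m) (f (fst m')) (f (fst m''))"
    using z(1) c g[THEN H.filt_carrier] unfolding e(1) by (simp add: mu_add)
  also have "\<dots> = mu (kap m) (kap m') (f (fst m''))"
    using z(2) c g[THEN H.filt_carrier] unfolding e(2) by (simp add: mu_add)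
  also have "\<dots> = mu (kap m) (kap m') (kap m'')" using z(3) c unfolding e(3) by (simp add: mu_add)
  finally show ?thesis .
qed

text \<open>In \<open>f2_assoc\<close> the outer factors \<open>f\<close> are replaced by
  \<open>kap\<close>, the errors having degree above \<open>n\<close>. Subtracting the equation
  between \<open>mu\<close> and the coboundary of \<open>\<phi>\<close> removes the defect.\<close>

lemma cassoc_positive:
  assumes m: "m \<in> SP" "m' \<in> SP" "m'' \<in> SP" shows "cassoc m m' m''"
proof -
  note s = SP(1)[OF m(1)] SP(1)[OF m(2)] SP(1)[OF m(3)]
  note a = SP(2)[OF m(1)] SP(2)[OF m(2)] SP(2)[OF m(3)]
  have c: "fst m \<in> carrier A" "fst m' \<in> carrier A" "fst m'' \<in> carrier A"
    "kap m \<in> CH" "kap m' \<in> CH" "kap m'' \<in> CH"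
    "yy m \<in> CH" "yy m' \<in> CH" "yy m'' \<in> CH" using a s by simp_all
  have z: "f2 (fst m) (fst m') \<otimes>\<^sub>H yy m'' = \<zero>\<^sub>H"
    by (rule H_filt_mult_zero[OF f2_filt_pos[OF a(1,2)] yy_L[OF s(3)]]) (use r in simp)
  have z': "parity H (yy m) \<otimes>\<^sub>H f2 (fst m') (fst m'') = \<zero>\<^sub>H"
    by (rule H_filt_mult_zero[OF H.parity_filt[OF yy_L[OF s(1)]] f2_filt_pos[OF a(2,3)]]) (use r in simp)
  have F: "f2 (fst m) (fst m') \<otimes>\<^sub>H kap m'' \<oplus>\<^sub>H f2 (fst m \<otimes> fst m') (fst m'')
      = parity H (kap m) \<otimes>\<^sub>H f2 (fst m') (fst m'') \<oplus>\<^sub>H f2 (fst m) (fst m' \<otimes> fst m'')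
        \<oplus>\<^sub>H mu (kap m) (kap m') (kap m'')"
  proof -
    have "f2 (fst m) (fst m') \<otimes>\<^sub>H f (fst m'') = f2 (fst m) (fst m') \<otimes>\<^sub>H kap m''"
      unfolding kap_yy(1)[OF s(3)] using c z by (simp add: H.A.r_distr)
    moreover have "parity H (f (fst m)) \<otimes>\<^sub>H f2 (fst m') (fst m'')
        = parity H (kap m) \<otimes>\<^sub>H f2 (fst m') (fst m'')"
      unfolding kap_yy(1)[OF s(1)] using c z' by (simp add: H.parity_add H.A.l_distr)
    ultimately show ?thesis using f2_assoc[OF a] by (simp add: mu_f_kap[OF m])
  qed
  let ?F1 = "f2 (fst m) (fst m') \<otimes>\<^sub>H kap m''" let ?F2 = "f2 (fst m \<otimes> fst m') (fst m'')"
  let ?F3 = "parity H (kap m) \<otimes>\<^sub>H f2 (fst m') (fst m'')" let ?F4 = "f2 (fst m) (fst m' \<otimes> fst m'')"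
  let ?P1 = "\<phi> (kap m) (kap m') \<otimes>\<^sub>H kap m''" let ?P2 = "\<phi> (kap m \<otimes>\<^sub>H kap m') (kap m'')"
  let ?P3 = "parity H (kap m) \<otimes>\<^sub>H \<phi> (kap m') (kap m'')" let ?P4 = "\<phi> (kap m) (kap m' \<otimes>\<^sub>H kap m'')"
  have G: "mu (kap m) (kap m') (kap m'') = ?P1 \<ominus>\<^sub>H ?P3 \<oplus>\<^sub>H ?P2 \<ominus>\<^sub>H ?P4"
    using mu_phi[OF c(4-6)] by (simp add: hoch_d_def)
  have "(?F1 \<ominus>\<^sub>H ?P1) \<oplus>\<^sub>H (?F2 \<ominus>\<^sub>H ?P2) = (?F1 \<oplus>\<^sub>H ?F2) \<ominus>\<^sub>H (?P1 \<oplus>\<^sub>H ?P2)"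
    by ((rule H.A.ag)+, insert c, simp_all)
  also have "\<dots> = (?F3 \<ominus>\<^sub>H ?P3) \<oplus>\<^sub>H (?F4 \<ominus>\<^sub>H ?P4)"
    unfolding F G by ((rule H.A.ag)+, insert c, simp_all)
  finally show ?thesis
    unfolding cassoc_def cc_def pair_fst_snd phi_kap_mult(1)[OF m] phi_kap_mult(2)[OF m(2,3,1)]
    using c by (simp add: H.A.minus_l_distr H.A.minus_r_distr)
qed

lemma cassoc_unit:
  assumes m: "m \<in> SS" "m' \<in> SS" "m'' \<in> SS" and a: "a \<in> carrier K"
  defines "u \<equiv> a \<odot>\<^bsub>N\<^esub> \<one>\<^bsub>N\<^esub>"
  shows "cassoc m m' m'' ==> cassoc (u \<oplus>\<^bsub>N\<^esub> m) m' m''" "cassoc m m' m'' ==> cassoc m (u \<oplus>\<^bsub>N\<^esub> m') m''"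
    "cassoc m m' m'' ==> cassoc m m' (u \<oplus>\<^bsub>N\<^esub> m'')"
proof -
  interpret N: gca K N by (rule sp.pair_gca)
  have u: "u \<in> SS" "cc u x = \<zero>\<^sub>H" "cc x u = \<zero>\<^sub>H"
    "u \<otimes>\<^bsub>N\<^esub> x = a \<odot>\<^bsub>N\<^esub> x" "x \<otimes>\<^bsub>N\<^esub> u = a \<odot>\<^bsub>N\<^esub> x" if "x \<in> SS" for x
    using a that N.smult_mult_left[of a "\<one>\<^bsub>N\<^esub>" x] N.smult_mult_right[of a x "\<one>\<^bsub>N\<^esub>"]
      N.A.l_one[of x] N.A.r_one[of x] SS_closed(5) unfolding u_def sp.pair_simps(1)
    by (simp_all only: SS_closed cc_smult cc_one kap_smult kap_one H.smult_r_null)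
  have ku: "kap u = a \<odot>\<^sub>H \<one>\<^sub>H" unfolding u_def kap_smult[OF a SS_closed(5)] kap_one by (rule refl)
  note x = u(1)[OF m(1)]
  have dist: "(x \<oplus>\<^bsub>N\<^esub> y) \<otimes>\<^bsub>N\<^esub> z = x \<otimes>\<^bsub>N\<^esub> z \<oplus>\<^bsub>N\<^esub> y \<otimes>\<^bsub>N\<^esub> z"
    "z \<otimes>\<^bsub>N\<^esub> (x \<oplus>\<^bsub>N\<^esub> y) = z \<otimes>\<^bsub>N\<^esub> x \<oplus>\<^bsub>N\<^esub> z \<otimes>\<^bsub>N\<^esub> y"
    if "x \<in> SS" "y \<in> SS" "z \<in> SS" for x y z
    using N.A.l_distr[of x y z] N.A.r_distr[of x y z] that by simp_all
  note S = m SS_closed(1-3) x a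
  have k: "kap m \<in> CH" "kap m' \<in> CH" "kap m'' \<in> CH" using m by simp_all
  have e: "cc m m' \<in> CH" "cc m' m'' \<in> CH" "cc m m'' \<in> CH"
    "cc (m \<otimes>\<^bsub>N\<^esub> m') m'' \<in> CH" "cc m (m' \<otimes>\<^bsub>N\<^esub> m'') \<in> CH" using S by simp_all
  {
    assume h: "cassoc m m' m''"
    show "cassoc (u \<oplus>\<^bsub>N\<^esub> m) m' m''" using h e k a unfolding cassoc_def
      by (simp add: S dist u ku cc_add cc_smult kap_add H.parity_add H.parity_smult H.A.l_distr
          H.smult_mult_left H.A.a_lcomm) (simp add: S H.A.a_assoc)
  next
    assume h: "cassoc m m' m''"
    show "cassoc m (u \<oplus>\<^bsub>N\<^esub> m') m''" using h e k a unfolding cassoc_def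
      by (simp add: S dist u ku cc_add cc_smult H.A.a_lcomm)
  next
    assume h: "cassoc m m' m''"
    have "a \<odot>\<^sub>H cc m m' \<oplus>\<^sub>H cc m m' \<otimes>\<^sub>H kap m'' \<oplus>\<^sub>H cc (m \<otimes>\<^bsub>N\<^esub> m') m''
        = a \<odot>\<^sub>H cc m m' \<oplus>\<^sub>H (cc m m' \<otimes>\<^sub>H kap m'' \<oplus>\<^sub>H cc (m \<otimes>\<^bsub>N\<^esub> m') m'')"
      using e k a by (intro H.A.a_assoc) simp_all
    also have "\<dots> = parity H (kap m) \<otimes>\<^sub>H cc m' m'' \<oplus>\<^sub>H (a \<odot>\<^sub>H cc m m' \<oplus>\<^sub>H cc m (m' \<otimes>\<^bsub>N\<^esub> m''))"
      unfolding h[unfolded cassoc_def] using e k a by (intro H.A.a_lcomm) simp_all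
    finally show "cassoc m m' (u \<oplus>\<^bsub>N\<^esub> m'')" using e k a unfolding cassoc_def
      by (simp add: S dist u ku cc_add cc_smult kap_add H.A.r_distr H.smult_mult_right)
  }
qed

lemma cassoc:
  assumes m: "m \<in> SS" "m' \<in> SS" "m'' \<in> SS" shows "cassoc m m' m''"
proof -
  obtain a p where p: "a \<in> carrier K" "p \<in> SP" "m = a \<odot>\<^bsub>N\<^esub> \<one>\<^bsub>N\<^esub> \<oplus>\<^bsub>N\<^esub> p" using SS_cases[OF m(1)] .
  obtain a' p' where p': "a' \<in> carrier K" "p' \<in> SP" "m' = a' \<odot>\<^bsub>N\<^esub> \<one>\<^bsub>N\<^esub> \<oplus>\<^bsub>N\<^esub> p'"
    using SS_cases[OF m(2)] .
  obtain a'' p'' where p'': "a'' \<in> carrier K" "p'' \<in> SP" "m'' = a'' \<odot>\<^bsub>N\<^esub> \<one>\<^bsub>N\<^esub> \<oplus>\<^bsub>N\<^esub> p''"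
    using SS_cases[OF m(3)] .
  note s = SP(1)[OF p(2)] SP(1)[OF p'(2)] SP(1)[OF p''(2)]
  have "cassoc p p' p''" by (rule cassoc_positive[OF p(2) p'(2) p''(2)])
  then have "cassoc m p' p''" unfolding p(3) by (rule cassoc_unit(1)[OF s p(1)])
  then have "cassoc m m' p''" unfolding p'(3) by (rule cassoc_unit(2)[OF m(1) s(2,3) p'(1)])
  then show ?thesis unfolding p''(3) by (rule cassoc_unit(3)[OF m(1,2) s(3) p''(1)])
qed

lemma lam_mult:
  assumes m: "m \<in> piece N k" "m' \<in> SS"
  shows "lam (m \<otimes>\<^bsub>N\<^esub> m') = lam m \<otimes>\<^sub>H kap m' \<oplus>\<^sub>H kap m \<otimes>\<^sub>H lam m'
    \<oplus>\<^sub>H cc (diff N m) m' \<oplus>\<^sub>H ksign H k (cc m (diff N m'))"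
proof -
  have s: "m \<in> SS" "fst m \<in> piece A k" using m(1) by (cases m; simp)+
  note D = SSD[OF s(1)] SSD[OF m(2)]
  have c: "kap m \<in> CH" "kap m' \<in> CH" "yy m \<in> CH" "yy m' \<in> CH"
    using s m by simp_all
  have 1: "cc (diff N m) m' = f2 (d (fst m)) (fst m')"
    using D c s by (simp add: cc_def kap_diff bilin_zero[OF phi_bilin] H.A.minus_eq)
  have "cc m (diff N m') = f2 (fst m) (d (fst m'))"
    using D c m(2) by (simp add: cc_def kap_diff bilin_zero[OF phi_bilin] H.A.minus_eq)
  then have 2: "ksign H k (cc m (diff N m')) = f2 (parity A (fst m)) (d (fst m'))"
    using D by (simp add: parity_homogeneous[OF s(2)] ksign_def f2_neg)
  \<comment> \<open>The difference of two products is difference times average plus average times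
    difference. This symmetric form is what allows the same \<open>kap\<close> on both
    sides.\<close>
  have 3: "f (fst m) \<otimes>\<^sub>H f (fst m') = snd m \<otimes>\<^sub>H snd m'
      \<oplus>\<^sub>H (lam m \<otimes>\<^sub>H kap m' \<oplus>\<^sub>H kap m \<otimes>\<^sub>H lam m')" unfolding kap_yy[OF s(1)] kap_yy[OF m(2)]
    by (insert c, simp add: H.A.ring_expand, (rule H.A.ag)+, simp_all)
  have l: "lam m \<in> CH" "lam m' \<in> CH" using D by (simp_all add: lam_def)
  show ?thesis unfolding 1 2 unfolding lam_def[of "m \<otimes>\<^bsub>N\<^esub> m'"] pair_fst_snd f_mult[OF D(4,8)] 3
    by ((rule H.A.ag)+, insert D c l, simp_all)
qed

lemma piece_N: "m \<in> piece N k \<longleftrightarrow> m \<in> SS \<and> fst m \<in> piece A k \<and> snd m \<in> piece H k" by (cases m) simp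

lemma kap_piece: "m \<in> piece N k ==> kap m \<in> piece H k"
  unfolding kap_def piece_N by (intro H.piece_smult hf(1) H.piece_add f_piece) simp_all

lemma cc_comm:
  assumes "m \<in> piece N i" "m' \<in> piece N j" shows "cc m m' = ksign H (i * j) (cc m' m)"
proof -
  have m: "m \<in> SS" "m' \<in> SS" "fst m \<in> piece A i" "fst m' \<in> piece A j" using assms by (simp_all add: piece_N)
  have "\<phi> (kap m) (kap m') = ksign H (j * i) (\<phi> (kap m') (kap m))"
    using sym kap_piece[OF assms(1)] kap_piece[OF assms(2)] unfolding symm_def by blast
  then show ?thesis
    using f2_comm[OF SSD(1)[OF m(1)] SSD(1)[OF m(2)] m(3,4)] m SSD[OF m(1)] SSD[OF m(2)]
    by (simp add: cc_def H.ksign_minus mult.commute)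
qed

lemma cc_piece:
  assumes "m \<in> piece N i" "m' \<in> piece N j" shows "cc m m' \<in> piece_pred H (i + j)" unfolding cc_def
  by (intro H.piece_pred_minus f2_piece phi(6) kap_piece assms) (use assms in \<open>simp_all add: piece_N\<close>)

text \<open>Unit parts of the arguments contribute nothing. For arguments of degree at least
  \<open>r\<close> the map \<open>\<phi>\<close> gives degree at least \<open>2 * r - 1\<close>;
  this is where the bound in \<open>L\<close> comes from.\<close>

lemma cc_L:
  assumes m: "m \<in> SS" "m' \<in> SS" shows "cc m m' \<in> L"
proof -
  obtain a p where p: "a \<in> carrier K" "p \<in> SP" "m = a \<odot>\<^bsub>N\<^esub> \<one>\<^bsub>N\<^esub> \<oplus>\<^bsub>N\<^esub> p" using SS_cases[OF m(1)] .
  obtain a' p' where p': "a' \<in> carrier K" "p' \<in> SP" "m' = a' \<odot>\<^bsub>N\<^esub> \<one>\<^bsub>N\<^esub> \<oplus>\<^bsub>N\<^esub> p'"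
    using SS_cases[OF m(2)] .
  note s = SP(1)[OF p(2)] SP(1)[OF p'(2)]
  note u = SS_closed(3)[OF p(1) SS_closed(5)] SS_closed(3)[OF p'(1) SS_closed(5)]
  have "cc m m' = cc p m'"
    unfolding p(3) cc_add(1)[OF u(1) s(1) m(2)] cc_smult(1)[OF p(1) SS_closed(5) m(2)] cc_one(1)[OF m(2)]
    using p(1) s m by simp
  also have "\<dots> = cc p p'"
    unfolding p'(3) cc_add(2)[OF u(2) s(2) s(1)] cc_smult(2)[OF p'(1) s(1) SS_closed(5)] cc_one(2)[OF s(1)]
    using p'(1) s by simp
  also have "\<dots> \<in> L" unfolding cc_def
    using H.filt_mono[OF f2_filt_pos[OF SP(2)[OF p(2)] SP(2)[OF p'(2)]], of "2 * r - 1"]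
      H.filt_mono[OF bilin_filt[OF phi_bilin SP(4)[OF p(2)] SP(4)[OF p'(2)]], of "2 * r - 1"]
    by (intro H.filt_minus) simp_all
  finally show ?thesis .
qed

lemma lam_L: "m \<in> SS ==> lam m \<in> L" by (simp add: lam_def SSD)

lemma lam_piece: "m \<in> piece N k ==> lam m \<in> piece H k"
  unfolding lam_def piece_N by (intro H.piece_minus f_piece) simp_all

lemma lam_diff: "m \<in> SS ==> lam (diff N m) = \<zero>\<^sub>H" using SSD(4)[of m] by (simp add: lam_def)

end

sublocale prim_hodge \<subseteq> cy: cylinder_data K "pair_dga A (cohomology A) SS" "cohomology A" L kap lam cc
  apply (intro cylinder_data.intro cylinder_data_axioms.intro sp.pair_dg H.gca_axioms)
  unfolding sp.pair_simps(1)
  subgoal by (rule L_graded)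
  subgoal by (rule L_mult(1))
  subgoal by (rule L_mult(2))
  subgoal by (rule kap_closed)
  subgoal by (rule kap_add)
  subgoal by (rule kap_smult)
  subgoal by (rule kap_piece)
  subgoal by (rule kap_one)
  subgoal by (rule kap_diff)
  subgoal by (rule kap_mult_L(1))
  subgoal by (rule kap_mult_L(2))
  subgoal by (rule lam_L)
  subgoal by (rule lam_add)
  subgoal by (rule lam_smult)
  subgoal by (rule lam_piece)
  subgoal by (rule lam_diff)
  subgoal by (rule cc_L)
  subgoal by (rule cc_add(1))
  subgoal by (rule cc_add(2))
  subgoal by (rule cc_smult(1))
  subgoal by (rule cc_smult(2))
  subgoal by (rule cc_piece)
  subgoal by (rule cc_one(1))
  subgoal by (rule cc_one(2))
  subgoal by (rule cc_comm)
  subgoal by (rule cassoc[unfolded cassoc_def])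
  subgoal by (rule lam_mult)
  done

context prim_hodge
begin

section \<open>The cylinder is quasi-isomorphic to the algebra and to its cohomology\<close>

lemma cyl_cocycle:
  "((q, h), z) \<in> cocycles cy.M \<longleftrightarrow> (q, h) \<in> SS \<and> z \<in> L \<and> q \<in> cocycles A \<and> f q = h"
proof -
  have "lam (q, h) = \<zero>\<^sub>H \<longleftrightarrow> f q = h" if "(q, h) \<in> SS"
    using that H.A.diff_zero_eq[of "f q" h] by (auto simp: lam_def SS_iff)
  then show ?thesis by (auto simp: cocycles_def SS_iff)
qed

text \<open>\<open>s q\<close> is a primitive of \<open>q\<close> on which \<open>f\<close>
  vanishes. Its partner in the pair may be any element of \<open>L\<close>, because
  \<open>SS\<close> asks for agreement with \<open>f\<close> only up to \<open>L\<close>; choosing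
  minus \<open>z\<close> makes \<open>lam\<close> produce the second entry \<open>z\<close>.\<close>

lemma cyl_boundary:
  assumes z: "((q, f q), z) \<in> cocycles cy.M" and q: "q \<in> boundaries A"
  shows "((q, f q), z) \<in> boundaries cy.M"
proof -
  have m: "q \<in> A2" "z \<in> L" using z by (simp_all add: cyl_cocycle SS_iff)
  have zc: "z \<in> CH" and qc: "q \<in> carrier A" using m(2) H.filt_carrier m(1) by auto
  have sB: "s q \<in> Bs" by (rule s_Bs[OF qc])
  have "s q \<in> A2" using A2_s[OF m(1)] sB by (intro A2I) (simp_all add: filt_zero)
  then have S: "(s q, \<ominus>\<^sub>H z) \<in> SS" using m(2) zc sB by (simp add: SS_iff H.A.minus_eq)
  have "lam (s q, \<ominus>\<^sub>H z) = z" using sB zc by (simp add: lam_def H.A.minus_eq)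
  then have "diff cy.M ((s q, \<ominus>\<^sub>H z), \<zero>\<^sub>H) = ((q, f q), z)" using q qc by (simp add: diff_s)
  moreover have "((s q, \<ominus>\<^sub>H z), \<zero>\<^sub>H) \<in> carrier cy.M" using S H.filt_zero by simp
  ultimately show ?thesis unfolding boundaries_def by (metis imageI)
qed

lemma cyl_section: "v \<in> cocycles A ==> ((pH v, f v), \<zero>\<^sub>H) \<in> cocycles cy.M"
proof -
  assume v: "v \<in> cocycles A"
  have vc: "v \<in> carrier A" by (rule cocycles_carrier[OF v])
  have "pH v \<in> A2" using parts(2)[OF vc] by (intro A2I) (simp_all add: filt_zero)
  then have "(pH v, f v) \<in> SS" using vc by (simp add: SS_iff H.filt_zero)
  then show ?thesis using vc parts(2)[OF vc] by (simp add: cyl_cocycle H.filt_zero Hs_cocycles)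
qed

lemma cyl_quasi_iso_left: "quasi_iso K cy.M A (\<lambda>x. fst (fst x))"
proof -
  have h: "(\<lambda>x. fst (fst x)) \<in> dgca_hom K cy.M A"
    unfolding dgca_hom_def algebra_hom_def ring_hom_def by auto
  interpret h: dg_hom K cy.M A "\<lambda>x. fst (fst x)"
    using h cy.cyl_dg dg_axioms by (simp add: dg_hom_def dg_hom_axioms_def)
  have "x \<in> boundaries cy.M" if "x \<in> cocycles cy.M" "fst (fst x) \<in> boundaries A" for x
    using that cyl_boundary by (cases x rule: prod.exhaust; cases "fst x") (auto simp: cyl_cocycle)
  moreover have "\<exists>u\<in>cocycles cy.M. fst (fst u) \<ominus> v \<in> boundaries A" if v: "v \<in> cocycles A" for v
  proof -
    have vc: "v \<in> carrier A" by (rule cocycles_carrier[OF v])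
    have "pH v \<ominus> v = pH v \<ominus> (pE v \<oplus> pH v)" by (subst (2) cocycles_parts[OF v]) (rule refl)
    also have "\<dots> = \<ominus> pE v" by ((rule A.ag)+, insert vc, simp_all)
    finally have "pH v \<ominus> v \<in> boundaries A" using Es(4)[OF parts(1)[OF vc]] by simp
    then show ?thesis using cyl_section[OF v] by (intro bexI[of _ "((pH v, f v), \<zero>\<^sub>H)"]) simp_all
  qed
  ultimately show ?thesis unfolding h.quasi_iso_iff by blast
qed

text \<open>In a cocycle the second component of the pair is \<open>f q\<close>. If it is zero, the
  closed \<open>q\<close> has harmonic part zero and is exact, so \<open>cyl_boundary\<close> gives
  injectivity. Surjectivity comes from \<open>cyl_section\<close> at harmonic
  representatives.\<close>

lemma cyl_quasi_iso_right: "quasi_iso K cy.M H (\<lambda>x. snd (fst x))"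
proof -
  have h: "(\<lambda>x. snd (fst x)) \<in> dgca_hom K cy.M H"
    unfolding dgca_hom_def algebra_hom_def ring_hom_def by (auto simp: cohomology_diff SS_iff)
  interpret h: dg_hom K cy.M H "\<lambda>x. snd (fst x)"
    using h cy.cyl_dg cohomology_dg[OF H.gca_axioms] by (simp add: dg_hom_def dg_hom_axioms_def)
  have bH: "boundaries H = {\<zero>\<^sub>H}" using H.A.zero_closed by (auto simp: boundaries_def cohomology_diff)
  have zH: "cocycles H = CH" by (auto simp: cocycles_def cohomology_diff)
  have "x \<in> boundaries cy.M" if x: "x \<in> cocycles cy.M" "snd (fst x) \<in> boundaries H" for x
  proof -
    obtain q h z where e: "x = ((q, h), z)" by (metis prod.exhaust)
    have z: "q \<in> cocycles A" "f q = h" "h = \<zero>\<^sub>H" using x unfolding e bH by (simp_all add: cyl_cocycle)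
    have qc: "q \<in> carrier A" by (rule cocycles_carrier[OF z(1)])
    have "cls A (pH q) = cls A \<zero>" using z by (simp add: f_def cohomology_zero)
    then have "pH q = \<zero>" by (rule rho_inj_Hs[OF parts(2)[OF qc] Hs(2)])
    then have "q = pE q" using cocycles_parts[OF z(1)] qc by simp
    then have "q \<in> boundaries A" using parts(1)[OF qc] by simp
    then show ?thesis using cyl_boundary x z unfolding e by blast
  qed
  moreover have "\<exists>u\<in>cocycles cy.M. snd (fst u) \<ominus>\<^sub>H v \<in> boundaries H" if v: "v \<in> cocycles H" for v
  proof -
    have vc: "v \<in> CH" using v zH by simp
    show ?thesis using cyl_section[OF Hs_cocycles[OF iota_Hs[OF vc]]] vc
      by (intro bexI[of _ "((pH (\<iota> v), f (\<iota> v)), \<zero>\<^sub>H)"]) (simp_all add: bH)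
  qed
  ultimately show ?thesis unfolding h.quasi_iso_iff by blast
qed

text \<open>The cylinder is copied into the type of lists by which \<open>formal\<close> bounds the size of zig-zags.\<close>

definition code :: "('a \<times> 'a set) \<times> 'a set => ('k + 'a + 'u) list" where
  "code x = [Inr (Inl (fst (fst x))), Inr (Inl (\<iota> (snd (fst x)))), Inr (Inl (\<iota> (snd x)))]"

lemma formal_cylinder: "formal TYPE('u) K A"
proof -
  have inj: "inj_on (code :: _ => ('k + 'a + 'u) list) (carrier cy.M)"
  proof (rule inj_onI)
    fix x y assume h: "x \<in> carrier cy.M" "y \<in> carrier cy.M" "code x = (code y :: ('k + 'a + 'u) list)"
    have c: "snd (fst w) \<in> CH" "snd w \<in> CH" if "w \<in> carrier cy.M" for w
    proof -
      have "fst w \<in> SS" "snd w \<in> L" using that by (simp_all add: mem_Times_iff)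
      then show "snd (fst w) \<in> CH" "snd w \<in> CH" by (simp_all add: SSD(2) H.filt_carrier)
    qed
    have e: "fst (fst x) = fst (fst y)" "\<iota> (snd (fst x)) = \<iota> (snd (fst y))" "\<iota> (snd x) = \<iota> (snd y)"
      using h(3) by (simp_all only: code_def list.inject sum.inject)
    have "snd (fst x) = snd (fst y)" "snd x = snd y"
      using arg_cong[OF e(2), of "cls A"] arg_cong[OF e(3), of "cls A"]
      by (simp_all only: cls_iota[OF c(1)[OF h(1)]] cls_iota[OF c(1)[OF h(2)]]
          cls_iota[OF c(2)[OF h(1)]] cls_iota[OF c(2)[OF h(2)]])
    then show "x = y" using e(1) by (simp add: prod_eq_iff)
  qed
  interpret t: transported K cy.M "code :: _ => ('k + 'a + 'u) list"
    using inj cy.cyl_dg by (simp add: transported_def transported_axioms_def)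
  have "qi_step K A t.T" "qi_step K t.T H"
    using t.tr_quasi_iso[OF cyl_quasi_iso_left] t.tr_quasi_iso[OF cyl_quasi_iso_right]
    unfolding qi_step_def by blast+
  then show ?thesis unfolding formal_def dgca_equivalent_def by blast
qed

end

section \<open>The free algebra\<close>

text \<open>The product of \<open>free_algebra\<close> for arbitrary functions on words. Its laws
  can so be proved by induction on the word, without regard to supports.\<close>

definition conv :: "('k, 'l) ring_scheme => ('x list => 'k) => ('x list => 'k) => 'x list => 'k" where
  "conv K f g w = (\<Oplus>\<^bsub>K\<^esub>i\<in>{..length w}. f (take i w) \<otimes>\<^bsub>K\<^esub> g (drop i w))"

context cring
begin

lemma conv_closed [simp]: "[|range f \<subseteq> carrier R; range g \<subseteq> carrier R|] ==> conv R f g w \<in> carrier R"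
  unfolding conv_def by (rule finsum_closed) (auto simp: image_subset_iff)

lemma conv_Nil: "[|range f \<subseteq> carrier R; range g \<subseteq> carrier R|] ==> conv R f g [] = f [] \<otimes> g []"
  by (auto simp: conv_def image_subset_iff)

text \<open>The cut before the first letter is separated from the others, which form a convolution
  with \<open>f\<close> shifted by that letter. This recursion drives the inductions below, where
  \<open>f\<close> has to vary.\<close>

lemma conv_Cons:
  assumes "range f \<subseteq> carrier R" "range g \<subseteq> carrier R"
  shows "conv R f g (x # w) = f [] \<otimes> g (x # w) \<oplus> conv R (\<lambda>v. f (x # v)) g w"
proof -
  have "conv R f g (x # w) = (\<Oplus>i\<in>{..length w}. f (take (Suc i) (x # w)) \<otimes> g (drop (Suc i) (x # w)))
      \<oplus> f (take 0 (x # w)) \<otimes> g (drop 0 (x # w))"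
    unfolding conv_def list.size(4) Nat.add_0_right add_Suc_right
    by (rule add.finprod_Suc2) (use assms in \<open>auto simp: image_subset_iff\<close>)
  also have "(\<Oplus>i\<in>{..length w}. f (take (Suc i) (x # w)) \<otimes> g (drop (Suc i) (x # w)))
      = conv R (\<lambda>v. f (x # v)) g w" by (simp add: conv_def)
  finally show ?thesis
    using assms conv_closed[of "\<lambda>v. f (x # v)" g w] by (auto simp: a_comm image_subset_iff)
qed

lemma conv_add:
  assumes "range f \<subseteq> carrier R" "range f' \<subseteq> carrier R" "range g \<subseteq> carrier R"
  shows "conv R (\<lambda>v. f v \<oplus> f' v) g w = conv R f g w \<oplus> conv R f' g w"
    "conv R g (\<lambda>v. f v \<oplus> f' v) w = conv R g f w \<oplus> conv R g f' w"
proof -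
  have c: "f v \<in> carrier R" "f' v \<in> carrier R" "g v \<in> carrier R" for v using assms by auto
  show "conv R (\<lambda>v. f v \<oplus> f' v) g w = conv R f g w \<oplus> conv R f' g w"
    "conv R g (\<lambda>v. f v \<oplus> f' v) w = conv R g f w \<oplus> conv R g f' w" unfolding conv_def using c
    by (simp_all add: l_distr r_distr finsum_addf Pi_def)
qed

lemma conv_smult:
  assumes "range f \<subseteq> carrier R" "range g \<subseteq> carrier R" "a \<in> carrier R"
  shows "conv R (\<lambda>v. a \<otimes> f v) g w = a \<otimes> conv R f g w"
proof -
  have c: "f v \<in> carrier R" "g v \<in> carrier R" for v using assms by auto
  show ?thesis unfolding conv_def using c assms(3) by (simp add: finsum_rdistr Pi_def m_assoc)
qed

lemma conv_assoc:
  assumes "range f \<subseteq> carrier R" "range g \<subseteq> carrier R" "range h \<subseteq> carrier R"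
  shows "conv R (conv R f g) h w = conv R f (conv R g h) w" using assms
proof (induct w arbitrary: f)
  case Nil
  have c: "f v \<in> carrier R" "g v \<in> carrier R" "h v \<in> carrier R" for v using Nil by auto
  have "range (conv R f g) \<subseteq> carrier R" "range (conv R g h) \<subseteq> carrier R"
    using Nil by (auto intro!: conv_closed)
  then show ?case using Nil c by (simp add: conv_Nil m_assoc)
next
  case (Cons x w)
  have c: "f v \<in> carrier R" "g v \<in> carrier R" "h v \<in> carrier R" for v using Cons(2-4) by auto
  let ?f = "\<lambda>v. f (x # v)" and ?g = "\<lambda>v. g (x # v)"
  have r: "range ?f \<subseteq> carrier R" "range ?g \<subseteq> carrier R" using c by auto
  have r': "range (conv R f g) \<subseteq> carrier R" "range (conv R ?f g) \<subseteq> carrier R"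
    "range (conv R g h) \<subseteq> carrier R" "range (\<lambda>v. f [] \<otimes> ?g v) \<subseteq> carrier R"
    using r Cons(2-4) c by (auto intro!: conv_closed)
  have "conv R (conv R f g) h (x # w)
      = f [] \<otimes> g [] \<otimes> h (x # w) \<oplus> conv R (\<lambda>v. f [] \<otimes> ?g v \<oplus> conv R ?f g v) h w"
    using Cons(2-4) r' by (simp add: conv_Cons conv_Nil)
  also have "conv R (\<lambda>v. f [] \<otimes> ?g v \<oplus> conv R ?f g v) h w
      = f [] \<otimes> conv R ?g h w \<oplus> conv R (conv R ?f g) h w"
    using r r' Cons(4) c by (simp add: conv_add conv_smult)
  also have "conv R (conv R ?f g) h w = conv R ?f (conv R g h) w" by (rule Cons(1)[OF r(1) Cons(3,4)])
  finally have "conv R (conv R f g) h (x # w)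
      = f [] \<otimes> (g [] \<otimes> h (x # w) \<oplus> conv R ?g h w) \<oplus> conv R ?f (conv R g h) w"
    using r r' Cons(4) c by (simp add: r_distr m_assoc a_assoc)
  then show ?case using r r' Cons(2-4) c by (simp add: conv_Cons)
qed

lemma conv_zero:
  assumes "range g \<subseteq> carrier R" shows "conv R (\<lambda>v. \<zero>) g w = \<zero>"
  using conv_smult[of "\<lambda>v. \<zero>" g \<zero> w] assms by simp

definition mono :: "'a => 'x list => 'x list => 'a" where
  "mono a u = (\<lambda>w. if w = u then a else \<zero>)"

lemma mono_range: "a \<in> carrier R ==> range (mono a u) \<subseteq> carrier R" by (auto simp: mono_def)

lemma mono_simps [simp]:
  "mono a u u = a" "mono a [] (x # v) = \<zero>" "mono a (x # u) [] = \<zero>" by (simp_all add: mono_def)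

lemma conv_mono:
  assumes g: "range g \<subseteq> carrier R" and a: "a \<in> carrier R"
  shows "conv R (mono a u) g w = (if take (length u) w = u then a \<otimes> g (drop (length u) w) else \<zero>)"
proof (induct u arbitrary: w)
  case Nil
  have c: "g v \<in> carrier R" for v using g by auto
  show ?case
  proof (cases w)
    case (Cons x v)
    then show ?thesis using c a by (simp add: conv_Cons[OF mono_range[OF a] g] conv_zero[OF g])
  qed (use a c in \<open>simp add: conv_Nil[OF mono_range[OF a] g]\<close>)
next
  case (Cons x u)
  have c: "g v \<in> carrier R" for v using g by auto
  show ?case
  proof (cases w)
    case w: (Cons y v)
    have "(\<lambda>v. mono a (x # u) (y # v)) = (if y = x then mono a u else (\<lambda>v. \<zero>))"
      by (auto simp: mono_def)
    then show ?thesis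
      using w c a Cons[of v] by (simp add: conv_Cons[OF mono_range[OF a] g] conv_zero[OF g])
  qed (use a c in \<open>simp add: conv_Nil[OF mono_range[OF a] g]\<close>)
qed

lemma conv_one_right:
  assumes "range f \<subseteq> carrier R" shows "conv R f (mono \<one> []) w = f w" using assms
proof (induct w arbitrary: f)
  case Nil
  have "f [] \<in> carrier R" using Nil by auto
  then show ?case by (simp add: conv_Nil[OF Nil mono_range[OF one_closed]])
next
  case (Cons x w)
  have c: "f v \<in> carrier R" for v using Cons(2) by auto
  have "conv R (\<lambda>v. f (x # v)) (mono \<one> []) w = f (x # w)" by (rule Cons(1)) (use c in auto)
  then show ?case using c by (simp add: conv_Cons[OF Cons(2) mono_range[OF one_closed]])
qed

abbreviation F where "F \<equiv> free_algebra R"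

lemma F_simps [simp]:
  "f \<in> carrier (F U) \<longleftrightarrow> range f \<subseteq> carrier R \<and> finite {w. f w \<noteq> \<zero>} \<and> (\<forall>w. f w \<noteq> \<zero> \<longrightarrow> set w \<subseteq> U)"
  "f \<otimes>\<^bsub>F U\<^esub> g = conv R f g" "\<one>\<^bsub>F U\<^esub> = mono \<one> []" "\<zero>\<^bsub>F U\<^esub> = (\<lambda>w. \<zero>)"
  "f \<oplus>\<^bsub>F U\<^esub> g = (\<lambda>w. f w \<oplus> g w)" "a \<odot>\<^bsub>F U\<^esub> f = (\<lambda>w. a \<otimes> f w)"
  by (auto simp: free_algebra_def conv_def mono_def fun_eq_iff)

lemma conv_support:
  assumes "range f \<subseteq> carrier R" "range g \<subseteq> carrier R" "conv R f g w \<noteq> \<zero>"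
  obtains u v where "w = u @ v" "f u \<noteq> \<zero>" "g v \<noteq> \<zero>"
proof (rule ccontr)
  assume n: "\<not> thesis"
  have c: "f v \<in> carrier R" "g v \<in> carrier R" for v using assms by auto
  have "f (take i w) \<otimes> g (drop i w) = \<zero>" for i
  proof -
    have "f (take i w) = \<zero> \<or> g (drop i w) = \<zero>" using n that[of "take i w" "drop i w"] by auto
    then show ?thesis using c by auto
  qed
  then show False using assms(3) by (simp add: conv_def)
qed

lemma F_ring: "ring (F U)"
proof (rule ringI')
  fix f g h assume "f \<in> carrier (F U)" "g \<in> carrier (F U)" "h \<in> carrier (F U)"
  note f = this[unfolded F_simps]
  have c: "f v \<in> carrier R" "g v \<in> carrier R" "h v \<in> carrier R" for v using f by auto
  show "f \<oplus>\<^bsub>F U\<^esub> g \<in> carrier (F U)"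
  proof -
    have "{w. f w \<oplus> g w \<noteq> \<zero>} \<subseteq> {w. f w \<noteq> \<zero>} \<union> {w. g w \<noteq> \<zero>}" by auto
    then have "finite {w. f w \<oplus> g w \<noteq> \<zero>}" by (rule finite_subset) (use f in auto)
    moreover have "set w \<subseteq> U" if "f w \<oplus> g w \<noteq> \<zero>" for w
      using f that c(2)[of w] by (cases "f w = \<zero>") auto
    ultimately show ?thesis using c by auto
  qed
  show "f \<otimes>\<^bsub>F U\<^esub> g \<in> carrier (F U)"
  proof -
    have s: "\<exists>u v. w = u @ v \<and> f u \<noteq> \<zero> \<and> g v \<noteq> \<zero>" if "conv R f g w \<noteq> \<zero>" for w
      by (rule conv_support[OF conjunct1[OF f(1)] conjunct1[OF f(2)] that]) blast
    then have "{w. conv R f g w \<noteq> \<zero>} \<subseteq> (\<lambda>(u, v). u @ v) ` ({w. f w \<noteq> \<zero>} \<times> {w. g w \<noteq> \<zero>})" by force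
    then have "finite {w. conv R f g w \<noteq> \<zero>}" by (rule finite_subset) (use f in auto)
    moreover have "set w \<subseteq> U" if w: "conv R f g w \<noteq> \<zero>" for w
    proof -
      obtain u v where "w = u @ v" "f u \<noteq> \<zero>" "g v \<noteq> \<zero>" using s[OF w] by blast
      moreover then have "set u \<subseteq> U" "set v \<subseteq> U" using f by blast+
      ultimately show ?thesis by simp
    qed
    moreover have "range (conv R f g) \<subseteq> carrier R" using f by (auto intro!: conv_closed)
    ultimately show ?thesis by simp
  qed
  show "f \<otimes>\<^bsub>F U\<^esub> g \<otimes>\<^bsub>F U\<^esub> h = f \<otimes>\<^bsub>F U\<^esub> (g \<otimes>\<^bsub>F U\<^esub> h)"
    using f conv_assoc[of f g h] by (auto simp: fun_eq_iff)
  show "(f \<oplus>\<^bsub>F U\<^esub> g) \<otimes>\<^bsub>F U\<^esub> h = f \<otimes>\<^bsub>F U\<^esub> h \<oplus>\<^bsub>F U\<^esub> g \<otimes>\<^bsub>F U\<^esub> h"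
    using f by (simp add: conv_add fun_eq_iff)
  show "h \<otimes>\<^bsub>F U\<^esub> (f \<oplus>\<^bsub>F U\<^esub> g) = h \<otimes>\<^bsub>F U\<^esub> f \<oplus>\<^bsub>F U\<^esub> h \<otimes>\<^bsub>F U\<^esub> g"
    using f by (simp add: conv_add fun_eq_iff)
  show "f \<oplus>\<^bsub>F U\<^esub> g \<oplus>\<^bsub>F U\<^esub> h = f \<oplus>\<^bsub>F U\<^esub> (g \<oplus>\<^bsub>F U\<^esub> h)" "f \<oplus>\<^bsub>F U\<^esub> g = g \<oplus>\<^bsub>F U\<^esub> f"
    "\<zero>\<^bsub>F U\<^esub> \<oplus>\<^bsub>F U\<^esub> f = f" using c by (simp_all add: fun_eq_iff a_assoc) (simp add: a_comm)
  show "\<one>\<^bsub>F U\<^esub> \<otimes>\<^bsub>F U\<^esub> f = f" "f \<otimes>\<^bsub>F U\<^esub> \<one>\<^bsub>F U\<^esub> = f"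
    using f c by (simp_all add: fun_eq_iff conv_one_right conv_mono)
  show "\<exists>g\<in>carrier (F U). g \<oplus>\<^bsub>F U\<^esub> f = \<zero>\<^bsub>F U\<^esub>"
    using f c a_inv_closed by (intro bexI[of _ "\<lambda>w. \<ominus> f w"]) (auto simp: l_neg image_subset_iff)
next
  have "{w. mono \<one> [] w \<noteq> \<zero>} \<subseteq> {[]}" by (auto simp: mono_def)
  then have "finite {w. mono \<one> [] w \<noteq> \<zero>}" by (rule finite_subset) simp
  then show "\<one>\<^bsub>F U\<^esub> \<in> carrier (F U)" using mono_range[OF one_closed, of "[]"] by (auto simp: mono_def)
  show "\<zero>\<^bsub>F U\<^esub> \<in> carrier (F U)" by auto
qed

end

section \<open>Evaluation of noncommutative polynomials\<close>

locale free_eval = gca K A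
  for K :: "('k, 'l) ring_scheme" and A :: "('k, 'a, 'm) dga_scheme" (structure) +
  fixes U :: "'x set" and g :: "'x => 'a"
  assumes g_closed: "x \<in> U ==> g x \<in> carrier A"
begin

abbreviation FU where "FU \<equiv> K.F U"

definition wd :: "'x list => 'a" where "wd u = foldr (\<lambda>x y. g x \<otimes> y) u \<one>"

definition ev :: "('x list => 'k) => 'a" where
  "ev f = (\<Oplus>w\<in>{w. f w \<noteq> \<zero>\<^bsub>K\<^esub>}. f w \<odot> wd w)"

lemma wd_simps [simp]: "wd [] = \<one>" "wd (x # u) = g x \<otimes> wd u" by (simp_all add: wd_def)

lemma wd_closed [simp]: "set u \<subseteq> U ==> wd u \<in> carrier A" by (induct u) (auto simp: g_closed)

lemma wd_append: "[|set u \<subseteq> U; set v \<subseteq> U|] ==> wd (u @ v) = wd u \<otimes> wd v"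
  by (induct u) (auto simp: g_closed A.m_assoc)

lemma ev_superset:
  assumes f: "f \<in> carrier FU" and S: "finite S" "{w. f w \<noteq> \<zero>\<^bsub>K\<^esub>} \<subseteq> S" "!!w. w \<in> S ==> set w \<subseteq> U"
  shows "ev f = (\<Oplus>w\<in>S. f w \<odot> wd w)"
proof -
  have c: "f w \<in> carrier K" for w using f by auto
  show ?thesis unfolding ev_def using c S by (intro A.finsum_superset) auto
qed

lemma F_support:
  assumes "f \<in> carrier FU"
  shows "finite {w. f w \<noteq> \<zero>\<^bsub>K\<^esub>}" "!!w. f w \<noteq> \<zero>\<^bsub>K\<^esub> ==> set w \<subseteq> U" "!!w. f w \<in> carrier K"
    "range f \<subseteq> carrier K" using assms by (auto simp: image_subset_iff)

lemma ev_closed [simp]: "f \<in> carrier FU ==> ev f \<in> carrier A"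
  unfolding ev_def by (rule A.finsum_closed) (simp del: K.F_simps add: F_support Pi_def)

lemma ev_add:
  assumes "f \<in> carrier FU" "h \<in> carrier FU"
  shows "ev (f \<oplus>\<^bsub>FU\<^esub> h) = ev f \<oplus> ev h"
proof -
  note f = F_support[OF assms(1)] and h = F_support[OF assms(2)]
  let ?S = "{w. f w \<noteq> \<zero>\<^bsub>K\<^esub>} \<union> {w. h w \<noteq> \<zero>\<^bsub>K\<^esub>}"
  have S: "finite ?S" "!!w. w \<in> ?S ==> set w \<subseteq> U" using f(1) h(1) by (simp, auto dest: f(2) h(2))
  have s: "{w. (f \<oplus>\<^bsub>FU\<^esub> h) w \<noteq> \<zero>\<^bsub>K\<^esub>} \<subseteq> ?S" by auto
  have m: "f \<oplus>\<^bsub>FU\<^esub> h \<in> carrier FU" by (rule ring.ring_simprules(1)[OF K.F_ring assms])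
  have e: "ev f = (\<Oplus>w\<in>?S. f w \<odot> wd w)" "ev h = (\<Oplus>w\<in>?S. h w \<odot> wd w)"
    by (rule ev_superset[OF assms(1) S(1) _ S(2)], blast, assumption)
      (rule ev_superset[OF assms(2) S(1) _ S(2)], blast, assumption)
  have "ev (f \<oplus>\<^bsub>FU\<^esub> h) = (\<Oplus>w\<in>?S. (f \<oplus>\<^bsub>FU\<^esub> h) w \<odot> wd w)" by (rule ev_superset[OF m S(1) s S(2)])
  also have "\<dots> = (\<Oplus>w\<in>?S. f w \<odot> wd w \<oplus> h w \<odot> wd w)"
    by (rule A.finsum_cong') (use f(3) h(3) S(2) in \<open>auto simp: smult_l_distr\<close>)
  also have "\<dots> = ev f \<oplus> ev h" unfolding e by (rule A.finsum_addf) (use f(3) h(3) S(2) in auto)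
  finally show ?thesis .
qed

lemma mono_F: "[|a \<in> carrier K; set u \<subseteq> U|] ==> K.mono a u \<in> carrier FU"
proof -
  assume a: "a \<in> carrier K" "set u \<subseteq> U"
  have "{w. K.mono a u w \<noteq> \<zero>\<^bsub>K\<^esub>} \<subseteq> {u}" by (auto simp: K.mono_def)
  then show ?thesis using K.mono_range[OF a(1), of u] a finite_subset by (fastforce simp: K.mono_def)
qed

lemma ev_mono: "[|a \<in> carrier K; set u \<subseteq> U|] ==> ev (K.mono a u) = a \<odot> wd u"
  by (subst ev_superset[of _ "{u}"]) (auto simp del: K.F_simps simp: mono_F, auto simp: K.mono_def split: if_splits)

lemma ev_mono_mult:
  assumes a: "a \<in> carrier K" "set u \<subseteq> U" and h: "h \<in> carrier FU"
  shows "ev (K.mono a u \<otimes>\<^bsub>FU\<^esub> h) = ev (K.mono a u) \<otimes> ev h"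
proof -
  note hs = F_support[OF h]
  let ?S = "{w. h w \<noteq> \<zero>\<^bsub>K\<^esub>}"
  let ?p = "K.mono a u \<otimes>\<^bsub>FU\<^esub> h"
  have p: "?p w = (if take (length u) w = u then a \<otimes>\<^bsub>K\<^esub> h (drop (length u) w) else \<zero>\<^bsub>K\<^esub>)" for w
    by (simp add: K.conv_mono[OF hs(4) a(1)])
  have m: "?p \<in> carrier FU" by (rule ring.ring_simprules(5)[OF K.F_ring mono_F[OF a] h])
  have s: "{w. ?p w \<noteq> \<zero>\<^bsub>K\<^esub>} \<subseteq> (\<lambda>v. u @ v) ` ?S"
  proof
    fix w assume "w \<in> {w. ?p w \<noteq> \<zero>\<^bsub>K\<^esub>}"
    then have "take (length u) w = u" "h (drop (length u) w) \<noteq> \<zero>\<^bsub>K\<^esub>"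
      using a(1) unfolding p by (auto split: if_splits)
    then show "w \<in> (\<lambda>v. u @ v) ` ?S" by (intro image_eqI[of _ _ "drop (length u) w"]) (metis append_take_drop_id, simp)
  qed
  have "ev ?p = (\<Oplus>w\<in>(\<lambda>v. u @ v) ` ?S. ?p w \<odot> wd w)"
  proof (rule ev_superset[OF m _ s])
    show "set w \<subseteq> U" if "w \<in> (\<lambda>v. u @ v) ` ?S" for w using that hs(2) a(2) by (elim imageE) simp
  qed (simp add: hs(1))
  also have "\<dots> = (\<Oplus>v\<in>?S. ?p (u @ v) \<odot> wd (u @ v))"
  proof (rule A.add.finprod_reindex)
    have "?p w \<in> carrier K" for w using F_support(3)[OF m] .
    then show "(\<lambda>w. ?p w \<odot> wd w) \<in> (\<lambda>v. u @ v) ` ?S \<rightarrow> carrier A"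
      using hs(2) a by (auto simp del: K.F_simps)
  qed (simp add: inj_on_def)
  also have "\<dots> = (\<Oplus>v\<in>?S. (a \<odot> wd u) \<otimes> (h v \<odot> wd v))" by (rule A.finsum_cong')
      (use hs a in \<open>auto simp del: K.F_simps simp: p wd_append smult_mult_left smult_mult_right smult_assoc1[symmetric] K.m_comm[of a]\<close>)
  also have "\<dots> = (a \<odot> wd u) \<otimes> ev h"
    unfolding ev_def by (rule A.finsum_rdistr[symmetric]) (use hs a in auto)
  finally show ?thesis by (simp only: ev_mono[OF a])
qed

lemma F_induct [consumes 1, case_names mono add]:
  assumes f: "f \<in> carrier FU"
    and mono: "!!a u. [|a \<in> carrier K; set u \<subseteq> U|] ==> Q (K.mono a u)"
    and add: "!!f h. [|f \<in> carrier FU; h \<in> carrier FU; Q f; Q h|] ==> Q (f \<oplus>\<^bsub>FU\<^esub> h)"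
  shows "Q f"
proof -
  have "Q f" if "finite S" "f \<in> carrier FU" "{w. f w \<noteq> \<zero>\<^bsub>K\<^esub>} \<subseteq> S" for S f using that
  proof (induct S arbitrary: f rule: finite_induct)
    case empty
    then have "f = K.mono \<zero>\<^bsub>K\<^esub> []" by (auto simp: K.mono_def)
    then show ?case using mono[of "\<zero>\<^bsub>K\<^esub>" "[]"] by simp
  next
    case (insert u S)
    note fs = F_support[OF insert(4)]
    show ?case
    proof (cases "f u = \<zero>\<^bsub>K\<^esub>")
      case True
      then have "{w. f w \<noteq> \<zero>\<^bsub>K\<^esub>} \<subseteq> S" using insert(5) by auto
      then show ?thesis using insert by blast
    next
      case False
      let ?h = "f(u := \<zero>\<^bsub>K\<^esub>)"
      have "{w. ?h w \<noteq> \<zero>\<^bsub>K\<^esub>} \<subseteq> {w. f w \<noteq> \<zero>\<^bsub>K\<^esub>}" by auto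
      then have "finite {w. ?h w \<noteq> \<zero>\<^bsub>K\<^esub>}" using fs(1) finite_subset by blast
      then have h: "?h \<in> carrier FU" using fs by (auto split: if_splits)
      have m: "K.mono (f u) u \<in> carrier FU" by (rule mono_F[OF fs(3) fs(2)[OF False]])
      have "Q ?h" by (rule insert(3)[OF h]) (use insert(5) in auto)
      then have "Q (K.mono (f u) u \<oplus>\<^bsub>FU\<^esub> ?h)" by (rule add[OF m h mono[OF fs(3) fs(2)[OF False]]])
      also have "K.mono (f u) u \<oplus>\<^bsub>FU\<^esub> ?h = f" using fs(3) by (auto simp: K.mono_def fun_eq_iff)
      finally show ?thesis .
    qed
  qed
  then show ?thesis using F_support(1)[OF f] f by blast
qed

lemma ev_mult:
  assumes "f \<in> carrier FU" "h \<in> carrier FU"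
  shows "ev (f \<otimes>\<^bsub>FU\<^esub> h) = ev f \<otimes> ev h" using assms(1)
proof (induct rule: F_induct)
  case (mono a u)
  then show ?case by (rule ev_mono_mult[OF _ _ assms(2)])
next
  case (add f f')
  note R = ring.ring_simprules[OF K.F_ring[of U]]
  have "ev ((f \<oplus>\<^bsub>FU\<^esub> f') \<otimes>\<^bsub>FU\<^esub> h) = ev (f \<otimes>\<^bsub>FU\<^esub> h) \<oplus> ev (f' \<otimes>\<^bsub>FU\<^esub> h)"
    unfolding R(13)[OF add(1,2) assms(2)] by (rule ev_add[OF R(5)[OF add(1) assms(2)] R(5)[OF add(2) assms(2)]])
  then show ?case unfolding add(3,4) ev_add[OF add(1,2)]
    using A.l_distr[OF ev_closed[OF add(1)] ev_closed[OF add(2)] ev_closed[OF assms(2)]] by simp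
qed

lemma ev_hom: "ring_hom_ring (K.F U) A ev"
proof (rule ring_hom_ringI)
  show "ev \<one>\<^bsub>FU\<^esub> = \<one>" using ev_mono[of "\<one>\<^bsub>K\<^esub>" "[]"] by simp
qed (rule K.F_ring A.ring_axioms ev_closed ev_mult ev_add; assumption?)+

lemma ev_smult:
  assumes "a \<in> carrier K" "f \<in> carrier FU" shows "ev (a \<odot>\<^bsub>FU\<^esub> f) = a \<odot> ev f"
proof -
  note fs = F_support[OF assms(2)]
  have e: "a \<odot>\<^bsub>FU\<^esub> f = K.mono a [] \<otimes>\<^bsub>FU\<^esub> f" by (simp add: fun_eq_iff K.conv_mono[OF fs(4) assms(1)])
  have "ev (K.mono a [] \<otimes>\<^bsub>FU\<^esub> f) = ev (K.mono a []) \<otimes> ev f"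
    by (rule ev_mono_mult[OF assms(1) _ assms(2)]) simp
  then show ?thesis unfolding e using assms by (simp del: K.F_simps add: ev_mono smult_mult_left)
qed

lemma letter_mono: "letter K x = K.mono \<one>\<^bsub>K\<^esub> [x]" by (simp add: letter_def K.mono_def)

lemma letter_F: "x \<in> U ==> letter K x \<in> carrier FU" unfolding letter_mono by (rule mono_F) auto

lemma ev_letter: "x \<in> U ==> ev (letter K x) = g x"
  using ev_mono[of "\<one>\<^bsub>K\<^esub>" "[x]"] g_closed[of x] by (simp add: letter_mono)

end

section \<open>The subalgebra generated by a partial splitting\<close>

locale gen_split = poincare K A n I
  for K :: "('k, 'l) ring_scheme" and A :: "('k, 'a, 'm) dga_scheme" (structure) and n I +
  fixes G :: "'a set set" and \<iota>\<^sub>0 :: "'a set => 'a"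
  assumes G_graded: "graded_subspace K (cohomology A) G"
    and i0_cocycle [simp]: "x \<in> G ==> \<iota>\<^sub>0 x \<in> cocycles A"
    and i0_add: "[|x \<in> G; y \<in> G|] ==> \<iota>\<^sub>0 (x \<oplus>\<^bsub>cohomology A\<^esub> y) = \<iota>\<^sub>0 x \<oplus> \<iota>\<^sub>0 y"
    and i0_smult: "[|a \<in> carrier K; x \<in> G|] ==> \<iota>\<^sub>0 (a \<odot>\<^bsub>cohomology A\<^esub> x) = a \<odot> \<iota>\<^sub>0 x"
    and i0_piece: "[|x \<in> G; x \<in> piece (cohomology A) k|] ==> \<iota>\<^sub>0 x \<in> piece A k"
    and cls_i0 [simp]: "x \<in> G ==> cls A (\<iota>\<^sub>0 x) = x"
begin

lemmas Gs = H.graded_subspaceD[OF G_graded]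

lemma i0_closed [simp]: "x \<in> G ==> \<iota>\<^sub>0 x \<in> carrier A" using i0_cocycle cocycles_carrier by blast

end

sublocale gen_split \<subseteq> fe: free_eval K A G \<iota>\<^sub>0 by unfold_locales simp

context gen_split
begin

abbreviation FG where "FG \<equiv> free_algebra K G"
abbreviation JG where "JG \<equiv> sym_ideal K H G"

text \<open>The linear relations evaluate to zero because \<open>\<iota>\<^sub>0\<close> is linear,
  the commutation relations because it preserves degrees and \<open>A\<close> is graded
  commutative.\<close>

lemma relations_kernel: "sym_relations K H G \<subseteq> a_kernel FG A fe.ev"
proof -
  interpret F: ring FG by (rule K.F_ring)
  interpret h: ring_hom_ring FG A fe.ev by (rule fe.ev_hom)
  have m: "fe.ev (u \<ominus>\<^bsub>FG\<^esub> v) = fe.ev u \<ominus> fe.ev v" if "u \<in> carrier FG" "v \<in> carrier FG" for u v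
    using that h.hom_add[of u "\<ominus>\<^bsub>FG\<^esub> v"] h.hom_a_inv[of v]
    by (simp only: a_minus_def F.a_inv_closed)
  have k: "u \<ominus>\<^bsub>FG\<^esub> v \<in> a_kernel FG A fe.ev"
    if "u \<in> carrier FG" "v \<in> carrier FG" "fe.ev u = fe.ev v" for u v unfolding a_kernel_def'
    using m[OF that(1,2)] that A.minus_self[OF fe.ev_closed[OF that(2)]] F.minus_closed[OF that(1,2)]
    by simp
  note l = fe.letter_F fe.ev_letter
  have 1: "letter K (x \<oplus>\<^sub>H y) \<ominus>\<^bsub>FG\<^esub> (letter K x \<oplus>\<^bsub>FG\<^esub> letter K y) \<in> a_kernel FG A fe.ev"
    if "x \<in> G" "y \<in> G" for x y
    by (rule k[OF l(1)[OF Gs(3)[OF that]] F.a_closed[OF l(1) l(1), OF that]])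
      (use that in \<open>simp del: K.F_simps add: h.hom_add l Gs(3) i0_add\<close>)
  have 2: "letter K (a \<odot>\<^sub>H x) \<ominus>\<^bsub>FG\<^esub> (a \<odot>\<^bsub>FG\<^esub> letter K x) \<in> a_kernel FG A fe.ev"
    if "a \<in> carrier K" "x \<in> G" for a x
  proof (rule k[OF l(1)[OF Gs(6)[OF that]]])
    have "a \<odot>\<^bsub>FG\<^esub> letter K x = K.mono a [x]"
      using that(1) by (auto simp: letter_def K.mono_def fun_eq_iff)
    then show "a \<odot>\<^bsub>FG\<^esub> letter K x \<in> carrier FG" using fe.mono_F[of a "[x]"] that by simp
  qed (use that in \<open>simp del: K.F_simps add: fe.ev_smult l Gs(6) i0_smult\<close>)
  have 3: "letter K x \<otimes>\<^bsub>FG\<^esub> letter K y \<ominus>\<^bsub>FG\<^esub> ksign FG (i * j) (letter K y \<otimes>\<^bsub>FG\<^esub> letter K x)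
      \<in> a_kernel FG A fe.ev"
    if "x \<in> G" "y \<in> G" "x \<in> piece H i" "y \<in> piece H j" for x y i j
  proof (rule k)
    have m: "letter K y \<otimes>\<^bsub>FG\<^esub> letter K x \<in> carrier FG" "letter K x \<otimes>\<^bsub>FG\<^esub> letter K y \<in> carrier FG"
      using l(1) that F.m_closed by blast+
    then show "letter K x \<otimes>\<^bsub>FG\<^esub> letter K y \<in> carrier FG"
      "ksign FG (i * j) (letter K y \<otimes>\<^bsub>FG\<^esub> letter K x) \<in> carrier FG"
      using F.a_inv_closed unfolding ksign_def by (simp_all only: if_split) simp
    have "fe.ev (ksign FG (i * j) (letter K y \<otimes>\<^bsub>FG\<^esub> letter K x)) = ksign A (i * j) (\<iota>\<^sub>0 y \<otimes> \<iota>\<^sub>0 x)"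
      using m(1) that by (simp del: K.F_simps add: ksign_def h.hom_a_inv h.hom_mult l)
    then show "fe.ev (letter K x \<otimes>\<^bsub>FG\<^esub> letter K y) = fe.ev (ksign FG (i * j) (letter K y \<otimes>\<^bsub>FG\<^esub> letter K x))"
      using that graded_comm[OF i0_piece[OF that(1,3)] i0_piece[OF that(2,4)]]
      by (simp del: K.F_simps add: h.hom_mult l)
  qed
  show ?thesis unfolding sym_relations_def Let_def using 1 2 3 by blast
qed

lemma JG_ideal: "ideal JG FG" and JG_kernel: "JG \<subseteq> a_kernel FG A fe.ev"
proof -
  interpret F: ring FG by (rule K.F_ring)
  interpret h: ring_hom_ring FG A fe.ev by (rule fe.ev_hom)
  have "sym_relations K H G \<subseteq> carrier FG" using relations_kernel unfolding a_kernel_def' by blast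
  then show "ideal JG FG" unfolding sym_ideal_def by (rule F.genideal_ideal)
  show "JG \<subseteq> a_kernel FG A fe.ev"
    unfolding sym_ideal_def by (rule F.genideal_minimal[OF h.kernel_is_ideal relations_kernel])
qed

text \<open>Evaluation is constant on cosets of the ideal (\<open>ev_coset\<close>), so the image of
  a coset is a singleton and no representative has to be chosen.\<close>

definition Phi :: "('a set list => 'k) set => 'a" where "Phi X = the_elem (fe.ev ` X)"

lemma ev_coset:
  assumes f: "f \<in> carrier FG" and y: "y \<in> JG +>\<^bsub>FG\<^esub> f" shows "y \<in> carrier FG" "fe.ev y = fe.ev f"
proof -
  interpret J: ideal JG FG by (rule JG_ideal)
  obtain j where j: "j \<in> JG" "y = j \<oplus>\<^bsub>FG\<^esub> f" using y unfolding a_r_coset_def' by blast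
  have jc: "j \<in> carrier FG" "fe.ev j = \<zero>" using JG_kernel j(1) unfolding a_kernel_def' by blast+
  show "y \<in> carrier FG" unfolding j(2) using jc(1) f by (rule J.a_closed)
  show "fe.ev y = fe.ev f" unfolding j(2) fe.ev_add[OF jc(1) f] jc(2) using fe.ev_closed[OF f] by simp
qed

lemma coset_self: "f \<in> carrier FG ==> f \<in> JG +>\<^bsub>FG\<^esub> f"
proof -
  interpret J: ideal JG FG by (rule JG_ideal)
  assume f: "f \<in> carrier FG"
  have "\<zero>\<^bsub>FG\<^esub> \<oplus>\<^bsub>FG\<^esub> f = f" by (rule J.l_zero[OF f])
  then show ?thesis unfolding a_r_coset_def'
    by (intro UN_I[OF additive_subgroup.zero_closed[OF ideal.axioms(1)[OF JG_ideal]]]) (simp only: singleton_iff)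
qed

lemma Phi_coset: "f \<in> carrier FG ==> Phi (JG +>\<^bsub>FG\<^esub> f) = fe.ev f"
proof -
  assume f: "f \<in> carrier FG"
  have "fe.ev ` (JG +>\<^bsub>FG\<^esub> f) = {fe.ev f}" using ev_coset(2)[OF f] coset_self[OF f] by blast
  then show ?thesis by (simp add: Phi_def)
qed

lemma sym_carrier: "carrier (sym_algebra K H G) = (\<lambda>f. JG +>\<^bsub>FG\<^esub> f) ` carrier FG"
  unfolding sym_algebra_def quotient_algebra_def FactRing_def A_RCOSETS_def' a_r_coset_def' by auto

lemma ev_cocycle: "f \<in> carrier FG ==> fe.ev f \<in> cocycles A"
proof (induct rule: fe.F_induct)
  case (mono a u)
  from mono(2) have "fe.wd u \<in> cocycles A" by (induct u) (auto simp: cocycles_mult, simp add: cocycles_iff)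
  then show ?case using mono graded_subspaceD(6)[OF cocycles_graded] by (simp add: fe.ev_mono)
next
  case (add f h)
  show ?case unfolding fe.ev_add[OF add(1,2)] by (rule graded_subspaceD(3)[OF cocycles_graded add(3,4)])
qed

lemma sym_ext: "sym_extension K A G \<iota>\<^sub>0 Phi"
proof -
  interpret J: ideal JG FG by (rule JG_ideal)
  have ops: "monoid.mult (sym_algebra K H G) = rcoset_mult FG JG"
    "ring.add (sym_algebra K H G) = set_add FG" "\<one>\<^bsub>sym_algebra K H G\<^esub> = JG +>\<^bsub>FG\<^esub> \<one>\<^bsub>FG\<^esub>"
    "smult (sym_algebra K H G) = (\<lambda>a X. (\<Union>x\<in>X. JG +>\<^bsub>FG\<^esub> (a \<odot>\<^bsub>FG\<^esub> x)))"
    by (simp_all add: sym_algebra_def quotient_algebra_def FactRing_def)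
  have "Phi \<in> ring_hom (sym_algebra K H G) (A\<lparr>carrier := cocycles A\<rparr>)"
  proof (rule ring_hom_memI)
    fix X Y assume "X \<in> carrier (sym_algebra K H G)" "Y \<in> carrier (sym_algebra K H G)"
    then obtain f h where f: "f \<in> carrier FG" "X = JG +>\<^bsub>FG\<^esub> f" and h: "h \<in> carrier FG" "Y = JG +>\<^bsub>FG\<^esub> h"
      unfolding sym_carrier by blast
    show "Phi X \<in> carrier (A\<lparr>carrier := cocycles A\<rparr>)"
      unfolding f(2) Phi_coset[OF f(1)] using ev_cocycle[OF f(1)] by simp
    show "Phi (X \<otimes>\<^bsub>sym_algebra K H G\<^esub> Y) = Phi X \<otimes>\<^bsub>A\<lparr>carrier := cocycles A\<rparr>\<^esub> Phi Y"
      unfolding ops f(2) h(2) J.rcoset_mult_add[OF f(1) h(1)] Phi_coset[OF f(1)] Phi_coset[OF h(1)]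
        Phi_coset[OF J.m_closed[OF f(1) h(1)]] fe.ev_mult[OF f(1) h(1)] by simp
    show "Phi (X \<oplus>\<^bsub>sym_algebra K H G\<^esub> Y) = Phi X \<oplus>\<^bsub>A\<lparr>carrier := cocycles A\<rparr>\<^esub> Phi Y"
      unfolding ops f(2) h(2) J.a_rcos_sum[OF f(1) h(1)] Phi_coset[OF f(1)] Phi_coset[OF h(1)]
        Phi_coset[OF J.a_closed[OF f(1) h(1)]] fe.ev_add[OF f(1) h(1)] by simp
  next
    show "Phi \<one>\<^bsub>sym_algebra K H G\<^esub> = \<one>\<^bsub>A\<lparr>carrier := cocycles A\<rparr>\<^esub>"
      unfolding ops Phi_coset[OF J.one_closed] ring_hom_one[OF ring_hom_ring.homh[OF fe.ev_hom]] by simp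
  qed
  moreover have "Phi (a \<odot>\<^bsub>sym_algebra K H G\<^esub> X) = a \<odot> Phi X"
    if a: "a \<in> carrier K" and X: "X \<in> carrier (sym_algebra K H G)" for a X
  proof -
    obtain f where f: "f \<in> carrier FG" "X = JG +>\<^bsub>FG\<^esub> f" using X unfolding sym_carrier by blast
    have s: "a \<odot>\<^bsub>FG\<^esub> y \<in> carrier FG" if "y \<in> carrier FG" for y
    proof -
      have "a \<odot>\<^bsub>FG\<^esub> y = K.mono a [] \<otimes>\<^bsub>FG\<^esub> y"
        using fe.F_support(4)[OF that] a by (simp add: fun_eq_iff K.conv_mono)
      then show ?thesis using J.m_closed[OF fe.mono_F[OF a, of "[]"] that] by simp
    qed
    have "fe.ev z = a \<odot> fe.ev f" if z: "z \<in> JG +>\<^bsub>FG\<^esub> (a \<odot>\<^bsub>FG\<^esub> y)" "y \<in> JG +>\<^bsub>FG\<^esub> f" for y z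
      using ev_coset(2)[OF s[OF ev_coset(1)[OF f(1) z(2)]] z(1)] ev_coset[OF f(1) z(2)] fe.ev_smult[OF a]
      by simp
    then have "fe.ev z = a \<odot> fe.ev f" if "z \<in> a \<odot>\<^bsub>sym_algebra K H G\<^esub> X" for z
      using that unfolding ops f(2) by (elim UN_E)
    moreover have "\<exists>z. z \<in> a \<odot>\<^bsub>sym_algebra K H G\<^esub> X"
      unfolding ops f(2) using coset_self[OF f(1)] coset_self[OF s[OF f(1)]] by blast
    ultimately have "fe.ev ` (a \<odot>\<^bsub>sym_algebra K H G\<^esub> X) = {a \<odot> fe.ev f}" by (metis (no_types, lifting) image_cong image_constant)
    then show ?thesis unfolding f(2) Phi_coset[OF f(1)] by (simp add: Phi_def)
  qed
  moreover have "Phi (sym_incl K H G x) = \<iota>\<^sub>0 x" if "x \<in> G" for x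
    unfolding sym_incl_def Phi_coset[OF fe.letter_F[OF that]] by (rule fe.ev_letter[OF that])
  ultimately show ?thesis by (simp add: sym_extension_def algebra_hom_def)
qed

text \<open>The subalgebra of closed elements generated by the values of
  \<open>\<iota>\<^sub>0\<close>. It is the image of the symmetric algebra by
  \<open>Phi_image\<close>.\<close>

definition ZZ :: "'a set" where "ZZ = fe.ev ` carrier FG"

lemma Phi_image: "Phi ` carrier (sym_algebra K H G) = ZZ"
  unfolding sym_carrier ZZ_def image_image using Phi_coset by (intro image_cong) auto

lemma ZZ_ops:
  "[|x \<in> ZZ; y \<in> ZZ|] ==> x \<oplus> y \<in> ZZ" "[|x \<in> ZZ; y \<in> ZZ|] ==> x \<otimes> y \<in> ZZ"
  "[|a \<in> carrier K; x \<in> ZZ|] ==> a \<odot> x \<in> ZZ" "\<one> \<in> ZZ" "\<zero> \<in> ZZ" "x \<in> ZZ ==> x \<in> cocycles A"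
  "X \<in> G ==> \<iota>\<^sub>0 X \<in> ZZ"
proof -
  interpret F: ring FG by (rule K.F_ring)
  interpret h: ring_hom_ring FG A fe.ev by (rule fe.ev_hom)
  have I: "fe.ev f \<in> ZZ" if "f \<in> carrier FG" for f unfolding ZZ_def using that by (rule imageI)
  have E: "\<exists>f\<in>carrier FG. x = fe.ev f" if "x \<in> ZZ" for x using that unfolding ZZ_def by blast
  show "x \<oplus> y \<in> ZZ" if xy: "x \<in> ZZ" "y \<in> ZZ" for x y
  proof -
    obtain f h where f: "f \<in> carrier FG" "x = fe.ev f" "h \<in> carrier FG" "y = fe.ev h"
      using E[OF xy(1)] E[OF xy(2)] by blast
    show ?thesis unfolding f(2,4) fe.ev_add[OF f(1,3), symmetric] by (rule I[OF F.a_closed[OF f(1,3)]])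
  qed
  show m: "x \<otimes> y \<in> ZZ" if xy: "x \<in> ZZ" "y \<in> ZZ" for x y
  proof -
    obtain f h where f: "f \<in> carrier FG" "x = fe.ev f" "h \<in> carrier FG" "y = fe.ev h"
      using E[OF xy(1)] E[OF xy(2)] by blast
    show ?thesis unfolding f(2,4) fe.ev_mult[OF f(1,3), symmetric] by (rule I[OF F.m_closed[OF f(1,3)]])
  qed
  show "\<one> \<in> ZZ" using I[OF F.one_closed] unfolding h.hom_one .
  show "\<zero> \<in> ZZ" using I[OF F.zero_closed] unfolding h.hom_zero .
  show c: "x \<in> cocycles A" if "x \<in> ZZ" for x using that ev_cocycle unfolding ZZ_def by blast
  show "\<iota>\<^sub>0 X \<in> ZZ" if "X \<in> G" for X
    using I[OF fe.letter_F[OF that]] unfolding fe.ev_letter[OF that] .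
  show "a \<odot> x \<in> ZZ" if "a \<in> carrier K" "x \<in> ZZ" for a x
  proof -
    have "fe.ev (K.mono a []) = a \<odot> \<one>" using fe.ev_mono[OF that(1), of "[]"] by simp
    then have "a \<odot> \<one> \<in> ZZ" using I[OF fe.mono_F[OF that(1), of "[]"]] by (simp del: K.F_simps)
    from m[OF this that(2)] show ?thesis
      using that(1) cocycles_carrier[OF c[OF that(2)]] by (simp add: smult_mult_left)
  qed
qed

lemma component_mult_ZZ:
  assumes x: "x \<in> carrier A" "!!i. component A i x \<in> ZZ" and y: "y \<in> carrier A" "!!i. component A i y \<in> ZZ"
  shows "component A k (x \<otimes> y) \<in> ZZ"
proof -
  have base: "component A k (component A i x \<otimes> component A j y) \<in> ZZ" for i j
    using component_of_piece[OF mult_piece[OF component_piece[OF x(1), of i] component_piece[OF y(1), of j]], of k]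
      ZZ_ops(2)[OF x(2)[of i] y(2)[of j]] ZZ_ops(5) by auto
  have 1: "component A k (component A i x \<otimes> (\<Oplus>j\<in>T. component A j y)) \<in> ZZ" if "finite T" for T i
    using that by (induct T rule: finite_induct)
      (use x(1) y(1) base ZZ_ops(1,5) in \<open>auto simp: A.r_distr component_add\<close>)
  have 2: "component A k (component A i x \<otimes> y) \<in> ZZ" for i
    using 1[OF finite_support[OF y(1)], of i] sum_components[OF y(1) finite_support[OF y(1)] order_refl] by simp
  have "component A k ((\<Oplus>i\<in>T. component A i x) \<otimes> y) \<in> ZZ" if "finite T" for T using that
    by (induct T rule: finite_induct)
      (use x(1) y(1) 2 ZZ_ops(1,5) in \<open>auto simp: A.l_distr component_add\<close>)
  from this[OF finite_support[OF x(1)]] show ?thesis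
    using sum_components[OF x(1) finite_support[OF x(1)] order_refl] by simp
qed

lemma i0_component: "x \<in> G ==> component A k (\<iota>\<^sub>0 x) = \<iota>\<^sub>0 (component H k x)"
  by (rule H.graded_map_component[OF gca_axioms G_graded, symmetric]) (auto simp: i0_add i0_piece)

lemma ZZ_component:
  assumes "x \<in> ZZ" shows "component A k x \<in> ZZ"
proof -
  obtain f where f: "f \<in> carrier FG" "x = fe.ev f" using assms unfolding ZZ_def by blast
  have "component A k (fe.ev f) \<in> ZZ" using f(1)
  proof (induct rule: fe.F_induct)
    case (mono a u)
    have "component A k (fe.wd u) \<in> ZZ" for k using mono(2)
    proof (induct u arbitrary: k)
      case Nil
      then show ?case using component_of_piece[OF one_piece, of k] ZZ_ops(4,5) by simp
    next
      case (Cons x u)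
      then have x: "x \<in> G" "set u \<subseteq> G" by auto
      show ?case
        using x Cons(1) component_mult_ZZ[of "\<iota>\<^sub>0 x" "fe.wd u"] i0_component Gs(7) ZZ_ops(7) by simp
    qed
    then show ?case using mono ZZ_ops(3) by (simp add: fe.ev_mono component_smult)
  next
    case (add f h)
    then show ?case
      unfolding fe.ev_add[OF add(1,2)] component_add[OF fe.ev_closed fe.ev_closed, OF add(1,2)]
      by (intro ZZ_ops(1))
  qed
  then show ?thesis by (simp add: f(2))
qed

lemma ZZ_graded: "graded_subspace K A ZZ" using cocycles_carrier[OF ZZ_ops(6)]
  by (intro graded_subspaceI subsetI ZZ_ops(1,3,5) ZZ_component)

text \<open>Elements of degree \<open>k\<close> are generated by \<open>G\<close> and products of elements of smaller positive degree.\<close>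

lemma cls_ZZ:
  assumes gen: "generating_subspace K H G"
    and H0: "!!X. X \<in> piece H 0 ==> \<exists>a\<in>carrier K. X = a \<odot>\<^sub>H \<one>\<^sub>H"
  shows "cls A ` ZZ = CH"
proof -
  let ?C = "cls A ` ZZ" and ?P = "positive_part H"
  have P: "x \<in> ?P \<longleftrightarrow> x \<in> H.filt 1" for x by (auto simp: positive_part_def H.filt_def)
  have C_add: "X \<oplus>\<^sub>H Y \<in> ?C" and C_mult: "X \<otimes>\<^sub>H Y \<in> ?C" if XY: "X \<in> ?C" "Y \<in> ?C" for X Y
  proof -
    obtain x y where x: "x \<in> ZZ" "X = cls A x" "y \<in> ZZ" "Y = cls A y" using XY by blast
    note z = ZZ_ops(6)[OF x(1)] ZZ_ops(6)[OF x(3)]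
    show "X \<oplus>\<^sub>H Y \<in> ?C" unfolding x(2,4) rho_add[OF z, symmetric] by (rule imageI[OF ZZ_ops(1)[OF x(1,3)]])
    show "X \<otimes>\<^sub>H Y \<in> ?C" unfolding x(2,4) rho_mult[OF z, symmetric] by (rule imageI[OF ZZ_ops(2)[OF x(1,3)]])
  qed
  have C_zero: "\<zero>\<^sub>H \<in> ?C" unfolding cohomology_zero by (rule imageI[OF ZZ_ops(5)])
  have C_one: "a \<odot>\<^sub>H \<one>\<^sub>H \<in> ?C" if a: "a \<in> carrier K" for a
    using imageI[OF ZZ_ops(3)[OF a ZZ_ops(4)], of "cls A"] rho_smult[OF a, of \<one>] ZZ_ops(6)[OF ZZ_ops(4)]
    by (simp add: cohomology_one)
  have C_G: "X \<in> ?C" if "X \<in> G" for X using imageI[OF ZZ_ops(7)[OF that], of "cls A"] that by simp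
  have piece: "X \<in> ?C" if "X \<in> piece H k" for k X using that
  proof (induct k arbitrary: X rule: less_induct)
    case (less k)
    show ?case
    proof (cases "k = 0")
      case True
      then show ?thesis using H0[of X] less(2) C_one by auto
    next
      case False
      then have k: "1 \<le> k" by simp
      have m2: "component H k (Y \<otimes>\<^sub>H Z) \<in> ?C" if Y: "Y \<in> piece H i" "1 \<le> i" and Z: "Z \<in> H.filt 1" for Y Z i
        using Z
      proof (induct rule: H.filt_induct)
        case (piece j Z)
        show ?case
        proof (cases "i + j = k")
          case True
          then have "Y \<in> ?C" "Z \<in> ?C" using less(1)[of i Y] less(1)[of j Z] Y piece by auto
          then show ?thesis using C_mult H.mult_piece[OF Y(1) piece(2)] True by auto
        next
          case False
          then show ?thesis
            using H.component_of_piece[OF H.mult_piece[OF Y(1) piece(2)], of k] C_zero by simp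
        qed
      next
        case (add Z Z')
        then show ?case
          using H.filt_carrier[OF add(1)] H.filt_carrier[OF add(2)] H.piece_carrier[OF Y(1)] C_add
          by (simp add: H.A.r_distr H.component_add)
      qed
      have m1: "component H k (Y \<otimes>\<^sub>H Z) \<in> ?C" if YZ: "Y \<in> H.filt 1" "Z \<in> H.filt 1" for Y Z
        using YZ(1)
      proof (induct rule: H.filt_induct)
        case (piece i Y)
        then show ?case using m2[OF piece(2,1) YZ(2)] by simp
      next
        case (add Y Y')
        then show ?case
          using H.filt_carrier[OF add(1)] H.filt_carrier[OF add(2)] H.filt_carrier[OF YZ(2)] C_add
          by (simp add: H.A.l_distr H.component_add)
      qed
      have prod: "S \<in> CH \<and> component H k S \<in> ?C" if "S \<in> ideal_prod H ?P ?P" for S using that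
      proof (induct rule: ideal_prod.induct)
        case (prod Y Z)
        then show ?case using m1[of Y Z] H.filt_carrier[of Y 1] H.filt_carrier[of Z 1] P by simp
      next
        case (sum S T)
        then show ?case using C_add by (simp add: H.component_add)
      qed
      have "X \<in> ?P" using less(2) k P H.filt_piece by blast
      then obtain Y S where YS: "Y \<in> G" "S \<in> ideal_prod H ?P ?P" "X = Y \<oplus>\<^sub>H S"
        using gen unfolding generating_subspace_def direct_sum_def by (metis H.mem_set_add)
      have Yc: "Y \<in> CH" using YS(1) Gs(1) by blast
      have "X = component H k Y \<oplus>\<^sub>H component H k S"
        using less(2) prod[OF YS(2)] Yc H.component_add[of Y S k] by (simp add: YS(3)[symmetric])
      then show ?thesis using C_add C_G[OF Gs(7)[OF YS(1)]] prod[OF YS(2)] by simp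
    qed
  qed
  have "X \<in> ?C" if "X \<in> CH" for X
    using that by (induct rule: H.graded_induct) (use piece C_add in auto)
  moreover have "?C \<subseteq> CH" using ZZ_ops(6) rho_closed by blast
  ultimately show ?thesis by blast
qed

text \<open>The complement of the exact elements is taken inside \<open>ZZ\<close>, as adaptedness
  demands, and above the image of \<open>\<iota>\<^sub>0\<close>, which contains no nonzero exact
  element because \<open>\<iota>\<^sub>0\<close> splits the projection to cohomology. It is harmonic
  in \<open>A\<close> since every class is represented in \<open>ZZ\<close>.\<close>

lemma adapted_complement:
  assumes "generating_subspace K H G"
    and "!!X. X \<in> piece H 0 ==> \<exists>a\<in>carrier K. X = a \<odot>\<^sub>H \<one>\<^sub>H"
  obtains W where "harmonic_subspace K A W" "!!x. x \<in> G ==> \<iota>\<^sub>0 x \<in> W" "W \<subseteq> ZZ"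
proof -
  let ?U = "ZZ \<inter> boundaries A" and ?W0 = "\<iota>\<^sub>0 ` G"
  have U: "graded_subspace K A ?U" by (rule graded_subspace_Int[OF ZZ_graded boundaries_graded])
  have W0: "graded_subspace K A ?W0"
  proof (rule graded_subspaceI)
    have "\<iota>\<^sub>0 \<zero>\<^sub>H = \<zero>" using i0_smult[OF K.zero_closed Gs(2)] Gs(2) by simp
    then show "\<zero> \<in> ?W0" using Gs(2) by (metis imageI)
    fix u v assume "u \<in> ?W0"
    then obtain x where x: "x \<in> G" "u = \<iota>\<^sub>0 x" by blast
    show "component A k u \<in> ?W0" for k
      unfolding x(2) i0_component[OF x(1)] by (rule imageI[OF Gs(7)[OF x(1)]])
    show "a \<odot> u \<in> ?W0" if "a \<in> carrier K" for a
      unfolding x(2) i0_smult[OF that x(1), symmetric] by (rule imageI[OF Gs(6)[OF that x(1)]])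
    assume "v \<in> ?W0"
    then obtain y where y: "y \<in> G" "v = \<iota>\<^sub>0 y" by blast
    show "u \<oplus> v \<in> ?W0"
      unfolding x(2) y(2) i0_add[OF x(1) y(1), symmetric] by (rule imageI[OF Gs(3)[OF x(1) y(1)]])
  qed auto
  have "?U \<inter> ?W0 \<subseteq> {\<zero>}"
  proof
    fix u assume u: "u \<in> ?U \<inter> ?W0"
    then obtain x where x: "x \<in> G" "u = \<iota>\<^sub>0 x" by blast
    have "x = \<zero>\<^sub>H" using u rho_zero_iff[OF i0_cocycle[OF x(1)]] unfolding x(2) cls_i0[OF x(1)] by simp
    then show "u \<in> {\<zero>}" using i0_smult[OF K.zero_closed Gs(2)] Gs(2) x by simp
  qed
  then have UW: "?U \<inter> ?W0 = {\<zero>}" using graded_subspaceD(2)[OF U] graded_subspaceD(2)[OF W0] by blast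
  obtain W where W: "graded_subspace K A W" "?W0 \<subseteq> W" "W \<subseteq> ZZ" "?U \<inter> W = {\<zero>}" "ZZ = ?U <+>\<^bsub>A\<^esub> W"
    by (rule graded_complement[OF ZZ_graded U _ W0 _ UW]) (use ZZ_ops(7) in auto)
  have Wz: "w \<in> cocycles A" if "w \<in> W" for w using that W(3) ZZ_ops(6) by blast
  have "cocycles A = boundaries A <+>\<^bsub>A\<^esub> W"
  proof (intro equalityI subsetI)
    fix z assume z: "z \<in> cocycles A"
    have "cls A ` ZZ = CH" by (rule cls_ZZ[OF assms(1)]) (rule assms(2))
    then have "cls A z \<in> cls A ` ZZ" using rho_closed[OF z] by simp
    then obtain y where y: "cls A z = cls A y" "y \<in> ZZ" by (rule imageE)
    obtain e w where ew: "e \<in> boundaries A" "w \<in> W" "y = e \<oplus> w"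
      using subsetD[OF equalityD1[OF W(5)] y(2)] unfolding mem_set_add by blast
    note c = cocycles_carrier[OF z] cocycles_carrier[OF ZZ_ops(6)[OF y(2)]]
    have "z \<ominus> y \<in> boundaries A" using y(1) cls_eq_iff[OF c] by simp
    then have b: "(z \<ominus> y) \<oplus> e \<in> boundaries A" using ew(1) by (rule boundaries_ops(1))
    have "z = ((z \<ominus> y) \<oplus> e) \<oplus> w" unfolding ew(3)
      by ((rule A.ag)+, insert c(1) boundaries_carrier[OF ew(1)] cocycles_carrier[OF Wz[OF ew(2)]], simp_all)
    then show "z \<in> boundaries A <+>\<^bsub>A\<^esub> W" unfolding mem_set_add using b ew(2) by blast
  next
    fix z assume "z \<in> boundaries A <+>\<^bsub>A\<^esub> W"
    then show "z \<in> cocycles A"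
      unfolding mem_set_add using Wz boundaries_cocycles graded_subspaceD(3)[OF cocycles_graded] by blast
  qed
  moreover have "boundaries A \<inter> W = {\<zero>}" using W(3,4) by blast
  ultimately have "harmonic_subspace K A W" using W(1) by (simp add: harmonic_subspace_def direct_sum_def)
  then show ?thesis using that W(2,3) by blast
qed

end

section \<open>Changing the harmonic subspace\<close>

context poincare
begin

lemma J_cocycle_boundary:
  assumes "z \<in> cocycles A" "e \<in> boundaries A"
  shows "J (z \<otimes> e) = \<zero>\<^sub>K" "J (e \<otimes> z) = \<zero>\<^sub>K"
  using assms by (auto intro: J_boundary boundaries_mult_left boundaries_mult_right)

end

text \<open>Harmonic elements of the old and the new kind agree up to exact ones, so a change of the
  harmonic subspace only shifts the exact part, and \<open>Bs\<close> can be kept. Orthogonality may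
  be lost.\<close>

lemma (in splitting) splitting_change:
  assumes W: "harmonic_subspace K A W" shows "splitting K A W Bs"
proof
  show "harmonic_subspace K A W" "graded_subspace K A Bs" by (rule W B_graded)+
  have Wg: "graded_subspace K A W" and Wd: "cocycles A = boundaries A <+>\<^bsub>A\<^esub> W" "boundaries A \<inter> W = {\<zero>}"
    using W by (simp_all add: harmonic_subspace_def direct_sum_def)
  note Ws = graded_subspaceD[OF Wg]
  fix x assume x: "x \<in> carrier A"
  have Wz: "w \<in> cocycles A" if "w \<in> W" for w
    unfolding Wd(1) mem_set_add using that Es(2) Ws(1) by (intro bexI[of _ \<zero>] bexI[of _ w]) auto
  have ez: "e \<oplus> w \<in> cocycles A" if "e \<in> boundaries A" "w \<in> W" for e w
    using that Wz boundaries_cocycles graded_subspaceD(3)[OF cocycles_graded] by blast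
  have "pH x \<in> cocycles A" using parts(2)[OF x] by (rule Hs_cocycles)
  then obtain e w where ew: "e \<in> boundaries A" "w \<in> W" "pH x = e \<oplus> w"
    unfolding Wd(1) mem_set_add by blast
  have c: "e \<in> carrier A" "w \<in> carrier A" using ew boundaries_carrier Ws(1) by auto
  have "x = pE x \<oplus> (e \<oplus> w) \<oplus> pB x" unfolding ew(3)[symmetric] by (rule parts(4)[OF x])
  also have "\<dots> = (pE x \<oplus> e) \<oplus> w \<oplus> pB x" by ((rule A.ag)+, insert x c, simp_all)
  finally have p: "hodge_parts A W Bs x (pE x \<oplus> e, w, pB x)"
    unfolding hodge_parts_def using ew x parts Es(3) by auto
  show "\<exists>!p. hodge_parts A W Bs x p"
  proof (rule ex1I[of "hodge_parts A W Bs x", OF p])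
    fix q assume "hodge_parts A W Bs x q"
    then obtain e' w' b' where q: "q = (e', w', b')" "e' \<in> boundaries A" "w' \<in> W" "b' \<in> Bs" "x = e' \<oplus> w' \<oplus> b'"
      by (cases q) (auto simp: hodge_parts_def)
    have c': "e' \<in> carrier A" "w' \<in> carrier A" "b' \<in> carrier A" using q boundaries_carrier Ws(1) Bs(1) by auto
    have xe: "x = (pE x \<oplus> e) \<oplus> w \<oplus> pB x" using p by (simp add: hodge_parts_def)
    have pB0: "pB (u \<oplus> v) = \<zero>" if "u \<in> boundaries A" "v \<in> W" for u v
      using cocycles_pB[OF ez[OF that]] .
    have b: "pB x = b'" using q pB0[OF q(2,3)] c' by (simp add: parts_add)
    have s: "(pE x \<oplus> e) \<oplus> w = e' \<oplus> w'"
    proof -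
      have "(pE x \<oplus> e) \<oplus> w = x \<ominus> pB x"
      proof -
        have "(pE x \<oplus> e) \<oplus> w = ((pE x \<oplus> e) \<oplus> w \<oplus> pB x) \<ominus> pB x"
          by ((rule A.ag)+, insert x c, simp_all)
        then show ?thesis by (simp only: xe[symmetric])
      qed
      also have "\<dots> = e' \<oplus> w'" unfolding b by (subst q(5)) ((rule A.ag)+, insert c', simp_all)
      finally show ?thesis .
    qed
    have "w \<ominus> w' = (pE x \<oplus> e) \<oplus> w \<ominus> (pE x \<oplus> e) \<ominus> w'" by ((rule A.ag)+, insert x c c', simp_all)
    also have "\<dots> = e' \<ominus> (pE x \<oplus> e)" unfolding s by ((rule A.ag)+, insert x c c', simp_all)
    also have "\<dots> \<in> boundaries A" by (rule Es(5)[OF q(2) Es(3)[OF parts(1)[OF x] ew(1)]])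
    finally have "w \<ominus> w' \<in> boundaries A \<inter> W" using Ws(5)[OF ew(2) q(3)] by blast
    then have w: "w = w'" unfolding Wd(2) using A.diff_zero_eq[OF c(2) c'(2)] by simp
    have "pE x \<oplus> e = e'" using s c c' x unfolding w by simp
    then show "q = (pE x \<oplus> e, w, pB x)" by (simp add: q(1) w b)
  qed
qed

text \<open>\<open>Bs\<close> need not be orthogonal to \<open>W\<close>. By duality each
  \<open>b\<close> in \<open>Bs\<close> has a correction in \<open>W\<close> that makes the sum
  orthogonal to \<open>W\<close>; the sums form \<open>Y\<close>. Products inside \<open>Y\<close>
  can still have nonzero integral. Subtracting half the exact part of the correction repairs this
  and keeps orthogonality to \<open>W\<close>, since exact elements are orthogonal to
  cocycles.\<close>

lemma (in hodge) hodge_change: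
  assumes char: "char_zero K" and W: "harmonic_subspace K A W"
  obtains B' where "hodge K A n I W B'"
proof -
  interpret S: splitting K A W Bs by (rule splitting_change[OF W])
  interpret S: split_ident K A H "cls A" W Bs ..
  obtain \<iota> where i: "!!X. X \<in> carrier H ==> \<iota> X \<in> W \<and> cls A (\<iota> X) = X"
    using S.section_exists by blast
  interpret R: realization K A H "cls A" \<iota> "\<lambda>X Y. S.s (\<iota> X \<otimes> \<iota> Y)"
    by (rule S.section_realization) (use i in auto)
  obtain t where t: "t \<in> carrier K" "t \<otimes>\<^sub>K (\<one>\<^sub>K \<oplus>\<^sub>K \<one>\<^sub>K) = \<one>\<^sub>K" using K.half_exists[OF char] by blast
  have tt: "t \<otimes>\<^sub>K a \<oplus>\<^sub>K t \<otimes>\<^sub>K a = a" if "a \<in> carrier K" for a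
  proof -
    have "t \<otimes>\<^sub>K a \<oplus>\<^sub>K t \<otimes>\<^sub>K a = (t \<otimes>\<^sub>K (\<one>\<^sub>K \<oplus>\<^sub>K \<one>\<^sub>K)) \<otimes>\<^sub>K a"
      using t(1) that by (simp add: K.r_distr K.l_distr)
    then show ?thesis using that by (simp only: t(2)) simp
  qed
  define Y where "Y = {y \<in> carrier A. S.pE y = \<zero> \<and> (\<forall>w\<in>W. J (w \<otimes> y) = \<zero>\<^sub>K)}"
  \<comment> \<open>\<open>S.pH\<close> projects onto the new \<open>W\<close>, whereas
    \<open>pE\<close> takes the exact part in the old decomposition.\<close>
  define \<theta> where "\<theta> y = y \<ominus> t \<odot> pE (S.pH y)" for y
  have Yc: "y \<in> carrier A" "S.pE y = \<zero>" "!!w. w \<in> W ==> J (w \<otimes> y) = \<zero>\<^sub>K" if "y \<in> Y" for y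
    using that by (auto simp: Y_def)
  have Y_graded: "graded_subspace K A Y"
  proof (rule graded_subspaceI)
    show "Y \<subseteq> carrier A" using Yc(1) by blast
    show "\<zero> \<in> Y" using S.Es(2) by (simp add: Y_def)
    show "x \<oplus> y \<in> Y" if "x \<in> Y" "y \<in> Y" for x y
      using that by (auto simp: Y_def S.parts_add A.r_distr J_add)
    show "a \<odot> y \<in> Y" if "a \<in> carrier K" "y \<in> Y" for a y
      using that by (auto simp: Y_def S.parts_smult smult_mult_right J_smult)
    show "component A k y \<in> Y" if y: "y \<in> Y" for k y
    proof -
      have "J (w \<otimes> component A k y) = \<zero>\<^sub>K" if w: "w \<in> W" for w
      proof (cases "k \<le> n")
        case True
        then show ?thesis
          using J_component_right[of w y k] w Yc[OF y] S.Hs(7)[OF w, of "n - k"] by simp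
      next
        case False
        then have "component A k y = \<zero>" using component_piece[OF Yc(1)[OF y], of k] piece_above[of k] by simp
        then show ?thesis using w by simp
      qed
      then show ?thesis using y S.parts_component(1)[OF Yc(1)[OF y], of k] by (simp add: Y_def)
    qed
  qed
  note Ys = graded_subspaceD[OF Y_graded]
  have th_c [simp]: "\<theta> y \<in> carrier A" if "y \<in> Y" for y
    using Yc(1)[OF that] t(1) by (simp add: \<theta>_def)
  have th_add: "\<theta> (x \<oplus> y) = \<theta> x \<oplus> \<theta> y" if "x \<in> Y" "y \<in> Y" for x y unfolding \<theta>_def
    by (insert Yc(1)[OF that(1)] Yc(1)[OF that(2)] t(1), simp add: S.parts_add parts_add smult_r_distr,
        (rule A.ag)+, simp_all)
  have th_smult: "\<theta> (a \<odot> y) = a \<odot> \<theta> y" if "a \<in> carrier K" "y \<in> Y" for a y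
    using Yc(1)[OF that(2)] t(1) that(1)
    by (simp add: \<theta>_def S.parts_smult parts_smult smult_minus smult_assoc1[symmetric] K.m_comm)
  have th_comp: "\<theta> (component A k y) = component A k (\<theta> y)" if "y \<in> Y" for k y
    using Yc(1)[OF that] t(1)
    by (simp add: \<theta>_def S.parts_component parts_component component_minus component_smult)
  have graded: "graded_subspace K A (\<theta> ` Y)"
  proof (rule graded_subspaceI)
    show "\<theta> ` Y \<subseteq> carrier A" by auto
    have "\<theta> \<zero> = \<zero>" using th_smult[OF K.zero_closed Ys(2)] th_c[OF Ys(2)] by simp
    then show "\<zero> \<in> \<theta> ` Y" using Ys(2) by (metis imageI)
    fix u assume "u \<in> \<theta> ` Y"
    then obtain x where x: "x \<in> Y" "u = \<theta> x" by blast
    show "component A k u \<in> \<theta> ` Y" for k unfolding x(2) th_comp[OF x(1), symmetric] by (rule imageI[OF Ys(7)[OF x(1)]])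
    show "a \<odot> u \<in> \<theta> ` Y" if "a \<in> carrier K" for a
      unfolding x(2) th_smult[OF that x(1), symmetric] by (rule imageI[OF Ys(6)[OF that x(1)]])
    fix v assume "v \<in> \<theta> ` Y"
    then obtain y where y: "y \<in> Y" "v = \<theta> y" by blast
    show "u \<oplus> v \<in> \<theta> ` Y" unfolding x(2) y(2) th_add[OF x(1) y(1), symmetric] by (rule imageI[OF Ys(3)[OF x(1) y(1)]])
  qed
  have Y_parts: "y = S.pH y \<oplus> S.pB y" if "y \<in> Y" for y
    using S.parts(4)[OF Yc(1)[OF that]] Yc[OF that] by simp
  \<comment> \<open>Duality turns the functional given by minus the integral against
    \<open>b\<close> into a class \<open>v\<close>; its representative in \<open>W\<close> is the
    correction of \<open>b\<close>.\<close>
  have lift: "\<exists>y\<in>Y. S.pB y = b" if b: "b \<in> Bs" for b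
  proof -
    let ?l = "\<lambda>X. \<ominus>\<^sub>K J (\<iota> X \<otimes> b)"
    have bc: "b \<in> carrier A" using b by simp
    have ic: "\<iota> X \<in> carrier A" if "X \<in> carrier H" for X using i[OF that] S.Hs(1) by blast
    have "\<exists>!v. v \<in> carrier H \<and> (\<forall>X\<in>carrier H. JH (X \<otimes>\<^sub>H v) = ?l X)" by (rule dual_right)
        (use ic bc in \<open>auto simp: R.iota_add R.iota_smult A.l_distr J_add smult_mult_left J_smult K.minus_add K.r_minus\<close>)
    then obtain v where v: "v \<in> carrier H" "!!X. X \<in> carrier H ==> JH (X \<otimes>\<^sub>H v) = ?l X" by blast
    have vW: "\<iota> v \<in> W" using i[OF v(1)] by blast
    have "J (w \<otimes> (\<iota> v \<oplus> b)) = \<zero>\<^sub>K" if w: "w \<in> W" for w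
    proof -
      have wz: "w \<in> cocycles A" by (rule S.Hs_cocycles[OF w])
      have wc: "cls A w \<in> carrier H" using wz by simp
      have e: "\<iota> (cls A w) = w" by (rule S.rho_inj_Hs) (use w i[OF wc] in auto)
      have "J (w \<otimes> \<iota> v) = JH (cls A w \<otimes>\<^sub>H v)"
        using J_cocycle[OF cocycles_mult[OF wz S.Hs_cocycles[OF vW]]] wz v(1) by (simp add: rho_mult)
      also have "\<dots> = \<ominus>\<^sub>K J (w \<otimes> b)" using v(2)[OF wc] by (simp add: e)
      finally show ?thesis using w ic[OF v(1)] bc by (simp add: A.r_distr J_add K.l_neg)
    qed
    moreover have "S.pE (\<iota> v \<oplus> b) = \<zero>" "S.pB (\<iota> v \<oplus> b) = b"
      using vW b ic[OF v(1)] bc by (simp_all add: S.parts_add)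
    ultimately show ?thesis using ic[OF v(1)] bc by (intro bexI[of _ "\<iota> v \<oplus> b"]) (auto simp: Y_def)
  qed
  \<comment> \<open>An element of \<open>Y\<close> without part in \<open>Bs\<close> lies in
    \<open>W\<close> and is orthogonal to \<open>W\<close>, so its class is zero by non-degeneracy.
    This gives uniqueness in the new decomposition.\<close>
  have small: "\<theta> y = \<zero>" if y: "y \<in> Y" "S.pB y = \<zero>" for y
  proof -
    note yc = Yc(1)[OF y(1)]
    have yW: "y \<in> W" using Y_parts[OF y(1)] y(2) S.parts(2)[OF yc] yc by simp
    have yz: "y \<in> cocycles A" by (rule S.Hs_cocycles[OF yW])
    have "cls A y = \<zero>\<^sub>H"
    proof (rule JH_nondegenerate(2))
      fix X assume X: "X \<in> carrier H"
      have "JH (X \<otimes>\<^sub>H cls A y) = J (\<iota> X \<otimes> y)"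
        using J_cocycle[OF cocycles_mult[OF S.Hs_cocycles yz], of "\<iota> X"] i[OF X] yz X S.Hs_cocycles[of "\<iota> X"]
        by (simp add: rho_mult)
      then show "JH (X \<otimes>\<^sub>H cls A y) = \<zero>\<^sub>K" using Yc(3)[OF y(1)] i[OF X] by simp
    qed (use yz in simp)
    then have "cls A y = cls A \<zero>" by (simp add: cohomology_zero)
    then have "y = \<zero>" by (rule S.rho_inj_Hs[OF yW S.Hs(2)])
    then show ?thesis using th_smult[OF K.zero_closed Ys(2)] th_c[OF Ys(2)] by simp
  qed
  have pB_th: "S.pB (\<theta> y) = S.pB y" if "y \<in> Y" for y
  proof -
    have "pE (S.pH y) \<in> boundaries A" using parts(1) Yc(1)[OF that] by simp
    then have "S.pB (t \<odot> pE (S.pH y)) = \<zero>" using Yc(1)[OF that] t(1) by (simp add: S.parts_smult)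
    then show ?thesis using Yc(1)[OF that] t(1) by (simp add: \<theta>_def S.parts_minus) (simp add: A.minus_eq)
  qed
  have split: "splitting K A W (\<theta> ` Y)"
  proof
    show "harmonic_subspace K A W" "graded_subspace K A (\<theta> ` Y)" by (rule W graded)+
    fix x assume x: "x \<in> carrier A"
    obtain y where y: "y \<in> Y" "S.pB y = S.pB x" using lift[OF S.parts(3)[OF x]] by blast
    note yc = Yc(1)[OF y(1)]
    let ?e = "t \<odot> pE (S.pH y)"
    have e: "?e \<in> boundaries A" using S.Es(6)[OF t(1)] parts(1) yc by simp
    have ec: "?e \<in> carrier A" using e boundaries_carrier by blast
    have p: "hodge_parts A W (\<theta> ` Y) x (S.pE x \<oplus> ?e, S.pH x \<ominus> S.pH y, \<theta> y)"
    proof -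
      have "x = S.pE x \<oplus> S.pH x \<oplus> S.pB x" by (rule S.parts(4)[OF x])
      also have "\<dots> = (S.pE x \<oplus> ?e) \<oplus> (S.pH x \<ominus> S.pH y) \<oplus> ((S.pH y \<oplus> S.pB y) \<ominus> ?e)"
        unfolding y(2) by ((rule A.ag)+, insert x yc ec, simp_all)
      also have "(S.pH y \<oplus> S.pB y) \<ominus> ?e = \<theta> y"
        unfolding \<theta>_def Y_parts[OF y(1), symmetric] by (rule refl)
      finally show ?thesis unfolding hodge_parts_def
        using S.Es(3)[OF S.parts(1)[OF x] e] S.Hs(5)[OF S.parts(2)[OF x] S.parts(2)[OF yc]] y(1) by auto
    qed
    show "\<exists>!p. hodge_parts A W (\<theta> ` Y) x p"
    proof (rule ex1I[of "hodge_parts A W (\<theta> ` Y) x", OF p])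
      fix q assume "hodge_parts A W (\<theta> ` Y) x q"
      then obtain e1 w1 y1 where q: "q = (e1, w1, \<theta> y1)" "e1 \<in> boundaries A" "w1 \<in> W" "y1 \<in> Y" "x = e1 \<oplus> w1 \<oplus> \<theta> y1"
        by (cases q) (auto simp: hodge_parts_def)
      have c1: "e1 \<in> carrier A" "w1 \<in> carrier A" "\<theta> y1 \<in> carrier A" "\<theta> y \<in> carrier A"
        using q boundaries_carrier S.Hs(1) y by auto
      have "S.pB x = S.pB y1" using q c1 pB_th[OF q(4)] Yc(1)[OF q(4)] by (simp add: S.parts_add)
      then have "S.pB (y \<ominus> y1) = \<zero>" using y yc Yc(1)[OF q(4)] by (simp add: S.parts_minus)
      then have z: "\<theta> (y \<ominus> y1) = \<zero>" by (rule small[OF Ys(5)[OF y(1) q(4)]])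
      have "y = (y \<ominus> y1) \<oplus> y1" by ((rule A.ag)+, insert yc Yc(1)[OF q(4)], simp_all)
      then have "\<theta> y = \<theta> (y \<ominus> y1) \<oplus> \<theta> y1" using th_add[OF Ys(5)[OF y(1) q(4)] q(4)] by simp
      then have th: "\<theta> y = \<theta> y1" using z c1 by simp
      have "S.pE x \<oplus> ?e \<oplus> (S.pH x \<ominus> S.pH y) = e1 \<oplus> w1"
      proof -
        have "S.pE x \<oplus> ?e \<oplus> (S.pH x \<ominus> S.pH y) = x \<ominus> \<theta> y"
          using p x yc ec c1 unfolding hodge_parts_def
          by (subst (3) conjunct2[OF conjunct2[OF conjunct2[OF p[unfolded hodge_parts_def prod.case]]]])
            ((rule A.ag)+, simp_all)
        also have "\<dots> = e1 \<oplus> w1" unfolding th by (subst q(5)) ((rule A.ag)+, insert c1, simp_all)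
        finally show ?thesis .
      qed
      then have eq: "S.pE x \<oplus> ?e \<oplus> (S.pH x \<ominus> S.pH y) \<oplus> \<zero> = e1 \<oplus> w1 \<oplus> \<zero>" by simp
      note P1 = S.parts_eqI[OF S.Es(3)[OF S.parts(1)[OF x] e] S.Hs(5)[OF S.parts(2)[OF x] S.parts(2)[OF yc]] S.Bs(2) refl]
      note P2 = S.parts_eqI[OF q(2,3) S.Bs(2) refl]
      have "S.pE x \<oplus> ?e = e1" "S.pH x \<ominus> S.pH y = w1" using P1(1,2) P2(1,2) unfolding eq by simp_all
      then show "q = (S.pE x \<oplus> ?e, S.pH x \<ominus> S.pH y, \<theta> y)" by (simp add: q(1) th)
    qed
  qed
  have o1: "J (w \<otimes> \<theta> y) = \<zero>\<^sub>K" if w: "w \<in> W" and y: "y \<in> Y" for w y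
  proof -
    have e: "t \<odot> pE (S.pH y) \<in> boundaries A" using S.Es(6)[OF t(1)] parts(1) Yc(1)[OF y] by simp
    have "J (w \<otimes> \<theta> y) = J (w \<otimes> y) \<ominus>\<^sub>K J (w \<otimes> (t \<odot> pE (S.pH y)))"
      using w Yc(1)[OF y] boundaries_carrier[OF e] by (simp add: \<theta>_def A.minus_r_distr J_minus)
    then show ?thesis
      using Yc(3)[OF y w] J_cocycle_boundary(1)[OF S.Hs_cocycles[OF w] e] by (simp add: K.minus_eq)
  qed
  have o2: "J (\<theta> y \<otimes> \<theta> y') = \<zero>\<^sub>K" if y: "y \<in> Y" "y' \<in> Y" for y y'
  proof -
    note c = Yc(1)[OF y(1)] Yc(1)[OF y(2)]
    define p b e q where "p = S.pH y" and "b = S.pB y" and "e = pE p" and "q = pH p"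
    define p' b' e' q' where "p' = S.pH y'" and "b' = S.pB y'" and "e' = pE p'" and "q' = pH p'"
    have W': "p \<in> W" "p' \<in> W" using S.parts(2) c by (simp_all add: p_def p'_def)
    have B: "b \<in> Bs" "b' \<in> Bs" using S.parts(3) c by (simp_all add: b_def b'_def)
    have z: "p \<in> cocycles A" "p' \<in> cocycles A" using W' S.Hs_cocycles by blast+
    have pc: "p \<in> carrier A" "p' \<in> carrier A" "b \<in> carrier A" "b' \<in> carrier A" using W' B by simp_all
    have E: "e \<in> boundaries A" "e' \<in> boundaries A" and Q: "q \<in> Hs" "q' \<in> Hs"
      using parts(1,2) pc by (simp_all add: e_def e'_def q_def q'_def)
    have ec: "e \<in> carrier A" "e' \<in> carrier A" "q \<in> carrier A" "q' \<in> carrier A" using E Q boundaries_carrier by auto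
    have ps: "p = e \<oplus> q" "p' = e' \<oplus> q'"
      using cocycles_parts[OF z(1)] cocycles_parts[OF z(2)] by (simp_all add: e_def e'_def q_def q'_def)
    have ys: "y = p \<oplus> b" "y' = p' \<oplus> b'" using Y_parts[OF y(1)] Y_parts[OF y(2)] by (simp_all add: p_def p'_def b_def b'_def)
    have th: "\<theta> y = p \<oplus> b \<ominus> t \<odot> e" "\<theta> y' = p' \<oplus> b' \<ominus> t \<odot> e'"
      unfolding \<theta>_def p_def[symmetric] p'_def[symmetric] e_def[symmetric] e'_def[symmetric] ys[symmetric] by simp_all
    have bp: "J (b \<otimes> p') = J (b \<otimes> e')" using J_Bs_Hs[OF B(1) Q(2)] pc ec unfolding ps by (simp add: A.r_distr J_add)
    have pb: "J (p \<otimes> b') = J (e \<otimes> b')" using J_Hs_Bs[OF Q(1) B(2)] pc ec unfolding ps by (simp add: A.l_distr J_add)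
    have k: "J (p \<otimes> p') \<in> carrier K" "J (b \<otimes> e') \<in> carrier K" "J (e \<otimes> b') \<in> carrier K" using pc ec by simp_all
    have "J (y \<otimes> p') = \<zero>\<^sub>K" by (rule J_orthogonal_swap[OF S.H_graded c(1) Yc(3)[OF y(1)] W'(2)])
    then have 1: "J (p \<otimes> p') \<oplus>\<^sub>K J (b \<otimes> e') = \<zero>\<^sub>K" using pc unfolding ys(1) by (simp add: A.l_distr J_add bp)
    have "J (p \<otimes> y') = \<zero>\<^sub>K" by (rule Yc(3)[OF y(2) W'(1)])
    then have 2: "J (p \<otimes> p') \<oplus>\<^sub>K J (e \<otimes> b') = \<zero>\<^sub>K" using pc unfolding ys(2) by (simp add: A.r_distr J_add pb)
    \<comment> \<open>The integral of \<open>y \<otimes> y'\<close> equals that of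
      \<open>b \<otimes> e'\<close>. The two subtracted halves contribute the integrals of
      \<open>b \<otimes> e'\<close> and \<open>e \<otimes> b'\<close>, so their equality is what
      makes the sum vanish.\<close>
    have X: "J (e \<otimes> b') = J (b \<otimes> e')" 
      using K.minus_equality[OF 1 k(2,1)] K.minus_equality[OF 2 k(3,1)] K.minus_minus[OF k(2)]
        K.minus_minus[OF k(3)] by simp
    have thc: "\<theta> y' \<in> carrier A" using y by simp
    have z1: "J (e \<otimes> p') = \<zero>\<^sub>K" "J (e \<otimes> e') = \<zero>\<^sub>K"
      using J_cocycle_boundary(2)[OF z(2) E(1)] J_cocycle_boundary(2)[OF boundaries_cocycles[OF E(2)] E(1)] .
    have b1: "J (b \<otimes> \<theta> y') = J (b \<otimes> e') \<ominus>\<^sub>K t \<otimes>\<^sub>K J (b \<otimes> e')"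
      unfolding th(2) using pc ec t(1) J_Bs_Bs[OF B]
      by (simp add: A.r_distr A.minus_r_distr J_add J_minus smult_mult_right J_smult bp)
    have e1: "J (e \<otimes> \<theta> y') = J (b \<otimes> e')" unfolding th(2) using pc ec t(1) z1
      by (simp add: A.r_distr A.minus_r_distr J_add J_minus smult_mult_right J_smult X K.minus_eq)
    have "J (\<theta> y \<otimes> \<theta> y') = J (p \<otimes> \<theta> y') \<oplus>\<^sub>K J (b \<otimes> \<theta> y') \<ominus>\<^sub>K t \<otimes>\<^sub>K J (e \<otimes> \<theta> y')"
      unfolding th(1) using pc ec t(1) thc
      by (simp add: A.l_distr A.minus_l_distr J_add J_minus smult_mult_left J_smult)
    also have "\<dots> = J (b \<otimes> e') \<ominus>\<^sub>K (t \<otimes>\<^sub>K J (b \<otimes> e') \<oplus>\<^sub>K t \<otimes>\<^sub>K J (b \<otimes> e'))"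
      unfolding b1 e1 o1[OF W'(1) y(2)] by ((rule K.ag)+, insert k t(1), simp_all)
    also have "\<dots> = \<zero>\<^sub>K" unfolding tt[OF k(2)] using k by simp
    finally show ?thesis .
  qed
  have "hodge K A n I W (\<theta> ` Y)"
    using split poincare_axioms o1 o2 by (auto simp: hodge_def hodge_axioms_def)
  then show ?thesis by (rule that)
qed

section \<open>Existence of adapted Hodge decompositions\<close>

context gca
begin

lemma positive_part_filt: "positive_part A = filt 1" by (auto simp: positive_part_def filt_def)

text \<open>A component of a product of homogeneous elements is that product or zero; inductions
  over the two factors and over sums do the rest.\<close>

lemma decomposables_graded: "graded_subspace K A (ideal_prod A (filt 1) (filt 1))" (is "graded_subspace K A ?D")
  and decomposables_positive: "ideal_prod A (filt 1) (filt 1) \<subseteq> filt 1"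
proof -
  show sub: "?D \<subseteq> filt 1"
  proof
    fix x assume "x \<in> ?D"
    then show "x \<in> filt 1" by induct (auto intro: filt_mult_ge filt_add)
  qed
  have zero: "\<zero> \<in> ?D" using ideal_prod.prod[OF filt_zero[of 1] filt_zero[of 1], where R = A] by simp
  have c2: "component A k (x \<otimes> y) \<in> ?D" if x: "x \<in> piece A i" "x \<in> filt 1" and y: "y \<in> filt 1" for x y i k
    using y
  proof (induct rule: filt_induct)
    case (piece j y)
    then show ?case
      using component_of_piece[OF mult_piece[OF x(1) piece(2)], of k] zero ideal_prod.prod[OF x(2) filt_piece[OF piece(2,1)], where R = A]
      by simp
  next
    case (add y z)
    then show ?case
      using filt_carrier[OF add(1)] filt_carrier[OF add(2)] filt_carrier[OF x(2)] ideal_prod.sum[OF add(3,4)]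
      by (simp add: A.r_distr component_add)
  qed
  have c1: "component A k (x \<otimes> y) \<in> ?D" if x: "x \<in> filt 1" and y: "y \<in> filt 1" for x y k using x
  proof (induct rule: filt_induct)
    case (piece j x)
    then show ?case using c2[OF piece(2) filt_piece[OF piece(2,1)] y] by simp
  next
    case (add x z)
    then show ?case
      using filt_carrier[OF add(1)] filt_carrier[OF add(2)] filt_carrier[OF y] ideal_prod.sum[OF add(3,4)]
      by (simp add: A.l_distr component_add)
  qed
  have c: "x \<in> carrier A" if "x \<in> ?D" for x using sub that filt_carrier by blast
  show "graded_subspace K A ?D"
  proof (rule graded_subspaceI)
    show "?D \<subseteq> carrier A" using c by blast
    show "\<zero> \<in> ?D" by (rule zero)
    show "x \<oplus> y \<in> ?D" if "x \<in> ?D" "y \<in> ?D" for x y using that by (rule ideal_prod.sum)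
    show "a \<odot> x \<in> ?D" if a: "a \<in> carrier K" and x: "x \<in> ?D" for a x using x
    proof induct
      case (prod x y)
      then show ?case
        using ideal_prod.prod[OF filt_smult[OF a prod(1)] prod(2), where R = A] filt_carrier a by (simp add: smult_mult_left)
    next
      case (sum x y)
      then show ?case using ideal_prod.sum[OF sum(2,4)] c[OF sum(1)] c[OF sum(3)] a by (simp add: smult_r_distr)
    qed
    show "component A k x \<in> ?D" if x: "x \<in> ?D" for k x using x
    proof induct
      case (prod x y)
      then show ?case by (rule c1)
    next
      case (sum x y)
      then show ?case using ideal_prod.sum[OF sum(2,4)] c[OF sum(1)] c[OF sum(3)] by (simp add: component_add)
    qed
  qed
qed

lemma generating_subspace_exists: obtains G where "generating_subspace K A G"
proof -
  let ?D = "ideal_prod A (filt 1) (filt 1)"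
  have z: "graded_subspace K A {\<zero>}" by (rule graded_subspaceI) (auto simp: component_zero)
  have z': "{\<zero>} \<subseteq> filt 1" "?D \<inter> {\<zero>} = {\<zero>}"
    using filt_zero graded_subspaceD(2)[OF decomposables_graded] by auto
  obtain G where G: "graded_subspace K A G" "{\<zero>} \<subseteq> G" "G \<subseteq> filt 1" "?D \<inter> G = {\<zero>}" "filt 1 = ?D <+>\<^bsub>A\<^esub> G"
    by (rule graded_complement[OF filt_graded decomposables_graded decomposables_positive z z'])
  have swap: "V <+>\<^bsub>A\<^esub> W \<subseteq> W <+>\<^bsub>A\<^esub> V" if "V \<subseteq> carrier A" "W \<subseteq> carrier A" for V W
  proof
    fix x assume "x \<in> V <+>\<^bsub>A\<^esub> W"
    then obtain v w where vw: "v \<in> V" "w \<in> W" "x = v \<oplus> w" unfolding mem_set_add by blast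
    then have "x = w \<oplus> v" using that A.a_comm[of v w] by blast
    then show "x \<in> W <+>\<^bsub>A\<^esub> V" unfolding mem_set_add using vw by blast
  qed
  note c = graded_subspaceD(1)[OF decomposables_graded] graded_subspaceD(1)[OF G(1)]
  have "?D <+>\<^bsub>A\<^esub> G = G <+>\<^bsub>A\<^esub> ?D" by (rule equalityI[OF swap[OF c] swap[OF c(2,1)]])
  from trans[OF G(5) this] have "generating_subspace K A G"
    unfolding generating_subspace_def direct_sum_def positive_part_filt using G(1,4) by blast
  then show ?thesis by (rule that)
qed

end

text \<open>A section restricted to a generating subspace is a partial splitting. The complement
  built from it is an adapted harmonic subspace, and \<open>hodge_change\<close> moves the given
  decomposition there.\<close>

lemma (in hodge) adapted_hodge_exists:
  assumes char: "char_zero K" and conn: "highly_connected K A k"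
  obtains \<H> \<iota> \<B> where "adapted_hodge K A n I \<H> \<iota> \<B>"
proof -
  note H0 = connected_H_piece_0[OF conn]
  obtain G where gen: "generating_subspace K H G" by (rule H.generating_subspace_exists)
  then have Gg: "graded_subspace K H G" by (simp add: generating_subspace_def)
  have Gc: "x \<in> carrier H" if "x \<in> G" for x using H.graded_subspaceD(1)[OF Gg] that by blast
  obtain \<iota>\<^sub>0 where i0: "!!X. X \<in> carrier H ==> \<iota>\<^sub>0 X \<in> Hs \<and> cls A (\<iota>\<^sub>0 X) = X" using section_exists by blast
  interpret R: realization K A H "cls A" \<iota>\<^sub>0 "\<lambda>X Y. s (\<iota>\<^sub>0 X \<otimes> \<iota>\<^sub>0 Y)"
    by (rule section_realization) (use i0 in auto)
  interpret gs: gen_split K A n I G \<iota>\<^sub>0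
    by unfold_locales (auto simp: Gg Gc R.iota_add R.iota_smult intro: R.iota_piece)
  obtain W where W: "harmonic_subspace K A W" "!!x. x \<in> G ==> \<iota>\<^sub>0 x \<in> W" "W \<subseteq> gs.ZZ"
    by (rule gs.adapted_complement[OF gen H0]) auto
  obtain B' where B': "hodge K A n I W B'" by (rule hodge_change[OF char W(1)])
  interpret S: hodge K A n I W B' by (rule B')
  obtain \<iota> where i: "!!X. X \<in> carrier H ==> \<iota> X \<in> W \<and> cls A (\<iota> X) = X" using S.section_exists by blast
  interpret R': realization K A H "cls A" \<iota> "\<lambda>X Y. S.s (\<iota> X \<otimes> \<iota> Y)"
    by (rule S.section_realization) (use i in auto)
  have image: "W = \<iota> ` carrier H"
  proof (intro equalityI subsetI)
    fix w assume w: "w \<in> W"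
    have c: "cls A w \<in> carrier H" using S.Hs_cocycles[OF w] by simp
    have "\<iota> (cls A w) = w" by (rule S.rho_inj_Hs) (use w i[OF c] in auto)
    then show "w \<in> \<iota> ` carrier H" using c by (metis imageI)
  qed (use i in auto)
  have "adapted K A W \<iota>" unfolding adapted_def Let_def
  proof (intro conjI exI)
    show "harmonic_subspace K A W" "W = \<iota> ` carrier H" "generating_subspace K H G"
      "sym_extension K A G \<iota>\<^sub>0 gs.Phi" by (rule W(1) image gen gs.sym_ext)+
    show "linear_on K H (carrier H) (A\<lparr>carrier := cocycles A\<rparr>) \<iota>"
      by (auto simp: linear_on_def R'.iota_add R'.iota_smult)
    show "\<forall>x\<in>carrier H. cls A (\<iota> x) = x" using i by blast
    show "partial_splitting K A G \<iota>\<^sub>0"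
      by (auto simp: partial_splitting_def linear_on_def gs.i0_add gs.i0_smult gs.i0_piece)
    show "\<forall>x\<in>G. \<iota> x = \<iota>\<^sub>0 x"
    proof
      fix x assume x: "x \<in> G"
      show "\<iota> x = \<iota>\<^sub>0 x"
        by (rule S.rho_inj_Hs) (use i[OF Gc[OF x]] i0[OF Gc[OF x]] W(2)[OF x] in auto)
    qed
    show "\<iota> ` carrier H \<subseteq> gs.Phi ` carrier (sym_algebra K H G)"
      unfolding gs.Phi_image image[symmetric] by (rule W(3))
  qed
  then show ?thesis using that B' hodge_decomposition_iff by (simp add: adapted_hodge_def)
qed

section \<open>Independence of the class and formality\<close>

lemma (in conn_hodge) trivial_imp_formal:
  assumes p: "\<phi> \<in> cochains2 K H" and e: "mu3 A Hs \<iota> Bs = d_hoch H \<phi>"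
  shows "formal TYPE('u) K A"
proof -
  note c = cochains2D[OF p]
  have h: "(\<lambda>X Y. diff_inv A Hs Bs (\<iota> X \<otimes> \<iota> Y)) = (\<lambda>X Y. s (\<iota> X \<otimes> \<iota> Y))" by (simp add: s_def)
  have "mu3 A Hs \<iota> Bs = massey A H (cls A) \<iota> (\<lambda>X Y. s (\<iota> X \<otimes> \<iota> Y))"
    using mu3_massey(2)[OF split_ident_axioms, of \<iota>] iota_Hs cls_iota unfolding h by blast
  then have "mu X Y Z = d_hoch H \<phi> (X, Y, Z)" if "X \<in> carrier H" "Y \<in> carrier H" "Z \<in> carrier H" for X Y Z
    using that e by (simp add: massey_def mu_def)
  moreover have "bilin (\<lambda>X Y. \<phi> (X, Y))" unfolding bilin_def using c by (simp add: cochains2_def)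
  ultimately have "primitive (\<lambda>X Y. \<phi> (X, Y))"
    by (simp add: primitive_def hoch_d_def H.d_hoch_apply)
  \<comment> \<open>Symmetry has to be arranged before the normalisation, which relies on
    it.\<close>
  then obtain \<phi>\<^sub>1 where p1: "primitive \<phi>\<^sub>1" "symm \<phi>\<^sub>1" by (rule symmetric_primitive)
  obtain \<phi>\<^sub>2 where "primitive \<phi>\<^sub>2" "symm \<phi>\<^sub>2"
    "!!X Y. [|X \<in> carrier H; Y \<in> carrier H|] ==> JH (\<phi>\<^sub>2 X Y) = \<zero>\<^sub>K"
    by (rule normalised_primitive[OF p1]) blast
  then interpret P: prim_hodge K A n I Hs Bs r \<iota> \<phi>\<^sub>2 by unfold_locales
  show ?thesis by (rule P.formal_cylinder)
qed

theorem theorem4p6: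
  fixes K :: "'k ring" and A :: "('k, 'a) dga" and I :: "'a set \<Rightarrow> 'k" and n r :: nat
  assumes "field K" and "char_zero K"
    and "r > 1"
    and "poincare_dgca K A n I"
    and "highly_connected K A (r - 1)"
    and "hodge_type K A n I"
    and "n \<le> 5 * r - 3"
  shows "(\<exists>\<H> \<iota> \<B>. adapted_hodge K A n I \<H> \<iota> \<B>) \<and>
    (\<forall>\<H> \<iota> \<B>. adapted_hodge K A n I \<H> \<iota> \<B> \<longrightarrow>
        mu3 A \<H> \<iota> \<B> \<in> hoch_cocycles K (cohomology A)) \<and>
    (\<forall>\<H> \<iota> \<B> \<H>' \<iota>' \<B>'. adapted_hodge K A n I \<H> \<iota> \<B> \<and> adapted_hodge K A n I \<H>' \<iota>' \<B>' \<longrightarrow>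
        hoch_class K (cohomology A) (mu3 A \<H> \<iota> \<B>) = hoch_class K (cohomology A) (mu3 A \<H>' \<iota>' \<B>')) \<and>
    mu3_class K A n I \<in> carrier (Hoch3 K (cohomology A)) \<and>
    (formal TYPE('u) K A \<longleftrightarrow> mu3_class K A n I = \<one>\<^bsub>Hoch3 K (cohomology A)\<^esub>)"
proof -
  interpret P: poincare K A n I
    using assms(4) by (simp add: poincare_def poincare_axioms_def dg_def poincare_dgca_def)
  let ?H = "cohomology A" and ?ah = "adapted_hodge K A n I"
  have hodge: "hodge K A n I \<H> \<B>" and sec: "!!X. X \<in> carrier ?H ==> \<iota> X \<in> \<H>" "!!X. X \<in> carrier ?H ==> cls A (\<iota> X) = X"
    if "?ah \<H> \<iota> \<B>" for \<H> \<iota> \<B>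
    using that by (auto simp: adapted_hodge_def adapted_def Let_def P.hodge_decomposition_iff)
  have R: "realization K A ?H (cls A) \<iota> (\<lambda>x y. diff_inv A \<H> \<B> (\<iota> x \<otimes>\<^bsub>A\<^esub> \<iota> y))"
    and mu: "mu3 A \<H> \<iota> \<B> = massey A ?H (cls A) \<iota> (\<lambda>x y. diff_inv A \<H> \<B> (\<iota> x \<otimes>\<^bsub>A\<^esub> \<iota> y))"
    if a: "?ah \<H> \<iota> \<B>" for \<H> \<iota> \<B>
  proof -
    interpret S: hodge K A n I \<H> \<B> by (rule hodge[OF a])
    show "realization K A ?H (cls A) \<iota> (\<lambda>x y. diff_inv A \<H> \<B> (\<iota> x \<otimes>\<^bsub>A\<^esub> \<iota> y))"
      by (rule mu3_massey(1)[OF S.split_ident_axioms]) (use sec[OF a] in auto)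
    show "mu3 A \<H> \<iota> \<B> = massey A ?H (cls A) \<iota> (\<lambda>x y. diff_inv A \<H> \<B> (\<iota> x \<otimes>\<^bsub>A\<^esub> \<iota> y))"
      by (rule mu3_massey(2)[OF S.split_ident_axioms]) (use sec[OF a] in auto)
  qed
  have cocycle: "mu3 A \<H> \<iota> \<B> \<in> hoch_cocycles K ?H" "mu3 A \<H> \<iota> \<B> \<in> cochains3 K ?H"
    if a: "?ah \<H> \<iota> \<B>" for \<H> \<iota> \<B>
    unfolding mu[OF a]
    by (rule realization.massey_hoch_cocycle[OF R[OF a]], rule realization.massey_cochain[OF R[OF a]])
  have unique: "hoch_class K ?H (mu3 A \<H> \<iota> \<B>) = hoch_class K ?H (mu3 A \<H>' \<iota>' \<B>')"
    if a: "?ah \<H> \<iota> \<B>" and a': "?ah \<H>' \<iota>' \<B>'" for \<H> \<iota> \<B> \<H>' \<iota>' \<B>'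
  proof -
    obtain \<phi> where p: "\<phi> \<in> cochains2 K ?H" "!!x y z. [|x \<in> carrier ?H; y \<in> carrier ?H; z \<in> carrier ?H|] ==>
        mu3 A \<H> \<iota> \<B> (x, y, z) = mu3 A \<H>' \<iota>' \<B>' (x, y, z) \<oplus>\<^bsub>?H\<^esub> d_hoch ?H \<phi> (x, y, z)"
      unfolding mu[OF a] mu[OF a'] by (rule P.massey_unique[OF R[OF a'] R[OF a]]) blast
    show ?thesis by (rule P.H.hoch_class_eqI[OF p(1) cocycle(2)[OF a] cocycle(2)[OF a'] p(2)])
  qed
  obtain \<H>0 \<B>0 where "hodge_decomposition K A n I \<H>0 \<B>0" using assms(6) unfolding hodge_type_def by blast
  then interpret S0: hodge K A n I \<H>0 \<B>0 by (simp add: P.hodge_decomposition_iff)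
  obtain \<H> \<iota> \<B> where ah: "?ah \<H> \<iota> \<B>" by (rule S0.adapted_hodge_exists[OF assms(2,5)])
  \<comment> \<open>The definite description denotes this class because all choices give the same
    one.\<close>
  have cls: "mu3_class K A n I = hoch_class K ?H (mu3 A \<H> \<iota> \<B>)"
    unfolding mu3_class_def by (rule the_equality) (use ah unique in blast)+
  interpret S: conn_hodge K A n I \<H> \<B> r \<iota>
    using hodge[OF ah] sec[OF ah] assms by (simp add: conn_hodge_def conn_hodge_axioms_def)
  have "formal TYPE('u) K A \<longleftrightarrow> (\<exists>\<phi>\<in>cochains2 K ?H. mu3 A \<H> \<iota> \<B> = d_hoch ?H \<phi>)"
  proof
    assume f: "formal TYPE('u) K A"
    show "\<exists>\<phi>\<in>cochains2 K ?H. mu3 A \<H> \<iota> \<B> = d_hoch ?H \<phi>"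
      unfolding mu[OF ah] by (rule formal_imp_trivial[OF P.cohomology_gca R[OF ah] f]) blast
  next
    assume "\<exists>\<phi>\<in>cochains2 K ?H. mu3 A \<H> \<iota> \<B> = d_hoch ?H \<phi>"
    then show "formal TYPE('u) K A" using S.trivial_imp_formal by blast
  qed
  then have "formal TYPE('u) K A \<longleftrightarrow> mu3_class K A n I = \<one>\<^bsub>Hoch3 K ?H\<^esub>"
    unfolding cls P.H.hoch_class_trivial_iff[OF cocycle(2)[OF ah]] .
  moreover have "mu3_class K A n I \<in> carrier (Hoch3 K ?H)"
    unfolding cls by (rule P.H.hoch_class_carrier[OF cocycle(1)[OF ah]])
  ultimately show ?thesis using ah cocycle(1) unique by blast
qed

end
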